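(* In the setting below (product initial state $\tau=\tau_{AB_1}\otimes\tau_{B_2C}$, four-outcome POVM $\mathscr{B}=(B^b_{B_1B_2})_{b=0}^3$ on $\mathcal{H}_{B_1}\otimes\mathcal{H}_{B_2}$, Hermitian observables $A_0,A_1$ on $\mathcal{H}_A$ and $C_0,C_1$ on $\mathcal{H}_C$ squaring to identity), let $\beta_b:=\operatorname{tr}(W_b\tau^b_{AC})$ for each $b$ with $p_b>0$ and let $\beta_{\mathrm{ave}}:=\sum_{b:\,p_b>0}p_b\beta_b$. Assume $\beta_{\mathrm{ave}}>x^*$. Set $q:=g(\beta_{\mathrm{ave}})$ and $\eta^*:=2\sqrt{q(1-q)}$. Then $$Q(\mathscr{B},\Phi)\;\ge\;\min_{\eta\in[0,\eta^*]}\frac{4\,s(\eta)\,q-t(\eta)}{8(1+\eta^* )},$$ where $s(\eta)=\frac{2}{\sqrt{1-\eta^2}}$ and $t(\eta)=\frac{4}{\sqrt{1-\eta^2}}-\frac{4}{1+\eta}$.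
   Context: All Hilbert spaces finite-dimensional. Bell states on $\mathbb{C}^2\otimes\mathbb{C}^2$: $|\Phi^0\rangle=(|00\rangle+|11\rangle)/\sqrt2$, $|\Phi^1\rangle=(|00\rangle-|11\rangle)/\sqrt2$, $|\Phi^2\rangle=(|01\rangle+|10\rangle)/\sqrt2$, $|\Phi^3\rangle=(|01\rangle-|10\rangle)/\sqrt2$, $\Phi^b:=|\Phi^b\rangle\langle\Phi^b|$, and $\Phi=(\Phi^b)_{b=0}^3$ is the Bell-state measurement on $\mathcal{H}_{B_1'}\otimes\mathcal{H}_{B_2'}=\mathbb{C}^2\otimes\mathbb{C}^2$. $p_b:=\operatorname{tr}[(\mathbb{1}_A\otimes B^b\otimes\mathbb{1}_C)\tau]$, $\tau^b_{AC}:=\frac1{p_b}\operatorname{tr}_{B_1B_2}[(\mathbb{1}_A\otimes B^b\otimes\mathbb{1}_C)\tau]$. Bell operators: $W_0:=A_0 C_0+A_0 C_1+A_1 C_0-A_1 C_1$, $W_1:=A_0 C_0+A_0 C_1-A_1 C_0+A_1 C_1$, $W_2:=-W_1$, $W_3:=-W_0$ (tensor products $A_x\otimes C_z$ implied). $x^*:=(16+14\sqrt2)/17$ and $g(\beta):=\frac12+\frac12\cdot\frac{\beta-x^*}{2\sqrt2-x^*}$. For a real POVM $\mathscr{F}=(F^j_{B_1B_2})_{j=1}^d$ on $\mathcal{H}_{B_1}\otimes\mathcal{H}_{B_2}$ and a projective ideal measurement $\mathscr{P}=(P^j_{B_1'B_2'})_{j=1}^d$ on $\mathcal{H}_{B_1'}\otimes\mathcal{H}_{B_2'}$,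 the quality is $Q(\mathscr{F},\mathscr{P}):=\frac{1}{|B_1'||B_2'|}\max_{\Lambda_{B_1},\Lambda_{B_2}}\sum_{j=1}^d\operatorname{tr}\big[(\Lambda_{B_1}\otimes\Lambda_{B_2})(F^j)\,P^j\big]$, maximized over completely positive unital maps $\Lambda_{B_i}:\mathcal{L}(\mathcal{H}_{B_i})\to\mathcal{L}(\mathcal{H}_{B_i'})$; $|X|$ denotes the dimension of $\mathcal{H}_X$. *)

theory Defs
  imports "HOL-Analysis.Analysis" "Jordan_Normal_Form.Matrix"
begin

text \<open>Finite-dimensional operators are complex matrices (Jordan_Normal_Form).
  Tensor products use the Kronecker convention: the basis vector |i>|k> of
  C^m (x) C^n has index i*n + k.\<close>

definition mtrace :: "complex mat \<Rightarrow> complex" where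
  "mtrace A = (\<Sum>i<dim_row A. A $$ (i, i))"

definition dagger :: "complex mat \<Rightarrow> complex mat" where
  "dagger A = mat (dim_col A) (dim_row A) (\<lambda>(i, j). cnj (A $$ (j, i)))"

definition hermitian :: "complex mat \<Rightarrow> bool" where
  "hermitian A \<longleftrightarrow> square_mat A \<and> dagger A = A"

definition psd :: "complex mat \<Rightarrow> bool" where
  "psd A \<longleftrightarrow> hermitian A \<and>
     (\<forall>v \<in> carrier_vec (dim_row A). 0 \<le> Re (conjugate v \<bullet> (A *\<^sub>v v)))"

definition kron :: "complex mat \<Rightarrow> complex mat \<Rightarrow> complex mat" where
  "kron A B = mat (dim_row A * dim_row B) (dim_col A * dim_col B)
     (\<lambda>(i, j). A $$ (i div dim_row B, j div dim_col B) * B $$ (i mod dim_row B, j mod dim_col B))"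

definition ptrace_mid :: "nat \<Rightarrow> nat \<Rightarrow> nat \<Rightarrow> complex mat \<Rightarrow> complex mat" where
  "ptrace_mid dA dM dC X = mat (dA * dC) (dA * dC)
     (\<lambda>(i, j). \<Sum>m<dM. X $$ ((i div dC) * dM * dC + m * dC + i mod dC,
                             (j div dC) * dM * dC + m * dC + j mod dC))"

definition density :: "nat \<Rightarrow> complex mat \<Rightarrow> bool" where
  "density n \<rho> \<longleftrightarrow> \<rho> \<in> carrier_mat n n \<and> psd \<rho> \<and> mtrace \<rho> = 1"

definition munit :: "nat \<Rightarrow> nat \<Rightarrow> nat \<Rightarrow> complex mat" where
  "munit n i j = mat n n (\<lambda>(r, s). if r = i \<and> s = j then 1 else 0)"

definition block :: "nat \<Rightarrow> complex mat \<Rightarrow> nat \<Rightarrow> nat \<Rightarrow> complex mat" where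
  "block d X a b = mat d d (\<lambda>(r, s). X $$ (a * d + r, b * d + s))"

text \<open>(id_n (x) Lambda)(X) for Lambda : L(C^d) -> L(C^d').\<close>
definition ampl :: "nat \<Rightarrow> nat \<Rightarrow> nat \<Rightarrow> (complex mat \<Rightarrow> complex mat) \<Rightarrow> complex mat \<Rightarrow> complex mat" where
  "ampl n d d' \<Lambda> X = mat (n * d') (n * d')
     (\<lambda>(i, j). \<Lambda> (block d X (i div d') (j div d')) $$ (i mod d', j mod d'))"

definition cp_unital :: "nat \<Rightarrow> nat \<Rightarrow> (complex mat \<Rightarrow> complex mat) \<Rightarrow> bool" where
  "cp_unital d d' \<Lambda> \<longleftrightarrow>
     (\<forall>X \<in> carrier_mat d d. \<Lambda> X \<in> carrier_mat d' d') \<and>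
     (\<forall>X \<in> carrier_mat d d. \<forall>Y \<in> carrier_mat d d. \<Lambda> (X + Y) = \<Lambda> X + \<Lambda> Y) \<and>
     (\<forall>c. \<forall>X \<in> carrier_mat d d. \<Lambda> (c \<cdot>\<^sub>m X) = c \<cdot>\<^sub>m \<Lambda> X) \<and>
     \<Lambda> (1\<^sub>m d) = 1\<^sub>m d' \<and>
     (\<forall>n. \<forall>X \<in> carrier_mat (n * d) (n * d). psd X \<longrightarrow> psd (ampl n d d' \<Lambda> X))"

text \<open>(Lambda1 (x) Lambda2)(X), X an operator on C^d1 (x) C^d2, the
  linear extension of Lambda1(E_ij) (x) Lambda2(E_kl).\<close>
definition map_tensor :: "nat \<Rightarrow> nat \<Rightarrow> nat \<Rightarrow> nat \<Rightarrow> (complex mat \<Rightarrow> complex mat) \<Rightarrow>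
    (complex mat \<Rightarrow> complex mat) \<Rightarrow> complex mat \<Rightarrow> complex mat" where
  "map_tensor d1 d2 d1' d2' \<Lambda>1 \<Lambda>2 X = mat (d1' * d2') (d1' * d2')
     (\<lambda>(r, s). \<Sum>i<d1. \<Sum>j<d1. \<Sum>k<d2. \<Sum>l<d2.
        X $$ (i * d2 + k, j * d2 + l) *
        kron (\<Lambda>1 (munit d1 i j)) (\<Lambda>2 (munit d2 k l)) $$ (r, s))"

text \<open>Quality Q(F,P) of a POVM F=(F j)_{j<n} on C^d1 (x) C^d2 w.r.t. an ideal
  measurement P=(P j)_{j<n} on C^d1' (x) C^d2'. The maximum is rendered as a
  supremum (it is attained).\<close>
definition quality :: "nat \<Rightarrow> nat \<Rightarrow> nat \<Rightarrow> nat \<Rightarrow> nat \<Rightarrow> (nat \<Rightarrow> complex mat) \<Rightarrow>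
    (nat \<Rightarrow> complex mat) \<Rightarrow> real" where
  "quality n d1 d2 d1' d2' F P =
     (1 / real (d1' * d2')) *
     Sup {(\<Sum>j<n. Re (mtrace (map_tensor d1 d2 d1' d2' \<Lambda>1 \<Lambda>2 (F j) * P j))) | \<Lambda>1 \<Lambda>2.
            cp_unital d1 d1' \<Lambda>1 \<and> cp_unital d2 d2' \<Lambda>2}"

text \<open>Bell states on C^2 (x) C^2, basis |00>,|01>,|10>,|11> = indices 0,1,2,3.\<close>
definition bell_vec :: "nat \<Rightarrow> complex vec" where
  "bell_vec b = (let s = 1 / complex_of_real (sqrt 2) in
     if b = 0 then vec 4 (\<lambda>i. if i = 0 \<or> i = 3 then s else 0)
     else if b = 1 then vec 4 (\<lambda>i. if i = 0 then s else if i = 3 then - s else 0)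
     else if b = 2 then vec 4 (\<lambda>i. if i = 1 \<or> i = 2 then s else 0)
     else vec 4 (\<lambda>i. if i = 1 then s else if i = 2 then - s else 0))"

definition bell_proj :: "nat \<Rightarrow> complex mat" where
  "bell_proj b = mat 4 4 (\<lambda>(i, j). bell_vec b $ i * cnj (bell_vec b $ j))"

definition bell_op :: "complex mat \<Rightarrow> complex mat \<Rightarrow> complex mat \<Rightarrow> complex mat \<Rightarrow> nat \<Rightarrow> complex mat" where
  "bell_op A0 A1 C0 C1 b =
     (let W0 = kron A0 C0 + kron A0 C1 + kron A1 C0 - kron A1 C1;
          W1 = kron A0 C0 + kron A0 C1 - kron A1 C0 + kron A1 C1
      in if b = 0 then W0 else if b = 1 then W1 else if b = 2 then - W1 else - W0)"

definition xstar :: real where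
  "xstar = (16 + 14 * sqrt 2) / 17"

definition gfun :: "real \<Rightarrow> real" where
  "gfun \<beta> = 1/2 + 1/2 * ((\<beta> - xstar) / (2 * sqrt 2 - xstar))"

definition sfun :: "real \<Rightarrow> real" where
  "sfun \<eta> = 2 / sqrt (1 - \<eta>^2)"

definition tfun :: "real \<Rightarrow> real" where
  "tfun \<eta> = 4 / sqrt (1 - \<eta>^2) - 4 / (1 + \<eta>)"

end

theory Submission
  imports Defs "Jordan_Normal_Form.Spectral_Radius" "HOL-Library.Function_Algebras"
begin

text \<open>Diagonalise \<open>A0 A1 + A1 A0\<close>; in each eigenspace \<open>P = (A0 + A1) / 2\<close> and \<open>M = (A0 - A1) / 2\<close>
  anticommute and square to scalars. Rescaling one to a reflection and the other to a contraction yields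
  \<open>P^\<close>, \<open>M^\<close>, and \<open>(1 + P^ \<otimes> Z) (1 + M^ \<otimes> X) / 2\<close> is the Choi matrix of an extraction channel to a qubit.
  A sum-of-squares decomposition shows that the operator obtained by pulling the Bell projector back through the
  channels of both outer parties dominates an affine function of the Bell operator, and this affine function is \<open>gfun\<close>.
  So after the extraction the outer qubits share \<open>\<Phi>\<^sup>b\<close> with average fidelity at least \<open>q\<close>.

  Read backwards, with Gram vectors of the two initial states, the extraction gives completely positive maps on the
  \<open>B\<close> systems whose values at \<open>1\<close> are the (transposed) qubit marginals \<open>\<sigma>\<close>, \<open>\<sigma>'\<close> instead of \<open>1 / 2\<close>.
  If \<open>\<sigma> = (1 - a S) / 2\<close> with a reflection \<open>S\<close>, complementarity of \<open>S\<close> and the Bell projector bounds the Bloch length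
  by \<open>a\<^sup>2 + (2 q - 1)\<^sup>2 \<le> 1\<close>, that is \<open>a \<le> \<eta>s\<close>, and likewise for \<open>\<sigma>'\<close>. The first map is made unital by the filter
  \<open>(2 \<sigma>)\<close> to the power \<open>-1/2\<close>, at a cost governed by \<open>sfun a\<close> and \<open>tfun a\<close>; the second by shrinking it by \<open>1 + \<eta>s\<close> or less and adding
  a positive remainder. Hence the quality dominates the function under the minimum at the single point \<open>\<eta> = a\<close>.\<close>

subsection \<open>Spectral theorem and Gram decompositions\<close>

text \<open>The extraction may not depend on the outcome, so one pair of channels has to serve all
  four Bell operators. Written through P, M and P', M', outcome b merely flips the signs of P' and
  M', and the Bell vector of b flips its correlations along Z (x) Z and X (x) X in the same way. A
  single operator inequality, the one for W_0, is therefore enough. Its slope (4 + 5 sqrt 2) / 16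
  and offset - (1 + 2 sqrt 2) / 4 belong to the line through (2 sqrt 2, 1) and (xstar, 1/2); scaled
  by 4 sqrt 2 they become the constants 5 + 2 sqrt 2 and 4 + 2 sqrt 2 met below. The shrinking of
  the smaller of P and M is what makes the inequality true away from the ideal angle: with cosine x
  and sine y its norm is (1 + sqrt 2) (x + y - 1), which is 0 for commuting observables and 1 at the
  ideal angle. On a block the inequality compares two commuting operators and ends as a polynomial
  inequality in two half-angle tangents, settled by the signs of Bernstein coefficients. Positivity
  concerns only real parts of Hermitian forms, so a real inner product suffices, and Gram vectors
  take the place of matrix square roots.\<close>

lemma dagger_index [simp]: "i < dim_col A \<Longrightarrow> j < dim_row A \<Longrightarrow> dagger A $$ (i, j) = cnj (A $$ (j, i))"
  and dagger_dim [simp]: "dim_row (dagger A) = dim_col A" "dim_col (dagger A) = dim_row A"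
  by (simp_all add: dagger_def)

lemma dagger_carrier [simp]: "A \<in> carrier_mat m n \<Longrightarrow> dagger A \<in> carrier_mat n m"
  by (auto simp: dagger_def)

lemma dagger_mult:
  assumes "A \<in> carrier_mat m k" "B \<in> carrier_mat k n"
  shows "dagger (A * B) = dagger B * dagger A"
  using assms by (intro eq_matI) (auto simp: scalar_prod_def mult.commute)

lemma dagger_dagger [simp]: "dagger (dagger A) = A"
  by (intro eq_matI) auto

lemma dagger_one [simp]: "dagger (1\<^sub>m n) = 1\<^sub>m n"
  by (intro eq_matI) auto

text \<open>The reflection along w = e_0 - v exchanges the unit vectors e_0 and v exactly when their
  inner product is real, hence the assumption on the first entry. Then |w|^2 = 2 - 2 t is twice the
  inner product of w with e_0.\<close>

lemma householder:
  fixes v :: "complex vec"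
  assumes v: "v \<in> carrier_vec (Suc n)" and nv: "(\<Sum>i<Suc n. (cmod (v $ i))^2) = 1"
    and v0: "v $ 0 = complex_of_real t"
  obtains H where "H \<in> carrier_mat (Suc n) (Suc n)" "dagger H = H" "H * H = 1\<^sub>m (Suc n)"
    "col H 0 = v"
proof -
  define w where "w i = (if i = 0 then 1 else 0) - v $ i" for i
  define S where "S = (\<Sum>i<Suc n. (cmod (w i))^2)"
  \<comment> \<open>If v = e_0 then S = 0, division by zero gives c = 0, and H is the identity, as
    it should be.\<close>
  define c where "c = complex_of_real (2 / S)"
  define H where "H = mat (Suc n) (Suc n) (\<lambda>(i,j). (if i = j then 1 else 0) - c * w i * cnj (w j))"
  have S: "S = 2 - 2*t"
  proof -
    have "S = (cmod (w 0))^2 + (\<Sum>i<n. (cmod (v $ Suc i))^2)"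
      unfolding S_def by (subst sum.lessThan_Suc_shift) (simp add: w_def)
    also have "(\<Sum>i<n. (cmod (v $ Suc i))^2) = 1 - (cmod (v $ 0))^2"
      using nv by (subst (asm) sum.lessThan_Suc_shift) simp
    also have "w 0 = complex_of_real (1 - t)" by (simp add: w_def v0)
    finally show ?thesis unfolding v0 norm_of_real by (simp add: power2_eq_square algebra_simps)
  qed
  have S': "(\<Sum>k<Suc n. cnj (w k) * w k) = complex_of_real S"
    unfolding S_def of_real_sum by (intro sum.cong) (simp_all add: complex_norm_square mult.commute del: of_real_power)
  have w0: "w i = 0" if "S = 0" "i < Suc n" for i
  proof -
    have "\<forall>i\<in>{..<Suc n}. (cmod (w i))^2 = 0" using that(1) unfolding S_def
      by (subst (asm) sum_nonneg_eq_0_iff) auto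
    then show ?thesis using that by auto
  qed
  have H: "H \<in> carrier_mat (Suc n) (Suc n)" by (simp add: H_def)
  moreover have "dagger H = H" by (intro eq_matI) (auto simp: H_def c_def)
  moreover have "H * H = 1\<^sub>m (Suc n)"
  proof (intro eq_matI)
    fix i j assume ij: "i < dim_row (1\<^sub>m (Suc n) :: complex mat)" "j < dim_col (1\<^sub>m (Suc n) :: complex mat)"
    have "(H * H) $$ (i,j) = (\<Sum>k<Suc n. ((if i = k then 1 else 0) - c * w i * cnj (w k)) * ((if k = j then 1 else 0) - c * w k * cnj (w j)))"
      using ij by (simp add: H_def scalar_prod_def atLeast0LessThan del: sum.lessThan_Suc)
    also have "\<dots> = (\<Sum>k<Suc n. (if k = j then (if i = k then 1 else 0) else 0) - (if k = i then c * w k * cnj (w j) else 0)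
        - (if k = j then c * w i * cnj (w k) else 0) + c * c * w i * cnj (w j) * (cnj (w k) * w k))"
      by (intro sum.cong) (auto simp: algebra_simps)
    also have "\<dots> = (if i = j then 1 else 0) - c * w i * cnj (w j) - c * w i * cnj (w j) + c * c * w i * cnj (w j) * of_real S"
      unfolding sum.distrib sum_subtractf sum_distrib_left[symmetric] S' using ij by (simp add: sum.delta' del: sum.lessThan_Suc)
    also have "\<dots> = (if i = j then 1 else 0) + w i * cnj (w j) * c * (c * of_real S - 2)"
      by (simp add: algebra_simps)
    also have "w i * cnj (w j) * c * (c * of_real S - 2) = 0"
      by (cases "S = 0") (use ij w0[of i] in \<open>auto simp: c_def\<close>)
    finally show "(H * H) $$ (i,j) = (1\<^sub>m (Suc n)) $$ (i,j)" using ij by simp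
  qed (auto simp: H_def)
  moreover have "col H 0 = v"
  proof (intro eq_vecI)
    fix i assume i: "i < dim_vec v"
    then have i': "i < Suc n" using v by simp
    have "col H 0 $ i = (if i = 0 then 1 else 0) - c * w i * cnj (w 0)" using i' by (simp add: H_def)
    also have "cnj (w 0) = of_real (1 - t)" by (simp add: w_def v0)
    also have "c * w i * of_real (1 - t) = w i"
    proof (cases "S = 0")
      case True then show ?thesis using w0[OF True i'] by simp
    next
      case False
      then have "2 / S * (1 - t) = 1" using S by (simp add: field_simps)
      moreover have "c * of_real (1 - t) = of_real (2 / S * (1 - t))" by (simp add: c_def)
      ultimately have "c * of_real (1 - t) = 1" by simp
      then show ?thesis by (simp add: mult.commute mult.left_commute mult.assoc)
    qed
    finally show "col H 0 $ i = v $ i" by (simp add: w_def)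
  qed (use v in \<open>simp add: H_def\<close>)
  ultimately show thesis using that by blast
qed

lemma unit_eigenvector:
  fixes A :: "complex mat"
  assumes A: "A \<in> carrier_mat (Suc n) (Suc n)"
  obtains v :: "complex vec" and k t where "v \<in> carrier_vec (Suc n)" "(\<Sum>i<Suc n. (cmod (v $ i))^2) = 1"
    "v $ 0 = complex_of_real t" "A *\<^sub>v v = k \<cdot>\<^sub>v v"
proof -
  obtain k where "k \<in> spectrum A" using spectrum_non_empty[OF A] by blast
  then obtain x where x: "x \<in> carrier_vec (Suc n)" "x \<noteq> 0\<^sub>v (Suc n)" "A *\<^sub>v x = k \<cdot>\<^sub>v x"
    using A unfolding spectrum_def eigenvalue_def eigenvector_def by auto
  define N where "N = (\<Sum>i<Suc n. (cmod (x $ i))^2)"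
  have "N \<noteq> 0"
  proof
    assume "N = 0"
    then have "\<forall>i\<in>{..<Suc n}. (cmod (x $ i))^2 = 0" unfolding N_def by (subst (asm) sum_nonneg_eq_0_iff) auto
    then have "x = 0\<^sub>v (Suc n)" using x(1) by (intro eq_vecI) auto
    with x show False by simp
  qed
  moreover have "N \<ge> 0" unfolding N_def by (intro sum_nonneg) auto
  ultimately have N: "N > 0" by simp
  \<comment> \<open>The phase that makes the first entry real, as \<open>householder\<close>
    requires; a vanishing entry gets the phase 1.\<close>
  define ph where "ph = (if x $ 0 = 0 then 1 else cnj (x $ 0) / of_real (cmod (x $ 0)))"
  have ph: "cmod ph = 1" by (simp add: ph_def norm_divide)
  have ph0: "ph * x $ 0 = of_real (cmod (x $ 0))"
    by (simp add: ph_def complex_norm_square[symmetric] mult.commute power2_eq_square field_simps)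
  define z where "z = ph / of_real (sqrt N)"
  have "(z \<cdot>\<^sub>v x) \<in> carrier_vec (Suc n)" using x by simp
  moreover have "(\<Sum>i<Suc n. (cmod ((z \<cdot>\<^sub>v x) $ i))^2) = (\<Sum>i<Suc n. (cmod (x $ i))^2 / N)"
    using x(1) N ph by (intro sum.cong) (auto simp: z_def norm_mult norm_divide power_mult_distrib power_divide)
  moreover have "\<dots> = 1" using N unfolding sum_divide_distrib[symmetric] N_def[symmetric] by simp
  moreover have "(z \<cdot>\<^sub>v x) $ 0 = of_real (cmod (x $ 0) / sqrt N)"
    using x(1) ph0 by (simp add: z_def)
  moreover have "A *\<^sub>v (z \<cdot>\<^sub>v x) = k \<cdot>\<^sub>v (z \<cdot>\<^sub>v x)"
    using x A by (simp add: mult_mat_vec smult_smult_assoc mult.commute)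
  ultimately show thesis using that by metis
qed

lemma dagger_four_block:
  assumes "A \<in> carrier_mat a b" "B \<in> carrier_mat a c" "C \<in> carrier_mat d b" "D \<in> carrier_mat d c"
  shows "dagger (four_block_mat A B C D) = four_block_mat (dagger A) (dagger C) (dagger B) (dagger D)"
  using assms by (intro eq_matI) auto

lemma dagger_zero [simp]: "dagger (0\<^sub>m m n) = 0\<^sub>m n m"
  by (intro eq_matI) auto

text \<open>Deflation: after conjugation with a reflection sending e_0 to an eigenvector, the first
  column is a multiple of e_0. Hermiticity clears the first row too and makes the eigenvalue real,
  so a smaller Hermitian block remains.\<close>

theorem hermitian_diagonalization:
  assumes "A \<in> carrier_mat n n" "dagger A = A"
  shows "\<exists>U d. U \<in> carrier_mat n n \<and> dagger U * U = 1\<^sub>m n \<and>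
    dagger U * A * U = mat n n (\<lambda>(i, j). if i = j then complex_of_real (d i) else 0)"
  using assms
proof (induction n arbitrary: A)
  case 0
  then show ?case by (intro exI[of _ "1\<^sub>m 0"] exI[of _ "\<lambda>_. 0"]) (auto intro!: eq_matI)
next
  case (Suc n)
  note A = Suc.prems(1) and herm = Suc.prems(2)
  obtain v :: "complex vec" and k t where v: "v \<in> carrier_vec (Suc n)"
    "(\<Sum>i<Suc n. (cmod (v $ i))^2) = 1" "v $ 0 = complex_of_real t" and Av: "A *\<^sub>v v = k \<cdot>\<^sub>v v"
    using unit_eigenvector[OF A] .
  obtain H where H: "H \<in> carrier_mat (Suc n) (Suc n)" and dH: "dagger H = H"
    and HH: "H * H = 1\<^sub>m (Suc n)" and Hv: "col H 0 = v"
    using householder[OF v] .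
  define A' where "A' = H * A * H"
  have A': "A' \<in> carrier_mat (Suc n) (Suc n)" using H A by (simp add: A'_def)
  have dA': "dagger A' = A'"
    unfolding A'_def using H A herm dH by (simp add: dagger_mult[of _ "Suc n" "Suc n" _ "Suc n"] assoc_mult_mat[of _ "Suc n" "Suc n" _ "Suc n" _ "Suc n"])
  have "col A' 0 = H *\<^sub>v (A *\<^sub>v v)"
    using H A Hv by (simp add: A'_def col_mult2[of _ "Suc n" "Suc n" _ "Suc n"] assoc_mult_mat_vec[of _ "Suc n" "Suc n" _ "Suc n"])
  also have "\<dots> = k \<cdot>\<^sub>v (H *\<^sub>v v)" unfolding Av using H v by (simp add: mult_mat_vec)
  also have "H *\<^sub>v v = col (H * H) 0" using H Hv by (simp add: col_mult2[of _ "Suc n" "Suc n" _ "Suc n"])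
  finally have col0: "col A' 0 = k \<cdot>\<^sub>v unit_vec (Suc n) 0" unfolding HH by simp
  have c0: "A' $$ (i, 0) = (if i = 0 then k else 0)" if "i < Suc n" for i
    using arg_cong[OF col0, of "\<lambda>w. w $ i"] that A' by auto
  have cnjA': "cnj (A' $$ (j, i)) = A' $$ (i, j)" if "i < Suc n" "j < Suc n" for i j
    using arg_cong[OF dA', of "\<lambda>M. M $$ (i, j)"] that A' by simp
  have r0: "A' $$ (0, i) = (if i = 0 then k else 0)" if "i < Suc n" for i
    using cnjA'[of 0 i] cnjA'[of 0 0] c0[OF that] c0[of 0] that by auto
  have "cnj k = k" using cnjA'[of 0 0] c0[of 0] by simp
  then obtain x where k: "k = complex_of_real x" by (metis Reals_cnj_iff Reals_cases)
  define A'' where "A'' = mat n n (\<lambda>(i, j). A' $$ (Suc i, Suc j))"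
  have A'': "A'' \<in> carrier_mat n n" by (simp add: A''_def)
  have "dagger A'' = A''" using cnjA' by (intro eq_matI) (auto simp: A''_def)
  then obtain U d where U: "U \<in> carrier_mat n n" "dagger U * U = 1\<^sub>m n"
    "dagger U * A'' * U = mat n n (\<lambda>(i, j). if i = j then complex_of_real (d i) else 0)"
    using Suc.IH[OF A''] by blast
  define K where "K = mat 1 1 (\<lambda>_. k)"
  have K: "K \<in> carrier_mat 1 1" by (simp add: K_def)
  have A'eq: "A' = four_block_mat K (0\<^sub>m 1 n) (0\<^sub>m n 1) A''"
    using A' c0 r0 by (intro eq_matI) (auto simp: K_def A''_def)
  define F where "F = four_block_mat (1\<^sub>m 1) (0\<^sub>m 1 n) (0\<^sub>m n 1) U"
  have F: "F \<in> carrier_mat (Suc n) (Suc n)" using four_block_carrier_mat[of "1\<^sub>m 1" 1 1 U n n] U unfolding F_def by simp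
  have dF: "dagger F = four_block_mat (1\<^sub>m 1) (0\<^sub>m 1 n) (0\<^sub>m n 1) (dagger U)"
    unfolding F_def using U by (subst dagger_four_block[of _ 1 1 _ n _ n]) auto
  have dU: "dagger U \<in> carrier_mat n n" using U by simp
  have AF: "A' * F = four_block_mat K (0\<^sub>m 1 n) (0\<^sub>m n 1) (A'' * U)"
    unfolding A'eq F_def using K A'' U
    by (subst mult_four_block_mat[of _ 1 1 _ n _ n _ _ 1 _ n]) auto
  have dFF: "dagger F * F = four_block_mat (1\<^sub>m 1) (0\<^sub>m 1 n) (0\<^sub>m n 1) (1\<^sub>m n)"
    unfolding dF unfolding F_def using U dU
    by (subst mult_four_block_mat[of _ 1 1 _ n _ n _ _ 1 _ n]) auto
  have dFAF: "dagger F * (A' * F) = four_block_mat K (0\<^sub>m 1 n) (0\<^sub>m n 1) (dagger U * (A'' * U))"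
    unfolding dF AF using K A'' U dU
    by (subst mult_four_block_mat[of _ 1 1 _ n _ n _ _ 1 _ n]) auto
  have asc: "X * Y * Z = X * (Y * Z)" if "X \<in> carrier_mat (Suc n) (Suc n)" "Y \<in> carrier_mat (Suc n) (Suc n)" "Z \<in> carrier_mat (Suc n) (Suc n)" for X Y Z :: "complex mat"
    using that by (rule assoc_mult_mat)
  have dFc: "dagger F \<in> carrier_mat (Suc n) (Suc n)" using F by simp
  have mc: "X * Y \<in> carrier_mat (Suc n) (Suc n)" if "X \<in> carrier_mat (Suc n) (Suc n)" "Y \<in> carrier_mat (Suc n) (Suc n)" for X Y :: "complex mat"
    using that by (rule mult_carrier_mat)
  have HHX: "H * (H * X) = X" if "X \<in> carrier_mat (Suc n) (Suc n)" for X
    using asc[OF H H that] HH that by simp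
  define V where "V = H * F"
  have V: "V \<in> carrier_mat (Suc n) (Suc n)" using H F by (simp add: V_def)
  have dV: "dagger V = dagger F * H" unfolding V_def using H F dH by (simp add: dagger_mult)
  have "dagger V * V = dagger F * F" unfolding dV unfolding V_def
    using H F dFc by (simp add: asc mc HHX)
  also have "\<dots> = 1\<^sub>m (Suc n)" unfolding dFF by (intro eq_matI) auto
  finally have 1: "dagger V * V = 1\<^sub>m (Suc n)" .
  have "dagger V * A * V = dagger F * (A' * F)" unfolding dV unfolding V_def A'_def
    using H F A dFc by (simp add: asc mc)
  also have "\<dots> = mat (Suc n) (Suc n) (\<lambda>(i, j). if i = j then complex_of_real ((case i of 0 \<Rightarrow> x | Suc i \<Rightarrow> d i)) else 0)"
  proof -
    have "dagger U * (A'' * U) = mat n n (\<lambda>(i, j). if i = j then complex_of_real (d i) else 0)"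
      using U(3) dU A'' U(1) by (simp add: assoc_mult_mat[of _ n n _ n _ n])
    then show ?thesis unfolding dFAF K_def k
      by (intro eq_matI) (auto split: nat.split)
  qed
  finally have 2: "dagger V * A * V = mat (Suc n) (Suc n) (\<lambda>(i, j). if i = j then complex_of_real ((case i of 0 \<Rightarrow> x | Suc i \<Rightarrow> d i)) else 0)" .
  show ?case
    by (rule exI[of _ V], rule exI[of _ "\<lambda>i. case i of 0 \<Rightarrow> x | Suc i \<Rightarrow> d i"], intro conjI V 1 2)
qed

text \<open>The vectors are the columns of U weighted by square roots of the eigenvalues. Every
  positive object below (states, effects, Choi matrices) enters through such vectors, which serve as
  purifications and as Kraus operators.\<close>

theorem psd_gram:
  assumes A: "A \<in> carrier_mat n n" and psd: "psd A"
  obtains W :: "nat \<Rightarrow> nat \<Rightarrow> complex"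
  where "\<And>i j. i < n \<Longrightarrow> j < n \<Longrightarrow> A $$ (i, j) = (\<Sum>k<n. W k i * cnj (W k j))"
proof -
  have dA: "dagger A = A" using psd by (simp add: psd_def hermitian_def)
  obtain U d where U: "U \<in> carrier_mat n n" "dagger U * U = 1\<^sub>m n"
    "dagger U * A * U = mat n n (\<lambda>(i, j). if i = j then complex_of_real (d i) else 0)"
    using hermitian_diagonalization[OF A dA] by blast
  define D where "D = mat n n (\<lambda>(i, j). if i = j then complex_of_real (d i) else 0)"
  have D: "D \<in> carrier_mat n n" by (simp add: D_def)
  have dU: "dagger U \<in> carrier_mat n n" using U by simp
  have U': "U * dagger U = 1\<^sub>m n" using mat_mult_left_right_inverse[OF dU U(1) U(2)] .
  have "U * D * dagger U = U * (dagger U * A * U) * dagger U" by (simp add: U D_def)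
  also have "\<dots> = (U * dagger U) * A * (U * dagger U)"
    using U(1) dU A by (simp add: assoc_mult_mat[of _ n n _ n _ n] mult_carrier_mat[of _ n n _ n])
  finally have AD: "A = U * D * dagger U" unfolding U' using A by simp
  have d: "d k \<ge> 0" if k: "k < n" for k
  proof -
    have c: "col U k \<in> carrier_vec n" using U k by auto
    have "complex_of_real (d k) = (dagger U * A * U) $$ (k, k)" unfolding U using k by simp
    also have "\<dots> = (dagger U * (A * U)) $$ (k, k)" using U dU A by (simp add: assoc_mult_mat[of _ n n _ n _ n])
    also have "\<dots> = row (dagger U) k \<bullet> col (A * U) k" using k U A by simp
    also have "col (A * U) k = A *\<^sub>v col U k" using k U A by (intro col_mult2)
    also have "row (dagger U) k = conjugate (col U k)" using k U by (intro eq_vecI) auto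
    finally have "Re (complex_of_real (d k)) = Re (conjugate (col U k) \<bullet> (A *\<^sub>v col U k))" by (rule arg_cong)
    moreover have "0 \<le> Re (conjugate (col U k) \<bullet> (A *\<^sub>v col U k))"
      using psd c A by (auto simp: psd_def)
    ultimately show ?thesis by simp
  qed
  show thesis
  proof (rule that[of "\<lambda>k i. complex_of_real (sqrt (d k)) * U $$ (i, k)"])
    fix i j assume ij: "i < n" "j < n"
    have UD: "(U * D) $$ (i, k) = U $$ (i, k) * d k" if "k < n" for k
    proof -
      have "(U * D) $$ (i, k) = (\<Sum>l<n. U $$ (i, l) * D $$ (l, k))"
        using ij U D that by (simp add: scalar_prod_def atLeast0LessThan)
      also have "\<dots> = (\<Sum>l<n. if l = k then U $$ (i, l) * d l else 0)"
        using that by (intro sum.cong) (auto simp: D_def)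
      finally show ?thesis using that by simp
    qed
    have "A $$ (i, j) = (\<Sum>k<n. (U * D) $$ (i, k) * cnj (U $$ (j, k)))"
      unfolding AD using ij U D by (simp add: scalar_prod_def atLeast0LessThan)
    also have "\<dots> = (\<Sum>k<n. complex_of_real (sqrt (d k)) * U $$ (i, k) * cnj (complex_of_real (sqrt (d k)) * U $$ (j, k)))"
    proof (intro sum.cong refl)
      fix k assume "k \<in> {..<n}"
      then have "k < n" by simp
      have e: "complex_of_real (d k) = complex_of_real (sqrt (d k)) * complex_of_real (sqrt (d k))"
        unfolding of_real_mult[symmetric] using d[OF \<open>k < n\<close>] by (simp only: real_sqrt_mult_self abs_of_nonneg)
      show "(U * D) $$ (i, k) * cnj (U $$ (j, k)) =
        complex_of_real (sqrt (d k)) * U $$ (i, k) * cnj (complex_of_real (sqrt (d k)) * U $$ (j, k))"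
        by (simp only: UD[OF \<open>k < n\<close>] e complex_cnj_mult complex_cnj_complex_of_real mult_ac)
    qed
    finally show "A $$ (i, j) = \<dots>" .
  qed
qed

subsection \<open>A sum-of-squares bound for the Bell operator\<close>

text \<open>Only semidefiniteness is available: the instance \<open>ip2\<close> reads finitely many
  entries of a function on all pairs of indices.\<close>

locale real_ip =
  fixes ip :: "'v::real_vector \<Rightarrow> 'v \<Rightarrow> real"
  assumes ip_sym: "ip u v = ip v u"
    and ip_add: "ip (u + v) w = ip u w + ip v w"
    and ip_scale: "ip (a *\<^sub>R u) w = a * ip u w"
    and ip_nonneg: "0 \<le> ip u u"
begin

lemma ip_minus: "ip (- u) w = - ip u w"
  using ip_scale[of "-1" u w] by simp

lemma ip_diff: "ip (u - v) w = ip u w - ip v w"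
  using ip_add[of u "-v" w] by (simp add: ip_minus)

lemma ip_right: "ip w (u + v) = ip w u + ip w v" "ip w (a *\<^sub>R u) = a * ip w u"
  "ip w (- u) = - ip w u" "ip w (u - v) = ip w u - ip w v"
  using ip_add ip_scale ip_minus ip_diff ip_sym by metis+

lemmas ip_lin = ip_add ip_scale ip_minus ip_diff ip_right

lemma ip_CS: "(ip u w)\<^sup>2 \<le> ip u u * ip w w"
proof (cases "ip w w = 0")
  case True
  have "ip u w = 0"
  proof (rule ccontr)
    assume nz: "ip u w \<noteq> 0"
    \<comment> \<open>With \<open>ip w w = 0\<close> the square of u + t w is affine in t; this t
      makes it -1.\<close>
    define t where "t = - (ip u u + 1) / (2 * ip u w)"
    have "0 \<le> ip (u + t *\<^sub>R w) (u + t *\<^sub>R w)" by (rule ip_nonneg)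
    also have "\<dots> = ip u u + 2 * t * ip u w" using True ip_sym[of w u] by (simp add: ip_lin algebra_simps)
    also have "\<dots> = -1" using nz by (simp add: t_def field_simps)
    finally show False by simp
  qed
  then show ?thesis using True by simp
next
  case False
  then have w: "ip w w > 0" using ip_nonneg[of w] by simp
  define t where "t = - ip u w / ip w w"
  have "0 \<le> ip (u + t *\<^sub>R w) (u + t *\<^sub>R w)" by (rule ip_nonneg)
  also have "\<dots> = ip u u + 2 * t * ip u w + t * t * ip w w" using ip_sym[of w u] by (simp add: ip_lin algebra_simps)
  also have "\<dots> = ip u u - (ip u w)\<^sup>2 / ip w w" using False by (simp add: t_def power2_eq_square field_simps)
  finally show ?thesis using w by (simp add: field_simps)
qed

definition selfadj :: "('v \<Rightarrow> 'v) \<Rightarrow> bool" where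
  "selfadj T \<longleftrightarrow> (\<forall>u w. T (u + w) = T u + T w) \<and> (\<forall>a u. T (a *\<^sub>R u) = a *\<^sub>R T u) \<and>
     (\<forall>u w. ip (T u) w = ip u (T w))"

lemma selfadjD:
  assumes "selfadj T"
  shows "T (u + w) = T u + T w" "T (a *\<^sub>R u) = a *\<^sub>R T u" "T (- u) = - T u" "T (u - w) = T u - T w"
    "ip (T u) w = ip u (T w)"
proof -
  show add: "T (u + w) = T u + T w" for u w using assms by (simp add: selfadj_def)
  show sc: "T (a *\<^sub>R u) = a *\<^sub>R T u" for a u using assms by (simp add: selfadj_def)
  show neg: "T (- u) = - T u" for u using sc[of "-1" u] by simp
  show "T (u - w) = T u - T w" using add[of u "-w"] by (simp add: neg)
  show "ip (T u) w = ip u (T w)" using assms by (simp add: selfadj_def)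
qed

lemma ip_contraction:
  assumes "selfadj T" "T (T u) = (t^2) *\<^sub>R u" "t \<ge> 0"
  shows "\<bar>ip u (T u)\<bar> \<le> t * ip u u"
proof -
  have "(ip u (T u))^2 \<le> ip u u * ip (T u) (T u)" by (rule ip_CS)
  also have "ip (T u) (T u) = t^2 * ip u u" using assms by (simp add: selfadjD ip_lin)
  finally have "(ip u (T u))^2 \<le> (t * ip u u)^2" by (simp add: power_mult_distrib power2_eq_square mult_ac)
  moreover have "t * ip u u \<ge> 0" using assms(3) ip_nonneg by simp
  ultimately show ?thesis using abs_le_square_iff[of "ip u (T u)" "t * ip u u"] by simp
qed

text \<open>The operator is L + N with L = al + c Y and Y = - X M X' M'. Since Y^2 = (s s')^2, the
  hypotheses \<open>plus\<close> and \<open>minus\<close> say L^2 >= N^2 on the two eigenspaces of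
  Y, and L > 0; as L and N commute this forces L >= - N. The proof reaches the conclusion without
  square roots of operators.\<close>

lemma chsh_block_nonneg:
  assumes sa: "selfadj X" "selfadj M" "selfadj X'" "selfadj M'"
    and anti: "\<And>u. M (X u) = - X (M u)" "\<And>u. M' (X' u) = - X' (M' u)"
    and comm: "\<And>u. X' (X u) = X (X' u)" "\<And>u. X' (M u) = M (X' u)"
      "\<And>u. M' (X u) = X (M' u)" "\<And>u. M' (M u) = M (M' u)"
    and V: "\<And>u. u \<in> V \<Longrightarrow> X u \<in> V" "\<And>u. u \<in> V \<Longrightarrow> M u \<in> V"
      "\<And>u. u \<in> V \<Longrightarrow> X' u \<in> V" "\<And>u. u \<in> V \<Longrightarrow> M' u \<in> V"
      "\<And>u w. u \<in> V \<Longrightarrow> w \<in> V \<Longrightarrow> u + w \<in> V" "\<And>u a. u \<in> V \<Longrightarrow> a *\<^sub>R u \<in> V"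
    and sq: "\<And>u. u \<in> V \<Longrightarrow> X (X u) = u" "\<And>u. u \<in> V \<Longrightarrow> M (M u) = (s^2) *\<^sub>R u"
      "\<And>u. u \<in> V \<Longrightarrow> X' (X' u) = u" "\<And>u. u \<in> V \<Longrightarrow> M' (M' u) = (s'^2) *\<^sub>R u"
    and s: "s \<ge> 0" "s' \<ge> 0" and v: "v \<in> V"
    and al: "\<bar>c * (s * s')\<bar> < al"
    and plus: "(k1 - k4 * (s * s'))^2 + (k2 * s' + k3 * s)^2 \<le> (al + c * (s * s'))^2"
    and minus: "(k1 + k4 * (s * s'))^2 + (k2 * s' - k3 * s)^2 \<le> (al - c * (s * s'))^2"
  shows "0 \<le> ip v (al *\<^sub>R v + k1 *\<^sub>R X (X' v) + k2 *\<^sub>R X (M' v) + k3 *\<^sub>R M (X' v) + k4 *\<^sub>R M (M' v)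
      - c *\<^sub>R X (M (X' (M' v))))"
proof -
  note lin = selfadjD(1-4)[OF sa(1)] selfadjD(1-4)[OF sa(2)] selfadjD(1-4)[OF sa(3)] selfadjD(1-4)[OF sa(4)]
  note adj = selfadjD(5)[OF sa(1)] selfadjD(5)[OF sa(2)] selfadjD(5)[OF sa(3)] selfadjD(5)[OF sa(4)]
  have Vm: "- u \<in> V" if "u \<in> V" for u using V(6)[OF that, of "-1"] by simp
  have dbl: "(2 * a) *\<^sub>R u = a *\<^sub>R u + a *\<^sub>R u" "(a * (b * 2)) *\<^sub>R u = (a * b) *\<^sub>R u + (a * b) *\<^sub>R u"
    "(a * (b * 4)) *\<^sub>R u = (a * b) *\<^sub>R u + (a * b) *\<^sub>R u + (a * b) *\<^sub>R u + (a * b) *\<^sub>R u" for a b and u :: 'v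
    unfolding scaleR_left_distrib[symmetric] by (simp_all add: algebra_simps)
  \<comment> \<open>Y is the hidden symmetry: it commutes with N, and N^2 is a combination of 1 and
    Y.\<close>
  define Y where "Y u = - X (M (X' (M' u)))" for u
  define N where "N u = k1 *\<^sub>R X (X' u) + k2 *\<^sub>R X (M' u) + k3 *\<^sub>R M (X' u) + k4 *\<^sub>R M (M' u)" for u
  define L where "L u = al *\<^sub>R u + c *\<^sub>R Y u" for u
  define Z where "Z u = al *\<^sub>R u - c *\<^sub>R Y u" for u
  define y where "y = s * s'"
  have y: "y \<ge> 0" using s by (simp add: y_def)
  have saY: "selfadj Y" unfolding selfadj_def Y_def
    by (simp add: lin ip_lin adj anti comm)
  have saN: "selfadj N" unfolding selfadj_def N_def
    by (simp add: lin ip_lin adj anti comm algebra_simps)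
  note Yl = selfadjD[OF saY] and Nl = selfadjD[OF saN]
  have YV: "Y u \<in> V" if "u \<in> V" for u using that V Vm by (simp add: Y_def)
  have NV: "N u \<in> V" if "u \<in> V" for u using that V by (simp add: N_def)
  have YN: "Y (N u) = N (Y u)" for u
    by (simp add: Y_def N_def lin anti comm algebra_simps)
  have YY: "Y (Y u) = y^2 *\<^sub>R u" if "u \<in> V" for u
    using that V by (simp add: Y_def lin anti comm sq y_def power_mult_distrib mult.commute)
  define n0 n1 where "n0 = k1^2 + k2^2 * s'^2 + k3^2 * s^2 + k4^2 * s^2 * s'^2" and "n1 = 2 * (k2 * k3 - k1 * k4)"
  have NN: "N (N u) = n0 *\<^sub>R u + n1 *\<^sub>R Y u" if "u \<in> V" for u
    using that V by (simp add: Y_def N_def n0_def n1_def lin anti comm sq algebra_simps power2_eq_square dbl)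
  define t where "t = L v + N v"
  have tV: "t \<in> V" unfolding t_def L_def using v V YV NV by simp
  have LN: "L (N u) = N (L u)" for u by (simp add: L_def YN Nl)
  have LL: "L (L u) = (al^2 + c^2*y^2) *\<^sub>R u + (2*al*c) *\<^sub>R Y u" if "u \<in> V" for u
    using YY[OF that] by (simp add: L_def Yl algebra_simps power2_eq_square dbl)
  have LYl: "L (u + w) = L u + L w" for u w by (simp add: L_def Yl algebra_simps)
  have Zl: "Z (u + w) = Z u + Z w" "Z (a *\<^sub>R u) = a *\<^sub>R Z u" for u w a
    by (simp_all add: Z_def Yl algebra_simps)
  have ZL: "Z (L u) = (al^2 - c^2 * y^2) *\<^sub>R u" if "u \<in> V" for u
    using YY[OF that] by (simp add: L_def Z_def Yl algebra_simps power2_eq_square)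
  \<comment> \<open>e + f Y is L^2 - N^2. With T = L + N, commutativity gives 2 L T = T^2 + (L^2 -
    N^2). Applying Z = al - c Y turns the factor L into the positive number al^2 - c^2 y^2, so T is
    positive once Z T^2 and Z (e + f Y) are.\<close>
  define e f where "e = al^2 + c^2*y^2 - n0" and "f = 2*al*c - n1"
  have "2 *\<^sub>R L t = (L t + N t) + (e *\<^sub>R v + f *\<^sub>R Y v)"
    unfolding t_def LYl selfadjD(1)[OF saN] LN NN[OF v] LL[OF v] e_def f_def
    by (simp add: algebra_simps scaleR_2 dbl)
  then have "Z (2 *\<^sub>R L t) = Z (L t + N t) + Z (e *\<^sub>R v + f *\<^sub>R Y v)" by (simp add: Zl)
  then have "ip v (2 *\<^sub>R Z (L t)) = ip v (Z (L t + N t)) + ip v (Z (e *\<^sub>R v + f *\<^sub>R Y v))"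
    by (simp add: Zl ip_lin)
  moreover have "ip v (2 *\<^sub>R Z (L t)) = 2 * (al^2 - c^2*y^2) * ip v t"
    unfolding ZL[OF tV] by (simp add: ip_lin)
  moreover have "ip v (Z (L t + N t)) = ip t (Z t)"
  proof -
    have "ip v (Z (L t + N t)) = ip v (L (Z t) + N (Z t))"
      by (simp add: Z_def L_def Yl Nl YN algebra_simps)
    also have "\<dots> = ip (L v + N v) (Z t)"
      by (simp add: L_def ip_lin Nl(5) Yl(5))
    finally show ?thesis by (simp add: t_def)
  qed
  moreover have "ip v (Z (e *\<^sub>R v + f *\<^sub>R Y v)) = (al*e - c*f*y^2) * ip v v + (al*f - c*e) * ip v (Y v)"
    using YY[OF v] by (simp add: Z_def Yl ip_lin algebra_simps)
  ultimately have main: "2 * (al^2 - c^2*y^2) * ip v t =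
      ip t (Z t) + ((al*e - c*f*y^2) * ip v v + (al*f - c*e) * ip v (Y v))" by linarith
  have cy: "\<bar>c * y\<bar> < al" using al by (simp add: y_def)
  then have al0: "al > 0" by linarith
  have contr: "\<bar>ip u (Y u)\<bar> \<le> y * ip u u" if "u \<in> V" for u
    using ip_contraction[OF saY YY[OF that] y] .
  have "c * ip t (Y t) \<le> al * ip t t"
  proof -
    have "c * ip t (Y t) \<le> \<bar>c\<bar> * \<bar>ip t (Y t)\<bar>" by (metis abs_ge_self abs_mult)
    also have "\<dots> \<le> \<bar>c\<bar> * (y * ip t t)" using contr[OF tV] by (intro mult_left_mono) auto
    also have "\<dots> = \<bar>c * y\<bar> * ip t t" using y by (simp add: abs_mult)
    also have "\<dots> \<le> al * ip t t" using cy ip_nonneg[of t] by (intro mult_right_mono) auto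
    finally show ?thesis .
  qed
  then have p1: "0 \<le> ip t (Z t)" by (simp add: Z_def ip_lin)
  have ep: "0 \<le> e + f * y" using plus unfolding e_def f_def n0_def n1_def y_def
    by (simp add: power2_eq_square algebra_simps)
  have em: "0 \<le> e - f * y" using minus unfolding e_def f_def n0_def n1_def y_def
    by (simp add: power2_eq_square algebra_simps)
  \<comment> \<open>At Y = y and Y = - y the operator Z (e + f Y) takes the values (al - c y) (e + f
    y) and (al + c y) (e - f y); the inequality says that both are nonnegative.\<close>
  have "\<bar>al*f - c*e\<bar> * y \<le> al*e - c*f*y^2"
  proof -
    have "0 \<le> (al + c*y) * (e - f*y)" using cy em by (intro mult_nonneg_nonneg) auto
    moreover have "0 \<le> (al - c*y) * (e + f*y)" using cy ep by (intro mult_nonneg_nonneg) auto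
    ultimately show ?thesis using y by (simp add: abs_if power2_eq_square algebra_simps)
  qed
  have "- ((al*f - c*e) * ip v (Y v)) \<le> \<bar>al*f - c*e\<bar> * \<bar>ip v (Y v)\<bar>" by (metis abs_ge_minus_self abs_mult)
  also have "\<dots> \<le> \<bar>al*f - c*e\<bar> * (y * ip v v)" using contr[OF v] by (intro mult_left_mono) auto
  also have "\<dots> = (\<bar>al*f - c*e\<bar> * y) * ip v v" by simp
  also have "\<dots> \<le> (al*e - c*f*y^2) * ip v v"
    using \<open>\<bar>al*f - c*e\<bar> * y \<le> al*e - c*f*y^2\<close> ip_nonneg[of v] by (intro mult_right_mono)
  finally have "0 \<le> 2 * (al^2 - c^2*y^2) * ip v t" unfolding main using p1 by linarith
  moreover have "al^2 - c^2*y^2 > 0"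
  proof -
    have "(c*y)^2 < al^2" using cy by (metis abs_less_iff abs_of_pos al0 abs_square_less_1 power2_abs power_strict_mono abs_ge_zero pos2)
    then show ?thesis by (simp add: power_mult_distrib)
  qed
  ultimately have "0 \<le> ip v t" by (simp add: zero_le_mult_iff)
  then show ?thesis unfolding t_def L_def N_def Y_def by (simp add: algebra_simps)
qed

end

section \<open>Two polynomial inequalities on the unit square, in Bernstein form\<close>

lemma bernstein_plus:
  fixes r A B :: real
  assumes r: "r^2 = 2"
  defines "g \<equiv> 2 * A * (1+A-r * A)" and "h \<equiv> 2 * B * (1+B-r * B)"
    and "DA \<equiv> 1+(3-2 * r) * A^2" and "DB \<equiv> 1+(3-2 * r) * B^2"
    and "cA \<equiv> 1-(3-2 * r) * A^2" and "cB \<equiv> 1-(3-2 * r) * B^2"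
    and "sA \<equiv> 2 * (r-1) * A" and "sB \<equiv> 2 * (r-1) * B"
  shows "((4+2 * r) * DA * DB+r * g * h)^2 - (DA * DB+g * h-(5+2 * r) * (cA * cB+sA * sB))^2 - (g * DB+h * DA-(5+2 * r) * (sA * cB+cA * sB))^2 =
    (40 * r-40) * (1-A)^4 * B^2 * (1-B)^2 + (120 * r-144) * (1-A)^4 * B^3 * (1-B) + (192 * r-264) * (1-A)^4 * B^4 + (160 * r-208) * A * (1-A)^3 * B * (1-B)^3 + (664 * r-880) * A * (1-A)^3 * B^2 * (1-B)^2 + 64 * A * (1-A)^3 * B^3 * (1-B) + (64-32 * r) * A * (1-A)^3 * B^4 + (40 * r-40) * A^2 * (1-A)^2 * (1-B)^4 + (664 * r-880) * A^2 * (1-A)^2 * B * (1-B)^3 + (2208 * r-3056) * A^2 * (1-A)^2 * B^2 * (1-B)^2 + (128-64 * r) * A^2 * (1-A)^2 * B^3 * (1-B) + (192-128 * r) * A^2 * (1-A)^2 * B^4 + (120 * r-144) * A^3 * (1-A) * (1-B)^4 + 64 * A^3 * (1-A) * B * (1-B)^3 + (128-64 * r) * A^3 * (1-A) * B^2 * (1-B)^2 + (192 * r-264) * A^4 * (1-B)^4 + (64-32 * r) * A^4 * B * (1-B)^3 + (192-128 * r) * A^4 * B^2 * (1-B)^2"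
proof -
  have rr: "r * r = 2" "r * (r * x) = 2 * x" for x
    using r by (simp_all add: power2_eq_square mult.assoc[symmetric])
  \<comment> \<open>Every expression is split as p + r q with p, q over the integers. The parts
    without r and with r then obey separate polynomial identities, where r = sqrt 2 no longer
    occurs.\<close>
  define p0 q0 where "p0 = 4+4 * B^2-8 * A * B^2+4 * A^2-8 * A^2 * B+4 * A^2 * B^2" and "q0 = 2-2 * B^2+4 * A * B+4 * A * B^2-2 * A^2+4 * A^2 * B-2 * A^2 * B^2"
  have e0: "(4+2 * r) * DA * DB+r * g * h = p0 + r * q0"
    unfolding g_def h_def DA_def DB_def cA_def cB_def sA_def sB_def p0_def q0_def
    by (simp add: algebra_simps power2_eq_square rr)
  define p1 q1 where "p1 = -4+10 * B^2-24 * A * B+4 * A * B^2+10 * A^2+4 * A^2 * B-8 * A^2 * B^2" and "q1 = -2-6 * B^2+16 * A * B-4 * A * B^2-6 * A^2-4 * A^2 * B+6 * A^2 * B^2"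
  have e1: "DA * DB+g * h-(5+2 * r) * (cA * cB+sA * sB) = p1 + r * q1"
    unfolding g_def h_def DA_def DB_def cA_def cB_def sA_def sB_def p1_def q1_def
    by (simp add: algebra_simps power2_eq_square rr)
  define p2 q2 where "p2 = 4 * B+2 * B^2+4 * A-24 * A * B^2+2 * A^2-24 * A^2 * B+28 * A^2 * B^2" and "q2 = -6 * B-2 * B^2-6 * A+18 * A * B^2-2 * A^2+18 * A^2 * B-20 * A^2 * B^2"
  have e2: "g * DB+h * DA-(5+2 * r) * (sA * cB+cA * sB) = p2 + r * q2"
    unfolding g_def h_def DA_def DB_def cA_def cB_def sA_def sB_def p2_def q2_def
    by (simp add: algebra_simps power2_eq_square rr)
  have sq: "(p + r * q)^2 = p^2 + 2 * q^2 + r * (2 * p * q)" for p q :: real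
    by (simp add: algebra_simps power2_eq_square rr)
  have c0: "p0^2 + 2 * q0^2 - (p1^2 + 2 * q1^2) - (p2^2 + 2 * q2^2) = -40 * (1-A)^4 * B^2 * (1-B)^2-144 * (1-A)^4 * B^3 * (1-B)-264 * (1-A)^4 * B^4-208 * A * (1-A)^3 * B * (1-B)^3-880 * A * (1-A)^3 * B^2 * (1-B)^2+64 * A * (1-A)^3 * B^3 * (1-B)+64 * A * (1-A)^3 * B^4-40 * A^2 * (1-A)^2 * (1-B)^4-880 * A^2 * (1-A)^2 * B * (1-B)^3-3056 * A^2 * (1-A)^2 * B^2 * (1-B)^2+128 * A^2 * (1-A)^2 * B^3 * (1-B)+192 * A^2 * (1-A)^2 * B^4-144 * A^3 * (1-A) * (1-B)^4+64 * A^3 * (1-A) * B * (1-B)^3+128 * A^3 * (1-A) * B^2 * (1-B)^2-264 * A^4 * (1-B)^4+64 * A^4 * B * (1-B)^3+192 * A^4 * B^2 * (1-B)^2"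
    unfolding p0_def q0_def p1_def q1_def p2_def q2_def by Groebner_Basis.algebra
  have c1: "2 * p0 * q0 - 2 * p1 * q1 - 2 * p2 * q2 = 40 * (1-A)^4 * B^2 * (1-B)^2+120 * (1-A)^4 * B^3 * (1-B)+192 * (1-A)^4 * B^4+160 * A * (1-A)^3 * B * (1-B)^3+664 * A * (1-A)^3 * B^2 * (1-B)^2-32 * A * (1-A)^3 * B^4+40 * A^2 * (1-A)^2 * (1-B)^4+664 * A^2 * (1-A)^2 * B * (1-B)^3+2208 * A^2 * (1-A)^2 * B^2 * (1-B)^2-64 * A^2 * (1-A)^2 * B^3 * (1-B)-128 * A^2 * (1-A)^2 * B^4+120 * A^3 * (1-A) * (1-B)^4-64 * A^3 * (1-A) * B^2 * (1-B)^2+192 * A^4 * (1-B)^4-32 * A^4 * B * (1-B)^3-128 * A^4 * B^2 * (1-B)^2"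
    unfolding p0_def q0_def p1_def q1_def p2_def q2_def by Groebner_Basis.algebra
  have "(p0+r * q0)^2 - (p1+r * q1)^2 - (p2+r * q2)^2 = (p0^2 + 2 * q0^2 - (p1^2 + 2 * q1^2) - (p2^2 + 2 * q2^2)) + r * (2 * p0 * q0 - 2 * p1 * q1 - 2 * p2 * q2)"
    unfolding sq by Groebner_Basis.algebra
  then show ?thesis unfolding e0 e1 e2 c0 c1 by Groebner_Basis.algebra
qed

lemma bernstein_minus:
  fixes r A B :: real
  assumes r: "r^2 = 2"
  defines "g \<equiv> 2 * A * (1+A-r * A)" and "h \<equiv> 2 * B * (1+B-r * B)"
    and "DA \<equiv> 1+(3-2 * r) * A^2" and "DB \<equiv> 1+(3-2 * r) * B^2"
    and "cA \<equiv> 1-(3-2 * r) * A^2" and "cB \<equiv> 1-(3-2 * r) * B^2"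
    and "sA \<equiv> 2 * (r-1) * A" and "sB \<equiv> 2 * (r-1) * B"
  shows "((4+2 * r) * DA * DB-r * g * h)^2 - (DA * DB-g * h-(5+2 * r) * (cA * cB-sA * sB))^2 - (h * DA-g * DB-(5+2 * r) * (cA * sB-sA * cB))^2 =
    (40 * r-40) * (1-A)^4 * B^2 * (1-B)^2 + (120 * r-144) * (1-A)^4 * B^3 * (1-B) + (192 * r-264) * (1-A)^4 * B^4 + (208-160 * r) * A * (1-A)^3 * B * (1-B)^3 + (560-344 * r) * A * (1-A)^3 * B^2 * (1-B)^2 + (960 * r-1216) * A * (1-A)^3 * B^3 * (1-B) + (1568 * r-2176) * A * (1-A)^3 * B^4 + (40 * r-40) * A^2 * (1-A)^2 * (1-B)^4 + (560-344 * r) * A^2 * (1-A)^2 * B * (1-B)^3 + (1888-1024 * r) * A^2 * (1-A)^2 * B^2 * (1-B)^2 + (1664 * r-1792) * A^2 * (1-A)^2 * B^3 * (1-B) + (2560 * r-3456) * A^2 * (1-A)^2 * B^4 + (120 * r-144) * A^3 * (1-A) * (1-B)^4 + (960 * r-1216) * A^3 * (1-A) * B * (1-B)^3 + (1664 * r-1792) * A^3 * (1-A) * B^2 * (1-B)^2 + (2816-1536 * r) * A^3 * (1-A) * B^3 * (1-B) + (4352-2944 * r) * A^3 * (1-A) * B^4 + (192 * r-264) * A^4 * (1-B)^4 + (1568 * r-2176) * A^4 * B * (1-B)^3 + (2560 * r-3456) * A^4 * B^2 * (1-B)^2 + (4352-2944 * r) * A^4 * B^3 * (1-B) + (7296-5120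 * r) * A^4 * B^4"
proof -
  have rr: "r * r = 2" "r * (r * x) = 2 * x" for x
    using r by (simp_all add: power2_eq_square mult.assoc[symmetric])
  define p0 q0 where "p0 = 4+4 * B^2+8 * A * B^2+4 * A^2+8 * A^2 * B+36 * A^2 * B^2" and "q0 = 2-2 * B^2-4 * A * B-4 * A * B^2-2 * A^2-4 * A^2 * B-26 * A^2 * B^2"
  have e0: "(4+2 * r) * DA * DB-r * g * h = p0 + r * q0"
    unfolding g_def h_def DA_def DB_def cA_def cB_def sA_def sB_def p0_def q0_def
    by (simp add: algebra_simps power2_eq_square rr)
  define p1 q1 where "p1 = -4+10 * B^2+24 * A * B-4 * A * B^2+10 * A^2-4 * A^2 * B-32 * A^2 * B^2" and "q1 = -2-6 * B^2-16 * A * B+4 * A * B^2-6 * A^2+4 * A^2 * B+22 * A^2 * B^2"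
  have e1: "DA * DB-g * h-(5+2 * r) * (cA * cB-sA * sB) = p1 + r * q1"
    unfolding g_def h_def DA_def DB_def cA_def cB_def sA_def sB_def p1_def q1_def
    by (simp add: algebra_simps power2_eq_square rr)
  define p2 q2 where "p2 = 4 * B+2 * B^2-4 * A+24 * A * B^2-2 * A^2-24 * A^2 * B" and "q2 = -6 * B-2 * B^2+6 * A-18 * A * B^2+2 * A^2+18 * A^2 * B"
  have e2: "h * DA-g * DB-(5+2 * r) * (cA * sB-sA * cB) = p2 + r * q2"
    unfolding g_def h_def DA_def DB_def cA_def cB_def sA_def sB_def p2_def q2_def
    by (simp add: algebra_simps power2_eq_square rr)
  have sq: "(p + r * q)^2 = p^2 + 2 * q^2 + r * (2 * p * q)" for p q :: real
    by (simp add: algebra_simps power2_eq_square rr)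
  have c0: "p0^2 + 2 * q0^2 - (p1^2 + 2 * q1^2) - (p2^2 + 2 * q2^2) = -40 * (1-A)^4 * B^2 * (1-B)^2-144 * (1-A)^4 * B^3 * (1-B)-264 * (1-A)^4 * B^4+208 * A * (1-A)^3 * B * (1-B)^3+560 * A * (1-A)^3 * B^2 * (1-B)^2-1216 * A * (1-A)^3 * B^3 * (1-B)-2176 * A * (1-A)^3 * B^4-40 * A^2 * (1-A)^2 * (1-B)^4+560 * A^2 * (1-A)^2 * B * (1-B)^3+1888 * A^2 * (1-A)^2 * B^2 * (1-B)^2-1792 * A^2 * (1-A)^2 * B^3 * (1-B)-3456 * A^2 * (1-A)^2 * B^4-144 * A^3 * (1-A) * (1-B)^4-1216 * A^3 * (1-A) * B * (1-B)^3-1792 * A^3 * (1-A) * B^2 * (1-B)^2+2816 * A^3 * (1-A) * B^3 * (1-B)+4352 * A^3 * (1-A) * B^4-264 * A^4 * (1-B)^4-2176 * A^4 * B * (1-B)^3-3456 * A^4 * B^2 * (1-B)^2+4352 * A^4 * B^3 * (1-B)+7296 * A^4 * B^4"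
    unfolding p0_def q0_def p1_def q1_def p2_def q2_def by Groebner_Basis.algebra
  have c1: "2 * p0 * q0 - 2 * p1 * q1 - 2 * p2 * q2 = 40 * (1-A)^4 * B^2 * (1-B)^2+120 * (1-A)^4 * B^3 * (1-B)+192 * (1-A)^4 * B^4-160 * A * (1-A)^3 * B * (1-B)^3-344 * A * (1-A)^3 * B^2 * (1-B)^2+960 * A * (1-A)^3 * B^3 * (1-B)+1568 * A * (1-A)^3 * B^4+40 * A^2 * (1-A)^2 * (1-B)^4-344 * A^2 * (1-A)^2 * B * (1-B)^3-1024 * A^2 * (1-A)^2 * B^2 * (1-B)^2+1664 * A^2 * (1-A)^2 * B^3 * (1-B)+2560 * A^2 * (1-A)^2 * B^4+120 * A^3 * (1-A) * (1-B)^4+960 * A^3 * (1-A) * B * (1-B)^3+1664 * A^3 * (1-A) * B^2 * (1-B)^2-1536 * A^3 * (1-A) * B^3 * (1-B)-2944 * A^3 * (1-A) * B^4+192 * A^4 * (1-B)^4+1568 * A^4 * B * (1-B)^3+2560 * A^4 * B^2 * (1-B)^2-2944 * A^4 * B^3 * (1-B)-5120 * A^4 * B^4"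
    unfolding p0_def q0_def p1_def q1_def p2_def q2_def by Groebner_Basis.algebra
  have "(p0+r * q0)^2 - (p1+r * q1)^2 - (p2+r * q2)^2 = (p0^2 + 2 * q0^2 - (p1^2 + 2 * q1^2) - (p2^2 + 2 * q2^2)) + r * (2 * p0 * q0 - 2 * p1 * q1 - 2 * p2 * q2)"
    unfolding sq by Groebner_Basis.algebra
  then show ?thesis unfolding e0 e1 e2 c0 c1 by Groebner_Basis.algebra
qed

text \<open>The products A^i (1-A)^(4-i) B^j (1-B)^(4-j) are nonnegative on the unit square, and
  here every coefficient is nonnegative for r in the given interval.\<close>

lemma bernstein_plus_nonneg:
  fixes r A B :: real
  assumes "7/5 \<le> r" "r \<le> 71/50" "0 \<le> A" "A \<le> 1" "0 \<le> B" "B \<le> 1"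
  shows "0 \<le> (40 * r-40) * (1-A)^4 * B^2 * (1-B)^2 + (120 * r-144) * (1-A)^4 * B^3 * (1-B) + (192 * r-264) * (1-A)^4 * B^4 + (160 * r-208) * A * (1-A)^3 * B * (1-B)^3 + (664 * r-880) * A * (1-A)^3 * B^2 * (1-B)^2 + 64 * A * (1-A)^3 * B^3 * (1-B) + (64-32 * r) * A * (1-A)^3 * B^4 + (40 * r-40) * A^2 * (1-A)^2 * (1-B)^4 + (664 * r-880) * A^2 * (1-A)^2 * B * (1-B)^3 + (2208 * r-3056) * A^2 * (1-A)^2 * B^2 * (1-B)^2 + (128-64 * r) * A^2 * (1-A)^2 * B^3 * (1-B) + (192-128 * r) * A^2 * (1-A)^2 * B^4 + (120 * r-144) * A^3 * (1-A) * (1-B)^4 + 64 * A^3 * (1-A) * B * (1-B)^3 + (128-64 * r) * A^3 * (1-A) * B^2 * (1-B)^2 + (192 * r-264) * A^4 * (1-B)^4 + (64-32 * r) * A^4 * B * (1-B)^3 + (192-128 * r) * A^4 * B^2 * (1-B)^2"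
  using assms by (intro add_nonneg_nonneg mult_nonneg_nonneg zero_le_power) auto

lemma bernstein_minus_nonneg:
  fixes r A B :: real
  assumes "7/5 \<le> r" "r \<le> 71/50" "0 \<le> A" "A \<le> 1" "0 \<le> B" "B \<le> 1"
  shows "0 \<le> (40 * r-40) * (1-A)^4 * B^2 * (1-B)^2 + (120 * r-144) * (1-A)^4 * B^3 * (1-B) + (192 * r-264) * (1-A)^4 * B^4 + (208-160 * r) * A * (1-A)^3 * B * (1-B)^3 + (560-344 * r) * A * (1-A)^3 * B^2 * (1-B)^2 + (960 * r-1216) * A * (1-A)^3 * B^3 * (1-B) + (1568 * r-2176) * A * (1-A)^3 * B^4 + (40 * r-40) * A^2 * (1-A)^2 * (1-B)^4 + (560-344 * r) * A^2 * (1-A)^2 * B * (1-B)^3 + (1888-1024 * r) * A^2 * (1-A)^2 * B^2 * (1-B)^2 + (1664 * r-1792) * A^2 * (1-A)^2 * B^3 * (1-B) + (2560 * r-3456) * A^2 * (1-A)^2 * B^4 + (120 * r-144) * A^3 * (1-A) * (1-B)^4 + (960 * r-1216) * A^3 * (1-A) * B * (1-B)^3 + (1664 * r-1792) * A^3 * (1-A) * B^2 * (1-B)^2 + (2816-1536 * r) * A^3 * (1-A) * B^3 * (1-B) + (4352-2944 * r) * A^3 * (1-A) * B^4 + (192 * r-264) * A^4 * (1-B)^4 + (1568 * r-2176) * A^4 * B * (1-B)^3 + (2560 * r-3456) * A^4 * B^2 * (1-B)^2 + (4352-2944 * r) * A^4 * B^3 * (1-B) + (7296-5120 * r) * A^4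 * B^4"
proof -
  \<comment> \<open>Only the coefficient 208 - 160 r is negative. Its monomial m is the geometric
    mean of two monomials with coefficient 40 r - 40, so a square of their roots absorbs it: 208 -
    160 r + 80 r - 80 = 128 - 80 r is positive.\<close>
  define m where "m = A * (1-A)^3 * B * (1-B)^3"
  have m: "m \<ge> 0" unfolding m_def using assms by (intro mult_nonneg_nonneg zero_le_power) auto
  have "0 \<le> (40 * r-40) * (A * (1-A) * (1-B)^2 - B * (1-B) * (1-A)^2)^2" using assms by auto
  also have "\<dots> = (40 * r-40) * A^2 * (1-A)^2 * (1-B)^4 + (40 * r-40) * (1-A)^4 * B^2 * (1-B)^2 - (80 * r-80) * m"
    unfolding m_def by Groebner_Basis.algebra
  finally have 1: "(80 * r-80) * m \<le> (40 * r-40) * A^2 * (1-A)^2 * (1-B)^4 + (40 * r-40) * (1-A)^4 * B^2 * (1-B)^2" by simp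
  have "(208-160 * r) * A * (1-A)^3 * B * (1-B)^3 = (208-160 * r) * m" unfolding m_def by Groebner_Basis.algebra
  moreover have "0 \<le> ((208-160 * r) + (80 * r-80)) * m" using m assms by (intro mult_nonneg_nonneg) auto
  ultimately have 2: "0 \<le> (208-160 * r) * A * (1-A)^3 * B * (1-B)^3 + (40 * r-40) * A^2 * (1-A)^2 * (1-B)^4 + (40 * r-40) * (1-A)^4 * B^2 * (1-B)^2"
    using 1 by (simp add: algebra_simps)
  have "0 \<le> (120 * r-144) * (1-A)^4 * B^3 * (1-B) + (192 * r-264) * (1-A)^4 * B^4 + (560-344 * r) * A * (1-A)^3 * B^2 * (1-B)^2 + (960 * r-1216) * A * (1-A)^3 * B^3 * (1-B) + (1568 * r-2176) * A * (1-A)^3 * B^4 + (560-344 * r) * A^2 * (1-A)^2 * B * (1-B)^3 + (1888-1024 * r) * A^2 * (1-A)^2 * B^2 * (1-B)^2 + (1664 * r-1792) * A^2 * (1-A)^2 * B^3 * (1-B) + (2560 * r-3456) * A^2 * (1-A)^2 * B^4 + (120 * r-144) * A^3 * (1-A) * (1-B)^4 + (960 * r-1216) * A^3 * (1-A) * B * (1-B)^3 + (1664 * r-1792) * A^3 * (1-A) * B^2 * (1-B)^2 + (2816-1536 * r) * A^3 * (1-A) * B^3 * (1-B) + (4352-2944 * r) * A^3 * (1-A) * B^4 + (192 * r-264) * A^4 * (1-B)^4 + (1568 * r-2176) * A^4 * B * (1-B)^3 + (2560 * r-3456) * A^4 * B^2 * (1-B)^2 + (4352-2944 * r) * A^4 *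 B^3 * (1-B) + (7296-5120 * r) * A^4 * B^4"
    using assms by (intro add_nonneg_nonneg mult_nonneg_nonneg zero_le_power) auto
  with 2 show ?thesis by linarith
qed

text \<open>Narrow enough to fix the signs of the Bernstein coefficients; the most demanding ones
  are 7296 - 5120 r, positive for r < 1.425, and 1568 r - 2176, positive for r > 1.388.\<close>

lemma sqrt2_bounds: "7/5 \<le> sqrt 2" "sqrt 2 \<le> 71/50"
  by (rule real_le_rsqrt, simp add: power2_eq_square) (rule real_le_lsqrt, simp_all add: power2_eq_square)

text \<open>For an angle in [0, pi/4] with cosine \<open>c\<close> and sine \<open>s\<close>, the tangent of half the angle
  times \<open>1 + sqrt 2\<close> runs over [0, 1].\<close>

lemma half_angle:
  fixes c s :: real
  assumes "0 \<le> s" "s \<le> c" "c^2 + s^2 = 1"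
  obtains A where "0 \<le> A" "A \<le> 1" "s / (1 + c) = (sqrt 2 - 1) * A"
    "c = (1-(3-2 * sqrt 2) * A^2) / (1+(3-2 * sqrt 2) * A^2)"
    "s = 2 * (sqrt 2-1) * A / (1+(3-2 * sqrt 2) * A^2)"
    "(1+sqrt 2) * (1 - s/(1+c)) * s = 2 * A * (1+A-sqrt 2 * A) / (1+(3-2 * sqrt 2) * A^2)"
    "1+(3-2 * sqrt 2) * A^2 > 0"
proof
  define r where "r = sqrt (2::real)"
  have r2: "r^2 = 2" by (simp add: r_def)
  have rr: "r * r = 2" "r * (r * x) = 2 * x" for x
    using r2 by (simp_all add: power2_eq_square mult.assoc[symmetric])
  define T where "T = s / (1+c)"
  define A where "A = (1+r) * T"
  have T0: "0 \<le> T" using assms by (simp add: T_def)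
  then show "0 \<le> (1+sqrt 2) * (s/(1+c))" using assms by simp
  have cs: "s * r \<le> 1"
  proof -
    have "s^2 \<le> c^2" using assms by (intro power_mono)
    then have "(s * r)^2 \<le> 1^2" using assms(3) r2 by (simp add: power_mult_distrib)
    then show ?thesis using power2_le_imp_le[of "s * r" 1] by simp
  qed
  then have "(1+r) * s \<le> 1 + c" using assms by (simp add: algebra_simps)
  \<comment> \<open>The angle is at most pi/4, so T is at most tan (pi/8) = sqrt 2 - 1, the
    reciprocal of 1 + sqrt 2.\<close>
  then have A1: "A \<le> 1" using assms by (simp add: A_def T_def divide_simps)
  then show "(1+sqrt 2) * (s/(1+c)) \<le> 1" by (simp add: A_def T_def r_def)
  have TA: "T = (r-1) * A" unfolding A_def by (simp add: algebra_simps rr)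
  then show "s / (1 + c) = (sqrt 2 - 1) * ((1+sqrt 2) * (s/(1+c)))"
    by (simp add: T_def A_def r_def)
  have TT: "(3-2 * r) * A^2 = T^2" unfolding TA by (simp add: algebra_simps power2_eq_square rr)
  have pos: "1 + T^2 > 0" by (simp add: add_pos_nonneg)
  then show "1+(3-2 * sqrt 2) * ((1+sqrt 2) * (s/(1+c)))^2 > 0" using TT by (simp add: A_def T_def r_def)
  have s: "s = T * (1+c)" using assms by (simp add: T_def)
  have c0: "1 + c > 0" using assms by linarith
  have "(1-c) * (1+c) = s^2" using assms(3) by Groebner_Basis.algebra
  also have "\<dots> = (T^2 * (1+c)) * (1+c)" unfolding power2_eq_square by (subst (1 2) s) simp
  finally have "1 - c = T^2 * (1+c)" using c0 by simp
  then have c: "c * (1+T^2) = 1-T^2" by (simp add: algebra_simps)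
  then have c': "c = (1-T^2)/(1+T^2)" using pos by (simp add: field_simps)
  then show "c = (1-(3-2 * sqrt 2) * ((1+sqrt 2) * (s/(1+c)))^2) / (1+(3-2 * sqrt 2) * ((1+sqrt 2) * (s/(1+c)))^2)"
    using TT by (simp add: A_def T_def r_def)
  have "s * (1+T^2) = T * (1+T^2 + c * (1+T^2))" by (subst s) (simp add: algebra_simps)
  also have "\<dots> = 2 * T" unfolding c by simp
  finally have s': "s = 2 * T/(1+T^2)" using pos by (simp add: field_simps)
  then have "s = 2 * (r-1) * A/(1+(3-2 * r) * A^2)" unfolding TT by (simp add: TA)
  then show "s = 2 * (sqrt 2-1) * ((1+sqrt 2) * (s/(1+c))) / (1+(3-2 * sqrt 2) * ((1+sqrt 2) * (s/(1+c)))^2)"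
    by (simp add: A_def T_def r_def)
  have "(1+r) * (1-T) * (2 * T) = 2 * A * (1+A-r * A)" unfolding TA by (simp add: algebra_simps rr)
  then have "(1+r) * (1-T) * s = 2 * A * (1+A-r * A)/(1+(3-2 * r) * A^2)" unfolding TT by (subst s') simp
  then show "(1+sqrt 2) * (1 - s/(1+c)) * s = 2 * ((1+sqrt 2) * (s/(1+c))) * (1+((1+sqrt 2) * (s/(1+c)))-sqrt 2 * ((1+sqrt 2) * (s/(1+c)))) / (1+(3-2 * sqrt 2) * ((1+sqrt 2) * (s/(1+c)))^2)"
    by (simp add: A_def T_def r_def)
qed

text \<open>These are the conditions \<open>plus\<close> and \<open>minus\<close> of
  \<open>chsh_block_nonneg\<close> for two Jordan angles up to pi/4, with g and h the norms of the
  damped parts. Half-angle tangents make cosine and sine rational, and clearing the positive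
  denominators DA and DB leaves the Bernstein polynomials.\<close>

lemma chsh_block_ineqs:
  fixes c s c' s' :: real
  assumes "0 \<le> s" "s \<le> c" "c^2 + s^2 = 1" "0 \<le> s'" "s' \<le> c'" "c'^2 + s'^2 = 1"
  defines "g \<equiv> (1+sqrt 2) * (1 - s/(1+c)) * s" and "h \<equiv> (1+sqrt 2) * (1 - s'/(1+c')) * s'"
  shows "(1+g * h-(5+2 * sqrt 2) * (c * c'+s * s'))^2 + (g+h-(5+2 * sqrt 2) * (s * c'+c * s'))^2 \<le> (4+2 * sqrt 2+sqrt 2 * g * h)^2"
    and "(1-g * h-(5+2 * sqrt 2) * (c * c'-s * s'))^2 + (h-g-(5+2 * sqrt 2) * (c * s'-s * c'))^2 \<le> (4+2 * sqrt 2-sqrt 2 * g * h)^2"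
proof -
  define r where "r = sqrt (2::real)"
  have r2: "r^2 = 2" by (simp add: r_def)
  have rb: "7/5 \<le> r" "r \<le> 71/50" using sqrt2_bounds by (auto simp: r_def)
  obtain A where A: "0 \<le> A" "A \<le> 1" "c = (1-(3-2 * r) * A^2) / (1+(3-2 * r) * A^2)"
    "s = 2 * (r-1) * A / (1+(3-2 * r) * A^2)" "g = 2 * A * (1+A-r * A) / (1+(3-2 * r) * A^2)" "1+(3-2 * r) * A^2 > 0"
    using half_angle[OF assms(1-3)] unfolding g_def r_def by metis
  obtain B where B: "0 \<le> B" "B \<le> 1" "c' = (1-(3-2 * r) * B^2) / (1+(3-2 * r) * B^2)"
    "s' = 2 * (r-1) * B / (1+(3-2 * r) * B^2)" "h = 2 * B * (1+B-r * B) / (1+(3-2 * r) * B^2)" "1+(3-2 * r) * B^2 > 0"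
    using half_angle[OF assms(4-6)] unfolding h_def r_def by metis
  define DA DB cA cB sA sB gA hB where D: "DA = 1+(3-2 * r) * A^2" "DB = 1+(3-2 * r) * B^2"
    "cA = 1-(3-2 * r) * A^2" "cB = 1-(3-2 * r) * B^2" "sA = 2 * (r-1) * A" "sB = 2 * (r-1) * B"
    "gA = 2 * A * (1+A-r * A)" "hB = 2 * B * (1+B-r * B)"
  have pos: "DA > 0" "DB > 0" using A B by (auto simp: D)
  have eq: "c = cA/DA" "s = sA/DA" "g = gA/DA" "c' = cB/DB" "s' = sB/DB" "h = hB/DB"
    using A B by (auto simp: D)
  have le: "y^2 + z^2 \<le> x^2" if "0 \<le> (x * (DA * DB))^2 - (y * (DA * DB))^2 - (z * (DA * DB))^2" for x y z
  proof -
    have "(x * (DA * DB))^2 - (y * (DA * DB))^2 - (z * (DA * DB))^2 = (DA * DB)^2 * (x^2 - (y^2+z^2))" by Groebner_Basis.algebra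
    with that have "0 \<le> (DA * DB)^2 * (x^2 - (y^2+z^2))" by simp
    then show ?thesis using pos by (simp add: zero_le_mult_iff)
  qed
  have p: "(4+2 * r+r * g * h) * (DA * DB) = (4+2 * r) * DA * DB+r * gA * hB"
    "(1+g * h-(5+2 * r) * (c * c'+s * s')) * (DA * DB) = DA * DB+gA * hB-(5+2 * r) * (cA * cB+sA * sB)"
    "(g+h-(5+2 * r) * (s * c'+c * s')) * (DA * DB) = gA * DB+hB * DA-(5+2 * r) * (sA * cB+cA * sB)"
    "(4+2 * r-r * g * h) * (DA * DB) = (4+2 * r) * DA * DB-r * gA * hB"
    "(1-g * h-(5+2 * r) * (c * c'-s * s')) * (DA * DB) = DA * DB-gA * hB-(5+2 * r) * (cA * cB-sA * sB)"
    "(h-g-(5+2 * r) * (c * s'-s * c')) * (DA * DB) = hB * DA-gA * DB-(5+2 * r) * (cA * sB-sA * cB)"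
    unfolding eq using pos by (simp_all add: field_simps)
  have "0 \<le> ((4+2 * r) * DA * DB+r * gA * hB)^2 - (DA * DB+gA * hB-(5+2 * r) * (cA * cB+sA * sB))^2 - (gA * DB+hB * DA-(5+2 * r) * (sA * cB+cA * sB))^2"
    unfolding D bernstein_plus[OF r2] using A B by (intro bernstein_plus_nonneg[OF rb])
  then show "(1+g * h-(5+2 * sqrt 2) * (c * c'+s * s'))^2 + (g+h-(5+2 * sqrt 2) * (s * c'+c * s'))^2 \<le> (4+2 * sqrt 2+sqrt 2 * g * h)^2"
    unfolding p[symmetric] r_def[symmetric] by (rule le)
  have "0 \<le> ((4+2 * r) * DA * DB-r * gA * hB)^2 - (DA * DB-gA * hB-(5+2 * r) * (cA * cB-sA * sB))^2 - (hB * DA-gA * DB-(5+2 * r) * (cA * sB-sA * cB))^2"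
    unfolding D bernstein_minus[OF r2] using A B by (intro bernstein_minus_nonneg[OF rb])
  then show "(1-g * h-(5+2 * sqrt 2) * (c * c'-s * s'))^2 + (h-g-(5+2 * sqrt 2) * (c * s'-s * c'))^2 \<le> (4+2 * sqrt 2-sqrt 2 * g * h)^2"
    unfolding p[symmetric] r_def[symmetric] by (rule le)
qed

text \<open>The larger of P and M is scaled to a reflection. The factor of the smaller one, of norm
  y say, is (1 + sqrt 2) (x + y - 1) / y when x^2 + y^2 = 1; the form chosen here avoids the
  division by y, which may be 0.\<close>

definition extP :: "real \<Rightarrow> real \<Rightarrow> real" where
  "extP x y = (if y \<le> x then 1 / x else (1 + sqrt 2) * (1 - x / (1 + y)))"

definition extM :: "real \<Rightarrow> real \<Rightarrow> real" where
  "extM x y = (if y \<le> x then (1 + sqrt 2) * (1 - y / (1 + x)) else 1 / y)"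

text \<open>The product equals (1 + sqrt 2) (x + y - 1), and x + y is at most sqrt 2 on the unit
  circle; the factor 1 + sqrt 2 normalises the maximum to 1.\<close>

lemma damping_bounds:
  fixes x y :: real
  assumes "0 \<le> y" "y \<le> x" "x^2 + y^2 = 1"
  shows "0 \<le> (1 + sqrt 2) * (1 - y / (1 + x)) * y" "(1 + sqrt 2) * (1 - y / (1 + x)) * y \<le> 1"
proof -
  have x: "1 + x > 0" using assms by simp
  have "1 - y / (1 + x) \<ge> 0" using assms x by (simp add: field_simps)
  then show "0 \<le> (1 + sqrt 2) * (1 - y / (1 + x)) * y" using assms by simp
  have "(1 - y / (1 + x)) * y * (1 + x) = (1 + x - y) * y" using x by (simp add: field_simps)
  also have "\<dots> = (x + y - 1) * (1 + x)" using assms(3) by (simp add: algebra_simps power2_eq_square)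
  finally have e: "(1 - y / (1 + x)) * y = x + y - 1" using x by simp
  have "(x + y)^2 \<le> 2" using assms(3) sum_squares_bound[of x y] by (simp add: power2_sum)
  then have "x + y \<le> sqrt 2" by (rule real_le_rsqrt)
  then have "(1 + sqrt 2) * (x + y - 1) \<le> (1 + sqrt 2) * (sqrt 2 - 1)" by (intro mult_left_mono) auto
  also have "\<dots> = 1" by (simp add: algebra_simps)
  finally show "(1 + sqrt 2) * (1 - y / (1 + x)) * y \<le> 1" using e by (simp add: mult.assoc)
qed

section \<open>The sum-of-squares inequality on a pair of Jordan blocks\<close>

context real_ip
begin

text \<open>V is a whole eigenspace, not a single two-dimensional block. Self-adjointness and
  anticommutation are properties of the operators on the full space; only the values x^2 and y^2 of
  the squares are local to V.\<close>

definition blk :: "'v set \<Rightarrow> ('v \<Rightarrow> 'v) \<Rightarrow> ('v \<Rightarrow> 'v) \<Rightarrow> real \<Rightarrow> real \<Rightarrow> bool" where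
  "blk V P M x y \<longleftrightarrow> selfadj P \<and> selfadj M \<and> (\<forall>u. M (P u) = - P (M u)) \<and>
     (\<forall>u\<in>V. P u \<in> V \<and> M u \<in> V \<and> P (P u) = x^2 *\<^sub>R u \<and> M (M u) = y^2 *\<^sub>R u) \<and>
     0 \<le> x \<and> 0 \<le> y \<and> x^2 + y^2 = 1"

definition subsp :: "'v set \<Rightarrow> bool" where
  "subsp V \<longleftrightarrow> (\<forall>u\<in>V. \<forall>w\<in>V. u + w \<in> V) \<and> (\<forall>u\<in>V. \<forall>a. a *\<^sub>R u \<in> V)"

definition commuting :: "('v \<Rightarrow> 'v) \<Rightarrow> ('v \<Rightarrow> 'v) \<Rightarrow> bool" where
  "commuting S T \<longleftrightarrow> (\<forall>u. S (T u) = T (S u))"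

lemma selfadj_scale: "selfadj T \<Longrightarrow> selfadj (\<lambda>u. a *\<^sub>R T u)"
  unfolding selfadj_def by (simp add: ip_lin scaleR_right_distrib)

lemma selfadj_minus: "selfadj T \<Longrightarrow> selfadj (\<lambda>u. - T u)"
  using selfadj_scale[of T "-1"] by simp

lemma blk_swap: "blk V P M x y \<Longrightarrow> blk V M P y x"
  unfolding blk_def by (auto simp: add.commute)

lemma blk_neg:
  assumes "blk V P M x y" "subsp V"
  shows "blk V P (\<lambda>u. - M u) x y"
proof -
  have "- u \<in> V" if "u \<in> V" for u using assms(2) that unfolding subsp_def by (metis scaleR_minus1_left)
  then show ?thesis using assms(1) unfolding blk_def by (auto simp: selfadj_minus selfadjD)
qed

text \<open>Both angles are at most pi/4, so P and P' become the reflections X and X'. The damping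
  factors f and f' of M and M' are moved into the coefficients of \<open>chsh_block_nonneg\<close>,
  which leaves M and M' with their norms y and y'.\<close>

lemma chsh_corner:
  assumes b: "blk V P M x y" "blk V P' M' x' y'" and sub: "subsp V" and v: "v \<in> V"
    and com: "commuting P' P" "commuting P' M" "commuting M' P" "commuting M' M"
    and xy: "y \<le> x" "y' \<le> x'"
  defines "f \<equiv> (1 + sqrt 2) * (1 - y / (1 + x))" and "f' \<equiv> (1 + sqrt 2) * (1 - y' / (1 + x'))"
    and "\<kappa> \<equiv> 5 + 2 * sqrt 2"
  shows "0 \<le> ip v ((4 + 2 * sqrt 2) *\<^sub>R v + (1/x * (1/x') - \<kappa>) *\<^sub>R P (P' v) + (1/x * f' - \<kappa>) *\<^sub>R P (M' v)
     + (f * (1/x') - \<kappa>) *\<^sub>R M (P' v) - (f * f' - \<kappa>) *\<^sub>R M (M' v)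
     - (sqrt 2 * (1/x * f * (1/x') * f')) *\<^sub>R P (M (P' (M' v))))"
proof -
  have sa: "selfadj P" "selfadj M" "selfadj P'" "selfadj M'" using b by (auto simp: blk_def)
  have pos: "0 \<le> y" "0 \<le> y'" and n: "x^2 + y^2 = 1" "x'^2 + y'^2 = 1" using b by (auto simp: blk_def)
  have "x \<noteq> 0" using n(1) xy(1) pos(1) by auto
  then have x: "x > 0" using xy(1) pos(1) by linarith
  have "x' \<noteq> 0" using n(2) xy(2) pos(2) by auto
  then have x': "x' > 0" using xy(2) pos(2) by linarith
  note lin = selfadjD(1-4)[OF sa(1)] selfadjD(1-4)[OF sa(2)] selfadjD(1-4)[OF sa(3)] selfadjD(1-4)[OF sa(4)]
  define X where "X u = (1/x) *\<^sub>R P u" for u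
  define X' where "X' u = (1/x') *\<^sub>R P' u" for u
  have saX: "selfadj X" "selfadj X'" unfolding X_def X'_def using selfadj_scale sa by auto
  define g h where "g = f * y" and "h = f' * y'"
  have gh: "0 \<le> g" "g \<le> 1" "0 \<le> h" "h \<le> 1"
    unfolding g_def h_def f_def f'_def using damping_bounds[OF pos(1) xy(1) n(1)] damping_bounds[OF pos(2) xy(2) n(2)] by auto
  note ineq = chsh_block_ineqs[OF pos(1) xy(1) n(1) pos(2) xy(2) n(2), folded f_def f'_def, folded g_def h_def \<kappa>_def]
  have c: "sqrt 2 * (f * f') * (y * y') = sqrt 2 * g * h" by (simp add: g_def h_def)
  have ghle: "g * h \<le> 1" using gh by (simp add: mult_le_one)
  have main: "0 \<le> ip v ((4 + 2 * sqrt 2) *\<^sub>R v + (1 - \<kappa> * (x*x')) *\<^sub>R X (X' v) + (f' - \<kappa> * x) *\<^sub>R X (M' v)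
     + (f - \<kappa> * x') *\<^sub>R M (X' v) + (- (f * f' - \<kappa>)) *\<^sub>R M (M' v)
     - (sqrt 2 * (f * f')) *\<^sub>R X (M (X' (M' v))))"
  proof (rule chsh_block_nonneg[OF saX(1) sa(2) saX(2) sa(4), where V = V and s = y and s' = y'])
    show "M (X u) = - X (M u)" "M' (X' u) = - X' (M' u)" for u
      using b by (simp_all add: X_def X'_def lin blk_def)
    show "X' (X u) = X (X' u)" "X' (M u) = M (X' u)" "M' (X u) = X (M' u)" "M' (M u) = M (M' u)" for u
      using com by (simp_all add: X_def X'_def lin commuting_def)
    show "X u \<in> V" "M u \<in> V" "X' u \<in> V" "M' u \<in> V" if "u \<in> V" for u
      using b sub that by (auto simp: X_def X'_def blk_def subsp_def)
    show "u + w \<in> V" if "u \<in> V" "w \<in> V" for u w using sub that by (auto simp: subsp_def)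
    show "a *\<^sub>R u \<in> V" if "u \<in> V" for u a using sub that by (auto simp: subsp_def)
    show "X (X u) = u" "M (M u) = y^2 *\<^sub>R u" "X' (X' u) = u" "M' (M' u) = y'^2 *\<^sub>R u" if "u \<in> V" for u
      using b x x' that by (auto simp: X_def X'_def lin blk_def power2_eq_square)
    show "y \<ge> 0" "y' \<ge> 0" "v \<in> V" by fact+
    have "sqrt 2 * (g * h) \<le> sqrt 2" using ghle by simp
    moreover have "0 \<le> sqrt 2 * (g * h)" using gh by simp
    moreover have "sqrt 2 \<ge> (0::real)" by simp
    ultimately have "\<bar>sqrt 2 * (g * h)\<bar> < 4 + 2 * sqrt 2" by linarith
    then show "\<bar>sqrt 2 * (f * f') * (y * y')\<bar> < 4 + 2 * sqrt 2" unfolding c by (simp only: mult.assoc)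
    show "(1 - \<kappa> * (x*x') - - (f * f' - \<kappa>) * (y * y'))^2 + ((f' - \<kappa> * x) * y' + (f - \<kappa> * x') * y)^2
        \<le> (4 + 2 * sqrt 2 + sqrt 2 * (f * f') * (y * y'))^2"
      using ineq(1) unfolding c by (simp add: g_def h_def algebra_simps)
    show "(1 - \<kappa> * (x*x') + - (f * f' - \<kappa>) * (y * y'))^2 + ((f' - \<kappa> * x) * y' - (f - \<kappa> * x') * y)^2
        \<le> (4 + 2 * sqrt 2 - sqrt 2 * (f * f') * (y * y'))^2"
      using ineq(2) unfolding c by (simp add: g_def h_def algebra_simps)
  qed
  have eqs: "(1 - \<kappa> * (x*x')) *\<^sub>R X (X' v) = (1/x * (1/x') - \<kappa>) *\<^sub>R P (P' v)"
    "(f' - \<kappa> * x) *\<^sub>R X (M' v) = (1/x * f' - \<kappa>) *\<^sub>R P (M' v)"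
    "(f - \<kappa> * x') *\<^sub>R M (X' v) = (f * (1/x') - \<kappa>) *\<^sub>R M (P' v)"
    "(sqrt 2 * (f * f')) *\<^sub>R X (M (X' (M' v))) = (sqrt 2 * (1/x * f * (1/x') * f')) *\<^sub>R P (M (P' (M' v)))"
    using x x' by (simp_all add: X_def X'_def lin field_simps)
  show ?thesis using main unfolding eqs scaleR_minus_left add_uminus_conv_diff .
qed

text \<open>The form P P' + P M' + M P' - M M' is invariant under exchanging P and M while M'
  changes sign, and under exchanging P' and M' while M changes sign. By anticommutation the quartic
  term P M P' M' is invariant as well, so these symmetries carry the corner with both angles up to
  pi/4 to the other three.\<close>

lemma chsh_extraction_block:
  assumes b: "blk V P M x y" "blk V P' M' x' y'" and sub: "subsp V" and v: "v \<in> V"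
    and com: "commuting P' P" "commuting P' M" "commuting M' P" "commuting M' M"
  defines "\<kappa> \<equiv> 5 + 2 * sqrt 2"
  defines "p \<equiv> extP x y" and "m \<equiv> extM x y" and "p' \<equiv> extP x' y'" and "m' \<equiv> extM x' y'"
  shows "0 \<le> ip v ((4 + 2 * sqrt 2) *\<^sub>R v + (p * p' - \<kappa>) *\<^sub>R P (P' v) + (p * m' - \<kappa>) *\<^sub>R P (M' v)
     + (m * p' - \<kappa>) *\<^sub>R M (P' v) - (m * m' - \<kappa>) *\<^sub>R M (M' v)
     - (sqrt 2 * (p * m * p' * m')) *\<^sub>R P (M (P' (M' v))))"
proof -
  have sa: "selfadj P" "selfadj M" "selfadj P'" "selfadj M'" using b by (auto simp: blk_def)
  note lin = selfadjD(1-4)[OF sa(1)] selfadjD(1-4)[OF sa(2)] selfadjD(1-4)[OF sa(3)] selfadjD(1-4)[OF sa(4)]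
  have anti: "M (P u) = - P (M u)" "M' (P' u) = - P' (M' u)" for u using b by (simp_all add: blk_def)
  note bs = blk_swap[OF b(1)] blk_swap[OF b(2)]
  note bn = blk_neg[OF b(1) sub] blk_neg[OF b(2) sub] blk_neg[OF bs(1) sub] blk_neg[OF bs(2) sub]
  have cn: "commuting (\<lambda>u. - S u) T" "commuting S (\<lambda>u. - T u)" "commuting (\<lambda>u. - S u) (\<lambda>u. - T u)"
    if "commuting S T" "selfadj S" "selfadj T" for S T
    using that by (auto simp: commuting_def selfadjD)
  have le: "y \<le> x \<or> x \<le> y" "y' \<le> x' \<or> x' \<le> y'" by auto
  consider (uu) "y \<le> x" "y' \<le> x'" | (su) "\<not> y \<le> x" "y' \<le> x'" | (us) "y \<le> x" "\<not> y' \<le> x'"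
    | (ss) "\<not> y \<le> x" "\<not> y' \<le> x'" by blast
  then show ?thesis
  proof cases
    case uu
    then show ?thesis using chsh_corner[OF b sub v com] by (simp add: p_def m_def p'_def m'_def extP_def extM_def \<kappa>_def)
  next
    case su
    have "0 \<le> ip v ((4 + 2 * sqrt 2) *\<^sub>R v + (m * p' - \<kappa>) *\<^sub>R M (P' v) + (m * m' - \<kappa>) *\<^sub>R M (- M' v)
     + (p * p' - \<kappa>) *\<^sub>R P (P' v) - (p * m' - \<kappa>) *\<^sub>R P (- M' v)
     - (sqrt 2 * (m * p * p' * m')) *\<^sub>R M (P (P' (- M' v))))"
      using chsh_corner[OF bs(1) bn(2) sub v com(2,1) cn(1)[OF com(4) sa(4,2)] cn(1)[OF com(3) sa(4,1)]] su
      by (simp add: p_def m_def p'_def m'_def extP_def extM_def \<kappa>_def)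
    then show ?thesis by (simp add: lin anti algebra_simps)
  next
    case us
    have "0 \<le> ip v ((4 + 2 * sqrt 2) *\<^sub>R v + (p * m' - \<kappa>) *\<^sub>R P (M' v) + (p * p' - \<kappa>) *\<^sub>R P (P' v)
     + (m * m' - \<kappa>) *\<^sub>R (- M (M' v)) - (m * p' - \<kappa>) *\<^sub>R (- M (P' v))
     - (sqrt 2 * (p * m * m' * p')) *\<^sub>R P (- M (M' (P' v))))"
      using chsh_corner[OF bn(1) bs(2) sub v com(3) cn(2)[OF com(4) sa(4,2)] com(1) cn(2)[OF com(2) sa(3,2)]] us
      by (simp add: p_def m_def p'_def m'_def extP_def extM_def \<kappa>_def)
    then show ?thesis by (simp add: lin anti algebra_simps)
  next
    case ss
    have "blk V (\<lambda>u. - M' u) P' y' x'" using blk_swap[OF blk_neg[OF b(2) sub]] .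
    note c = chsh_corner[OF bn(3) this sub v cn(1)[OF com(4) sa(4,2)] cn(3)[OF com(3) sa(4,1)] com(2) cn(2)[OF com(1) sa(3,1)]]
    have "0 \<le> ip v ((4 + 2 * sqrt 2) *\<^sub>R v + (m * m' - \<kappa>) *\<^sub>R M (- M' v) + (m * p' - \<kappa>) *\<^sub>R M (P' v)
     + (p * m' - \<kappa>) *\<^sub>R (- P (- M' v)) - (p * p' - \<kappa>) *\<^sub>R (- P (P' v))
     - (sqrt 2 * (m * p * m' * p')) *\<^sub>R M (- P (- M' (P' v))))"
      using c ss by (simp add: p_def m_def p'_def m'_def extP_def extM_def \<kappa>_def)
    then show ?thesis by (simp add: lin anti algebra_simps)
  qed
qed

text \<open>If R is the reflection, then (1 + R)^2 = 2 (1 + R), so (1 + R) (1 + S) is half of (1 +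
  R) (1 + S) (1 + R), and 1 + S is positive because S is a contraction. The squares are prescribed
  at v, R v and S v because in the application they are known on one block.\<close>

lemma commuting_product_nonneg:
  assumes sa: "selfadj R" "selfadj S" and com: "commuting R S"
    and sq: "R (R v) = rho^2 *\<^sub>R v" "S (S v) = sig^2 *\<^sub>R v"
      "R (R (S v)) = rho^2 *\<^sub>R S v" "S (S (R v)) = sig^2 *\<^sub>R R v"
    and b: "0 \<le> rho" "rho \<le> 1" "0 \<le> sig" "sig \<le> 1" "rho = 1 \<or> sig = 1"
  shows "0 \<le> ip v (v + R v + S v + R (S v))"
proof -
  have *: "0 \<le> ip v (v + R v + S v + R (S v))"
    if "selfadj R" "selfadj S" "commuting R S" "R (R v) = v" "S (S v) = s^2 *\<^sub>R v"
       "R (R (S v)) = S v" "S (S (R v)) = s^2 *\<^sub>R R v" "0 \<le> s" "s \<le> 1" for R S s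
  proof -
    note l = selfadjD[OF that(1)] selfadjD[OF that(2)]
    have c: "S (R u) = R (S u)" for u using that(3) by (simp add: commuting_def)
    define w where "w = v + R v"
    have "S (S w) = s^2 *\<^sub>R w" using that by (simp add: w_def l c scaleR_right_distrib)
    then have "\<bar>ip w (S w)\<bar> \<le> s * ip w w" using ip_contraction[OF that(2)] that by blast
    also have "\<dots> \<le> 1 * ip w w" using that ip_nonneg[of w] by (intro mult_right_mono) auto
    finally have "0 \<le> ip w (w + S w)" by (simp add: ip_lin)
    also have "ip w (w + S w) = ip v ((w + S w) + R (w + S w))" by (simp add: w_def ip_lin l)
    also have "(w + S w) + R (w + S w) = 2 *\<^sub>R (v + R v + S v + R (S v))"
      using that by (simp add: w_def l c scaleR_2)
    finally show ?thesis by (simp add: ip_lin)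
  qed
  from b(5) show ?thesis
  proof
    assume "rho = 1"
    then show ?thesis using *[of R S sig] assms by simp
  next
    assume "sig = 1"
    moreover have "commuting S R" using com by (simp add: commuting_def)
    ultimately have "0 \<le> ip v (v + S v + R v + S (R v))" using *[of S R rho] assms by simp
    then show ?thesis using com by (simp add: commuting_def add_ac)
  qed
qed

end

section \<open>Complementarity of a projection and a reflection\<close>

context real_ip
begin

text \<open>Q R Q = 0 makes Q and R Q R projections onto orthogonal subspaces, which R exchanges; w
  is the component orthogonal to both.\<close>

lemma projection_split:
  fixes v :: 'v
  assumes sa: "selfadj Q" "selfadj R" and Q: "\<And>u. Q (Q u) = Q u" and R: "\<And>u. R (R u) = u"
    and QRQ: "\<And>u. Q (R (Q u)) = 0"
  defines "w \<equiv> v - Q v - R (Q (R v))"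
  shows "ip v v = ip w w + ip (Q v) (Q v) + ip (Q (R v)) (Q (R v))"
    and "ip v (R v) = ip w (R w) + 2 * ip (Q v) (Q (R v))"
proof -
  note l = selfadjD[OF sa(1)] selfadjD[OF sa(2)]
  have z: "ip u 0 = 0" "ip 0 u = 0" for u using ip_right(2)[of u 0 0] ip_scale[of 0 0 u] by simp_all
  have R0: "R 0 = 0" "Q 0 = 0" using selfadjD(2)[OF sa(2), of 0 0] selfadjD(2)[OF sa(1), of 0 0] by simp_all
  have sw: "ip v (R (Q v)) = ip v (Q (R v))" using ip_sym[of v "Q (R v)"] by (simp add: l(5) selfadjD(5)[OF sa(2)])
  show "ip v v = ip w w + ip (Q v) (Q v) + ip (Q (R v)) (Q (R v))"
    unfolding w_def by (simp add: ip_lin l Q R QRQ z R0 algebra_simps)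
  show "ip v (R v) = ip w (R w) + 2 * ip (Q v) (Q (R v))"
    unfolding w_def by (simp add: ip_lin l Q R QRQ z R0 sw algebra_simps)
qed

text \<open>On the sum of the ranges of Q and R Q R, the operators 2 Q - 1 and R behave like the
  Pauli matrices Z and X, so a unit combination of them has norm 1. On the rest 2 Q - 1 is -1, and
  lam <= 1 + nu suffices.\<close>

lemma bloch_fidelity_bound:
  assumes sa: "selfadj Q" "selfadj R" and Q: "\<And>u. Q (Q u) = Q u" and R: "\<And>u. R (R u) = u"
    and QRQ: "\<And>u. Q (R (Q u)) = 0"
    and ln: "0 \<le> lam" "0 \<le> nu" "lam^2 + nu^2 = 1"
  shows "lam * ip v (R v) + nu * (2 * ip (Q v) (Q v) - ip v v) \<le> ip v v"
proof -
  define w where "w = v - Q v - R (Q (R v))"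
  define x z where "x = Q v" and "z = Q (R v)"
  note s = projection_split[OF sa Q R QRQ, where v = v, folded w_def x_def z_def]
  have "nu^2 \<le> 1^2" using ln(3) zero_le_power2[of lam] unfolding power_one by linarith
  then have nu: "nu \<le> 1" by (rule power2_le_imp_le) simp
  have "lam^2 \<le> 1^2" using ln(3) zero_le_power2[of nu] unfolding power_one by linarith
  then have lam: "lam \<le> 1" by (rule power2_le_imp_le) simp
  \<comment> \<open>The difference of the two sides is a form in x and z with diagonal 1 - nu, 1 +
    nu and off-diagonal entry - lam. As lam^2 = (1 - nu) (1 + nu), it is the square of m x - p
    z.\<close>
  define p m where "p = sqrt (1 + nu)" and "m = sqrt (1 - nu)"
  have pm: "p * p = 1 + nu" "m * m = 1 - nu" using nu ln(2) by (simp_all add: p_def m_def)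
  have "p * m = sqrt (1 - nu^2)" unfolding p_def m_def real_sqrt_mult[symmetric] by (simp add: algebra_simps power2_eq_square)
  also have "1 - nu^2 = lam^2" using ln(3) by simp
  also have "sqrt (lam^2) = lam" using ln(1) by simp
  finally have lpm: "lam = p * m" by simp
  have "0 \<le> ip (m *\<^sub>R x - p *\<^sub>R z) (m *\<^sub>R x - p *\<^sub>R z)" by (rule ip_nonneg)
  also have "\<dots> = (m * m) * ip x x + (p * p) * ip z z - 2 * (p * m) * ip x z"
    using ip_sym[of z x] by (simp add: ip_lin algebra_simps)
  finally have a: "2 * lam * ip x z \<le> (1 - nu) * ip x x + (1 + nu) * ip z z"
    unfolding pm lpm by simp
  have "\<bar>ip w (R w)\<bar> \<le> 1 * ip w w" by (rule ip_contraction[OF sa(2)]) (simp_all add: R)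
  then have "lam * ip w (R w) \<le> lam * ip w w" using ln(1) by (intro mult_left_mono) auto
  also have "\<dots> \<le> (1 + nu) * ip w w" using lam ln(2) ip_nonneg[of w] by (intro mult_right_mono) auto
  finally have b: "lam * ip w (R w) \<le> (1 + nu) * ip w w" .
  show ?thesis unfolding s using a b by (simp add: algebra_simps x_def[symmetric])
qed

text \<open>The cross term 2 a b <Q v, Q R v> of the expanded square is at least - a b times |Q v|^2
  + |Q R v|^2. What is then missing is b (a - b) (|Q v|^2 + |Q R v|^2), and that sum is at most
  |v|^2 by \<open>projection_split\<close>.\<close>

lemma filtered_fidelity_bound:
  assumes sa: "selfadj Q" "selfadj R" and Q: "\<And>u. Q (Q u) = Q u" and R: "\<And>u. R (R u) = u"
    and QRQ: "\<And>u. Q (R (Q u)) = 0" and ab: "0 \<le> b" "b \<le> a"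
  shows "(a^2 - b^2) * ip (Q v) (Q v) - b * (a - b) * ip v v \<le>
    ip (Q (a *\<^sub>R v + b *\<^sub>R R v)) (Q (a *\<^sub>R v + b *\<^sub>R R v))"
proof -
  define w where "w = v - Q v - R (Q (R v))"
  define x z where "x = Q v" and "z = Q (R v)"
  note s = projection_split(1)[OF sa Q R QRQ, where v = v, folded w_def x_def z_def]
  have le: "ip x x + ip z z \<le> ip v v" using s ip_nonneg[of w] by simp
  have "0 \<le> a * b * ip (x + z) (x + z)" using ab ip_nonneg by simp
  also have "\<dots> = a * b * (ip x x + ip z z + 2 * ip x z)" using ip_sym[of z x] by (simp add: ip_lin)
  finally have 1: "0 \<le> a * b * (ip x x + ip z z + 2 * ip x z)" .
  have 2: "b * (a - b) * (ip x x + ip z z) \<le> b * (a - b) * ip v v"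
    using le ab by (intro mult_left_mono) auto
  have "ip (Q (a *\<^sub>R v + b *\<^sub>R R v)) (Q (a *\<^sub>R v + b *\<^sub>R R v)) = a^2 * ip x x + b^2 * ip z z + 2 * a * b * ip x z"
    using ip_sym[of z x] by (simp add: selfadjD[OF sa(1)] ip_lin x_def z_def power2_eq_square algebra_simps)
  then show ?thesis using 1 2 by (simp add: x_def[symmetric] power2_eq_square algebra_simps)
qed

end

section \<open>Operators on C^n (x) C^m and their joint Jordan blocks\<close>

instantiation "fun" :: (type, scaleR) scaleR
begin
definition "a *\<^sub>R f = (\<lambda>x. a *\<^sub>R f x)"
instance ..
end

instance "fun" :: (type, real_vector) real_vector
  by standard (simp_all add: scaleR_fun_def fun_eq_iff plus_fun_def algebra_simps)

type_synonym mf = "nat \<Rightarrow> nat \<Rightarrow> complex"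

text \<open>A vector of C^n (x) C^m is a function of two indices, and A acts on the first. Values at
  rows outside the range are cut to 0, so that composition and commutation laws are plain equations
  between functions.\<close>

definition opL :: "nat \<Rightarrow> mf \<Rightarrow> mf \<Rightarrow> mf" where
  "opL n A v = (\<lambda>i j. if i < n then \<Sum>k<n. A i k * v k j else 0)"

definition opR :: "nat \<Rightarrow> mf \<Rightarrow> mf \<Rightarrow> mf" where
  "opR m B v = (\<lambda>i j. if j < m then \<Sum>k<m. B j k * v i k else 0)"

definition ip2 :: "nat \<Rightarrow> nat \<Rightarrow> mf \<Rightarrow> mf \<Rightarrow> real" where
  "ip2 n m u v = (\<Sum>i<n. \<Sum>j<m. Re (cnj (u i j) * v i j))"

definition herm :: "nat \<Rightarrow> mf \<Rightarrow> bool" where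
  "herm n A \<longleftrightarrow> (\<forall>i<n. \<forall>j<n. A j i = cnj (A i j))"

interpretation ip2: real_ip "ip2 n m" for n m
proof
  fix u v w :: mf and a :: real
  show "ip2 n m u v = ip2 n m v u" unfolding ip2_def by (intro sum.cong refl) (simp add: mult.commute)
  show "ip2 n m (u + v) w = ip2 n m u w + ip2 n m v w"
    unfolding ip2_def plus_fun_apply by (simp only: complex_cnj_add distrib_right plus_complex.sel sum.distrib)
  show "ip2 n m (a *\<^sub>R u) w = a * ip2 n m u w"
    unfolding ip2_def sum_distrib_left scaleR_fun_def by (simp only: complex_cnj_scaleR mult_scaleR_left scaleR_complex.sel)
  show "0 \<le> ip2 n m u u" unfolding ip2_def by (intro sum_nonneg) simp
qed

lemma ip2_eq_Re: "ip2 n m u v = Re (\<Sum>i<n. \<Sum>j<m. cnj (u i j) * v i j)"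
  by (simp add: ip2_def)

lemma opL_lin: "opL n A (u + v) = opL n A u + opL n A v" "opL n A (a *\<^sub>R u) = a *\<^sub>R opL n A u"
  by (intro ext, simp add: opL_def distrib_left sum.distrib)
     (intro ext, simp add: opL_def scaleR_fun_def scaleR_sum_right)

lemma opR_lin: "opR n A (u + v) = opR n A u + opR n A v" "opR n A (a *\<^sub>R u) = a *\<^sub>R opR n A u"
  by (intro ext, simp add: opR_def distrib_left sum.distrib)
     (intro ext, simp add: opR_def scaleR_fun_def scaleR_sum_right)

lemma opL_apply: "i < n \<Longrightarrow> opL n A v i j = (\<Sum>k<n. A i k * v k j)"
  and opR_apply: "j < m \<Longrightarrow> opR m A v i j = (\<Sum>k<m. A j k * v i k)"
  by (simp_all add: opL_def opR_def)

lemma hermD: "herm n A \<Longrightarrow> i < n \<Longrightarrow> j < n \<Longrightarrow> cnj (A i j) = A j i"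
  unfolding herm_def by (metis)

lemma opL_selfadj:
  assumes "herm n A" shows "ip2.selfadj n m (opL n A)"
proof -
  have "ip2 n m (opL n A u) w = ip2 n m u (opL n A w)" for u w
  proof -
    have "(\<Sum>i<n. \<Sum>j<m. cnj (opL n A u i j) * w i j) = (\<Sum>i<n. \<Sum>j<m. \<Sum>k<n. cnj (A i k) * cnj (u k j) * w i j)"
      by (intro sum.cong refl) (simp only: opL_apply lessThan_iff cnj_sum complex_cnj_mult sum_distrib_right)
    also have "\<dots> = (\<Sum>i<n. \<Sum>j<m. \<Sum>k<n. A k i * cnj (u k j) * w i j)"
      by (intro sum.cong refl) (simp add: hermD[OF assms])
    also have "\<dots> = (\<Sum>j<m. \<Sum>i<n. \<Sum>k<n. A k i * cnj (u k j) * w i j)" by (rule sum.swap)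
    also have "\<dots> = (\<Sum>j<m. \<Sum>k<n. \<Sum>i<n. A k i * cnj (u k j) * w i j)"
      by (rule sum.cong[OF refl], rule sum.swap)
    also have "\<dots> = (\<Sum>k<n. \<Sum>j<m. \<Sum>i<n. A k i * cnj (u k j) * w i j)" by (rule sum.swap)
    also have "\<dots> = (\<Sum>k<n. \<Sum>j<m. cnj (u k j) * opL n A w k j)"
      by (intro sum.cong refl) (simp only: opL_apply lessThan_iff sum_distrib_left mult_ac)
    finally show ?thesis by (simp add: ip2_eq_Re)
  qed
  then show ?thesis unfolding ip2.selfadj_def by (simp add: opL_lin)
qed

lemma opR_selfadj:
  assumes "herm m A" shows "ip2.selfadj n m (opR m A)"
proof -
  have "ip2 n m (opR m A u) w = ip2 n m u (opR m A w)" for u w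
  proof -
    have "(\<Sum>i<n. \<Sum>j<m. cnj (opR m A u i j) * w i j) = (\<Sum>i<n. \<Sum>j<m. \<Sum>k<m. cnj (A j k) * cnj (u i k) * w i j)"
      by (intro sum.cong refl) (simp only: opR_apply lessThan_iff cnj_sum complex_cnj_mult sum_distrib_right)
    also have "\<dots> = (\<Sum>i<n. \<Sum>j<m. \<Sum>k<m. A k j * cnj (u i k) * w i j)"
      by (intro sum.cong refl) (simp add: hermD[OF assms])
    also have "\<dots> = (\<Sum>i<n. \<Sum>k<m. \<Sum>j<m. A k j * cnj (u i k) * w i j)"
      by (rule sum.cong[OF refl], rule sum.swap)
    also have "\<dots> = (\<Sum>i<n. \<Sum>k<m. cnj (u i k) * opR m A w i k)"
      by (intro sum.cong refl) (simp only: opR_apply lessThan_iff sum_distrib_left mult_ac)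
    finally show ?thesis by (simp add: ip2_eq_Re)
  qed
  then show ?thesis unfolding ip2.selfadj_def by (simp add: opR_lin)
qed

lemma opR_opL: "opR m B (opL n A v) = opL n A (opR m B v)"
proof (intro ext)
  fix i j
  show "opR m B (opL n A v) i j = opL n A (opR m B v) i j"
  proof (cases "i < n \<and> j < m")
    case True
    then have "opR m B (opL n A v) i j = (\<Sum>k<m. \<Sum>l<n. A i l * (B j k * v l k))"
      by (simp only: opR_apply opL_apply sum_distrib_left mult_ac)
    also have "\<dots> = (\<Sum>l<n. \<Sum>k<m. A i l * (B j k * v l k))" by (rule sum.swap)
    also have "\<dots> = opL n A (opR m B v) i j" using True by (simp only: opR_apply opL_apply sum_distrib_left)
    finally show ?thesis .
  qed (auto simp: opR_def opL_def)
qed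

lemma opL_opL:
  "opL n A (opL n B v) = opL n (\<lambda>i j. \<Sum>k<n. A i k * B k j) v"
proof (intro ext)
  fix i j
  have "(\<Sum>k<n. A i k * (\<Sum>l<n. B k l * v l j)) = (\<Sum>l<n. (\<Sum>k<n. A i k * B k l) * v l j)"
    unfolding sum_distrib_left sum_distrib_right by (subst sum.swap) (simp add: mult_ac)
  then show "opL n A (opL n B v) i j = opL n (\<lambda>i j. \<Sum>k<n. A i k * B k j) v i j"
    by (simp add: opL_def)
qed

lemma opR_opR:
  "opR n A (opR n B v) = opR n (\<lambda>i j. \<Sum>k<n. A i k * B k j) v"
proof (intro ext)
  fix i j
  have "(\<Sum>k<n. A j k * (\<Sum>l<n. B k l * v i l)) = (\<Sum>l<n. (\<Sum>k<n. A j k * B k l) * v i l)"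
    unfolding sum_distrib_left sum_distrib_right by (subst sum.swap) (simp add: mult_ac)
  then show "opR n A (opR n B v) i j = opR n (\<lambda>i j. \<Sum>k<n. A i k * B k j) v i j"
    by (simp add: opR_def)
qed

text \<open>A pair \<open>P = (A0 + A1) / 2\<close>, \<open>M = (A0 - A1) / 2\<close> of dichotomic observables, in an eigenbasis of
  \<open>P\<^sup>2\<close>; \<open>x i\<close> is the cosine of the Jordan angle of the block containing the \<open>i\<close>-th basis vector.\<close>

definition jordan :: "nat \<Rightarrow> (nat \<Rightarrow> real) \<Rightarrow> mf \<Rightarrow> mf \<Rightarrow> bool" where
  "jordan n x P M \<longleftrightarrow> herm n P \<and> herm n M \<and>
     (\<forall>i<n. \<forall>j<n. (\<Sum>k<n. P i k * P k j) = (if i = j then of_real ((x i)\<^sup>2) else 0)) \<and>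
     (\<forall>i<n. \<forall>j<n. (\<Sum>k<n. M i k * M k j) = (if i = j then of_real (1 - (x i)\<^sup>2) else 0)) \<and>
     (\<forall>i<n. \<forall>j<n. (\<Sum>k<n. M i k * P k j) = - (\<Sum>k<n. P i k * M k j)) \<and>
     (\<forall>i<n. \<forall>j<n. x i \<noteq> x j \<longrightarrow> P i j = 0 \<and> M i j = 0) \<and> (\<forall>i<n. 0 \<le> x i \<and> x i \<le> 1)"

text \<open>P has no entries between different values of x, so scaling row i by a function of
  \<open>x i\<close> applies that function of the block operator; the result stays Hermitian. The
  second argument of \<open>extP\<close> is the sine of the Jordan angle.\<close>

definition hatP :: "(nat \<Rightarrow> real) \<Rightarrow> mf \<Rightarrow> mf" where
  "hatP x P i j = of_real (extP (x i) (sqrt (1 - (x i)\<^sup>2))) * P i j"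

definition hatM :: "(nat \<Rightarrow> real) \<Rightarrow> mf \<Rightarrow> mf" where
  "hatM x M i j = of_real (extM (x i) (sqrt (1 - (x i)\<^sup>2))) * M i j"

definition restr :: "nat \<Rightarrow> nat \<Rightarrow> (nat \<Rightarrow> real) \<Rightarrow> (nat \<Rightarrow> real) \<Rightarrow> real \<Rightarrow> real \<Rightarrow> mf \<Rightarrow> mf" where
  "restr n m x y a b v = (\<lambda>i j. if i < n \<and> j < m \<and> x i = a \<and> y j = b then v i j else 0)"

definition blkset :: "nat \<Rightarrow> nat \<Rightarrow> (nat \<Rightarrow> real) \<Rightarrow> (nat \<Rightarrow> real) \<Rightarrow> real \<Rightarrow> real \<Rightarrow> mf set" where
  "blkset n m x y a b = {u. \<forall>i j. u i j \<noteq> 0 \<longrightarrow> i < n \<and> j < m \<and> x i = a \<and> y j = b}"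

lemma restr_in_blkset: "restr n m x y a b v \<in> blkset n m x y a b"
  by (simp add: restr_def blkset_def)

lemma blksetD: "u \<in> blkset n m x y a b \<Longrightarrow> u i j \<noteq> 0 \<Longrightarrow> i < n \<and> j < m \<and> x i = a \<and> y j = b"
  unfolding blkset_def by blast

lemma blksetI: "(\<And>i j. u i j \<noteq> 0 \<Longrightarrow> i < n \<and> j < m \<and> x i = a \<and> y j = b) \<Longrightarrow> u \<in> blkset n m x y a b"
  unfolding blkset_def by blast

lemma subsp_blkset: "ip2.subsp (blkset n m x y a b)"
  unfolding ip2.subsp_def
proof (intro conjI ballI allI)
  fix u w assume uw: "u \<in> blkset n m x y a b" "w \<in> blkset n m x y a b"
  show "u + w \<in> blkset n m x y a b"
  proof (rule blksetI)
    fix i j assume "(u + w) i j \<noteq> 0"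
    then have "u i j \<noteq> 0 \<or> w i j \<noteq> 0" by auto
    then show "i < n \<and> j < m \<and> x i = a \<and> y j = b" using blksetD[OF uw(1)] blksetD[OF uw(2)] by blast
  qed
next
  fix u c assume u: "u \<in> blkset n m x y a b"
  show "c *\<^sub>R u \<in> blkset n m x y a b"
    by (rule blksetI, rule blksetD[OF u]) (simp add: scaleR_fun_def)
qed

text \<open>The entry (i, j) survives in exactly one piece, that of a = x i and b = y j. An operator
  that respects the pieces is therefore positive as soon as it is positive on each of them.\<close>

lemma ip2_restr:
  "ip2 n m v w = (\<Sum>a\<in>x ` {..<n}. \<Sum>b\<in>y ` {..<m}. ip2 n m (restr n m x y a b v) (restr n m x y a b w))"
proof -
  have "(\<Sum>a\<in>x ` {..<n}. \<Sum>b\<in>y ` {..<m}. ip2 n m (restr n m x y a b v) (restr n m x y a b w)) =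
    (\<Sum>a\<in>x ` {..<n}. \<Sum>b\<in>y ` {..<m}. \<Sum>i<n. \<Sum>j<m. if b = y j then if a = x i then Re (cnj (v i j) * w i j) else 0 else 0)"
    unfolding ip2_def restr_def by (intro sum.cong refl) auto
  also have "\<dots> = (\<Sum>a\<in>x ` {..<n}. \<Sum>i<n. \<Sum>b\<in>y ` {..<m}. \<Sum>j<m. if b = y j then if a = x i then Re (cnj (v i j) * w i j) else 0 else 0)"
    by (intro sum.cong refl) (rule sum.swap)
  also have "\<dots> = (\<Sum>a\<in>x ` {..<n}. \<Sum>i<n. \<Sum>j<m. \<Sum>b\<in>y ` {..<m}. if b = y j then if a = x i then Re (cnj (v i j) * w i j) else 0 else 0)"
    by (intro sum.cong refl) (rule sum.swap)
  also have "\<dots> = (\<Sum>a\<in>x ` {..<n}. \<Sum>i<n. \<Sum>j<m. if a = x i then Re (cnj (v i j) * w i j) else 0)"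
    by (intro sum.cong refl) (simp add: sum.delta)
  also have "\<dots> = (\<Sum>i<n. \<Sum>a\<in>x ` {..<n}. \<Sum>j<m. if a = x i then Re (cnj (v i j) * w i j) else 0)"
    by (rule sum.swap)
  also have "\<dots> = (\<Sum>i<n. \<Sum>j<m. \<Sum>a\<in>x ` {..<n}. if a = x i then Re (cnj (v i j) * w i j) else 0)"
    by (intro sum.cong refl) (rule sum.swap)
  also have "\<dots> = (\<Sum>i<n. \<Sum>j<m. Re (cnj (v i j) * w i j))"
    by (intro sum.cong refl) (simp add: sum.delta)
  finally show ?thesis by (simp add: ip2_def)
qed

lemma restr_lin:
  "restr n m x y a b (u + v) = restr n m x y a b u + restr n m x y a b v"
  "restr n m x y a b (u - v) = restr n m x y a b u - restr n m x y a b v"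
  "restr n m x y a b (c *\<^sub>R u) = c *\<^sub>R restr n m x y a b u"
  by (auto simp: restr_def fun_eq_iff scaleR_fun_def)

lemma restr_opL:
  assumes "\<And>i k. i < n \<Longrightarrow> k < n \<Longrightarrow> x i \<noteq> x k \<Longrightarrow> A i k = 0"
  shows "restr n m x y a b (opL n A v) = opL n A (restr n m x y a b v)"
proof (intro ext)
  fix i j
  have e1: "restr n m x y a b (opL n A v) i j = (if i < n \<and> j < m \<and> x i = a \<and> y j = b then (\<Sum>k<n. A i k * v k j) else 0)"
    by (simp add: restr_def opL_def)
  have e2: "opL n A (restr n m x y a b v) i j = (if i < n then (\<Sum>k<n. A i k * restr n m x y a b v k j) else 0)"
    by (simp add: opL_def)
  show "restr n m x y a b (opL n A v) i j = opL n A (restr n m x y a b v) i j"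
  proof (cases "i < n \<and> j < m \<and> x i = a \<and> y j = b")
    case True
    then have "(\<Sum>k<n. A i k * v k j) = (\<Sum>k<n. A i k * restr n m x y a b v k j)"
      using assms[of i] by (intro sum.cong refl) (auto simp: restr_def)
    then show ?thesis using True e1 e2 by simp
  next
    case False
    then have "(\<Sum>k<n. A i k * restr n m x y a b v k j) = 0" if "i < n"
      using assms[of i] that by (intro sum.neutral) (auto simp: restr_def)
    then show ?thesis using False e1 e2 by auto
  qed
qed

lemma restr_opR:
  assumes "\<And>j k. j < m \<Longrightarrow> k < m \<Longrightarrow> y j \<noteq> y k \<Longrightarrow> A j k = 0"
  shows "restr n m x y a b (opR m A v) = opR m A (restr n m x y a b v)"
proof (intro ext)
  fix i j
  have e1: "restr n m x y a b (opR m A v) i j = (if i < n \<and> j < m \<and> x i = a \<and> y j = b then (\<Sum>k<m. A j k * v i k) else 0)"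
    by (simp add: restr_def opR_def)
  have e2: "opR m A (restr n m x y a b v) i j = (if j < m then (\<Sum>k<m. A j k * restr n m x y a b v i k) else 0)"
    by (simp add: opR_def)
  show "restr n m x y a b (opR m A v) i j = opR m A (restr n m x y a b v) i j"
  proof (cases "i < n \<and> j < m \<and> x i = a \<and> y j = b")
    case True
    then have "(\<Sum>k<m. A j k * v i k) = (\<Sum>k<m. A j k * restr n m x y a b v i k)"
      using assms[of j] by (intro sum.cong refl) (auto simp: restr_def)
    then show ?thesis using True e1 e2 by simp
  next
    case False
    then have "(\<Sum>k<m. A j k * restr n m x y a b v i k) = 0" if "j < m"
      using assms[of j] that by (intro sum.neutral) (auto simp: restr_def)
    then show ?thesis using False e1 e2 by auto
  qed
qed

lemma blkset_restr: "u \<in> blkset n m x y a b \<Longrightarrow> restr n m x y a b u = u"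
proof (intro ext)
  fix i j
  assume "u \<in> blkset n m x y a b"
  then have "u i j \<noteq> 0 \<longrightarrow> i < n \<and> j < m \<and> x i = a \<and> y j = b" using blksetD by blast
  then show "restr n m x y a b u i j = u i j" by (cases "u i j = 0") (auto simp: restr_def)
qed

lemma opL_scaled:
  assumes "u \<in> blkset n m x y a b" "\<And>i k. i < n \<Longrightarrow> k < n \<Longrightarrow> x i \<noteq> x k \<Longrightarrow> A i k = 0"
  shows "opL n (\<lambda>i j. of_real (f (x i)) * A i j) u = f a *\<^sub>R opL n A u"
proof -
  have "of_real (f (x i)) * A i k * u k j = of_real (f a) * (A i k * u k j)" if "i < n" "k < n" for i j k
  proof -
    have "u k j \<noteq> 0 \<longrightarrow> x k = a" using blksetD[OF assms(1)] by blast
    then show ?thesis using assms(2)[OF that] by (cases "u k j = 0"; cases "x i = x k") auto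
  qed
  then have "(\<Sum>k<n. of_real (f (x i)) * A i k * u k j) = of_real (f a) * (\<Sum>k<n. A i k * u k j)" if "i < n" for i j
    unfolding sum_distrib_left using that by (intro sum.cong refl) simp
  then show ?thesis by (auto simp: opL_def fun_eq_iff scaleR_fun_def scaleR_conv_of_real)
qed

lemma opR_scaled:
  assumes "u \<in> blkset n m x y a b" "\<And>i k. i < m \<Longrightarrow> k < m \<Longrightarrow> y i \<noteq> y k \<Longrightarrow> A i k = 0"
  shows "opR m (\<lambda>i j. of_real (f (y i)) * A i j) u = f b *\<^sub>R opR m A u"
proof -
  have "of_real (f (y j)) * A j k * u i k = of_real (f b) * (A j k * u i k)" if "j < m" "k < m" for i j k
  proof -
    have "u i k \<noteq> 0 \<longrightarrow> y k = b" using blksetD[OF assms(1)] by blast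
    then show ?thesis using assms(2)[OF that] by (cases "u i k = 0"; cases "y j = y k") auto
  qed
  then have "(\<Sum>k<m. of_real (f (y j)) * A j k * u i k) = of_real (f b) * (\<Sum>k<m. A j k * u i k)" if "j < m" for i j
    unfolding sum_distrib_left using that by (intro sum.cong refl) simp
  then show ?thesis by (auto simp: opR_def fun_eq_iff scaleR_fun_def scaleR_conv_of_real)
qed

lemma opL_diag:
  assumes "u \<in> blkset n m x y a b" "\<And>i k. i < n \<Longrightarrow> k < n \<Longrightarrow> A i k = (if i = k then of_real (f (x i)) else 0)"
  shows "opL n A u = f a *\<^sub>R u"
proof (intro ext)
  fix i j
  have sup: "u i j \<noteq> 0 \<longrightarrow> i < n \<and> j < m \<and> x i = a \<and> y j = b"
    using blksetD[OF assms(1)] by blast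
  have "(\<Sum>k<n. A i k * u k j) = (\<Sum>k<n. if k = i then of_real (f (x i)) * u k j else 0)" if "i < n"
    using assms(2) that by (intro sum.cong refl) auto
  then show "opL n A u i j = (f a *\<^sub>R u) i j" using sup
    by (cases "u i j = 0") (auto simp: opL_def scaleR_fun_def scaleR_conv_of_real)
qed

lemma opR_diag:
  assumes "u \<in> blkset n m x y a b" "\<And>i k. i < m \<Longrightarrow> k < m \<Longrightarrow> A i k = (if i = k then of_real (f (y i)) else 0)"
  shows "opR m A u = f b *\<^sub>R u"
proof (intro ext)
  fix i j
  have sup: "u i j \<noteq> 0 \<longrightarrow> i < n \<and> j < m \<and> x i = a \<and> y j = b"
    using blksetD[OF assms(1)] by blast
  have "(\<Sum>k<m. A j k * u i k) = (\<Sum>k<m. if k = j then of_real (f (y j)) * u i k else 0)" if "j < m"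
    using assms(2) that by (intro sum.cong refl) auto
  then show "opR m A u i j = (f b *\<^sub>R u) i j" using sup
    by (cases "u i j = 0") (auto simp: opR_def scaleR_fun_def scaleR_conv_of_real)
qed

lemma opL_blkset:
  assumes "u \<in> blkset n m x y a b" "\<And>i k. i < n \<Longrightarrow> k < n \<Longrightarrow> x i \<noteq> x k \<Longrightarrow> A i k = 0"
  shows "opL n A u \<in> blkset n m x y a b"
  using restr_in_blkset[of n m x y a b "opL n A u"] restr_opL[of n x A m y a b u] assms blkset_restr[OF assms(1)] by simp

lemma opR_blkset:
  assumes "u \<in> blkset n m x y a b" "\<And>i k. i < m \<Longrightarrow> k < m \<Longrightarrow> y i \<noteq> y k \<Longrightarrow> A i k = 0"
  shows "opR m A u \<in> blkset n m x y a b"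
  using restr_in_blkset[of n m x y a b "opR m A u"] restr_opR[of m y A n x a b u] assms blkset_restr[OF assms(1)] by simp

lemma opL_uminus_kernel: "opL n (\<lambda>i j. - A i j) v = - opL n A v"
  by (intro ext) (simp add: opL_def sum_negf)

lemma opR_uminus_kernel: "opR n (\<lambda>i j. - A i j) v = - opR n A v"
  by (intro ext) (simp add: opR_def sum_negf)

lemma opL_cong: "(\<And>i j. i < n \<Longrightarrow> j < n \<Longrightarrow> A i j = B i j) \<Longrightarrow> opL n A v = opL n B v"
  by (intro ext) (simp add: opL_def)

lemma opR_cong: "(\<And>i j. i < n \<Longrightarrow> j < n \<Longrightarrow> A i j = B i j) \<Longrightarrow> opR n A v = opR n B v"
  by (intro ext) (simp add: opR_def)

lemma jordanD:
  assumes "jordan n x P M"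
  shows "herm n P" "herm n M"
    "\<And>i j. i < n \<Longrightarrow> j < n \<Longrightarrow> (\<Sum>k<n. P i k * P k j) = (if i = j then of_real ((x i)\<^sup>2) else 0)"
    "\<And>i j. i < n \<Longrightarrow> j < n \<Longrightarrow> (\<Sum>k<n. M i k * M k j) = (if i = j then of_real (1 - (x i)\<^sup>2) else 0)"
    "\<And>i j. i < n \<Longrightarrow> j < n \<Longrightarrow> (\<Sum>k<n. M i k * P k j) = - (\<Sum>k<n. P i k * M k j)"
    "\<And>i j. i < n \<Longrightarrow> j < n \<Longrightarrow> x i \<noteq> x j \<Longrightarrow> P i j = 0"
    "\<And>i j. i < n \<Longrightarrow> j < n \<Longrightarrow> x i \<noteq> x j \<Longrightarrow> M i j = 0"
    "\<And>i. i < n \<Longrightarrow> 0 \<le> x i" "\<And>i. i < n \<Longrightarrow> x i \<le> 1"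
  using assms unfolding jordan_def by blast+

lemma angle_range:
  assumes "\<And>i. i < n \<Longrightarrow> 0 \<le> x i" "\<And>i. i < n \<Longrightarrow> x i \<le> (1::real)" "a \<in> x ` {..<n}"
  shows "0 \<le> a" "0 \<le> sqrt (1 - a\<^sup>2)" "a\<^sup>2 + (sqrt (1 - a\<^sup>2))\<^sup>2 = 1" "(sqrt (1 - a\<^sup>2))\<^sup>2 = 1 - a\<^sup>2"
proof -
  show a: "0 \<le> a" using assms by auto
  have "a\<^sup>2 \<le> 1\<^sup>2" using assms by (intro power_mono) auto
  then show "0 \<le> sqrt (1 - a\<^sup>2)" "a\<^sup>2 + (sqrt (1 - a\<^sup>2))\<^sup>2 = 1" "(sqrt (1 - a\<^sup>2))\<^sup>2 = 1 - a\<^sup>2" by simp_all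
qed

lemma jordan_blkL:
  assumes j: "jordan n x P M" and a: "a \<in> x ` {..<n}"
  shows "ip2.blk n m (blkset n m x y a b) (opL n P) (opL n M) a (sqrt (1 - a\<^sup>2))"
  unfolding ip2.blk_def
proof (intro conjI allI ballI)
  note J = jordanD[OF j]
  note r = angle_range[OF J(8,9) a]
  show "ip2.selfadj n m (opL n P)" "ip2.selfadj n m (opL n M)" using J opL_selfadj by auto
  show "opL n M (opL n P u) = - opL n P (opL n M u)" for u
    unfolding opL_opL opL_uminus_kernel[symmetric] by (rule opL_cong) (rule J(5))
  show "0 \<le> a" "0 \<le> sqrt (1 - a\<^sup>2)" "a\<^sup>2 + (sqrt (1 - a\<^sup>2))\<^sup>2 = 1" using r by auto
  fix u assume u: "u \<in> blkset n m x y a b"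
  show "opL n P u \<in> blkset n m x y a b" "opL n M u \<in> blkset n m x y a b"
    using opL_blkset[OF u] J(6,7) by auto
  show "opL n P (opL n P u) = a\<^sup>2 *\<^sub>R u"
    unfolding opL_opL by (rule opL_diag[OF u, of _ "\<lambda>t. t\<^sup>2"]) (rule J(3))
  have "opL n M (opL n M u) = (1 - a\<^sup>2) *\<^sub>R u"
    unfolding opL_opL by (rule opL_diag[OF u, of _ "\<lambda>t. 1 - t\<^sup>2"]) (rule J(4))
  then show "opL n M (opL n M u) = (sqrt (1 - a\<^sup>2))\<^sup>2 *\<^sub>R u" by (simp only: r(4))
qed

lemma jordan_blkR:
  assumes j: "jordan m y P M" and a: "b \<in> y ` {..<m}"
  shows "ip2.blk n m (blkset n m x y a b) (opR m P) (opR m M) b (sqrt (1 - b\<^sup>2))"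
  unfolding ip2.blk_def
proof (intro conjI allI ballI)
  note J = jordanD[OF j]
  note r = angle_range[OF J(8,9) a]
  show "ip2.selfadj n m (opR m P)" "ip2.selfadj n m (opR m M)" using J opR_selfadj by auto
  show "opR m M (opR m P u) = - opR m P (opR m M u)" for u
    unfolding opR_opR opR_uminus_kernel[symmetric] by (rule opR_cong) (rule J(5))
  show "0 \<le> b" "0 \<le> sqrt (1 - b\<^sup>2)" "b\<^sup>2 + (sqrt (1 - b\<^sup>2))\<^sup>2 = 1" using r by auto
  fix u assume u: "u \<in> blkset n m x y a b"
  show "opR m P u \<in> blkset n m x y a b" "opR m M u \<in> blkset n m x y a b"
    using opR_blkset[OF u] J(6,7) by auto
  show "opR m P (opR m P u) = b\<^sup>2 *\<^sub>R u"
    unfolding opR_opR by (rule opR_diag[OF u, of _ "\<lambda>t. t\<^sup>2"]) (rule J(3))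
  have "opR m M (opR m M u) = (1 - b\<^sup>2) *\<^sub>R u"
    unfolding opR_opR by (rule opR_diag[OF u, of _ "\<lambda>t. 1 - t\<^sup>2"]) (rule J(4))
  then show "opR m M (opR m M u) = (sqrt (1 - b\<^sup>2))\<^sup>2 *\<^sub>R u" by (simp only: r(4))
qed

lemma hat_zero:
  assumes "jordan n x P M" "i < n" "k < n" "x i \<noteq> x k"
  shows "hatP x P i k = 0" "hatM x M i k = 0"
  using jordanD(6,7)[OF assms] by (simp_all add: hatP_def hatM_def)

lemma hat_herm:
  assumes "jordan n x P M"
  shows "herm n (hatP x P)" "herm n (hatM x M)"
proof -
  note J = jordanD[OF assms]
  have "hatP x P j i = cnj (hatP x P i j)" "hatM x M j i = cnj (hatM x M i j)" if "i < n" "j < n" for i j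
  proof -
    have "hatP x P j i = cnj (hatP x P i j) \<and> hatM x M j i = cnj (hatM x M i j)"
    proof (cases "x i = x j")
      case True
      show ?thesis by (simp add: hatP_def hatM_def True hermD[OF J(1) that] hermD[OF J(2) that])
    next
      case False
      then show ?thesis using hat_zero[OF assms that(2,1) False[symmetric]] hat_zero[OF assms that False] by simp
    qed
    then show "hatP x P j i = cnj (hatP x P i j)" "hatM x M j i = cnj (hatM x M i j)" by auto
  qed
  then show "herm n (hatP x P)" "herm n (hatM x M)" unfolding herm_def by blast+
qed

lemma hat_opL:
  assumes "jordan n x P M" "u \<in> blkset n m x y a b"
  shows "opL n (hatP x P) u = extP a (sqrt (1 - a\<^sup>2)) *\<^sub>R opL n P u"
    "opL n (hatM x M) u = extM a (sqrt (1 - a\<^sup>2)) *\<^sub>R opL n M u"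
  using opL_scaled[OF assms(2), of P "\<lambda>t. extP t (sqrt (1 - t\<^sup>2))"] opL_scaled[OF assms(2), of M "\<lambda>t. extM t (sqrt (1 - t\<^sup>2))"]
    jordanD(6,7)[OF assms(1)] unfolding hatP_def[abs_def] hatM_def[abs_def] by blast+

lemma hat_opR:
  assumes "jordan m y P M" "u \<in> blkset n m x y a b"
  shows "opR m (hatP y P) u = extP b (sqrt (1 - b\<^sup>2)) *\<^sub>R opR m P u"
    "opR m (hatM y M) u = extM b (sqrt (1 - b\<^sup>2)) *\<^sub>R opR m M u"
  using opR_scaled[OF assms(2), of P "\<lambda>t. extP t (sqrt (1 - t\<^sup>2))"] opR_scaled[OF assms(2), of M "\<lambda>t. extM t (sqrt (1 - t\<^sup>2))"]
    jordanD(6,7)[OF assms(1)] unfolding hatP_def[abs_def] hatM_def[abs_def] by blast+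

lemma commuting_opR_opL: "ip2.commuting (opR m B) (opL n A)"
  unfolding ip2.commuting_def by (simp add: opR_opL)

text \<open>The operator is 4 sqrt 2 times the difference between the Bell projector pulled back
  through both extractions and the affine function of W_0 = 2 (P P' + P M' + M P' - M M'). All terms
  preserve the joint eigenspaces, where the rescaled operators are multiples of the original
  ones.\<close>

lemma chsh_extraction:
  assumes jA: "jordan n x P M" and jC: "jordan m y P' M'"
  defines "Ph \<equiv> opL n (hatP x P)" and "Mh \<equiv> opL n (hatM x M)"
    and "Ph' \<equiv> opR m (hatP y P')" and "Mh' \<equiv> opR m (hatM y M')"
  shows "0 \<le> ip2 n m v ((4 + 2 * sqrt 2) *\<^sub>R v + Ph (Ph' v) + Ph (Mh' v) + Mh (Ph' v) - Mh (Mh' v)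
      - sqrt 2 *\<^sub>R Ph (Mh (Ph' (Mh' v)))
      - (5 + 2 * sqrt 2) *\<^sub>R (opL n P (opR m P' v) + opL n P (opR m M' v) + opL n M (opR m P' v) - opL n M (opR m M' v)))"
proof -
  define T where "T u = (4 + 2 * sqrt 2) *\<^sub>R u + Ph (Ph' u) + Ph (Mh' u) + Mh (Ph' u) - Mh (Mh' u)
      - sqrt 2 *\<^sub>R Ph (Mh (Ph' (Mh' u)))
      - (5 + 2 * sqrt 2) *\<^sub>R (opL n P (opR m P' u) + opL n P (opR m M' u) + opL n M (opR m P' u) - opL n M (opR m M' u))" for u
  note JA = jordanD[OF jA] and JC = jordanD[OF jC]
  have Tr: "restr n m x y a b (T v) = T (restr n m x y a b v)" for a b
    unfolding T_def restr_lin Ph_def Mh_def Ph'_def Mh'_def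
    by (simp add: restr_opL[of n x] restr_opR[of m y] hat_zero[OF jA] hat_zero[OF jC] JA(6,7) JC(6,7))
  have "0 \<le> ip2 n m u (T u)" if u: "u \<in> blkset n m x y a b" and a: "a \<in> x ` {..<n}" and b: "b \<in> y ` {..<m}" for u a b
  proof -
    define p q p' q' where pq: "p = extP a (sqrt (1 - a\<^sup>2))" "q = extM a (sqrt (1 - a\<^sup>2))"
      "p' = extP b (sqrt (1 - b\<^sup>2))" "q' = extM b (sqrt (1 - b\<^sup>2))"
    have hA: "Ph w = p *\<^sub>R opL n P w" "Mh w = q *\<^sub>R opL n M w" if "w \<in> blkset n m x y a b" for w
      using hat_opL[OF jA that] by (simp_all add: Ph_def Mh_def pq)
    have hC: "Ph' w = p' *\<^sub>R opR m P' w" "Mh' w = q' *\<^sub>R opR m M' w" if "w \<in> blkset n m x y a b" for w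
      using hat_opR[OF jC that] by (simp_all add: Ph'_def Mh'_def pq)
    have sc: "c *\<^sub>R w \<in> blkset n m x y a b" if "w \<in> blkset n m x y a b" for c w
      using subsp_blkset that unfolding ip2.subsp_def by blast
    have cl: "opL n P w \<in> blkset n m x y a b" "opL n M w \<in> blkset n m x y a b"
      "opR m P' w \<in> blkset n m x y a b" "opR m M' w \<in> blkset n m x y a b" if "w \<in> blkset n m x y a b" for w
      using opL_blkset[OF that] opR_blkset[OF that] JA(6,7) JC(6,7) by auto
    have "0 \<le> ip2 n m u ((4 + 2 * sqrt 2) *\<^sub>R u + (p * p' - (5 + 2 * sqrt 2)) *\<^sub>R opL n P (opR m P' u)
        + (p * q' - (5 + 2 * sqrt 2)) *\<^sub>R opL n P (opR m M' u)
        + (q * p' - (5 + 2 * sqrt 2)) *\<^sub>R opL n M (opR m P' u) - (q * q' - (5 + 2 * sqrt 2)) *\<^sub>R opL n M (opR m M' u)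
        - (sqrt 2 * (p * q * p' * q')) *\<^sub>R opL n P (opL n M (opR m P' (opR m M' u))))"
      unfolding pq
      by (rule ip2.chsh_extraction_block[OF jordan_blkL[OF jA a] jordan_blkR[OF jC b] subsp_blkset u
        commuting_opR_opL commuting_opR_opL commuting_opR_opL commuting_opR_opL])
    also have "\<dots> = ip2 n m u (T u)"
    proof (rule arg_cong[of _ _ "ip2 n m u"])
      have t: "Ph (Ph' u) = (p * p') *\<^sub>R opL n P (opR m P' u)" "Ph (Mh' u) = (p * q') *\<^sub>R opL n P (opR m M' u)"
        "Mh (Ph' u) = (q * p') *\<^sub>R opL n M (opR m P' u)" "Mh (Mh' u) = (q * q') *\<^sub>R opL n M (opR m M' u)"
        "Ph (Mh (Ph' (Mh' u))) = (p * q * p' * q') *\<^sub>R opL n P (opL n M (opR m P' (opR m M' u)))"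
        by (simp_all add: hA hC u cl sc opL_lin opR_lin mult_ac)
      have "(4 + 2 * sqrt 2) *\<^sub>R u + (p * p' - k) *\<^sub>R e1 + (p * q' - k) *\<^sub>R e2 + (q * p' - k) *\<^sub>R e3
          - (q * q' - k) *\<^sub>R e4 - (sqrt 2 * l) *\<^sub>R e5 =
        (4 + 2 * sqrt 2) *\<^sub>R u + (p * p') *\<^sub>R e1 + (p * q') *\<^sub>R e2 + (q * p') *\<^sub>R e3 - (q * q') *\<^sub>R e4
          - sqrt 2 *\<^sub>R (l *\<^sub>R e5) - k *\<^sub>R (e1 + e2 + e3 - e4)" for e1 e2 e3 e4 e5 :: mf and k l
        by (simp add: scaleR_left_diff_distrib scaleR_right_distrib scaleR_right_diff_distrib)
      then show "(4 + 2 * sqrt 2) *\<^sub>R u + (p * p' - (5 + 2 * sqrt 2)) *\<^sub>R opL n P (opR m P' u)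
        + (p * q' - (5 + 2 * sqrt 2)) *\<^sub>R opL n P (opR m M' u)
        + (q * p' - (5 + 2 * sqrt 2)) *\<^sub>R opL n M (opR m P' u) - (q * q' - (5 + 2 * sqrt 2)) *\<^sub>R opL n M (opR m M' u)
        - (sqrt 2 * (p * q * p' * q')) *\<^sub>R opL n P (opL n M (opR m P' (opR m M' u))) = T u"
        unfolding T_def t .
    qed
    finally show ?thesis .
  qed
  then have "0 \<le> ip2 n m (restr n m x y a b v) (restr n m x y a b (T v))" if "a \<in> x ` {..<n}" "b \<in> y ` {..<m}" for a b
    unfolding Tr using restr_in_blkset that by blast
  then have "0 \<le> ip2 n m v (T v)" unfolding ip2_restr[of n m v "T v" x y] by (intro sum_nonneg) auto
  then show ?thesis by (simp only: T_def)
qed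

text \<open>P^ (x) Z and M^ (x) X commute because the anticommutation signs of the two factors
  cancel. On each block one of them is a reflection and the other a contraction, which is the
  situation of \<open>commuting_product_nonneg\<close>.\<close>

lemma extraction_choi_nonneg:
  assumes jA: "jordan n x P M"
    and Z: "herm 2 Z" "\<And>i j. i < 2 \<Longrightarrow> j < 2 \<Longrightarrow> (\<Sum>k<2. Z i k * Z k j) = (if i = j then 1 else 0)"
    and X: "herm 2 X" "\<And>i j. i < 2 \<Longrightarrow> j < 2 \<Longrightarrow> (\<Sum>k<2. X i k * X k j) = (if i = j then 1 else 0)"
    and ZX: "\<And>i j. i < 2 \<Longrightarrow> j < 2 \<Longrightarrow> (\<Sum>k<2. X i k * Z k j) = - (\<Sum>k<2. Z i k * X k j)"
  shows "0 \<le> ip2 n 2 v (v + opL n (hatP x P) (opR 2 Z v) + opL n (hatM x M) (opR 2 X v)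
      + opL n (hatP x P) (opL n (hatM x M) (opR 2 Z (opR 2 X v))))"
proof -
  define T where "T u = u + opL n (hatP x P) (opR 2 Z u) + opL n (hatM x M) (opR 2 X u)
      + opL n (hatP x P) (opL n (hatM x M) (opR 2 Z (opR 2 X u)))" for u
  note JA = jordanD[OF jA]
  \<comment> \<open>The qubit carries no block structure; a constant angle function makes every
    qubit operator block preserving.\<close>
  define y where "y = (\<lambda>_::nat. 0::real)"
  have yr: "restr n 2 x y a b (opR 2 A w) = opR 2 A (restr n 2 x y a b w)" for A w a b
    by (rule restr_opR) (simp add: y_def)
  have Tr: "restr n 2 x y a b (T v) = T (restr n 2 x y a b v)" for a b
    unfolding T_def restr_lin
    by (simp add: restr_opL[of n x] yr hat_zero[OF jA])
  have "0 \<le> ip2 n 2 u (T u)" if u: "u \<in> blkset n 2 x y a b" and a: "a \<in> x ` {..<n}" for u a b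
  proof -
    let ?V = "blkset n 2 x y a b"
    define c where "c = sqrt (1 - a\<^sup>2)"
    note r = angle_range[OF JA(8,9) a, folded c_def]
    define p q where pq: "p = extP a c" "q = extM a c"
    define R S where "R w = p *\<^sub>R opL n P (opR 2 Z w)" and "S w = q *\<^sub>R opL n M (opR 2 X w)" for w
    have sc: "t *\<^sub>R w \<in> ?V" if "w \<in> ?V" for t w
      using subsp_blkset that unfolding ip2.subsp_def by blast
    have cl: "opL n P w \<in> ?V" "opL n M w \<in> ?V" "opR 2 Z w \<in> ?V" "opR 2 X w \<in> ?V" if "w \<in> ?V" for w
      using opL_blkset[OF that] opR_blkset[OF that] JA(6,7) by (auto simp: y_def)
    note b = jordan_blkL[OF jA a, of 2 y b, folded c_def]
    have PP: "opL n P (opL n P w) = a\<^sup>2 *\<^sub>R w" "opL n M (opL n M w) = c\<^sup>2 *\<^sub>R w" if "w \<in> ?V" for w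
      using b that unfolding ip2.blk_def by auto
    have anti: "opL n M (opL n P w) = - opL n P (opL n M w)" for w using b unfolding ip2.blk_def by blast
    have ZZ: "opR 2 Z (opR 2 Z w) = w" "opR 2 X (opR 2 X w) = w" if "w \<in> ?V" for w
      using opR_diag[OF that, of "\<lambda>i j. \<Sum>k<2. Z i k * Z k j" "\<lambda>_. 1"] opR_diag[OF that, of "\<lambda>i j. \<Sum>k<2. X i k * X k j" "\<lambda>_. 1"] Z X
      unfolding opR_opR by simp_all
    have antiZ: "opR 2 X (opR 2 Z w) = - opR 2 Z (opR 2 X w)" for w
      unfolding opR_opR opR_uminus_kernel[symmetric] by (rule opR_cong) (rule ZX)
    have neg: "opL n A (- w) = - opL n A w" "opR 2 A (- w) = - opR 2 A w" for A w
      using opL_lin(2)[of n A "-1" w] opR_lin(2)[of 2 A "-1" w] by simp_all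
    note saL = opL_selfadj[OF JA(1), of 2] opL_selfadj[OF JA(2), of 2] and saR = opR_selfadj[OF Z(1), of n] opR_selfadj[OF X(1), of n]
    have "ip2.selfadj n 2 R" "ip2.selfadj n 2 S"
      unfolding ip2.selfadj_def R_def S_def
      by (simp_all add: opL_lin opR_lin scaleR_right_distrib ip2.ip_lin ip2.selfadjD(5)[OF saL(1)] ip2.selfadjD(5)[OF saL(2)]
        ip2.selfadjD(5)[OF saR(1)] ip2.selfadjD(5)[OF saR(2)] opR_opL mult.commute)
    moreover have "ip2.commuting R S" unfolding ip2.commuting_def R_def S_def
      by (simp add: opL_lin opR_lin opR_opL anti antiZ neg mult.commute)
    moreover have "R (R w) = (p * a)\<^sup>2 *\<^sub>R w" "S (S w) = (q * c)\<^sup>2 *\<^sub>R w" if "w \<in> ?V" for w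
      unfolding R_def S_def using that
      by (simp_all add: opL_lin opR_lin opR_opL cl sc PP ZZ power_mult_distrib power2_eq_square mult_ac)
    moreover have "S u \<in> ?V" "R u \<in> ?V" using u by (simp_all add: S_def R_def sc cl)
    moreover have "0 \<le> p * a \<and> p * a \<le> 1 \<and> 0 \<le> q * c \<and> q * c \<le> 1 \<and> (p * a = 1 \<or> q * c = 1)"
    proof (cases "c \<le> a")
      case True
      then have "a \<noteq> 0" using r by auto
      then show ?thesis using True damping_bounds[of c a] r by (simp add: pq extP_def extM_def)
    next
      case False
      then have "c \<noteq> 0" using r by auto
      then show ?thesis using False damping_bounds[of a c] r by (simp add: pq extP_def extM_def add.commute)
    qed
    ultimately have "0 \<le> ip2 n 2 u (u + R u + S u + R (S u))"
      using u by (intro ip2.commuting_product_nonneg[where rho = "p * a" and sig = "q * c"]) auto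
    have hA: "opL n (hatP x P) w = p *\<^sub>R opL n P w" "opL n (hatM x M) w = q *\<^sub>R opL n M w" if "w \<in> ?V" for w
      using hat_opL[OF jA that] by (simp_all add: pq c_def)
    note \<open>0 \<le> ip2 n 2 u (u + R u + S u + R (S u))\<close>
    also have "u + R u + S u + R (S u) = T u"
      unfolding R_def S_def T_def using u
      by (simp add: hA cl sc opL_lin opR_lin opR_opL mult_ac)
    finally show ?thesis .
  qed
  then have "0 \<le> ip2 n 2 (restr n 2 x y a b v) (restr n 2 x y a b (T v))" if "a \<in> x ` {..<n}" for a b
    unfolding Tr using restr_in_blkset that by blast
  then have "0 \<le> ip2 n 2 v (T v)" unfolding ip2_restr[of n 2 v "T v" x y] by (intro sum_nonneg) auto
  then show ?thesis by (simp only: T_def)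
qed

subsection \<open>Kraus maps and the quality\<close>

lemma sum_mult_index:
  fixes f :: "nat \<Rightarrow> 'a::comm_monoid_add"
  shows "(\<Sum>x<a * b. f x) = (\<Sum>i<a. \<Sum>k<b. f (i * b + k))"
proof -
  have "sum f {i * b..<i * b + b} = (\<Sum>k<b. f (i * b + k))" for i
    using sum.shift_bounds_nat_ivl[of f 0 "i * b" b] by (simp add: lessThan_atLeast0 add.commute)
  then show ?thesis using sum.nat_group[of f b a] by simp
qed

lemma mult_index_less:
  fixes i k a b :: nat
  assumes "i < a" "k < b" shows "i * b + k < a * b"
proof -
  have "i * b + k < Suc i * b" using assms by simp
  also have "\<dots> \<le> a * b" using assms by (intro mult_right_mono) auto
  finally show ?thesis .
qed

lemma mtrace_mult:
  assumes "X \<in> carrier_mat n n" "Y \<in> carrier_mat n n"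
  shows "mtrace (X * Y) = (\<Sum>i<n. \<Sum>j<n. X $$ (i, j) * Y $$ (j, i))"
  using assms unfolding mtrace_def by (auto simp: scalar_prod_def atLeast0LessThan intro!: sum.cong)

lemma quadratic_form:
  fixes A :: "complex mat" and v :: "complex vec"
  assumes "A \<in> carrier_mat n n" "v \<in> carrier_vec n"
  shows "conjugate v \<bullet> (A *\<^sub>v v) = (\<Sum>i<n. \<Sum>j<n. cnj (v $ i) * A $$ (i, j) * v $ j)"
  using assms by (auto simp: scalar_prod_def atLeast0LessThan sum_distrib_left mult.assoc intro!: sum.cong)

lemma psd_quadratic_form:
  assumes "psd A" "A \<in> carrier_mat n n"
  shows "0 \<le> Re (\<Sum>i<n. \<Sum>j<n. cnj (f i) * A $$ (i, j) * f j)"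
proof -
  have "0 \<le> Re (conjugate (vec n f) \<bullet> (A *\<^sub>v vec n f))" using assms by (auto simp: psd_def)
  also have "conjugate (vec n f) \<bullet> (A *\<^sub>v vec n f) = (\<Sum>i<n. \<Sum>j<n. cnj (f i) * A $$ (i, j) * f j)"
    by (subst quadratic_form[OF assms(2)]) auto
  finally show ?thesis .
qed

lemma psdI:
  assumes A: "A \<in> carrier_mat n n" and h: "\<And>i j. i < n \<Longrightarrow> j < n \<Longrightarrow> cnj (A $$ (j, i)) = A $$ (i, j)"
    and q: "\<And>f. 0 \<le> Re (\<Sum>i<n. \<Sum>j<n. cnj (f i) * A $$ (i, j) * f j)"
  shows "psd A"
  unfolding psd_def hermitian_def
proof (intro conjI ballI)
  show "square_mat A" using A by simp
  show "dagger A = A" using A h by (intro eq_matI) auto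
  fix v :: "complex vec" assume "v \<in> carrier_vec (dim_row A)"
  then have v: "v \<in> carrier_vec n" using A by simp
  show "0 \<le> Re (conjugate v \<bullet> (A *\<^sub>v v))" unfolding quadratic_form[OF A v] by (rule q)
qed

lemma psd_herm: "psd A \<Longrightarrow> A \<in> carrier_mat n n \<Longrightarrow> i < n \<Longrightarrow> j < n \<Longrightarrow> cnj (A $$ (j, i)) = A $$ (i, j)"
  unfolding psd_def hermitian_def by (metis carrier_matD dagger_index)

lemma sum_bilinear:
  fixes x :: "'a::semiring_0"
  shows "(\<Sum>r\<in>R. \<Sum>s\<in>S. a r * x * b s) = sum a R * x * sum b S"
  unfolding sum_distrib_right unfolding sum_distrib_left ..

text \<open>Each instance of \<open>sum.swap\<close> names two index sets and is applied in one
  direction only, so the rewriting terminates with the sums sorted. The later reordering lemmas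
  follow the same pattern.\<close>

lemma sum_reorder_kraus:
  "(\<Sum>a\<in>A. \<Sum>r\<in>R. \<Sum>b\<in>B. \<Sum>s\<in>S. \<Sum>k\<in>K. \<Sum>m\<in>M. \<Sum>l\<in>L. t a r b s k m l) = (\<Sum>k\<in>K. \<Sum>a\<in>A. \<Sum>m\<in>M. \<Sum>b\<in>B. \<Sum>l\<in>L. \<Sum>r\<in>R. \<Sum>s\<in>S. t a r b s k m l)"
  by (simp only:
    sum.swap[where A = A and B = K]
    sum.swap[where A = R and B = B]
    sum.swap[where A = R and B = K]
    sum.swap[where A = R and B = M]
    sum.swap[where A = R and B = L]
    sum.swap[where A = B and B = K]
    sum.swap[where A = B and B = M]
    sum.swap[where A = S and B = K]
    sum.swap[where A = S and B = M]
    sum.swap[where A = S and B = L])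


text \<open>The map in the Heisenberg picture, from operators on C^d (index m) to operators on the
  qubit (index r), with the conjugated Kraus operator on the left.\<close>

definition kraus :: "nat \<Rightarrow> 'k set \<Rightarrow> ('k \<Rightarrow> nat \<Rightarrow> nat \<Rightarrow> complex) \<Rightarrow> complex mat \<Rightarrow> complex mat" where
  "kraus d K V F = mat 2 2 (\<lambda>(r, s). \<Sum>\<kappa>\<in>K. \<Sum>m<d. \<Sum>m'<d. cnj (V \<kappa> m r) * F $$ (m, m') * V \<kappa> m' s)"

lemma kraus_index: "r < 2 \<Longrightarrow> s < 2 \<Longrightarrow>
    kraus d K V F $$ (r, s) = (\<Sum>\<kappa>\<in>K. \<Sum>m<d. \<Sum>m'<d. cnj (V \<kappa> m r) * F $$ (m, m') * V \<kappa> m' s)"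
  by (simp add: kraus_def)

lemma kraus_cp_unital:
  assumes unit: "\<And>r s. r < 2 \<Longrightarrow> s < 2 \<Longrightarrow> (\<Sum>\<kappa>\<in>K. \<Sum>m<d. cnj (V \<kappa> m r) * V \<kappa> m s) = (if r = s then 1 else 0)"
  shows "cp_unital d 2 (kraus d K V)"
  unfolding cp_unital_def
proof (intro conjI ballI allI impI)
  fix X Y :: "complex mat" and c :: complex
  assume X: "X \<in> carrier_mat d d"
  show "kraus d K V X \<in> carrier_mat 2 2" by (simp add: kraus_def)
  show "kraus d K V (c \<cdot>\<^sub>m X) = c \<cdot>\<^sub>m kraus d K V X"
    using X by (intro eq_matI) (auto simp: kraus_def sum_distrib_left mult_ac intro!: sum.cong)
  assume Y: "Y \<in> carrier_mat d d"
  show "kraus d K V (X + Y) = kraus d K V X + kraus d K V Y"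
  proof (intro eq_matI)
    fix r s assume "r < dim_row (kraus d K V X + kraus d K V Y)" "s < dim_col (kraus d K V X + kraus d K V Y)"
    then have rs: "r < 2" "s < 2" by (auto simp: kraus_def)
    have "kraus d K V (X + Y) $$ (r, s) = (\<Sum>\<kappa>\<in>K. \<Sum>m<d. \<Sum>m'<d. cnj (V \<kappa> m r) * X $$ (m, m') * V \<kappa> m' s + cnj (V \<kappa> m r) * Y $$ (m, m') * V \<kappa> m' s)"
      unfolding kraus_index[OF rs] using X Y by (intro sum.cong refl) (simp add: distrib_left distrib_right)
    also have "\<dots> = kraus d K V X $$ (r, s) + kraus d K V Y $$ (r, s)"
      unfolding kraus_index[OF rs] sum.distrib ..
    finally show "kraus d K V (X + Y) $$ (r, s) = (kraus d K V X + kraus d K V Y) $$ (r, s)"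
      using rs by (simp add: kraus_def)
  qed (auto simp: kraus_def)
next
  show "kraus d K V (1\<^sub>m d) = 1\<^sub>m 2"
  proof (intro eq_matI)
    fix r s assume "r < dim_row (1\<^sub>m 2 :: complex mat)" "s < dim_col (1\<^sub>m 2 :: complex mat)"
    then have rs: "r < 2" "s < 2" by auto
    have "(\<Sum>m'<d. cnj (V \<kappa> m r) * 1\<^sub>m d $$ (m, m') * V \<kappa> m' s) = cnj (V \<kappa> m r) * V \<kappa> m s" if "m < d" for m \<kappa>
    proof -
      have "(\<Sum>m'<d. cnj (V \<kappa> m r) * 1\<^sub>m d $$ (m, m') * V \<kappa> m' s) = (\<Sum>m'<d. if m' = m then cnj (V \<kappa> m r) * V \<kappa> m s else 0)"
        using that by (intro sum.cong) auto
      then show ?thesis using that by simp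
    qed
    then show "kraus d K V (1\<^sub>m d) $$ (r, s) = 1\<^sub>m 2 $$ (r, s)" using unit[OF rs] rs by (simp add: kraus_index)
  qed (auto simp: kraus_def)
next
  fix n and X :: "complex mat" assume X: "X \<in> carrier_mat (n * d) (n * d)" and psd: "psd X"
  have blk: "block d X a b $$ (m, m') = X $$ (a * d + m, b * d + m')" if "m < d" "m' < d" for a b m m'
    using that by (simp add: block_def)
  have amp: "ampl n d 2 (kraus d K V) X $$ (a * 2 + r, b * 2 + s) =
      (\<Sum>\<kappa>\<in>K. \<Sum>m<d. \<Sum>m'<d. cnj (V \<kappa> m r) * X $$ (a * d + m, b * d + m') * V \<kappa> m' s)"
    if "a < n" "b < n" "r < 2" "s < 2" for a b r s
    using that mult_index_less[of a n r 2] mult_index_less[of b n s 2]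
    by (simp add: ampl_def kraus_index blk div_add1_eq[of "_ * 2"] mod_add_eq[symmetric])
  show "psd (ampl n d 2 (kraus d K V) X)"
  proof (rule psdI[of _ "n * 2"])
    show "ampl n d 2 (kraus d K V) X \<in> carrier_mat (n * 2) (n * 2)" by (simp add: ampl_def)
    fix i j assume ij: "i < n * 2" "j < n * 2"
    define a r b s where ab: "a = i div 2" "r = i mod 2" "b = j div 2" "s = j mod 2"
    have i: "i = a * 2 + r" and j: "j = b * 2 + s" and lt: "a < n" "b < n" "r < 2" "s < 2" using ij by (auto simp: ab)
    have "cnj (ampl n d 2 (kraus d K V) X $$ (j, i)) =
       (\<Sum>\<kappa>\<in>K. \<Sum>m<d. \<Sum>m'<d. V \<kappa> m s * X $$ (a * d + m', b * d + m) * cnj (V \<kappa> m' r))"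
      unfolding i j amp[OF lt(2,1,4,3)] cnj_sum complex_cnj_mult complex_cnj_cnj
      using psd_herm[OF psd X] mult_index_less lt by (intro sum.cong refl) (simp add: mult_index_less)
    also have "\<dots> = ampl n d 2 (kraus d K V) X $$ (i, j)"
      unfolding i j amp[OF lt] by (rule sum.cong[OF refl], subst sum.swap) (simp add: mult_ac)
    finally show "cnj (ampl n d 2 (kraus d K V) X $$ (j, i)) = ampl n d 2 (kraus d K V) X $$ (i, j)" .
  next
    fix f :: "nat \<Rightarrow> complex"
    \<comment> \<open>w is f pushed through 1 (x) V, so the form of the amplified image at f is a
      sum over the Kraus index of forms of X.\<close>
    define w where "w \<kappa> x = (\<Sum>s<2. V \<kappa> (x mod d) s * f (x div d * 2 + s))" for \<kappa> x
    have w: "w \<kappa> (b * d + m) = (\<Sum>s<2. V \<kappa> m s * f (b * 2 + s))" if "m < d" for \<kappa> b m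
      using that by (simp add: w_def)
    have "(\<Sum>i<n * 2. \<Sum>j<n * 2. cnj (f i) * ampl n d 2 (kraus d K V) X $$ (i, j) * f j) =
      (\<Sum>a<n. \<Sum>r<2. \<Sum>b<n. \<Sum>s<2. cnj (f (a * 2 + r)) * ampl n d 2 (kraus d K V) X $$ (a * 2 + r, b * 2 + s) * f (b * 2 + s))"
      unfolding sum_mult_index ..
    also have "\<dots> = (\<Sum>a<n. \<Sum>r<2. \<Sum>b<n. \<Sum>s<2. \<Sum>\<kappa>\<in>K. \<Sum>m<d. \<Sum>m'<d.
        cnj (V \<kappa> m r * f (a * 2 + r)) * X $$ (a * d + m, b * d + m') * (V \<kappa> m' s * f (b * 2 + s)))"
      by (intro sum.cong refl) (simp add: amp sum_distrib_left sum_distrib_right mult_ac)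
    also have "\<dots> = (\<Sum>\<kappa>\<in>K. \<Sum>a<n. \<Sum>m<d. \<Sum>b<n. \<Sum>m'<d. \<Sum>r<2. \<Sum>s<2.
        cnj (V \<kappa> m r * f (a * 2 + r)) * X $$ (a * d + m, b * d + m') * (V \<kappa> m' s * f (b * 2 + s)))"
      by (rule sum_reorder_kraus)
    also have "\<dots> = (\<Sum>\<kappa>\<in>K. \<Sum>i<n * d. \<Sum>j<n * d. cnj (w \<kappa> i) * X $$ (i, j) * w \<kappa> j)"
      unfolding sum_mult_index
    proof (intro sum.cong refl)
      fix \<kappa> a m b m' assume "m \<in> {..<d}" "m' \<in> {..<d}"
      then show "(\<Sum>r<2. \<Sum>s<2. cnj (V \<kappa> m r * f (a * 2 + r)) * X $$ (a * d + m, b * d + m') * (V \<kappa> m' s * f (b * 2 + s))) =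
        cnj (w \<kappa> (a * d + m)) * X $$ (a * d + m, b * d + m') * w \<kappa> (b * d + m')"
        unfolding sum_bilinear by (simp only: w lessThan_iff cnj_sum)
    qed
    finally have eq: "(\<Sum>i<n * 2. \<Sum>j<n * 2. cnj (f i) * ampl n d 2 (kraus d K V) X $$ (i, j) * f j) =
      (\<Sum>\<kappa>\<in>K. \<Sum>i<n * d. \<Sum>j<n * d. cnj (w \<kappa> i) * X $$ (i, j) * w \<kappa> j)" .
    show "0 \<le> Re (\<Sum>i<n * 2. \<Sum>j<n * 2. cnj (f i) * ampl n d 2 (kraus d K V) X $$ (i, j) * f j)"
      unfolding eq Re_sum[of _ K] using psd_quadratic_form[OF psd X] by (intro sum_nonneg) auto
  qed
qed

section \<open>Boundedness of the set whose supremum is the quality\<close>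

lemma Re_mult_cnj: "Re (z * cnj z) = (cmod z)\<^sup>2" "Re (cnj z * z) = (cmod z)\<^sup>2"
  by (metis Re_complex_of_real complex_norm_square mult.commute)+

lemma psd_entry_bound:
  assumes "psd Y" "Y \<in> carrier_mat n n" "x < n" "y < n"
  shows "cmod (Y $$ (x, y)) \<le> (Re (Y $$ (x, x)) + Re (Y $$ (y, y))) / 2"
proof -
  obtain W :: "nat \<Rightarrow> nat \<Rightarrow> complex"
    where W: "\<And>i j. i < n \<Longrightarrow> j < n \<Longrightarrow> Y $$ (i, j) = (\<Sum>k<n. W k i * cnj (W k j))"
    using psd_gram[OF assms(2,1)] by blast
  have diag: "Re (Y $$ (i, i)) = (\<Sum>k<n. (cmod (W k i))\<^sup>2)" if "i < n" for i
    unfolding W[OF that that] Re_sum by (intro sum.cong refl) (rule Re_mult_cnj)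
  have "cmod (Y $$ (x, y)) \<le> (\<Sum>k<n. cmod (W k x * cnj (W k y)))" unfolding W[OF assms(3,4)] by (rule norm_sum)
  also have "\<dots> \<le> (\<Sum>k<n. ((cmod (W k x))\<^sup>2 + (cmod (W k y))\<^sup>2) / 2)"
  proof (intro sum_mono)
    fix k
    have "2 * cmod (W k x) * cmod (W k y) \<le> (cmod (W k x))\<^sup>2 + (cmod (W k y))\<^sup>2" by (rule sum_squares_bound)
    then show "cmod (W k x * cnj (W k y)) \<le> ((cmod (W k x))\<^sup>2 + (cmod (W k y))\<^sup>2) / 2" by (simp add: norm_mult)
  qed
  also have "\<dots> = (Re (Y $$ (x, x)) + Re (Y $$ (y, y))) / 2"
    unfolding diag[OF assms(3)] diag[OF assms(4)] sum_divide_distrib[symmetric] sum.distrib ..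
  finally show ?thesis .
qed

lemma psd_diag_nonneg:
  assumes "psd Y" "Y \<in> carrier_mat n n" "x < n"
  shows "0 \<le> Re (Y $$ (x, x))"
  using order_trans[OF norm_ge_zero psd_entry_bound[OF assms assms(3)]] by simp

lemma cp_unital_psd:
  assumes "cp_unital d d' \<Lambda>" "X \<in> carrier_mat d d" "psd X"
  shows "psd (\<Lambda> X)"
proof -
  have L: "\<Lambda> X \<in> carrier_mat d' d'" using assms unfolding cp_unital_def by blast
  have "\<forall>n. \<forall>X \<in> carrier_mat (n * d) (n * d). psd X \<longrightarrow> psd (ampl n d d' \<Lambda> X)"
    using assms(1) unfolding cp_unital_def by blast
  then have "psd (ampl 1 d d' \<Lambda> X)" using assms(2,3) by (metis mult_1)
  moreover have "block d X 0 0 = X" using assms(2) by (intro eq_matI) (auto simp: block_def)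
  then have "ampl 1 d d' \<Lambda> X = \<Lambda> X" using L by (intro eq_matI) (auto simp: ampl_def)
  ultimately show ?thesis by simp
qed

text \<open>A bound uniform over all completely positive unital maps. Positivity of 1 - E_xx
  together with unitality bounds the diagonal entries of the image of E_xx by 1. For E_ij, twofold
  amplification of a positive rank-one matrix compares its entries with such diagonal ones.\<close>

lemma cp_unital_entry_bound:
  assumes cp: "cp_unital d d' \<Lambda>" and ij: "i < d" "j < d" and rs: "r < d'" "s < d'"
  shows "cmod (\<Lambda> (munit d i j) $$ (r, s)) \<le> 1"
proof -
  have car: "\<Lambda> (munit d x y) \<in> carrier_mat d' d'" for x y
    using cp unfolding cp_unital_def by (simp add: munit_def)
  have diag: "Re (\<Lambda> (munit d x x) $$ (t, t)) \<le> 1" if x: "x < d" and t: "t < d'" for x t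
  proof -
    define Z :: "complex mat" where "Z = mat d d (\<lambda>(a, b). if a = b \<and> a \<noteq> x then 1 else 0)"
    have Z: "Z \<in> carrier_mat d d" by (simp add: Z_def)
    have "psd Z"
    proof (rule psdI[OF Z])
      show "cnj (Z $$ (b, a)) = Z $$ (a, b)" if "a < d" "b < d" for a b using that by (auto simp: Z_def)
      fix f :: "nat \<Rightarrow> complex"
      have "(\<Sum>a<d. \<Sum>b<d. cnj (f a) * Z $$ (a, b) * f b) = (\<Sum>a<d. \<Sum>b<d. if b = a then (if a \<noteq> x then cnj (f a) * f a else 0) else 0)"
        by (intro sum.cong refl) (auto simp: Z_def)
      also have "\<dots> = (\<Sum>a<d. if a \<noteq> x then cnj (f a) * f a else 0)" by (intro sum.cong refl) simp
      also have "Re \<dots> = (\<Sum>a<d. if a \<noteq> x then (cmod (f a))\<^sup>2 else 0)"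
        unfolding Re_sum by (intro sum.cong refl) (simp only: Re_mult_cnj if_distrib[of Re] zero_complex.sel)
      finally show "0 \<le> Re (\<Sum>a<d. \<Sum>b<d. cnj (f a) * Z $$ (a, b) * f b)" by (simp add: sum_nonneg)
    qed
    then have "psd (\<Lambda> Z)" by (rule cp_unital_psd[OF cp Z])
    moreover have LZ: "\<Lambda> Z \<in> carrier_mat d' d'" using cp Z unfolding cp_unital_def by blast
    ultimately have "0 \<le> Re (\<Lambda> Z $$ (t, t))" using t by (intro psd_diag_nonneg)
    moreover have "Z + munit d x x = 1\<^sub>m d" by (intro eq_matI) (auto simp: Z_def munit_def)
    moreover have "munit d x x \<in> carrier_mat d d" by (simp add: munit_def)
    then have "\<Lambda> (Z + munit d x x) = \<Lambda> Z + \<Lambda> (munit d x x)"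
      using cp Z unfolding cp_unital_def by blast
    moreover have "\<Lambda> (1\<^sub>m d) = 1\<^sub>m d'" using cp unfolding cp_unital_def by blast
    ultimately have "0 \<le> Re (\<Lambda> Z $$ (t, t))" "\<Lambda> Z + \<Lambda> (munit d x x) = 1\<^sub>m d'" by simp_all
    note nn = this(1) and one = this(2)
    have "(\<Lambda> Z + \<Lambda> (munit d x x)) $$ (t, t) = 1" unfolding one using t by simp
    then have "\<Lambda> Z $$ (t, t) + \<Lambda> (munit d x x) $$ (t, t) = 1" using t LZ car[of x x] by simp
    then have "Re (\<Lambda> Z $$ (t, t)) + Re (\<Lambda> (munit d x x) $$ (t, t)) = 1" unfolding plus_complex.sel[symmetric] by simp
    then show ?thesis using nn by linarith
  qed
  \<comment> \<open>g is the direct sum of e_i and e_j in C^2 (x) C^d; its rank-one matrix has the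
    blocks E_ii, E_ij and E_jj.\<close>
  define g :: "nat \<Rightarrow> complex" where "g a = (if a = i then 1 else 0) + (if a = d + j then 1 else 0)" for a
  define X where "X = mat (2 * d) (2 * d) (\<lambda>(a, b). g a * cnj (g b))"
  have X: "X \<in> carrier_mat (2 * d) (2 * d)" by (simp add: X_def)
  have "psd X"
  proof (rule psdI[OF X])
    show "cnj (X $$ (b, a)) = X $$ (a, b)" if "a < 2 * d" "b < 2 * d" for a b using that by (simp add: X_def)
    fix f :: "nat \<Rightarrow> complex"
    have "(\<Sum>a<2 * d. \<Sum>b<2 * d. cnj (f a) * X $$ (a, b) * f b) = (\<Sum>a<2 * d. \<Sum>b<2 * d. (cnj (f a) * g a) * 1 * (cnj (g b) * f b))"
      by (intro sum.cong refl) (simp add: X_def)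
    also have "\<dots> = (\<Sum>a<2 * d. cnj (f a) * g a) * cnj (\<Sum>a<2 * d. cnj (f a) * g a)"
      unfolding sum_bilinear by (simp add: mult.commute)
    also have "Re \<dots> = (cmod (\<Sum>a<2 * d. cnj (f a) * g a))\<^sup>2" by (rule Re_mult_cnj)
    finally show "0 \<le> Re (\<Sum>a<2 * d. \<Sum>b<2 * d. cnj (f a) * X $$ (a, b) * f b)" by simp
  qed
  then have psdY: "psd (ampl 2 d d' \<Lambda> X)" using cp X unfolding cp_unital_def by blast
  have Y: "ampl 2 d d' \<Lambda> X \<in> carrier_mat (2 * d') (2 * d')" by (simp add: ampl_def)
  have b: "block d X 0 0 = munit d i i" "block d X 0 1 = munit d i j" "block d X 1 1 = munit d j j"
    using ij by (intro eq_matI; auto simp: block_def munit_def X_def g_def)+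
  have "cmod (ampl 2 d d' \<Lambda> X $$ (r, d' + s)) \<le> (Re (ampl 2 d d' \<Lambda> X $$ (r, r)) + Re (ampl 2 d d' \<Lambda> X $$ (d' + s, d' + s))) / 2"
    using rs by (intro psd_entry_bound[OF psdY Y]) auto
  also have "ampl 2 d d' \<Lambda> X $$ (r, d' + s) = \<Lambda> (munit d i j) $$ (r, s)" using rs b by (simp add: ampl_def)
  also have "ampl 2 d d' \<Lambda> X $$ (r, r) = \<Lambda> (munit d i i) $$ (r, r)" using rs b by (simp add: ampl_def)
  also have "ampl 2 d d' \<Lambda> X $$ (d' + s, d' + s) = \<Lambda> (munit d j j) $$ (s, s)" using rs b by (simp add: ampl_def)
  also have "(Re (\<Lambda> (munit d i i) $$ (r, r)) + Re (\<Lambda> (munit d j j) $$ (s, s))) / 2 \<le> (1 + 1) / 2"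
    by (intro divide_right_mono add_mono diag ij rs) simp
  finally show ?thesis by simp
qed

lemma map_tensor_index:
  assumes "r < d1'" "r' < d1'" "s < d2'" "s' < d2'"
    and L: "\<And>i j. \<Lambda>1 (munit d1 i j) \<in> carrier_mat d1' d1'" "\<And>k l. \<Lambda>2 (munit d2 k l) \<in> carrier_mat d2' d2'"
  shows "map_tensor d1 d2 d1' d2' \<Lambda>1 \<Lambda>2 X $$ (r * d2' + s, r' * d2' + s') =
    (\<Sum>i<d1. \<Sum>j<d1. \<Sum>k<d2. \<Sum>l<d2. X $$ (i * d2 + k, j * d2 + l) *
      (\<Lambda>1 (munit d1 i j) $$ (r, r') * \<Lambda>2 (munit d2 k l) $$ (s, s')))"
proof -
  note lt = mult_index_less[OF assms(1,3)] mult_index_less[OF assms(2,4)]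
  have K: "kron (\<Lambda>1 (munit d1 i j)) (\<Lambda>2 (munit d2 k l)) $$ (r * d2' + s, r' * d2' + s') =
      \<Lambda>1 (munit d1 i j) $$ (r, r') * \<Lambda>2 (munit d2 k l) $$ (s, s')" for i j k l
    using L(1)[of i j] L(2)[of k l] lt assms(3,4) by (simp add: kron_def)
  show ?thesis unfolding map_tensor_def using lt by (simp add: K)
qed

text \<open>The real supremum dominates the members of a set only if the set is bounded above, so
  without this bound no particular pair of maps would say anything about
  \<open>quality\<close>.\<close>

lemma quality_bdd_above:
  "bdd_above {(\<Sum>j<n. Re (mtrace (map_tensor d1 d2 2 2 \<Lambda>1 \<Lambda>2 (F j) * bell_proj j))) | \<Lambda>1 \<Lambda>2.
            cp_unital d1 2 \<Lambda>1 \<and> cp_unital d2 2 \<Lambda>2}"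
proof (rule bdd_aboveI)
  define C where "C b = (\<Sum>i<d1. \<Sum>j<d1. \<Sum>k<d2. \<Sum>l<d2. cmod (F b $$ (i * d2 + k, j * d2 + l)))" for b
  fix v assume "v \<in> {(\<Sum>j<n. Re (mtrace (map_tensor d1 d2 2 2 \<Lambda>1 \<Lambda>2 (F j) * bell_proj j))) | \<Lambda>1 \<Lambda>2.
            cp_unital d1 2 \<Lambda>1 \<and> cp_unital d2 2 \<Lambda>2}"
  then obtain \<Lambda>1 \<Lambda>2 where cp: "cp_unital d1 2 \<Lambda>1" "cp_unital d2 2 \<Lambda>2"
    and v: "v = (\<Sum>j<n. Re (mtrace (map_tensor d1 d2 2 2 \<Lambda>1 \<Lambda>2 (F j) * bell_proj j)))" by blast
  have car: "\<Lambda>1 (munit d1 i j) \<in> carrier_mat 2 2" "\<Lambda>2 (munit d2 i j) \<in> carrier_mat 2 2" for i j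
    using cp unfolding cp_unital_def by (simp_all add: munit_def)
  have MT: "map_tensor d1 d2 2 2 \<Lambda>1 \<Lambda>2 X \<in> carrier_mat 4 4" for X by (simp add: map_tensor_def)
  have BP: "bell_proj b \<in> carrier_mat 4 4" for b by (simp add: bell_proj_def)
  have ent: "cmod (map_tensor d1 d2 2 2 \<Lambda>1 \<Lambda>2 (F b) $$ (x, y)) \<le> C b" if "x < 4" "y < 4" for x y b
  proof -
    have xy: "x = (x div 2) * 2 + x mod 2" "y = (y div 2) * 2 + y mod 2" "x div 2 < 2" "y div 2 < 2" "x mod 2 < 2" "y mod 2 < 2"
      using that by auto
    have mt: "map_tensor d1 d2 2 2 \<Lambda>1 \<Lambda>2 (F b) $$ (x, y) = (\<Sum>i<d1. \<Sum>j<d1. \<Sum>k<d2. \<Sum>l<d2. F b $$ (i * d2 + k, j * d2 + l) *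
      (\<Lambda>1 (munit d1 i j) $$ (x div 2, y div 2) * \<Lambda>2 (munit d2 k l) $$ (x mod 2, y mod 2)))"
      using map_tensor_index[of "x div 2" 2 "y div 2" "x mod 2" 2 "y mod 2" \<Lambda>1 d1 \<Lambda>2 d2 "F b", OF xy(3-6) car] by simp
    have "cmod (map_tensor d1 d2 2 2 \<Lambda>1 \<Lambda>2 (F b) $$ (x, y)) \<le> (\<Sum>i<d1. \<Sum>j<d1. \<Sum>k<d2. \<Sum>l<d2. cmod (F b $$ (i * d2 + k, j * d2 + l) *
      (\<Lambda>1 (munit d1 i j) $$ (x div 2, y div 2) * \<Lambda>2 (munit d2 k l) $$ (x mod 2, y mod 2))))"
      unfolding mt by (rule sum_norm_le, rule sum_norm_le, rule sum_norm_le, rule sum_norm_le, rule order_refl)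
    also have "\<dots> \<le> C b" unfolding C_def
    proof (rule sum_mono, rule sum_mono, rule sum_mono, rule sum_mono)
      fix i j k l assume "i \<in> {..<d1}" "j \<in> {..<d1}" "k \<in> {..<d2}" "l \<in> {..<d2}"
      then have "cmod (\<Lambda>1 (munit d1 i j) $$ (x div 2, y div 2)) \<le> 1" "cmod (\<Lambda>2 (munit d2 k l) $$ (x mod 2, y mod 2)) \<le> 1"
        using cp_unital_entry_bound[OF cp(1)] cp_unital_entry_bound[OF cp(2)] xy by auto
      then have "cmod (\<Lambda>1 (munit d1 i j) $$ (x div 2, y div 2)) * cmod (\<Lambda>2 (munit d2 k l) $$ (x mod 2, y mod 2)) \<le> 1"
        by (intro mult_le_one) auto
      then show "cmod (F b $$ (i * d2 + k, j * d2 + l) *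
        (\<Lambda>1 (munit d1 i j) $$ (x div 2, y div 2) * \<Lambda>2 (munit d2 k l) $$ (x mod 2, y mod 2))) \<le> cmod (F b $$ (i * d2 + k, j * d2 + l))"
        unfolding norm_mult by (intro mult_left_le) auto
    qed
    finally show ?thesis .
  qed
  have "Re (mtrace (map_tensor d1 d2 2 2 \<Lambda>1 \<Lambda>2 (F b) * bell_proj b)) \<le> (\<Sum>x<4. \<Sum>y<4. C b * cmod (bell_proj b $$ (y, x)))" for b
  proof -
    have "Re (mtrace (map_tensor d1 d2 2 2 \<Lambda>1 \<Lambda>2 (F b) * bell_proj b)) \<le> cmod (mtrace (map_tensor d1 d2 2 2 \<Lambda>1 \<Lambda>2 (F b) * bell_proj b))"
      by (rule complex_Re_le_cmod)
    also have "\<dots> \<le> (\<Sum>x<4. \<Sum>y<4. cmod (map_tensor d1 d2 2 2 \<Lambda>1 \<Lambda>2 (F b) $$ (x, y) * bell_proj b $$ (y, x)))"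
      unfolding mtrace_mult[OF MT BP] by (rule sum_norm_le, rule sum_norm_le, rule order_refl)
    also have "\<dots> \<le> (\<Sum>x<4. \<Sum>y<4. C b * cmod (bell_proj b $$ (y, x)))"
      unfolding norm_mult using ent by (intro sum_mono mult_right_mono) auto
    finally show ?thesis .
  qed
  then show "v \<le> (\<Sum>b<n. \<Sum>x<4. \<Sum>y<4. C b * cmod (bell_proj b $$ (y, x)))"
    unfolding v by (intro sum_mono)
qed

subsection \<open>Restoring unitality on qubits\<close>

lemma sum_reorder_value:
  "(\<Sum>i\<in>I. \<Sum>j\<in>J. \<Sum>k\<in>K. \<Sum>l\<in>L. \<Sum>n\<in>N. \<Sum>p\<in>P. \<Sum>q\<in>Q. t i j k l n p q) = (\<Sum>p\<in>P. \<Sum>q\<in>Q. \<Sum>n\<in>N. \<Sum>i\<in>I. \<Sum>k\<in>K. \<Sum>j\<in>J. \<Sum>l\<in>L. t i j k l n p q)"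
  by (simp only:
    sum.swap[where A = I and B = N]
    sum.swap[where A = I and B = P]
    sum.swap[where A = I and B = Q]
    sum.swap[where A = J and B = K]
    sum.swap[where A = J and B = N]
    sum.swap[where A = J and B = P]
    sum.swap[where A = J and B = Q]
    sum.swap[where A = K and B = N]
    sum.swap[where A = K and B = P]
    sum.swap[where A = K and B = Q]
    sum.swap[where A = L and B = N]
    sum.swap[where A = L and B = P]
    sum.swap[where A = L and B = Q]
    sum.swap[where A = N and B = P]
    sum.swap[where A = N and B = Q])

lemma sum_reorder_trace:
  "(\<Sum>r\<in>R. \<Sum>s\<in>S. \<Sum>u\<in>U. \<Sum>v\<in>V. \<Sum>p\<in>P. \<Sum>q\<in>Q. \<Sum>n\<in>N. t r s u v p q n) = (\<Sum>p\<in>P. \<Sum>q\<in>Q. \<Sum>n\<in>N. \<Sum>r\<in>R. \<Sum>s\<in>S. \<Sum>u\<in>U. \<Sum>v\<in>V. t r s u v p q n)"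
  by (simp only:
    sum.swap[where A = R and B = P]
    sum.swap[where A = R and B = Q]
    sum.swap[where A = R and B = N]
    sum.swap[where A = S and B = P]
    sum.swap[where A = S and B = Q]
    sum.swap[where A = S and B = N]
    sum.swap[where A = U and B = P]
    sum.swap[where A = U and B = Q]
    sum.swap[where A = U and B = N]
    sum.swap[where A = V and B = P]
    sum.swap[where A = V and B = Q]
    sum.swap[where A = V and B = N])

definition bellf :: "nat \<Rightarrow> nat \<Rightarrow> nat \<Rightarrow> complex" where
  "bellf b r s = (if r < 2 \<and> s < 2 then bell_vec b $ (r * 2 + s) else 0)"

text \<open>Bell vectors have real entries, so their overlap with w needs no conjugation.\<close>

definition fid :: "nat \<Rightarrow> mf \<Rightarrow> real" where
  "fid b w = (cmod (\<Sum>r<2. \<Sum>s<2. bellf b r s * w r s))\<^sup>2"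

text \<open>A Gram vector \<beta> of an effect pulled back to two qubits through the adjoints of one
  pair of Kraus operators. By \<open>kraus_value\<close> the fidelities of these vectors add up to
  the value of the pair of maps.\<close>

definition omega :: "nat \<Rightarrow> nat \<Rightarrow> mf \<Rightarrow> mf \<Rightarrow> (nat \<Rightarrow> complex) \<Rightarrow> mf" where
  "omega d1 d2 V V' \<beta> r s = (\<Sum>i<d1. \<Sum>k<d2. cnj (V i r) * cnj (V' k s) * \<beta> (i * d2 + k))"

lemma sum_lt2: "(\<Sum>r<2. f r) = f 0 + f (Suc 0)" for f :: "nat \<Rightarrow> 'a::comm_monoid_add"
  by (simp add: numeral_2_eq_2)

lemma less_2_cases': "(r::nat) < 2 \<Longrightarrow> r = 0 \<or> r = Suc 0"
  by auto

lemma bellf_values: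
  "bellf 0 0 0 = 1 / complex_of_real (sqrt 2)" "bellf 0 0 (Suc 0) = 0" "bellf 0 (Suc 0) 0 = 0" "bellf 0 (Suc 0) (Suc 0) = 1 / complex_of_real (sqrt 2)"
  "bellf (Suc 0) 0 0 = 1 / complex_of_real (sqrt 2)" "bellf (Suc 0) 0 (Suc 0) = 0" "bellf (Suc 0) (Suc 0) 0 = 0" "bellf (Suc 0) (Suc 0) (Suc 0) = - (1 / complex_of_real (sqrt 2))"
  "bellf 2 0 0 = 0" "bellf 2 0 (Suc 0) = 1 / complex_of_real (sqrt 2)" "bellf 2 (Suc 0) 0 = 1 / complex_of_real (sqrt 2)" "bellf 2 (Suc 0) (Suc 0) = 0"
  "bellf 3 0 0 = 0" "bellf 3 0 (Suc 0) = 1 / complex_of_real (sqrt 2)" "bellf 3 (Suc 0) 0 = - (1 / complex_of_real (sqrt 2))" "bellf 3 (Suc 0) (Suc 0) = 0"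
  by (simp_all add: bellf_def bell_vec_def Let_def)

lemma less_4_cases: "(b::nat) < 4 \<Longrightarrow> b = 0 \<or> b = Suc 0 \<or> b = 2 \<or> b = 3"
  by auto

lemma inv_sqrt2_sq: "1 / complex_of_real (sqrt 2) * (1 / complex_of_real (sqrt 2)) = 1 / 2"
  by (simp flip: of_real_mult)

lemma bellf_cnj: "b < 4 \<Longrightarrow> cnj (bellf b r s) = bellf b r s"
  by (auto dest!: less_4_cases simp: bellf_def bell_vec_def Let_def)

lemma bellf_marginal:
  assumes "b < 4" "r < 2" "r' < 2"
  shows "(\<Sum>s<2. bellf b r s * bellf b r' s) = (if r = r' then 1 / 2 else 0)"
    and "(\<Sum>s<2. bellf b s r * bellf b s r') = (if r = r' then 1 / 2 else 0)"
  using less_4_cases[OF assms(1)] less_2_cases'[OF assms(2)] less_2_cases'[OF assms(3)]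
  by (elim disjE; simp add: sum_lt2 bellf_values inv_sqrt2_sq del: times_divide_eq_left times_divide_eq_right)+

lemma kraus_munit:
  assumes "i < d" "j < d" "r < 2" "s < 2"
  shows "kraus d K V (munit d i j) $$ (r, s) = (\<Sum>\<kappa>\<in>K. cnj (V \<kappa> i r) * V \<kappa> j s)"
  unfolding kraus_index[OF assms(3,4)]
proof (rule sum.cong[OF refl])
  fix \<kappa>
  have "(\<Sum>m<d. \<Sum>m'<d. cnj (V \<kappa> m r) * munit d i j $$ (m, m') * V \<kappa> m' s) =
    (\<Sum>m<d. if m = i then cnj (V \<kappa> i r) * V \<kappa> j s else 0)"
  proof (rule sum.cong[OF refl])
    fix m assume m: "m \<in> {..<d}"
    have "(\<Sum>m'<d. cnj (V \<kappa> m r) * munit d i j $$ (m, m') * V \<kappa> m' s) =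
      (\<Sum>m'<d. if m' = j then (if m = i then cnj (V \<kappa> i r) * V \<kappa> j s else 0) else 0)"
      using m by (intro sum.cong refl) (auto simp: munit_def)
    then show "(\<Sum>m'<d. cnj (V \<kappa> m r) * munit d i j $$ (m, m') * V \<kappa> m' s) = (if m = i then cnj (V \<kappa> i r) * V \<kappa> j s else 0)"
      using assms by simp
  qed
  also have "\<dots> = cnj (V \<kappa> i r) * V \<kappa> j s" using assms by simp
  finally show "(\<Sum>m<d. \<Sum>m'<d. cnj (V \<kappa> m r) * munit d i j $$ (m, m') * V \<kappa> m' s) = cnj (V \<kappa> i r) * V \<kappa> j s" .
qed

lemma map_tensor_kraus:
  assumes B: "\<And>x y. x < d1 * d2 \<Longrightarrow> y < d1 * d2 \<Longrightarrow> B $$ (x, y) = (\<Sum>n<N. \<beta> n x * cnj (\<beta> n y))"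
    and rs: "r < 2" "r' < 2" "s < 2" "s' < 2"
  shows "map_tensor d1 d2 2 2 (kraus d1 K V) (kraus d2 K' V') B $$ (r * 2 + s, r' * 2 + s') =
    (\<Sum>p\<in>K. \<Sum>q\<in>K'. \<Sum>n<N. omega d1 d2 (V p) (V' q) (\<beta> n) r s * cnj (omega d1 d2 (V p) (V' q) (\<beta> n) r' s'))"
proof -
  define x where "x i k p q n = cnj (V p i r) * cnj (V' q k s) * \<beta> n (i * d2 + k)" for i k p q n
  define y where "y j l p q n = V p j r' * V' q l s' * cnj (\<beta> n (j * d2 + l))" for j l p q n
  have "map_tensor d1 d2 2 2 (kraus d1 K V) (kraus d2 K' V') B $$ (r * 2 + s, r' * 2 + s') =
    (\<Sum>i<d1. \<Sum>j<d1. \<Sum>k<d2. \<Sum>l<d2. B $$ (i * d2 + k, j * d2 + l) *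
      (kraus d1 K V (munit d1 i j) $$ (r, r') * kraus d2 K' V' (munit d2 k l) $$ (s, s')))"
    by (rule map_tensor_index) (use rs in \<open>simp_all add: kraus_def\<close>)
  also have "\<dots> = (\<Sum>i<d1. \<Sum>j<d1. \<Sum>k<d2. \<Sum>l<d2. \<Sum>n<N. \<Sum>p\<in>K. \<Sum>q\<in>K'. x i k p q n * y j l p q n)"
  proof (intro sum.cong refl)
    fix i j k l assume "i \<in> {..<d1}" "j \<in> {..<d1}" "k \<in> {..<d2}" "l \<in> {..<d2}"
    then have "B $$ (i * d2 + k, j * d2 + l) * (kraus d1 K V (munit d1 i j) $$ (r, r') * kraus d2 K' V' (munit d2 k l) $$ (s, s')) =
      (\<Sum>n<N. \<beta> n (i * d2 + k) * cnj (\<beta> n (j * d2 + l))) *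
      ((\<Sum>p\<in>K. cnj (V p i r) * V p j r') * (\<Sum>q\<in>K'. cnj (V' q k s) * V' q l s'))"
      using rs by (simp add: kraus_munit B mult_index_less)
    also have "\<dots> = (\<Sum>n<N. \<Sum>p\<in>K. \<Sum>q\<in>K'. (\<beta> n (i * d2 + k) * cnj (\<beta> n (j * d2 + l))) * ((cnj (V p i r) * V p j r') * (cnj (V' q k s) * V' q l s')))"
      unfolding sum_distrib_right unfolding sum_distrib_left ..
    also have "\<dots> = (\<Sum>n<N. \<Sum>p\<in>K. \<Sum>q\<in>K'. x i k p q n * y j l p q n)"
      by (intro sum.cong refl) (simp add: x_def y_def mult_ac)
    finally show "B $$ (i * d2 + k, j * d2 + l) * (kraus d1 K V (munit d1 i j) $$ (r, r') * kraus d2 K' V' (munit d2 k l) $$ (s, s')) =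
      (\<Sum>n<N. \<Sum>p\<in>K. \<Sum>q\<in>K'. x i k p q n * y j l p q n)" .
  qed
  also have "\<dots> = (\<Sum>p\<in>K. \<Sum>q\<in>K'. \<Sum>n<N. \<Sum>i<d1. \<Sum>k<d2. \<Sum>j<d1. \<Sum>l<d2. x i k p q n * y j l p q n)"
    by (rule sum_reorder_value)
  also have "\<dots> = (\<Sum>p\<in>K. \<Sum>q\<in>K'. \<Sum>n<N. (\<Sum>i<d1. \<Sum>k<d2. x i k p q n) * (\<Sum>j<d1. \<Sum>l<d2. y j l p q n))"
    unfolding sum_distrib_right unfolding sum_distrib_left ..
  also have "\<dots> = (\<Sum>p\<in>K. \<Sum>q\<in>K'. \<Sum>n<N. omega d1 d2 (V p) (V' q) (\<beta> n) r s * cnj (omega d1 d2 (V p) (V' q) (\<beta> n) r' s'))"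
    by (intro sum.cong refl) (simp add: omega_def x_def y_def)
  finally show ?thesis .
qed

lemma kraus_value:
  assumes B: "\<And>x y. x < d1 * d2 \<Longrightarrow> y < d1 * d2 \<Longrightarrow> B $$ (x, y) = (\<Sum>n<N. \<beta> n x * cnj (\<beta> n y))" and b: "b < 4"
  shows "Re (mtrace (map_tensor d1 d2 2 2 (kraus d1 K V) (kraus d2 K' V') B * bell_proj b)) =
    (\<Sum>p\<in>K. \<Sum>q\<in>K'. \<Sum>n<N. fid b (omega d1 d2 (V p) (V' q) (\<beta> n)))"
proof -
  define w where "w p q n = omega d1 d2 (V p) (V' q) (\<beta> n)" for p q n
  have 4: "(4::nat) = 2 * 2" by simp
  have car: "map_tensor d1 d2 2 2 (kraus d1 K V) (kraus d2 K' V') B \<in> carrier_mat (2 * 2) (2 * 2)" "bell_proj b \<in> carrier_mat (2 * 2) (2 * 2)"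
    by (simp_all add: map_tensor_def bell_proj_def)
  have bp: "bell_proj b $$ (r' * 2 + s', r * 2 + s) = bellf b r' s' * bellf b r s" if "r < 2" "s < 2" "r' < 2" "s' < 2" for r s r' s'
    using that mult_index_less[of r 2 s 2] mult_index_less[of r' 2 s' 2] bellf_cnj[OF b, of r s] by (simp add: bell_proj_def bellf_def)
  have "mtrace (map_tensor d1 d2 2 2 (kraus d1 K V) (kraus d2 K' V') B * bell_proj b) =
    (\<Sum>r<2. \<Sum>s<2. \<Sum>r'<2. \<Sum>s'<2. map_tensor d1 d2 2 2 (kraus d1 K V) (kraus d2 K' V') B $$ (r * 2 + s, r' * 2 + s') * bell_proj b $$ (r' * 2 + s', r * 2 + s))"
    unfolding mtrace_mult[OF car] sum_mult_index ..
  also have "\<dots> = (\<Sum>r<2. \<Sum>s<2. \<Sum>r'<2. \<Sum>s'<2. \<Sum>p\<in>K. \<Sum>q\<in>K'. \<Sum>n<N. (bellf b r s * w p q n r s) * (bellf b r' s' * cnj (w p q n r' s')))"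
  proof (intro sum.cong refl)
    fix r s r' s' assume "r \<in> {..<2::nat}" "s \<in> {..<2::nat}" "r' \<in> {..<2::nat}" "s' \<in> {..<2::nat}"
    then have lt: "r < 2" "r' < 2" "s < 2" "s' < 2" by auto
    show "map_tensor d1 d2 2 2 (kraus d1 K V) (kraus d2 K' V') B $$ (r * 2 + s, r' * 2 + s') * bell_proj b $$ (r' * 2 + s', r * 2 + s) =
      (\<Sum>p\<in>K. \<Sum>q\<in>K'. \<Sum>n<N. (bellf b r s * w p q n r s) * (bellf b r' s' * cnj (w p q n r' s')))"
      unfolding map_tensor_kraus[where N = N and \<beta> = \<beta> and B = B and ?d1.0 = d1 and ?d2.0 = d2, OF B lt, simplified] bp[OF lt(1,3,2,4)] sum_distrib_right w_def
      by (intro sum.cong refl) (simp add: mult_ac)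
  qed
  also have "\<dots> = (\<Sum>p\<in>K. \<Sum>q\<in>K'. \<Sum>n<N. \<Sum>r<2. \<Sum>s<2. \<Sum>r'<2. \<Sum>s'<2. (bellf b r s * w p q n r s) * (bellf b r' s' * cnj (w p q n r' s')))"
    by (rule sum_reorder_trace)
  also have "\<dots> = (\<Sum>p\<in>K. \<Sum>q\<in>K'. \<Sum>n<N. (\<Sum>r<2. \<Sum>s<2. bellf b r s * w p q n r s) * (\<Sum>r'<2. \<Sum>s'<2. bellf b r' s' * cnj (w p q n r' s')))"
    unfolding sum_distrib_right unfolding sum_distrib_left ..
  also have "\<dots> = (\<Sum>p\<in>K. \<Sum>q\<in>K'. \<Sum>n<N. (\<Sum>r<2. \<Sum>s<2. bellf b r s * w p q n r s) * cnj (\<Sum>r'<2. \<Sum>s'<2. bellf b r' s' * w p q n r' s'))"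
    unfolding cnj_sum complex_cnj_mult bellf_cnj[OF b] ..
  finally show ?thesis unfolding w_def[symmetric] fid_def Re_mult_cnj[symmetric] by (simp only: Re_sum)
qed

section \<open>Bloch vectors of the marginals and reflections acting on Bell states\<close>

definition refl2 :: "mf \<Rightarrow> bool" where
  "refl2 S \<longleftrightarrow> herm 2 S \<and> S 0 0 + S 1 1 = 0 \<and> (\<forall>i<2. \<forall>j<2. (\<Sum>k<2. S i k * S k j) = (if i = j then 1 else 0))"

lemma refl2D:
  assumes "refl2 S"
  shows "herm 2 S" "S 0 0 + S 1 1 = 0" "\<And>i j. i < 2 \<Longrightarrow> j < 2 \<Longrightarrow> (\<Sum>k<2. S i k * S k j) = (if i = j then 1 else 0)"
  using assms unfolding refl2_def by blast+

text \<open>a is the difference of the two eigenvalues. With the minus sign in front of S, the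
  inverse square root of \<sigma> is a combination of 1 and S with nonnegative coefficients, as
  \<open>filtered_fidelity_bound\<close> requires.\<close>

lemma bloch_form:
  assumes h: "herm 2 \<sigma>" and tr: "\<sigma> 0 0 + \<sigma> 1 1 = 1"
  obtains a S where "0 \<le> a" "refl2 S"
    "\<And>r s. r < 2 \<Longrightarrow> s < 2 \<Longrightarrow> \<sigma> r s = ((if r = s then 1 else 0) - of_real a * S r s) / 2"
proof -
  have "cnj (\<sigma> 0 0) = \<sigma> 0 0" "cnj (\<sigma> 1 1) = \<sigma> 1 1" using hermD[OF h] by auto
  then obtain u v where u: "\<sigma> 0 0 = of_real u" and v: "\<sigma> 1 1 = of_real v"
    by (metis Reals_cases Reals_cnj_iff)
  have uv: "u + v = 1" using tr unfolding u v by (metis of_real_add of_real_eq_1_iff)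
  define w where "w = \<sigma> 0 1"
  have w': "\<sigma> 1 0 = cnj w" using hermD[OF h, of 0 1] by (simp add: w_def)
  define a where "a = sqrt ((u - v)\<^sup>2 + 4 * (cmod w)\<^sup>2)"
  have a0: "0 \<le> a" by (simp add: a_def)
  have a2: "a\<^sup>2 = (u - v)\<^sup>2 + 4 * (cmod w)\<^sup>2" by (simp add: a_def)
  show thesis
  proof (cases "a = 0")
    case True
    then have "(u - v)\<^sup>2 + 4 * (cmod w)\<^sup>2 = 0" using a2 by simp
    then have "(u - v)\<^sup>2 = 0" "(cmod w)\<^sup>2 = 0" using zero_le_power2[of "u - v"] zero_le_power2[of "cmod w"] by linarith+
    then have w0: "w = 0" and "u = v" by simp_all
    then have "u = 1 / 2" "v = 1 / 2" using uv by simp_all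
    then have "complex_of_real u = of_real (1 / 2)" "complex_of_real v = of_real (1 / 2)" by (simp_all only:)
    then have uv': "\<sigma> 0 0 = 1 / 2" "\<sigma> (Suc 0) (Suc 0) = 1 / 2" "\<sigma> 0 (Suc 0) = 0" "\<sigma> (Suc 0) 0 = 0"
      using u v w' w0 w_def by simp_all
    have e: "\<sigma> r s = (if r = s then 1 else 0) / 2" if "r < 2" "s < 2" for r s
      using less_2_cases'[OF that(1)] less_2_cases'[OF that(2)] uv' by auto
    \<comment> \<open>At a = 0 the direction is arbitrary; the Pauli matrix Z is taken.\<close>
    define S :: mf where "S i j = (if i = j then (if i = 0 then 1 else -1) else 0)" for i j
    have "refl2 S" unfolding refl2_def herm_def
      by (auto simp: sum_lt2 S_def dest!: less_2_cases')
    then show ?thesis using that[of 0 S] e by simp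
  next
    case False
    define S :: mf where "S i j = ((if i = j then 1 else 0) - 2 * \<sigma> i j) / of_real a" for i j
    define p e where "p = complex_of_real ((v - u) / a)" and "e = - 2 * w / complex_of_real a"
    have s00: "S 0 0 = p" "S 1 1 = - p" "S 0 1 = e" "S 1 0 = cnj e"
    proof -
      have "v = 1 - u" using uv by simp
      then show "S 0 0 = p" "S 1 1 = - p" unfolding S_def u v p_def by (simp_all add: diff_divide_distrib)
      show "S 0 1 = e" "S 1 0 = cnj e" unfolding S_def w' w_def[symmetric] e_def by simp_all
    qed
    have ww: "w * cnj w = of_real ((cmod w)\<^sup>2)" by (rule complex_norm_square[symmetric])
    have sq1: "p * p + e * cnj e = 1"
    proof -
      have "p * p + e * cnj e = of_real ((v - u)\<^sup>2 / a\<^sup>2) + 4 * (w * cnj w) / of_real (a\<^sup>2)"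
        by (simp add: p_def e_def power2_eq_square)
      also have "\<dots> = of_real ((v - u)\<^sup>2 / a\<^sup>2 + 4 * (cmod w)\<^sup>2 / a\<^sup>2)" unfolding ww by simp
      also have "(v - u)\<^sup>2 / a\<^sup>2 + 4 * (cmod w)\<^sup>2 / a\<^sup>2 = ((u - v)\<^sup>2 + 4 * (cmod w)\<^sup>2) / a\<^sup>2"
        by (simp add: add_divide_distrib power2_commute)
      also have "\<dots> = 1" unfolding a2[symmetric] using False by simp
      finally show ?thesis by simp
    qed
    have cp: "cnj p = p" by (simp add: p_def)
    have "refl2 S" unfolding refl2_def herm_def
    proof (intro conjI allI impI)
      show "S 0 0 + S 1 1 = 0" unfolding s00 by simp
      fix i j :: nat assume ij: "i < 2" "j < 2"
      show "S j i = cnj (S i j)"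
        using less_2_cases'[OF ij(1)] less_2_cases'[OF ij(2)] s00 cp by auto
      show "(\<Sum>k<2. S i k * S k j) = (if i = j then 1 else 0)"
        using less_2_cases'[OF ij(1)] less_2_cases'[OF ij(2)] sq1 s00
        by (auto simp: sum_lt2 algebra_simps)
    qed
    moreover have "\<sigma> r s = ((if r = s then 1 else 0) - of_real a * S r s) / 2" for r s
      using False by (simp add: S_def)
    ultimately show ?thesis using that[of a S] a0 by blast
  qed
qed

definition bra :: "nat \<Rightarrow> mf \<Rightarrow> complex" where
  "bra b u = (\<Sum>r<2. \<Sum>s<2. bellf b r s * u r s)"

definition Qb :: "nat \<Rightarrow> mf \<Rightarrow> mf" where
  "Qb b u = (\<lambda>r s. bra b u * bellf b r s)"

text \<open>Outside the qubit range this is the identity, where \<open>opL\<close> would give 0: the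
  complementarity bounds need an involution on all functions. On the entries read by
  \<open>ip2 2 2\<close> the two agree.\<close>

definition Rl :: "mf \<Rightarrow> mf \<Rightarrow> mf" where
  "Rl S u = (\<lambda>i j. if i < 2 then \<Sum>k<2. S i k * u k j else u i j)"

definition Rr :: "mf \<Rightarrow> mf \<Rightarrow> mf" where
  "Rr S u = (\<lambda>i j. if j < 2 then \<Sum>k<2. S j k * u i k else u i j)"

lemma bra_lin: "bra b (u + v) = bra b u + bra b v" "bra b (a *\<^sub>R u) = of_real a * bra b u" "bra b (\<lambda>r s. c * u r s) = c * bra b u"
  by (simp_all add: bra_def sum_lt2 scaleR_fun_def scaleR_conv_of_real algebra_simps)

lemma ip2_Qb: "b < 4 \<Longrightarrow> ip2 2 2 (Qb b u) w = Re (cnj (bra b u) * bra b w)"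
  unfolding ip2_eq_Re Qb_def bra_def[of b w] sum_distrib_left
  by (rule arg_cong[of _ _ Re]) (intro sum.cong refl, simp add: bellf_cnj)

lemma bra_bellf: "b < 4 \<Longrightarrow> bra b (bellf b) = 1"
  unfolding bra_def by (simp add: bellf_marginal)

lemma Qb_selfadj: "b < 4 \<Longrightarrow> ip2.selfadj 2 2 (Qb b)"
  unfolding ip2.selfadj_def
proof (intro conjI allI)
  assume b: "b < 4"
  show "Qb b (u + w) = Qb b u + Qb b w" "Qb b (a *\<^sub>R u) = a *\<^sub>R Qb b u" for u w a
    by (simp_all add: Qb_def bra_lin fun_eq_iff scaleR_fun_def scaleR_conv_of_real algebra_simps)
  show "ip2 2 2 (Qb b u) w = ip2 2 2 u (Qb b w)" for u w
    unfolding ip2.ip_sym[of 2 2 u "Qb b w"] ip2_Qb[OF b] by (simp add: mult.commute)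
qed

lemma Qb_idem: "b < 4 \<Longrightarrow> Qb b (Qb b u) = Qb b u"
  by (simp add: Qb_def bra_lin(3) bra_bellf)

lemma fid_eq: "b < 4 \<Longrightarrow> fid b u = ip2 2 2 (Qb b u) (Qb b u)"
  using Qb_selfadj[of b] ip2.selfadjD(5)[of 2 2 "Qb b" u "Qb b u"] ip2_Qb[of b u "u"] Re_mult_cnj(2)[of "bra b u"]
  by (simp add: Qb_idem fid_def bra_def[symmetric] ip2.ip_sym[of 2 2 u])

lemma ip2_cong: "(\<And>i j. i < n \<Longrightarrow> j < m \<Longrightarrow> u i j = u' i j) \<Longrightarrow> ip2 n m u w = ip2 n m u' w"
  unfolding ip2_def by (intro sum.cong refl) simp

lemma Rl_selfadj: assumes "refl2 S" shows "ip2.selfadj 2 2 (Rl S)"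
  unfolding ip2.selfadj_def
proof (intro conjI allI)
  show "Rl S (u + w) = Rl S u + Rl S w" "Rl S (a *\<^sub>R u) = a *\<^sub>R Rl S u" for u w a
    by (intro ext, simp add: Rl_def scaleR_fun_def algebra_simps sum_lt2)+
  have e: "ip2 2 2 (Rl S u) w = ip2 2 2 (opL 2 S u) w" for u w by (rule ip2_cong) (simp add: Rl_def opL_def)
  show "ip2 2 2 (Rl S u) w = ip2 2 2 u (Rl S w)" for u w
    unfolding ip2.ip_sym[of 2 2 u "Rl S w"] e
    using ip2.selfadjD(5)[OF opL_selfadj[OF refl2D(1)[OF assms]], where u = u and w = w] ip2.ip_sym by metis
qed

lemma Rr_selfadj: assumes "refl2 S" shows "ip2.selfadj 2 2 (Rr S)"
  unfolding ip2.selfadj_def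
proof (intro conjI allI)
  show "Rr S (u + w) = Rr S u + Rr S w" "Rr S (a *\<^sub>R u) = a *\<^sub>R Rr S u" for u w a
    by (intro ext, simp add: Rr_def scaleR_fun_def algebra_simps sum_lt2)+
  have e: "ip2 2 2 (Rr S u) w = ip2 2 2 (opR 2 S u) w" for u w by (rule ip2_cong) (simp add: Rr_def opR_def)
  show "ip2 2 2 (Rr S u) w = ip2 2 2 u (Rr S w)" for u w
    unfolding ip2.ip_sym[of 2 2 u "Rr S w"] e
    using ip2.selfadjD(5)[OF opR_selfadj[OF refl2D(1)[OF assms]], where u = u and w = w] ip2.ip_sym by metis
qed

lemma Rl_invol: assumes "refl2 S" shows "Rl S (Rl S u) = u"
proof (intro ext)
  fix i j
  show "Rl S (Rl S u) i j = u i j"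
  proof (cases "i < 2")
    case True
    have "Rl S (Rl S u) i j = (\<Sum>k<2. S i k * (\<Sum>l<2. S k l * u l j))" using True by (simp add: Rl_def)
    also have "\<dots> = (\<Sum>l<2. (\<Sum>k<2. S i k * S k l) * u l j)" by (simp add: sum_lt2 algebra_simps)
    also have "\<dots> = (\<Sum>l<2. (if i = l then 1 else 0) * u l j)" using refl2D(3)[OF assms True] by (intro sum.cong refl) simp
    also have "\<dots> = u i j" using less_2_cases'[OF True] by (auto simp: sum_lt2)
    finally show ?thesis .
  qed (simp add: Rl_def)
qed

lemma Rr_invol: assumes "refl2 S" shows "Rr S (Rr S u) = u"
proof (intro ext)
  fix i j
  show "Rr S (Rr S u) i j = u i j"
  proof (cases "j < 2")
    case True
    have "Rr S (Rr S u) i j = (\<Sum>k<2. S j k * (\<Sum>l<2. S k l * u i l))" using True by (simp add: Rr_def)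
    also have "\<dots> = (\<Sum>l<2. (\<Sum>k<2. S j k * S k l) * u i l)" by (simp add: sum_lt2 algebra_simps)
    also have "\<dots> = (\<Sum>l<2. (if j = l then 1 else 0) * u i l)" using refl2D(3)[OF assms True] by (intro sum.cong refl) simp
    also have "\<dots> = u i j" using less_2_cases'[OF True] by (auto simp: sum_lt2)
    finally show ?thesis .
  qed (simp add: Rr_def)
qed

text \<open>Both marginals of a Bell vector are 1/2, so the expectation of a local S is half its
  trace, which is 0. This is the source of the condition Q R Q = 0.\<close>

lemma bra_R_bellf:
  assumes "refl2 S" "b < 4"
  shows "bra b (Rl S (bellf b)) = 0" "bra b (Rr S (bellf b)) = 0"
proof -
  have "bra b (Rl S (bellf b)) = (\<Sum>r<2. \<Sum>k<2. S r k * (\<Sum>s<2. bellf b r s * bellf b k s))"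
    unfolding bra_def Rl_def by (simp add: sum_lt2 algebra_simps)
  also have "\<dots> = (\<Sum>r<2. \<Sum>k<2. S r k * (if r = k then 1 / 2 else 0))"
    by (intro sum.cong refl) (simp add: bellf_marginal[OF assms(2)])
  also have "\<dots> = (S 0 0 + S 1 1) / 2" by (simp add: sum_lt2)
  finally show "bra b (Rl S (bellf b)) = 0" using refl2D(2)[OF assms(1)] by simp
  have "bra b (Rr S (bellf b)) = (\<Sum>r<2. \<Sum>k<2. S r k * (\<Sum>s<2. bellf b s r * bellf b s k))"
    unfolding bra_def Rr_def by (simp add: sum_lt2 algebra_simps)
  also have "\<dots> = (\<Sum>r<2. \<Sum>k<2. S r k * (if r = k then 1 / 2 else 0))"
    by (intro sum.cong refl) (simp add: bellf_marginal[OF assms(2)])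
  also have "\<dots> = (S 0 0 + S 1 1) / 2" by (simp add: sum_lt2)
  finally show "bra b (Rr S (bellf b)) = 0" using refl2D(2)[OF assms(1)] by simp
qed

lemma Qb_R_Qb:
  assumes "refl2 S" "b < 4"
  shows "Qb b (Rl S (Qb b u)) = 0" "Qb b (Rr S (Qb b u)) = 0"
proof -
  have e: "Rl S (Qb b u) = (\<lambda>r s. bra b u * Rl S (bellf b) r s)" "Rr S (Qb b u) = (\<lambda>r s. bra b u * Rr S (bellf b) r s)"
    by (auto simp: Rl_def Rr_def Qb_def fun_eq_iff sum_distrib_left mult_ac)
  have "bra b (Rl S (Qb b u)) = 0" "bra b (Rr S (Qb b u)) = 0"
    unfolding e bra_lin(3) bra_R_bellf[OF assms] by simp_all
  then show "Qb b (Rl S (Qb b u)) = 0" "Qb b (Rr S (Qb b u)) = 0"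
    by (simp_all add: Qb_def[of b "Rl S (Qb b u)"] Qb_def[of b "Rr S (Qb b u)"] fun_eq_iff)
qed

definition blochmat :: "real \<Rightarrow> mf \<Rightarrow> mf \<Rightarrow> bool" where
  "blochmat a S \<sigma> \<longleftrightarrow> 0 \<le> a \<and> refl2 S \<and>
     (\<forall>r<2. \<forall>s<2. \<sigma> r s = ((if r = s then 1 else 0) - of_real a * S r s) / 2)"

lemma blochmat_trace:
  assumes "blochmat a S \<sigma>"
  shows "(\<Sum>r<2. \<sigma> r r) = 1" "(\<Sum>r<2. \<Sum>k<2. S r k * \<sigma> k r) = - of_real a"
proof -
  have S: "refl2 S" and e: "\<And>r s. r < 2 \<Longrightarrow> s < 2 \<Longrightarrow> \<sigma> r s = ((if r = s then 1 else 0) - of_real a * S r s) / 2"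
    using assms unfolding blochmat_def by blast+
  have tr: "S (Suc 0) (Suc 0) = - S 0 0" using refl2D(2)[OF S] by (simp add: add_eq_0_iff2)
  have sq: "S 0 0 * S 0 0 + S 0 (Suc 0) * S (Suc 0) 0 = 1" using refl2D(3)[OF S, of 0 0] by (simp add: sum_lt2)
  show "(\<Sum>r<2. \<sigma> r r) = 1" by (simp add: sum_lt2 e tr field_simps)
  have "(\<Sum>r<2. \<Sum>k<2. S r k * \<sigma> k r) = - of_real a * (S 0 0 * S 0 0 + S 0 (Suc 0) * S (Suc 0) 0)"
    by (simp add: sum_lt2 e tr field_simps)
  then show "(\<Sum>r<2. \<Sum>k<2. S r k * \<sigma> k r) = - of_real a" by (simp add: sq)
qed

text \<open>The effects sum to the identity, so all extracted vectors together have the product of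
  the two marginals as Gram operator. The index i collects outcome, Kraus and Gram indices;
  \<open>bb i\<close> is the outcome whose Bell vector is compared with \<open>w i\<close>.\<close>

locale gram_family =
  fixes I :: "'i set" and w :: "'i \<Rightarrow> mf" and bb :: "'i \<Rightarrow> nat" and \<sigma> \<sigma>' :: mf and a c :: real and S S' :: mf
  assumes gram: "\<And>r r' s s'. r < 2 \<Longrightarrow> r' < 2 \<Longrightarrow> s < 2 \<Longrightarrow> s' < 2 \<Longrightarrow>
      (\<Sum>i\<in>I. w i r s * cnj (w i r' s')) = \<sigma> r r' * \<sigma>' s s'"
    and bb: "\<And>i. i \<in> I \<Longrightarrow> bb i < 4"
    and bl: "blochmat a S \<sigma>" "blochmat c S' \<sigma>'"
begin

lemma reflS: "refl2 S" "refl2 S'" and ac: "0 \<le> a" "0 \<le> c"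
  using bl unfolding blochmat_def by auto

lemma gram': "r < 2 \<Longrightarrow> r' < 2 \<Longrightarrow> s < 2 \<Longrightarrow> s' < 2 \<Longrightarrow> (\<Sum>i\<in>I. cnj (w i r' s') * w i r s) = \<sigma> r r' * \<sigma>' s s'"
  using gram by (simp add: mult.commute)

lemma norm_sum: "(\<Sum>i\<in>I. ip2 2 2 (w i) (w i)) = 1"
proof -
  have "(\<Sum>i\<in>I. ip2 2 2 (w i) (w i)) = Re (\<Sum>r<2. \<Sum>s<2. \<Sum>i\<in>I. cnj (w i r s) * w i r s)"
    unfolding ip2_eq_Re Re_sum[symmetric] by (simp add: sum_lt2 sum.distrib)
  also have "\<dots> = Re ((\<Sum>r<2. \<sigma> r r) * (\<Sum>s<2. \<sigma>' s s))"
    by (simp add: gram' sum_lt2[of "\<lambda>r. \<sigma> r r"] sum_lt2[of "\<lambda>s. \<sigma>' s s"]) (simp add: sum_lt2 gram' algebra_simps)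
  finally show ?thesis unfolding blochmat_trace(1)[OF bl(1)] blochmat_trace(1)[OF bl(2)] by simp
qed

lemma Rl_sum: "(\<Sum>i\<in>I. ip2 2 2 (w i) (Rl S (w i))) = - a"
proof -
  have "(\<Sum>i\<in>I. ip2 2 2 (w i) (Rl S (w i))) = Re (\<Sum>r<2. \<Sum>s<2. \<Sum>k<2. S r k * (\<Sum>i\<in>I. cnj (w i r s) * w i k s))"
    unfolding ip2_eq_Re Re_sum[symmetric]
    by (simp add: sum_lt2 Rl_def sum.distrib sum_distrib_left algebra_simps)
  also have "(\<Sum>r<2. \<Sum>s<2. \<Sum>k<2. S r k * (\<Sum>i\<in>I. cnj (w i r s) * w i k s)) = (\<Sum>r<2. \<Sum>s<2. \<Sum>k<2. S r k * (\<sigma> k r * \<sigma>' s s))"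
    by (intro sum.cong refl) (simp add: gram')
  also have "\<dots> = (\<Sum>r<2. \<Sum>k<2. S r k * \<sigma> k r) * (\<Sum>s<2. \<sigma>' s s)"
    by (simp add: sum_lt2 algebra_simps)
  finally show ?thesis unfolding blochmat_trace(2)[OF bl(1)] blochmat_trace(1)[OF bl(2)] by simp
qed

lemma Rr_sum: "(\<Sum>i\<in>I. ip2 2 2 (w i) (Rr S' (w i))) = - c"
proof -
  have "(\<Sum>i\<in>I. ip2 2 2 (w i) (Rr S' (w i))) = Re (\<Sum>r<2. \<Sum>s<2. \<Sum>k<2. S' s k * (\<Sum>i\<in>I. cnj (w i r s) * w i r k))"
    unfolding ip2_eq_Re Re_sum[symmetric]
    by (simp add: sum_lt2 Rr_def sum.distrib sum_distrib_left algebra_simps)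
  also have "(\<Sum>r<2. \<Sum>s<2. \<Sum>k<2. S' s k * (\<Sum>i\<in>I. cnj (w i r s) * w i r k)) = (\<Sum>r<2. \<Sum>s<2. \<Sum>k<2. S' s k * (\<sigma> r r * \<sigma>' k s))"
    by (intro sum.cong refl) (simp add: gram')
  also have "\<dots> = (\<Sum>r<2. \<sigma> r r) * (\<Sum>s<2. \<Sum>k<2. S' s k * \<sigma>' k s)"
    by (simp add: sum_lt2 algebra_simps)
  finally show ?thesis unfolding blochmat_trace(2)[OF bl(2)] blochmat_trace(1)[OF bl(1)] by simp
qed

abbreviation "F \<equiv> \<Sum>i\<in>I. fid (bb i) (w i)"

text \<open>\<open>bloch_fidelity_bound\<close> gives lam t + nu (2 F - 1) <= 1 for every admissible
  direction (lam, nu). Choosing the direction of (t, 2 F - 1) itself bounds its length by 1.\<close>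

lemma bloch_length_aux:
  assumes F: "1 / 2 < F" and sa: "ip2.selfadj 2 2 R" and R: "\<And>u. R (R u) = u"
    and QRQ: "\<And>b u. b < 4 \<Longrightarrow> Qb b (R (Qb b u)) = 0"
    and t: "(\<Sum>i\<in>I. ip2 2 2 (w i) (R (w i))) = - t" "0 \<le> t"
  shows "t\<^sup>2 + (2 * F - 1)\<^sup>2 \<le> 1"
proof -
  define \<rho> where "\<rho> = sqrt (t\<^sup>2 + (2 * F - 1)\<^sup>2)"
  have "0 < (2 * F - 1)\<^sup>2" using F by simp
  then have \<rho>: "\<rho> > 0" unfolding \<rho>_def by (simp add: add_nonneg_pos)
  have \<rho>2: "\<rho>\<^sup>2 = t\<^sup>2 + (2 * F - 1)\<^sup>2" unfolding \<rho>_def by simp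
  define lam nu where "lam = t / \<rho>" and "nu = (2 * F - 1) / \<rho>"
  have ln: "0 \<le> lam" "0 \<le> nu" "lam\<^sup>2 + nu\<^sup>2 = 1"
  proof -
    show "0 \<le> lam" "0 \<le> nu" using t(2) F \<rho> by (simp_all add: lam_def nu_def)
    have "lam\<^sup>2 + nu\<^sup>2 = (t\<^sup>2 + (2 * F - 1)\<^sup>2) / \<rho>\<^sup>2" by (simp add: lam_def nu_def power_divide add_divide_distrib)
    then show "lam\<^sup>2 + nu\<^sup>2 = 1" unfolding \<rho>2[symmetric] using \<rho> by simp
  qed
  \<comment> \<open>The marginals contain - a S, so the expectation of R is - t and the bound is
    applied to - R.\<close>
  have sam: "ip2.selfadj 2 2 (\<lambda>u. - R u)" using ip2.selfadj_minus[OF sa] .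
  have Rm: "- R (- R u) = u" for u using ip2.selfadjD(3)[OF sa] R by simp
  have Q0: "Qb b (- R (Qb b u)) = 0" if "b < 4" for b u
    using ip2.selfadjD(3)[OF Qb_selfadj[OF that]] QRQ[OF that] by simp
  have "lam * ip2 2 2 (w i) (- R (w i)) + nu * (2 * fid (bb i) (w i) - ip2 2 2 (w i) (w i)) \<le> ip2 2 2 (w i) (w i)" if "i \<in> I" for i
    unfolding fid_eq[OF bb[OF that]]
    by (rule ip2.bloch_fidelity_bound[OF Qb_selfadj[OF bb[OF that]] sam Qb_idem[OF bb[OF that]] Rm Q0[OF bb[OF that]] ln])
  then have "(\<Sum>i\<in>I. lam * ip2 2 2 (w i) (- R (w i)) + nu * (2 * fid (bb i) (w i) - ip2 2 2 (w i) (w i))) \<le> (\<Sum>i\<in>I. ip2 2 2 (w i) (w i))"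
    by (rule sum_mono)
  moreover have "(\<Sum>i\<in>I. lam * ip2 2 2 (w i) (- R (w i)) + nu * (2 * fid (bb i) (w i) - ip2 2 2 (w i) (w i))) =
    lam * - (\<Sum>i\<in>I. ip2 2 2 (w i) (R (w i))) + nu * (2 * F - (\<Sum>i\<in>I. ip2 2 2 (w i) (w i)))"
    unfolding ip2.ip_lin by (simp add: sum.distrib sum_subtractf sum_distrib_left sum_negf right_diff_distrib)
  ultimately have "lam * t + nu * (2 * F - 1) \<le> 1" unfolding t norm_sum by simp
  moreover have "lam * t + nu * (2 * F - 1) = (t\<^sup>2 + (2 * F - 1)\<^sup>2) / \<rho>"
    by (simp add: lam_def nu_def power2_eq_square add_divide_distrib)
  ultimately have "\<rho>\<^sup>2 / \<rho> \<le> 1" unfolding \<rho>2 by simp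
  then have "\<rho> \<le> 1" using \<rho> by (simp add: power2_eq_square)
  then have "\<rho>\<^sup>2 \<le> 1\<^sup>2" using \<rho> by (intro power_mono) auto
  then show ?thesis unfolding \<rho>2 by simp
qed

lemma bloch_lengths:
  assumes "1 / 2 < F"
  shows "a\<^sup>2 + (2 * F - 1)\<^sup>2 \<le> 1" "c\<^sup>2 + (2 * F - 1)\<^sup>2 \<le> 1"
  using bloch_length_aux[OF assms Rl_selfadj[OF reflS(1)] Rl_invol[OF reflS(1)] Qb_R_Qb(1)[OF reflS(1)] Rl_sum ac(1)]
    bloch_length_aux[OF assms Rr_selfadj[OF reflS(2)] Rr_invol[OF reflS(2)] Qb_R_Qb(2)[OF reflS(2)] Rr_sum ac(2)] by auto

lemma filtered_sum:
  assumes uv: "0 \<le> v" "v \<le> u"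
  shows "(u\<^sup>2 - v\<^sup>2) * F - v * (u - v) \<le> (\<Sum>i\<in>I. fid (bb i) (u *\<^sub>R w i + v *\<^sub>R Rl S (w i)))"
proof -
  have "(u\<^sup>2 - v\<^sup>2) * fid (bb i) (w i) - v * (u - v) * ip2 2 2 (w i) (w i) \<le> fid (bb i) (u *\<^sub>R w i + v *\<^sub>R Rl S (w i))" if "i \<in> I" for i
    unfolding fid_eq[OF bb[OF that]]
    by (rule ip2.filtered_fidelity_bound[OF Qb_selfadj[OF bb[OF that]] Rl_selfadj[OF reflS(1)] Qb_idem[OF bb[OF that]]
        Rl_invol[OF reflS(1)] Qb_R_Qb(1)[OF reflS(1) bb[OF that]] uv])
  then have "(\<Sum>i\<in>I. (u\<^sup>2 - v\<^sup>2) * fid (bb i) (w i) - v * (u - v) * ip2 2 2 (w i) (w i)) \<le> (\<Sum>i\<in>I. fid (bb i) (u *\<^sub>R w i + v *\<^sub>R Rl S (w i)))"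
    by (rule sum_mono)
  then show ?thesis unfolding sum_subtractf sum_distrib_left[symmetric] norm_sum by simp
qed

end

section \<open>The filter, the unital completion and the resulting quality bound\<close>

definition lin2 :: "mf \<Rightarrow> real \<Rightarrow> real \<Rightarrow> mf" where
  "lin2 S x y r s = of_real x * (if r = s then 1 else 0) + of_real y * S r s"

lemma lin2_scale: "of_real z * lin2 S x y r s = lin2 S (z * x) (z * y) r s"
  by (simp add: lin2_def algebra_simps)

lemma sum_reorder_22:
  "(\<Sum>k\<in>K. \<Sum>m\<in>M. \<Sum>x\<in>X. \<Sum>y\<in>Y. t k m x y) = (\<Sum>x\<in>X. \<Sum>y\<in>Y. \<Sum>k\<in>K. \<Sum>m\<in>M. t k m x y)"
  by (simp only:
    sum.swap[where A = K and B = X]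
    sum.swap[where A = K and B = Y]
    sum.swap[where A = M and B = X]
    sum.swap[where A = M and B = Y])

lemma lin2_mult:
  assumes "refl2 S" "r < 2" "s < 2"
  shows "(\<Sum>t<2. lin2 S x y r t * lin2 S x' y' t s) = lin2 S (x * x' + y * y') (x * y' + y * x') r s"
proof -
  have "(\<Sum>t<2. lin2 S x y r t * lin2 S x' y' t s) =
    of_real (x * x') * (if r = s then 1 else 0) + of_real (x * y' + y * x') * S r s + of_real (y * y') * (\<Sum>t<2. S r t * S t s)"
    using less_2_cases'[OF assms(2)] less_2_cases'[OF assms(3)] by (auto simp: lin2_def sum_lt2 algebra_simps)
  then show ?thesis unfolding refl2D(3)[OF assms] by (auto simp: lin2_def algebra_simps)
qed

lemma lin2_cnj: "refl2 S \<Longrightarrow> r < 2 \<Longrightarrow> s < 2 \<Longrightarrow> cnj (lin2 S x y r s) = lin2 S x y s r"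
  using hermD[OF refl2D(1)] by (auto simp: lin2_def)

lemma blochmat_lin2: "blochmat a S \<sigma> \<Longrightarrow> r < 2 \<Longrightarrow> s < 2 \<Longrightarrow> \<sigma> r s = lin2 S (1/2) (- a / 2) r s"
  unfolding blochmat_def by (auto simp: lin2_def field_simps)

lemma fid_cong: "(\<And>r s. r < 2 \<Longrightarrow> s < 2 \<Longrightarrow> w r s = w' r s) \<Longrightarrow> fid b w = fid b w'"
  unfolding fid_def by (simp add: sum_lt2)

lemma fid_scale: "fid b (\<lambda>r s. of_real x * w r s) = x\<^sup>2 * fid b w"
proof -
  have "(\<Sum>r<2. \<Sum>s<2. bellf b r s * (of_real x * w r s)) = of_real x * (\<Sum>r<2. \<Sum>s<2. bellf b r s * w r s)"
    by (simp add: sum_lt2 algebra_simps)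
  then show ?thesis unfolding fid_def by (simp add: norm_mult power_mult_distrib)
qed

lemma fid_nonneg: "0 \<le> fid b w"
  by (simp add: fid_def)

text \<open>u + v S is the inverse square root of (1 - a S) / 2, whose eigenvalues are (1 - a) / 2
  at S = 1 and (1 + a) / 2 at S = -1. Hence u + v = sqrt (2 / (1 - a)) and u - v = sqrt (2 / (1 +
  a)). The difference of squares is \<open>sfun a\<close>, the product v (u - v) is a quarter of
  \<open>tfun a\<close>, and the last two equations say (u + v S)^2 (1 - a S) / 2 = 1.\<close>

lemma filter_coefficients:
  fixes a :: real
  assumes "0 \<le> a" "a < 1"
  obtains u v where "0 \<le> v" "v \<le> u" "u\<^sup>2 - v\<^sup>2 = 2 / sqrt (1 - a\<^sup>2)" "v * (u - v) = 1 / sqrt (1 - a\<^sup>2) - 1 / (1 + a)"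
    "(u\<^sup>2 + v\<^sup>2 - 2 * u * v * a) / 2 = 1" "2 * u * v = a * (u\<^sup>2 + v\<^sup>2)"
proof -
  define x y where "x = sqrt (2 / (1 + a))" and "y = sqrt (2 / (1 - a))"
  have x2: "x * x = 2 / (1 + a)" and y2: "y * y = 2 / (1 - a)" using assms by (simp_all add: x_def y_def)
  have "x * y = sqrt (2\<^sup>2 / (1 - a\<^sup>2))" unfolding x_def y_def real_sqrt_mult[symmetric]
    by (simp add: power2_eq_square algebra_simps)
  also have "\<dots> = 2 / sqrt (1 - a\<^sup>2)" unfolding real_sqrt_divide by simp
  finally have xy: "x * y = 2 / sqrt (1 - a\<^sup>2)" .
  have xle: "x \<le> y" unfolding x_def y_def using assms by (intro real_sqrt_le_mono divide_left_mono) auto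
  have x0: "0 \<le> x" "0 \<le> y" using assms by (simp_all add: x_def y_def)
  define u v where "u = (x + y) / 2" and "v = (y - x) / 2"
  have s: "u\<^sup>2 + v\<^sup>2 = (x * x + y * y) / 2" "2 * u * v = (y * y - x * x) / 2"
    by (simp_all add: u_def v_def power2_eq_square field_simps)
  have d: "1 + a \<noteq> 0" "1 - a \<noteq> 0" using assms by auto
  show thesis
  proof (rule that[of v u])
    show "0 \<le> v" "v \<le> u" using xle x0 by (simp_all add: u_def v_def)
    show "u\<^sup>2 - v\<^sup>2 = 2 / sqrt (1 - a\<^sup>2)" unfolding xy[symmetric] by (simp add: u_def v_def power2_eq_square field_simps)
    have "v * (u - v) = (x * y - x * x) / 2" by (simp add: u_def v_def field_simps)
    also have "\<dots> = x * y / 2 - x * x / 2" by (rule diff_divide_distrib)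
    also have "x * x / 2 = 1 / (1 + a)" using x2 nonzero_mult_div_cancel_left[of 2 "1 / (1 + a)"] by (simp only: times_divide_eq_right mult_1_right)
    also have "x * y / 2 = 1 / sqrt (1 - a\<^sup>2)" unfolding xy by simp
    finally show "v * (u - v) = 1 / sqrt (1 - a\<^sup>2) - 1 / (1 + a)" .
    define z where "z = 1 / ((1 + a) * (1 - a))"
    have z: "z * ((1 + a) * (1 - a)) = 1" using d by (simp add: z_def)
    have "x * x = 2 * (z * (1 - a))" "y * y = 2 * (z * (1 + a))" unfolding x2 y2 z_def using d by simp_all
    then have s': "u\<^sup>2 + v\<^sup>2 = 2 * z" "2 * u * v = 2 * a * z" unfolding s by (simp_all add: algebra_simps)
    have "(u\<^sup>2 + v\<^sup>2 - 2 * u * v * a) / 2 = z * ((1 + a) * (1 - a))" unfolding s' by (simp add: field_simps)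
    then show "(u\<^sup>2 + v\<^sup>2 - 2 * u * v * a) / 2 = 1" unfolding z .
    show "2 * u * v = a * (u\<^sup>2 + v\<^sup>2)" unfolding s' by simp
  qed
qed

lemma omega_filter:
  "omega d1 d2 (\<lambda>m r. \<Sum>t<2. V m t * G t r) V' \<beta> r s = (\<Sum>t<2. cnj (G t r) * omega d1 d2 V V' \<beta> t s)"
proof -
  have "omega d1 d2 (\<lambda>m r. \<Sum>t<2. V m t * G t r) V' \<beta> r s =
    (\<Sum>i<d1. \<Sum>k<d2. \<Sum>t<2. cnj (G t r) * (cnj (V i t) * cnj (V' k s) * \<beta> (i * d2 + k)))"
    unfolding omega_def by (intro sum.cong refl) (simp add: sum_lt2 algebra_simps)
  also have "\<dots> = (\<Sum>t<2. cnj (G t r) * omega d1 d2 V V' \<beta> t s)"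
    unfolding omega_def by (simp add: sum_lt2 sum.distrib sum_distrib_left)
  finally show ?thesis .
qed

lemma omega_scale: "omega d1 d2 V (\<lambda>m s. of_real x * V' m s) \<beta> r s = of_real x * omega d1 d2 V V' \<beta> r s"
  unfolding omega_def sum_distrib_left by (intro sum.cong refl) simp

lemma marginal_herm: "herm 2 (\<lambda>r s. \<Sum>\<kappa>\<in>K. \<Sum>m<d. cnj (V \<kappa> m r) * V \<kappa> m s)"
  unfolding herm_def by (simp add: mult.commute)

text \<open>Completeness of the measurement leaves only the terms with i = j and k = l, and the sum
  factors into the values of the two maps at the identity.\<close>

lemma povm_gram:
  fixes \<beta> :: "nat \<Rightarrow> nat \<Rightarrow> nat \<Rightarrow> complex" and N :: nat
  assumes B: "\<And>b x y. b < 4 \<Longrightarrow> x < d1 * d2 \<Longrightarrow> y < d1 * d2 \<Longrightarrow> Bm b $$ (x, y) = (\<Sum>n<N. \<beta> b n x * cnj (\<beta> b n y))"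
    and one: "\<And>x y. x < d1 * d2 \<Longrightarrow> y < d1 * d2 \<Longrightarrow> (\<Sum>b<4. Bm b $$ (x, y)) = (if x = y then 1 else 0)"
    and rs: "r < 2" "r' < 2" "s < 2" "s' < 2"
  shows "(\<Sum>b<4. \<Sum>p\<in>K. \<Sum>q\<in>K'. \<Sum>n<N. omega d1 d2 (V p) (V' q) (\<beta> b n) r s * cnj (omega d1 d2 (V p) (V' q) (\<beta> b n) r' s')) =
    (\<Sum>p\<in>K. \<Sum>m<d1. cnj (V p m r) * V p m r') * (\<Sum>q\<in>K'. \<Sum>m<d2. cnj (V' q m s) * V' q m s')"
proof -
  define k1 k2 where "k1 i j = kraus d1 K V (munit d1 i j) $$ (r, r')" and "k2 k l = kraus d2 K' V' (munit d2 k l) $$ (s, s')" for i j k l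
  have "(\<Sum>b<4. \<Sum>p\<in>K. \<Sum>q\<in>K'. \<Sum>n<N. omega d1 d2 (V p) (V' q) (\<beta> b n) r s * cnj (omega d1 d2 (V p) (V' q) (\<beta> b n) r' s')) =
    (\<Sum>b<4. map_tensor d1 d2 2 2 (kraus d1 K V) (kraus d2 K' V') (Bm b) $$ (r * 2 + s, r' * 2 + s'))"
  proof (rule sum.cong[OF refl])
    fix b assume "b \<in> {..<4::nat}"
    then have "b < 4" by simp
    show "(\<Sum>p\<in>K. \<Sum>q\<in>K'. \<Sum>n<N. omega d1 d2 (V p) (V' q) (\<beta> b n) r s * cnj (omega d1 d2 (V p) (V' q) (\<beta> b n) r' s')) =
      map_tensor d1 d2 2 2 (kraus d1 K V) (kraus d2 K' V') (Bm b) $$ (r * 2 + s, r' * 2 + s')"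
      by (rule map_tensor_kraus[OF B[OF \<open>b < 4\<close>] rs, symmetric])
  qed
  also have "\<dots> = (\<Sum>b<4. \<Sum>i<d1. \<Sum>j<d1. \<Sum>k<d2. \<Sum>l<d2. Bm b $$ (i * d2 + k, j * d2 + l) * (k1 i j * k2 k l))"
    unfolding k1_def k2_def using rs by (intro sum.cong refl map_tensor_index) (simp_all add: kraus_def)
  also have "\<dots> = (\<Sum>i<d1. \<Sum>j<d1. \<Sum>k<d2. \<Sum>l<d2. \<Sum>b<4. Bm b $$ (i * d2 + k, j * d2 + l) * (k1 i j * k2 k l))"
    by (subst sum.swap, rule sum.cong[OF refl], subst sum.swap, rule sum.cong[OF refl], subst sum.swap, rule sum.cong[OF refl], rule sum.swap)
  also have "\<dots> = (\<Sum>i<d1. \<Sum>j<d1. \<Sum>k<d2. \<Sum>l<d2. if l = k then (if j = i then k1 i i * k2 k k else 0) else 0)"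
  proof (intro sum.cong refl)
    fix i j k l assume ijkl: "i \<in> {..<d1}" "j \<in> {..<d1}" "k \<in> {..<d2}" "l \<in> {..<d2}"
    have inj: "i * d2 + k = j * d2 + l \<longleftrightarrow> i = j \<and> k = l"
    proof
      assume e: "i * d2 + k = j * d2 + l"
      have "(i * d2 + k) div d2 = i" "(j * d2 + l) div d2 = j" "(i * d2 + k) mod d2 = k" "(j * d2 + l) mod d2 = l" using ijkl by auto
      then show "i = j \<and> k = l" using e by metis
    qed simp
    show "(\<Sum>b<4. Bm b $$ (i * d2 + k, j * d2 + l) * (k1 i j * k2 k l)) = (if l = k then (if j = i then k1 i i * k2 k k else 0) else 0)"
      unfolding sum_distrib_right[symmetric] using ijkl inj by (subst one) (auto simp: mult_index_less)
  qed
  also have "\<dots> = (\<Sum>i<d1. \<Sum>j<d1. if j = i then (\<Sum>k<d2. k1 i i * k2 k k) else 0)"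
    by (intro sum.cong refl) simp
  also have "\<dots> = (\<Sum>i<d1. k1 i i) * (\<Sum>k<d2. k2 k k)" by (simp add: sum_product)
  also have "(\<Sum>i<d1. k1 i i) = (\<Sum>p\<in>K. \<Sum>m<d1. cnj (V p m r) * V p m r')"
    unfolding k1_def using rs by (subst sum.swap) (simp add: kraus_munit)
  also have "(\<Sum>k<d2. k2 k k) = (\<Sum>q\<in>K'. \<Sum>m<d2. cnj (V' q m s) * V' q m s')"
    unfolding k2_def using rs by (subst sum.swap) (simp add: kraus_munit)
  finally show ?thesis .
qed

text \<open>Only one side is filtered exactly. The other is multiplied by a number, which commutes
  with the filtering estimate, so the two costs simply multiply.\<close>

theorem quality_ge_extracted:
  fixes V :: "'k \<Rightarrow> mf" and V' :: "'l \<Rightarrow> mf" and \<beta> :: "nat \<Rightarrow> nat \<Rightarrow> nat \<Rightarrow> complex" and N :: nat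
  assumes fin: "finite K" "finite K'" and d2: "0 < d2"
    and B: "\<And>b x y. b < 4 \<Longrightarrow> x < d1 * d2 \<Longrightarrow> y < d1 * d2 \<Longrightarrow> Bm b $$ (x, y) = (\<Sum>n<N. \<beta> b n x * cnj (\<beta> b n y))"
    and one: "\<And>x y. x < d1 * d2 \<Longrightarrow> y < d1 * d2 \<Longrightarrow> (\<Sum>b<4. Bm b $$ (x, y)) = (if x = y then 1 else 0)"
    and tr: "(\<Sum>\<kappa>\<in>K. \<Sum>m<d1. \<Sum>r<2. cnj (V \<kappa> m r) * V \<kappa> m r) = 1"
    and tr': "(\<Sum>\<kappa>\<in>K'. \<Sum>m<d2. \<Sum>r<2. cnj (V' \<kappa> m r) * V' \<kappa> m r) = 1"
    and q: "1 / 2 < q" "q \<le> (\<Sum>b<4. \<Sum>x\<in>K. \<Sum>y\<in>K'. \<Sum>n<N. fid b (omega d1 d2 (V x) (V' y) (\<beta> b n)))"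
  defines "\<eta>s \<equiv> 2 * sqrt (q * (1 - q))"
  shows "Inf ((\<lambda>\<eta>. (4 * sfun \<eta> * q - tfun \<eta>) / (8 * (1 + \<eta>s))) ` {0..\<eta>s}) \<le> quality 4 d1 d2 2 2 Bm bell_proj"
proof -
  define \<sigma> where "\<sigma> r s = (\<Sum>\<kappa>\<in>K. \<Sum>m<d1. cnj (V \<kappa> m r) * V \<kappa> m s)" for r s
  define \<sigma>' where "\<sigma>' r s = (\<Sum>\<kappa>\<in>K'. \<Sum>m<d2. cnj (V' \<kappa> m r) * V' \<kappa> m s)" for r s
  have hs: "herm 2 \<sigma>" "herm 2 \<sigma>'" unfolding \<sigma>_def[abs_def] \<sigma>'_def[abs_def] by (rule marginal_herm)+
  have ts: "\<sigma> 0 0 + \<sigma> 1 1 = 1" "\<sigma>' 0 0 + \<sigma>' 1 1 = 1"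
    using tr tr' unfolding \<sigma>_def \<sigma>'_def by (simp_all add: sum_lt2 sum.distrib)
  obtain a S where "0 \<le> a" "refl2 S" "\<And>r s. r < 2 \<Longrightarrow> s < 2 \<Longrightarrow> \<sigma> r s = ((if r = s then 1 else 0) - of_real a * S r s) / 2"
    using bloch_form[OF hs(1) ts(1)] by blast
  then have blA: "blochmat a S \<sigma>" unfolding blochmat_def by blast
  obtain c S' where "0 \<le> c" "refl2 S'" "\<And>r s. r < 2 \<Longrightarrow> s < 2 \<Longrightarrow> \<sigma>' r s = ((if r = s then 1 else 0) - of_real c * S' r s) / 2"
    using bloch_form[OF hs(2) ts(2)] by blast
  then have blC: "blochmat c S' \<sigma>'" unfolding blochmat_def by blast
  note S = \<open>refl2 S\<close> and S' = \<open>refl2 S'\<close>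
  define I where "I = {..<4::nat} \<times> K \<times> K' \<times> {..<N}"
  define w where "w i = (case i of (b, x, y, n) \<Rightarrow> omega d1 d2 (V x) (V' y) (\<beta> b n))" for i
  have sumI: "(\<Sum>b<4. \<Sum>x\<in>K. \<Sum>y\<in>K'. \<Sum>n<N. g b x y n) = (\<Sum>i\<in>I. case i of (b, x, y, n) \<Rightarrow> g b x y n)"
    for g :: "nat \<Rightarrow> 'k \<Rightarrow> 'l \<Rightarrow> nat \<Rightarrow> 'z::comm_monoid_add"
    unfolding I_def by (simp add: sum.cartesian_product)
  interpret gram_family I w fst \<sigma> \<sigma>' a c S S'
  proof
    fix r r' s s' :: nat assume rs: "r < 2" "r' < 2" "s < 2" "s' < 2"
    have "(\<Sum>i\<in>I. w i r s * cnj (w i r' s')) =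
      (\<Sum>b<4. \<Sum>x\<in>K. \<Sum>y\<in>K'. \<Sum>n<N. omega d1 d2 (V x) (V' y) (\<beta> b n) r s * cnj (omega d1 d2 (V x) (V' y) (\<beta> b n) r' s'))"
      unfolding sumI by (intro sum.cong refl) (auto simp: w_def)
    also have "\<dots> = \<sigma> r r' * \<sigma>' s s'" unfolding \<sigma>_def \<sigma>'_def by (rule povm_gram[OF B one rs])
    finally show "(\<Sum>i\<in>I. w i r s * cnj (w i r' s')) = \<sigma> r r' * \<sigma>' s s'" .
  next
    show "fst i < 4" if "i \<in> I" for i using that by (auto simp: I_def)
  qed (fact blA blC)+
  have "(\<Sum>b<4. \<Sum>x\<in>K. \<Sum>y\<in>K'. \<Sum>n<N. fid b (omega d1 d2 (V x) (V' y) (\<beta> b n))) = F"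
    unfolding sumI by (intro sum.cong refl) (auto simp: w_def)
  then have qF: "q \<le> F" using q(2) by simp
  then have F2: "1 / 2 < F" using q(1) by linarith
  note len = bloch_lengths[OF F2]
  have "(2 * F - 1)\<^sup>2 \<le> 1\<^sup>2" using len(1) zero_le_power2[of a] unfolding power_one by linarith
  then have "2 * F - 1 \<le> 1" by (rule power2_le_imp_le) simp
  then have q1: "q \<le> 1" using qF by linarith
  \<comment> \<open>4 q (1 - q) = 1 - (2 q - 1)^2, so the bounds on the Bloch lengths turn into a, c
    <= \<eta>s.\<close>
  have \<eta>2: "\<eta>s\<^sup>2 = 1 - (2 * q - 1)\<^sup>2" using q(1) q1 unfolding \<eta>s_def by (simp add: power2_eq_square algebra_simps)
  have \<eta>0: "0 \<le> \<eta>s" using q(1) q1 by (simp add: \<eta>s_def)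
  have "(2 * q - 1)\<^sup>2 \<le> (2 * F - 1)\<^sup>2" using qF q(1) by (intro power_mono) auto
  then have "a\<^sup>2 \<le> \<eta>s\<^sup>2" "c\<^sup>2 \<le> \<eta>s\<^sup>2" using len \<eta>2 by linarith+
  then have a\<eta>: "a \<le> \<eta>s" and c\<eta>: "c \<le> \<eta>s" using power2_le_imp_le[OF _ \<eta>0] by auto
  have "0 < (2 * q - 1)\<^sup>2" using q(1) by simp
  then have "\<eta>s\<^sup>2 < 1\<^sup>2" using \<eta>2 by simp
  then have \<eta>1: "\<eta>s < 1" using power2_less_imp_less[of \<eta>s 1] by simp
  then have a1: "a < 1" using a\<eta> by simp
  obtain u v where uv: "0 \<le> v" "v \<le> u" "u\<^sup>2 - v\<^sup>2 = 2 / sqrt (1 - a\<^sup>2)" "v * (u - v) = 1 / sqrt (1 - a\<^sup>2) - 1 / (1 + a)"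
    "(u\<^sup>2 + v\<^sup>2 - 2 * u * v * a) / 2 = 1" "2 * u * v = a * (u\<^sup>2 + v\<^sup>2)"
    by (rule filter_coefficients[OF ac(1) a1])
  define G where "G = lin2 S u v"
  define Vg where "Vg \<kappa> m r = (\<Sum>t<2. V \<kappa> m t * G t r)" for \<kappa> m r
  have cp1: "cp_unital d1 2 (kraus d1 K Vg)"
  proof (rule kraus_cp_unital)
    fix r s :: nat assume rs: "r < 2" "s < 2"
    have "(\<Sum>\<kappa>\<in>K. \<Sum>m<d1. cnj (Vg \<kappa> m r) * Vg \<kappa> m s) = (\<Sum>t'<2. (\<Sum>t<2. cnj (G t r) * \<sigma> t t') * G t' s)"
    proof -
      have "cnj (Vg \<kappa> m r) * Vg \<kappa> m s = (\<Sum>t'<2. \<Sum>t<2. cnj (G t r) * (cnj (V \<kappa> m t) * V \<kappa> m t') * G t' s)" for \<kappa> m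
        unfolding Vg_def by (simp add: sum_lt2 algebra_simps)
      then have "(\<Sum>\<kappa>\<in>K. \<Sum>m<d1. cnj (Vg \<kappa> m r) * Vg \<kappa> m s) =
        (\<Sum>\<kappa>\<in>K. \<Sum>m<d1. \<Sum>t'<2. \<Sum>t<2. cnj (G t r) * (cnj (V \<kappa> m t) * V \<kappa> m t') * G t' s)" by (simp only:)
      also have "\<dots> = (\<Sum>t'<2. \<Sum>t<2. \<Sum>\<kappa>\<in>K. \<Sum>m<d1. cnj (G t r) * (cnj (V \<kappa> m t) * V \<kappa> m t') * G t' s)"
        by (rule sum_reorder_22)
      finally show ?thesis unfolding \<sigma>_def sum_distrib_left sum_distrib_right .
    qed
    also have "\<dots> = (\<Sum>t'<2. (\<Sum>t<2. lin2 S u v r t * lin2 S (1/2) (- a / 2) t t') * lin2 S u v t' s)"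
      unfolding G_def using rs by (intro sum.cong refl arg_cong2[of _ _ _ _ times]) (simp_all add: lin2_cnj[OF S] blochmat_lin2[OF blA])
    also have "\<dots> = (\<Sum>t'<2. lin2 S (u * (1/2) + v * (- a / 2)) (u * (- a / 2) + v * (1/2)) r t' * lin2 S u v t' s)"
      using rs by (intro sum.cong refl) (simp only: lin2_mult[OF S] lessThan_iff)
    also have "\<dots> = lin2 S ((u * (1/2) + v * (- a / 2)) * u + (u * (- a / 2) + v * (1/2)) * v)
        ((u * (1/2) + v * (- a / 2)) * v + (u * (- a / 2) + v * (1/2)) * u) r s"
      by (rule lin2_mult[OF S rs])
    also have "(u * (1/2) + v * (- a / 2)) * u + (u * (- a / 2) + v * (1/2)) * v = 1"
      using uv(5) by (simp add: power2_eq_square algebra_simps)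
    also have "(u * (1/2) + v * (- a / 2)) * v + (u * (- a / 2) + v * (1/2)) * u = 0"
      using uv(6) by (simp add: power2_eq_square algebra_simps)
    finally show "(\<Sum>\<kappa>\<in>K. \<Sum>m<d1. cnj (Vg \<kappa> m r) * Vg \<kappa> m s) = (if r = s then 1 else 0)" by (simp add: lin2_def)
  qed
  \<comment> \<open>Scaled by x^2 = 2 / (1 + c), the second map has the value (1 - c S') / (1 + c)
    at the identity. What is missing to 1 is c (1 + S') / (1 + c), a positive matrix equal to y^2 (1
    + S')^2 because (1 + S')^2 = 2 (1 + S').\<close>
  define x y where "x = sqrt (2 / (1 + c))" and "y = sqrt (c / (2 * (1 + c)))"
  have c1: "1 + c > 0" using ac(2) by simp
  define z where "z = 1 / (1 + c)"
  have z: "z + c * z = 1" using c1 by (simp add: z_def field_simps)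
  have x2: "x * x = 2 * z" and y2: "y * y = c * z / 2" using ac(2) by (simp_all add: x_def y_def z_def)
  \<comment> \<open>The remainder is the map sending F to F_00 times y^2 (1 + S')^2. Its Kraus
    operators read the zeroth basis vector, which exists since d2 > 0, and k runs over the rows of 1
    + S'.\<close>
  define V2 :: "'l + nat \<Rightarrow> mf" where "V2 = case_sum (\<lambda>\<kappa> m s. of_real x * V' \<kappa> m s) (\<lambda>k m s. if m = 0 then of_real y * lin2 S' 1 1 k s else 0)"
  define K2 where "K2 = K' <+> {..<2::nat}"
  have sumK2: "(\<Sum>\<kappa>\<in>K2. g \<kappa>) = (\<Sum>\<kappa>\<in>K'. g (Inl \<kappa>)) + (\<Sum>k<2. g (Inr k))" for g :: "'l + nat \<Rightarrow> 'z::comm_monoid_add"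
    unfolding K2_def using fin(2) by (simp add: sum.Plus)
  have cp2: "cp_unital d2 2 (kraus d2 K2 V2)"
  proof (rule kraus_cp_unital)
    fix r s :: nat assume rs: "r < 2" "s < 2"
    have "(\<Sum>\<kappa>\<in>K'. \<Sum>m<d2. cnj (V2 (Inl \<kappa>) m r) * V2 (Inl \<kappa>) m s) = of_real (x * x) * \<sigma>' r s"
      unfolding \<sigma>'_def sum_distrib_left by (intro sum.cong refl) (simp add: V2_def)
    also have "\<dots> = lin2 S' z (- (z * c)) r s"
      unfolding blochmat_lin2[OF blC rs] x2 lin2_scale by simp
    finally have 1: "(\<Sum>\<kappa>\<in>K'. \<Sum>m<d2. cnj (V2 (Inl \<kappa>) m r) * V2 (Inl \<kappa>) m s) = \<dots>" .
    have "(\<Sum>m<d2. cnj (V2 (Inr k) m r) * V2 (Inr k) m s) = of_real (y * y) * (lin2 S' 1 1 r k * lin2 S' 1 1 k s)" if "k < 2" for k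
    proof -
      have "(\<Sum>m<d2. cnj (V2 (Inr k) m r) * V2 (Inr k) m s) = (\<Sum>m<d2. if m = 0 then of_real (y * y) * (lin2 S' 1 1 r k * lin2 S' 1 1 k s) else 0)"
        using lin2_cnj[OF S' that rs(1), of 1 1] by (intro sum.cong refl) (simp add: V2_def)
      then show ?thesis using d2 by simp
    qed
    then have "(\<Sum>k<2. \<Sum>m<d2. cnj (V2 (Inr k) m r) * V2 (Inr k) m s) = of_real (y * y) * (\<Sum>k<2. lin2 S' 1 1 r k * lin2 S' 1 1 k s)"
      unfolding sum_distrib_left by (intro sum.cong refl) simp
    also have "\<dots> = of_real (y * y) * lin2 S' 2 2 r s" unfolding lin2_mult[OF S' rs] by simp
    also have "\<dots> = lin2 S' (c * z) (c * z) r s" unfolding y2 lin2_scale by simp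
    finally have 2: "(\<Sum>k<2. \<Sum>m<d2. cnj (V2 (Inr k) m r) * V2 (Inr k) m s) = \<dots>" .
    have "lin2 S' z (- (z * c)) r s + lin2 S' (c * z) (c * z) r s =
      of_real (z + c * z) * (if r = s then 1 else 0)"
      unfolding lin2_def by (simp add: algebra_simps)
    also have "of_real (z + c * z) = (1::complex)" unfolding z by simp
    finally show "(\<Sum>\<kappa>\<in>K2. \<Sum>m<d2. cnj (V2 \<kappa> m r) * V2 \<kappa> m s) = (if r = s then 1 else 0)"
      unfolding sumK2 1 2 by simp
  qed
  define val where "val = (\<Sum>j<4. Re (mtrace (map_tensor d1 d2 2 2 (kraus d1 K Vg) (kraus d2 K2 V2) (Bm j) * bell_proj j)))"
  have "val \<le> Sup {(\<Sum>j<4. Re (mtrace (map_tensor d1 d2 2 2 \<Lambda>1 \<Lambda>2 (Bm j) * bell_proj j))) | \<Lambda>1 \<Lambda>2.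
            cp_unital d1 2 \<Lambda>1 \<and> cp_unital d2 2 \<Lambda>2}"
    by (rule cSup_upper[OF _ quality_bdd_above]) (use cp1 cp2 val_def in blast)
  then have Qval: "val / 4 \<le> quality 4 d1 d2 2 2 Bm bell_proj" unfolding quality_def by simp
  have fidg: "fid b (omega d1 d2 (Vg p) (\<lambda>m s. of_real x * V' y m s) be) = x\<^sup>2 * fid b (u *\<^sub>R omega d1 d2 (V p) (V' y) be + v *\<^sub>R Rl S (omega d1 d2 (V p) (V' y) be))" for b p y be
  proof -
    have "omega d1 d2 (Vg p) (V' y) be r s = (u *\<^sub>R omega d1 d2 (V p) (V' y) be + v *\<^sub>R Rl S (omega d1 d2 (V p) (V' y) be)) r s" if "r < 2" for r s
    proof -
      have "omega d1 d2 (Vg p) (V' y) be r s = (\<Sum>t<2. cnj (G t r) * omega d1 d2 (V p) (V' y) be t s)"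
        unfolding Vg_def by (rule omega_filter)
      also have "\<dots> = (\<Sum>t<2. lin2 S u v r t * omega d1 d2 (V p) (V' y) be t s)"
        unfolding G_def using that by (intro sum.cong refl) (simp add: lin2_cnj[OF S])
      also have "\<dots> = of_real u * omega d1 d2 (V p) (V' y) be r s + of_real v * (\<Sum>t<2. S r t * omega d1 d2 (V p) (V' y) be t s)"
        using less_2_cases'[OF that] by (auto simp: lin2_def sum_lt2 algebra_simps)
      finally show ?thesis using that by (simp add: Rl_def scaleR_fun_def scaleR_conv_of_real)
    qed
    then have "fid b (omega d1 d2 (Vg p) (V' y) be) = fid b (u *\<^sub>R omega d1 d2 (V p) (V' y) be + v *\<^sub>R Rl S (omega d1 d2 (V p) (V' y) be))"
      by (intro fid_cong)
    moreover have "omega d1 d2 (Vg p) (\<lambda>m s. of_real x * V' y m s) be = (\<lambda>r s. of_real x * omega d1 d2 (Vg p) (V' y) be r s)"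
      by (intro ext omega_scale)
    ultimately show ?thesis by (simp only: fid_scale)
  qed
  have "val = (\<Sum>b<4. \<Sum>p\<in>K. \<Sum>y\<in>K2. \<Sum>n<N. fid b (omega d1 d2 (Vg p) (V2 y) (\<beta> b n)))"
    unfolding val_def using kraus_value[OF B] by (intro sum.cong refl) simp
  \<comment> \<open>The added Kraus operators contribute nonnegative fidelities and are
    dropped.\<close>
  also have "\<dots> \<ge> (\<Sum>b<4. \<Sum>p\<in>K. \<Sum>y\<in>K'. \<Sum>n<N. fid b (omega d1 d2 (Vg p) (V2 (Inl y)) (\<beta> b n)))"
    unfolding sumK2 by (intro sum_mono) (simp add: sum_nonneg fid_nonneg)
  finally have "(\<Sum>b<4. \<Sum>p\<in>K. \<Sum>y\<in>K'. \<Sum>n<N. fid b (omega d1 d2 (Vg p) (V2 (Inl y)) (\<beta> b n))) \<le> val" .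
  moreover have "(\<Sum>b<4. \<Sum>p\<in>K. \<Sum>y\<in>K'. \<Sum>n<N. fid b (omega d1 d2 (Vg p) (V2 (Inl y)) (\<beta> b n))) =
    x\<^sup>2 * (\<Sum>i\<in>I. fid (fst i) (u *\<^sub>R w i + v *\<^sub>R Rl S (w i)))"
    unfolding sumI sum_distrib_left by (intro sum.cong refl) (auto simp: V2_def fidg w_def)
  moreover have "x\<^sup>2 * ((u\<^sup>2 - v\<^sup>2) * F - v * (u - v)) \<le> x\<^sup>2 * (\<Sum>i\<in>I. fid (fst i) (u *\<^sub>R w i + v *\<^sub>R Rl S (w i)))"
    using filtered_sum[OF uv(1,2)] by (intro mult_left_mono) auto
  ultimately have v1: "x\<^sup>2 * ((u\<^sup>2 - v\<^sup>2) * F - v * (u - v)) \<le> val" by linarith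
  define D where "D = sqrt (1 - a\<^sup>2)"
  have "a\<^sup>2 < 1\<^sup>2" using a1 ac(1) by (intro power_strict_mono) auto
  then have D: "D > 0" by (simp add: D_def)
  \<comment> \<open>The right-hand side of \<open>filtered_sum\<close> after replacing F by its
    lower bound q; it is a quarter of 4 s(a) q - t(a).\<close>
  define Nq where "Nq = 2 * q / D - 1 / D + 1 / (1 + a)"
  have "2 * q / D - 1 / D = (2 * q - 1) / D" by (simp add: diff_divide_distrib)
  then have Nq0: "0 \<le> Nq" using q(1) D ac(1) by (simp add: Nq_def)
  have "2 * q / D \<le> 2 * F / D" using qF D by (intro divide_right_mono) auto
  then have "Nq \<le> (u\<^sup>2 - v\<^sup>2) * F - v * (u - v)" unfolding uv(3,4) D_def[symmetric] Nq_def by simp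
  then have "x\<^sup>2 * Nq \<le> val" using order_trans[OF mult_left_mono[OF _ zero_le_power2[of x]] v1] by blast
  moreover have "x\<^sup>2 = 2 / (1 + c)" using x2 by (simp add: power2_eq_square z_def)
  ultimately have "2 / (1 + c) * Nq \<le> val" by simp
  \<comment> \<open>Replacing c by the larger \<eta>s lowers the first factor; this weakens the
    bound only because Nq is nonnegative.\<close>
  moreover have "2 / (1 + \<eta>s) * Nq \<le> 2 / (1 + c) * Nq"
    using Nq0 c\<eta> c1 by (intro mult_right_mono divide_left_mono) auto
  ultimately have "2 / (1 + \<eta>s) * Nq \<le> val" by (rule order_trans[rotated])
  then have "2 / (1 + \<eta>s) * Nq / 4 \<le> val / 4" by (rule divide_right_mono) simp
  then have "2 / (1 + \<eta>s) * Nq / 4 \<le> quality 4 d1 d2 2 2 Bm bell_proj" using Qval by (rule order_trans)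
  moreover have "2 / (1 + \<eta>s) * Nq / 4 = (4 * sfun a * q - tfun a) / (8 * (1 + \<eta>s))"
  proof -
    have "4 * sfun a * q - tfun a = 4 * Nq" unfolding sfun_def tfun_def Nq_def D_def[symmetric] by (simp add: algebra_simps)
    then show ?thesis using \<eta>0 by (simp add: field_simps)
  qed
  moreover have "Inf ((\<lambda>\<eta>. (4 * sfun \<eta> * q - tfun \<eta>) / (8 * (1 + \<eta>s))) ` {0..\<eta>s}) \<le> (4 * sfun a * q - tfun a) / (8 * (1 + \<eta>s))"
  proof (rule cInf_lower)
    show "(4 * sfun a * q - tfun a) / (8 * (1 + \<eta>s)) \<in> (\<lambda>\<eta>. (4 * sfun \<eta> * q - tfun \<eta>) / (8 * (1 + \<eta>s))) ` {0..\<eta>s}"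
      using ac(1) a\<eta> by auto
    \<comment> \<open>Needed for the infimum to lie below its values: 4 s q - t = 4 (2 q - 1) / sqrt
      (1 - \<eta>^2) + 4 / (1 + \<eta>) is nonnegative as q > 1/2.\<close>
    show "bdd_below ((\<lambda>\<eta>. (4 * sfun \<eta> * q - tfun \<eta>) / (8 * (1 + \<eta>s))) ` {0..\<eta>s})"
    proof (rule bdd_belowI2[where m = 0])
      fix \<eta> assume e: "\<eta> \<in> {0..\<eta>s}"
      then have "\<eta>\<^sup>2 \<le> 1\<^sup>2" using \<eta>1 by (intro power_mono) auto
      then have sq: "0 \<le> sqrt (1 - \<eta>\<^sup>2)" by simp
      have "4 * sfun \<eta> * q - tfun \<eta> = 4 * (2 * q - 1) / sqrt (1 - \<eta>\<^sup>2) + 4 / (1 + \<eta>)"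
        unfolding sfun_def tfun_def by (simp add: diff_divide_distrib right_diff_distrib)
      also have "\<dots> \<ge> 0" using sq q(1) e by (intro add_nonneg_nonneg divide_nonneg_nonneg) auto
      finally show "0 \<le> (4 * sfun \<eta> * q - tfun \<eta>) / (8 * (1 + \<eta>s))" using \<eta>0 by simp
    qed
  qed
  ultimately show ?thesis by linarith
qed

subsection \<open>Extraction channels\<close>

text \<open>T commutes with its square; comparing entries gives (e i - e j) T i j = 0.\<close>

lemma square_diag_block:
  fixes T :: mf
  assumes sq: "\<And>i j. i < n \<Longrightarrow> j < n \<Longrightarrow> (\<Sum>k<n. T i k * T k j) = (if i = j then of_real (e i) else 0)"
    and ij: "i < n" "j < n" "e i \<noteq> e j"
  shows "T i j = 0"
proof -
  have "(\<Sum>l<n. T i l * (\<Sum>k<n. T l k * T k j)) = (\<Sum>l<n. if l = j then T i j * of_real (e j) else 0)"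
    using ij by (intro sum.cong refl) (auto simp: sq)
  then have 1: "(\<Sum>l<n. T i l * (\<Sum>k<n. T l k * T k j)) = T i j * of_real (e j)" using ij by simp
  have "(\<Sum>k<n. (\<Sum>l<n. T i l * T l k) * T k j) = (\<Sum>k<n. if k = i then of_real (e i) * T i j else 0)"
    using ij by (intro sum.cong refl) (auto simp: sq)
  then have 2: "(\<Sum>k<n. (\<Sum>l<n. T i l * T l k) * T k j) = of_real (e i) * T i j" using ij by simp
  have "(\<Sum>l<n. T i l * (\<Sum>k<n. T l k * T k j)) = (\<Sum>k<n. (\<Sum>l<n. T i l * T l k) * T k j)"
    unfolding sum_distrib_left sum_distrib_right by (subst sum.swap) (simp only: mult.assoc)
  then have "T i j * of_real (e j) = of_real (e i) * T i j" unfolding 1 2 .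
  then have "T i j = 0 \<or> e j = e i" by (simp add: mult.commute)
  then show ?thesis using ij(3) by auto
qed

lemma herm_square_diag_nonneg:
  fixes T :: mf
  assumes "herm n T" "i < n" "(\<Sum>k<n. T i k * T k i) = of_real e"
  shows "0 \<le> e"
proof -
  have "(\<Sum>k<n. T i k * T k i) = (\<Sum>k<n. T i k * cnj (T i k))"
    using assms(2) by (intro sum.cong refl) (simp add: hermD[OF assms(1)])
  then have "e = Re (\<Sum>k<n. T i k * cnj (T i k))" using assms(3) by (metis Re_complex_of_real)
  also have "\<dots> = (\<Sum>k<n. (cmod (T i k))\<^sup>2)" by (simp only: Re_sum Re_mult_cnj)
  also have "\<dots> \<ge> 0" by (intro sum_nonneg) simp
  finally show ?thesis .
qed

text \<open>From a0^2 = a1^2 = 1 follow P^2 + M^2 = (a0^2 + a1^2) / 2 = 1 and P M + M P = (a0^2 -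
  a1^2) / 2 = 0. A basis diagonalising P^2 thus diagonalises M^2 as well, with P^2 = d / 4.\<close>

lemma jordanI:
  fixes a0 a1 :: mf and d :: "nat \<Rightarrow> real"
  assumes h: "herm n a0" "herm n a1"
    and s0: "\<And>i j. i < n \<Longrightarrow> j < n \<Longrightarrow> (\<Sum>k<n. a0 i k * a0 k j) = (if i = j then 1 else 0)"
    and s1: "\<And>i j. i < n \<Longrightarrow> j < n \<Longrightarrow> (\<Sum>k<n. a1 i k * a1 k j) = (if i = j then 1 else 0)"
    and dd: "\<And>i j. i < n \<Longrightarrow> j < n \<Longrightarrow> (\<Sum>k<n. (a0 i k + a1 i k) * (a0 k j + a1 k j)) = (if i = j then of_real (d i) else 0)"
  shows "jordan n (\<lambda>i. sqrt (d i) / 2) (\<lambda>i j. (a0 i j + a1 i j) / 2) (\<lambda>i j. (a0 i j - a1 i j) / 2)"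
proof -
  define P where "P i j = (a0 i j + a1 i j) / 2" for i j
  define M where "M i j = (a0 i j - a1 i j) / 2" for i j
  define s01 s10 where "s01 i j = (\<Sum>k<n. a0 i k * a1 k j)" and "s10 i j = (\<Sum>k<n. a1 i k * a0 k j)" for i j
  have hP: "herm n P" "herm n M" using hermD[OF h(1)] hermD[OF h(2)] by (simp_all add: herm_def P_def M_def)
  have dd': "(if i = j then of_real (d i) else 0) = 2 * (if i = j then 1 else 0) + s01 i j + s10 i j" if "i < n" "j < n" for i j
    unfolding dd[OF that, symmetric] s01_def s10_def distrib_left distrib_right sum.distrib s0[OF that] s1[OF that] by simp
  have PP: "(\<Sum>k<n. P i k * P k j) = (if i = j then of_real (d i / 4) else 0)" if "i < n" "j < n" for i j
  proof -
    have "(\<Sum>k<n. P i k * P k j) = (\<Sum>k<n. (a0 i k + a1 i k) * (a0 k j + a1 k j)) / 4"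
      unfolding P_def sum_divide_distrib by (intro sum.cong refl) simp
    then show ?thesis unfolding dd[OF that] by (cases "i = j") simp_all
  qed
  have MM: "(\<Sum>k<n. M i k * M k j) = (if i = j then of_real (1 - d i / 4) else 0)" if "i < n" "j < n" for i j
  proof -
    have "(\<Sum>k<n. M i k * M k j) = (\<Sum>k<n. (a0 i k - a1 i k) * (a0 k j - a1 k j)) / 4"
      unfolding M_def sum_divide_distrib by (intro sum.cong refl) simp
    also have "(\<Sum>k<n. (a0 i k - a1 i k) * (a0 k j - a1 k j)) = 2 * (if i = j then 1 else 0) - s01 i j - s10 i j"
      unfolding s01_def s10_def left_diff_distrib right_diff_distrib sum_subtractf s0[OF that] s1[OF that] by simp
    also have "\<dots> = 4 * (if i = j then 1 else 0) - (if i = j then of_real (d i) else 0)"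
      unfolding dd'[OF that] by simp
    finally show ?thesis by (cases "i = j") (simp_all add: diff_divide_distrib)
  qed
  have MP: "(\<Sum>k<n. M i k * P k j) = - (\<Sum>k<n. P i k * M k j)" if "i < n" "j < n" for i j
  proof -
    have "(\<Sum>k<n. M i k * P k j) = (\<Sum>k<n. (a0 i k - a1 i k) * (a0 k j + a1 k j)) / 4"
      unfolding M_def P_def sum_divide_distrib by (intro sum.cong refl) simp
    also have "(\<Sum>k<n. (a0 i k - a1 i k) * (a0 k j + a1 k j)) = s01 i j - s10 i j"
      unfolding s01_def s10_def left_diff_distrib distrib_left sum_subtractf sum.distrib s0[OF that] s1[OF that] by simp
    finally have 1: "(\<Sum>k<n. M i k * P k j) = (s01 i j - s10 i j) / 4" .
    have "(\<Sum>k<n. P i k * M k j) = (\<Sum>k<n. (a0 i k + a1 i k) * (a0 k j - a1 k j)) / 4"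
      unfolding M_def P_def sum_divide_distrib by (intro sum.cong refl) simp
    also have "(\<Sum>k<n. (a0 i k + a1 i k) * (a0 k j - a1 k j)) = s10 i j - s01 i j"
      unfolding s01_def s10_def right_diff_distrib distrib_right sum_subtractf sum.distrib s0[OF that] s1[OF that] by simp
    finally have 2: "(\<Sum>k<n. P i k * M k j) = (s10 i j - s01 i j) / 4" .
    show ?thesis unfolding 1 2 by (simp add: diff_divide_distrib)
  qed
  \<comment> \<open>d i / 4 and 1 - d i / 4 are diagonal entries of squares of Hermitian matrices;
    this puts the cosine into [0, 1].\<close>
  have d0: "0 \<le> d i / 4" if "i < n" for i by (rule herm_square_diag_nonneg[OF hP(1) that]) (simp add: PP[OF that that])
  have d1: "0 \<le> 1 - d i / 4" if "i < n" for i by (rule herm_square_diag_nonneg[OF hP(2) that]) (simp add: MM[OF that that])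
  have x2: "(sqrt (d i) / 2)\<^sup>2 = d i / 4" if "i < n" for i using d0[OF that] by (simp add: power_divide)
  have "jordan n (\<lambda>i. sqrt (d i) / 2) P M" unfolding jordan_def
  proof (intro conjI allI impI)
    fix i j assume ij: "i < n" "j < n"
    show "(\<Sum>k<n. P i k * P k j) = (if i = j then of_real ((sqrt (d i) / 2)\<^sup>2) else 0)" unfolding x2[OF ij(1)] by (rule PP[OF ij])
    show "(\<Sum>k<n. M i k * M k j) = (if i = j then of_real (1 - (sqrt (d i) / 2)\<^sup>2) else 0)" unfolding x2[OF ij(1)] by (rule MM[OF ij])
    show "(\<Sum>k<n. M i k * P k j) = - (\<Sum>k<n. P i k * M k j)" by (rule MP[OF ij])
    assume ne: "sqrt (d i) / 2 \<noteq> sqrt (d j) / 2"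
    have "d i / 4 \<noteq> d j / 4" "1 - d i / 4 \<noteq> 1 - d j / 4" using ne by auto
    then show "P i j = 0" "M i j = 0" using square_diag_block[OF PP ij] square_diag_block[OF MM ij] by auto
  next
    fix i assume i: "i < n"
    show "0 \<le> sqrt (d i) / 2" using d0[OF i] by simp
    have "sqrt (d i) \<le> sqrt (2\<^sup>2)" using d1[OF i] by (intro real_sqrt_le_mono) simp
    then show "sqrt (d i) / 2 \<le> 1" by simp
  qed (rule hP)+
  then show ?thesis by (simp only: P_def[abs_def] M_def[abs_def])
qed

lemma observables_jordan:
  assumes A: "A0 \<in> carrier_mat n n" "A1 \<in> carrier_mat n n" and dag: "dagger A0 = A0" "dagger A1 = A1"
    and inv: "A0 * A0 = 1\<^sub>m n" "A1 * A1 = 1\<^sub>m n"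
  obtains U x where "U \<in> carrier_mat n n" "U * dagger U = 1\<^sub>m n"
    "jordan n x (\<lambda>i j. ((dagger U * A0 * U) $$ (i, j) + (dagger U * A1 * U) $$ (i, j)) / 2)
      (\<lambda>i j. ((dagger U * A0 * U) $$ (i, j) - (dagger U * A1 * U) $$ (i, j)) / 2)"
proof -
  \<comment> \<open>H is 4 P^2 and differs from the anticommutator of A0 and A1 by twice the
    identity, so both have the same eigenvectors.\<close>
  define H where "H = (A0 + A1) * (A0 + A1)"
  have AA: "A0 + A1 \<in> carrier_mat n n" using A by simp
  have H: "H \<in> carrier_mat n n" unfolding H_def using AA by simp
  have "dagger (A0 + A1) = dagger A0 + dagger A1" using A by (intro eq_matI) auto
  then have "dagger (A0 + A1) = A0 + A1" using dag by simp
  then have "dagger H = H" unfolding H_def using dagger_mult[OF AA AA] by simp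
  then obtain U d where U: "U \<in> carrier_mat n n" "dagger U * U = 1\<^sub>m n"
    "dagger U * H * U = mat n n (\<lambda>(i, j). if i = j then complex_of_real (d i) else 0)"
    using hermitian_diagonalization[OF H] by blast
  have dU: "dagger U \<in> carrier_mat n n" using U by simp
  have U': "U * dagger U = 1\<^sub>m n" using mat_mult_left_right_inverse[OF dU U(1) U(2)] .
  have asc: "X * Y * Z = X * (Y * Z)" if "X \<in> carrier_mat n n" "Y \<in> carrier_mat n n" "Z \<in> carrier_mat n n" for X Y Z :: "complex mat"
    using that by (rule assoc_mult_mat)
  have mc: "X * Y \<in> carrier_mat n n" if "X \<in> carrier_mat n n" "Y \<in> carrier_mat n n" for X Y :: "complex mat"
    using that by (rule mult_carrier_mat)
  have UU: "U * (dagger U * X) = X" if "X \<in> carrier_mat n n" for X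
    using asc[OF U(1) dU that] U' that by simp
  have conj_mult: "(dagger U * X * U) * (dagger U * Y * U) = dagger U * (X * Y) * U"
    if "X \<in> carrier_mat n n" "Y \<in> carrier_mat n n" for X Y
    using that U(1) dU by (simp add: asc mc UU)
  have conj_one: "dagger U * 1\<^sub>m n * U = 1\<^sub>m n" using U dU by simp
  define a0 where "a0 i j = (dagger U * A0 * U) $$ (i, j)" for i j
  define a1 where "a1 i j = (dagger U * A1 * U) $$ (i, j)" for i j
  have conj_add: "dagger U * (A0 + A1) * U = dagger U * A0 * U + dagger U * A1 * U"
    using A U dU by (simp add: mult_add_distrib_mat[of _ n n] add_mult_distrib_mat[of _ n n] mc)
  have hconj: "dagger (dagger U * X * U) = dagger U * X * U" if "X \<in> carrier_mat n n" "dagger X = X" for X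
    using that U(1) dU by (simp add: dagger_mult[of _ n n _ n] asc mc)
  have ent: "(X * Y) $$ (i, j) = (\<Sum>k<n. X $$ (i, k) * Y $$ (k, j))" if "X \<in> carrier_mat n n" "Y \<in> carrier_mat n n" "i < n" "j < n" for X Y :: "complex mat" and i j
    using that by (simp add: scalar_prod_def atLeast0LessThan)
  have addent: "(X + Y) $$ (i, j) = X $$ (i, j) + Y $$ (i, j)" if "X \<in> carrier_mat n n" "Y \<in> carrier_mat n n" "i < n" "j < n" for X Y :: "complex mat" and i j
    using that by simp
  have Sc: "dagger U * (A0 + A1) * U \<in> carrier_mat n n" using AA U dU mc by auto
  have Cc: "dagger U * A0 * U \<in> carrier_mat n n" "dagger U * A1 * U \<in> carrier_mat n n" using A U dU mc by auto
  have "jordan n (\<lambda>i. sqrt (d i) / 2) (\<lambda>i j. (a0 i j + a1 i j) / 2) (\<lambda>i j. (a0 i j - a1 i j) / 2)"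
  proof (rule jordanI)
    have hC: "C $$ (j, i) = cnj (C $$ (i, j))" if "C \<in> carrier_mat n n" "dagger C = C" "i < n" "j < n" for C i j
    proof -
      have "dagger C $$ (j, i) = cnj (C $$ (i, j))" using that by (intro dagger_index) auto
      then show ?thesis using that(2) by simp
    qed
    have "a0 j i = cnj (a0 i j)" "a1 j i = cnj (a1 i j)" if "i < n" "j < n" for i j
      unfolding a0_def a1_def using hC[OF Cc(1) hconj[OF A(1) dag(1)] that] hC[OF Cc(2) hconj[OF A(2) dag(2)] that] .
    then show "herm n a0" "herm n a1" unfolding herm_def by blast+
    fix i j assume ij: "i < n" "j < n"
    show "(\<Sum>k<n. a0 i k * a0 k j) = (if i = j then 1 else 0)"
      unfolding a0_def ent[OF Cc(1) Cc(1) ij, symmetric] conj_mult[OF A(1) A(1)] inv conj_one using ij by simp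
    show "(\<Sum>k<n. a1 i k * a1 k j) = (if i = j then 1 else 0)"
      unfolding a1_def ent[OF Cc(2) Cc(2) ij, symmetric] conj_mult[OF A(2) A(2)] inv conj_one using ij by simp
    have "(\<Sum>k<n. (a0 i k + a1 i k) * (a0 k j + a1 k j)) = (\<Sum>k<n. (dagger U * (A0 + A1) * U) $$ (i, k) * (dagger U * (A0 + A1) * U) $$ (k, j))"
      unfolding conj_add a0_def a1_def using ij by (intro sum.cong refl) (simp only: addent[OF Cc] lessThan_iff)
    also have "\<dots> = (dagger U * H * U) $$ (i, j)"
      unfolding ent[OF Sc Sc ij, symmetric] conj_mult[OF AA AA] H_def ..
    finally show "(\<Sum>k<n. (a0 i k + a1 i k) * (a0 k j + a1 k j)) = (if i = j then of_real (d i) else 0)"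
      unfolding U(3) using ij by simp
  qed
  then show thesis using that[OF U(1) U'] unfolding a0_def a1_def by blast
qed

lemma sum_reorder_fid:
  "(\<Sum>k\<in>K. \<Sum>l\<in>L. \<Sum>r\<in>R. \<Sum>s\<in>S. \<Sum>i\<in>I. \<Sum>j\<in>J. \<Sum>u\<in>U. \<Sum>v\<in>V. \<Sum>m\<in>M. \<Sum>n\<in>N. t k l r s i j u v m n) = (\<Sum>i\<in>I. \<Sum>j\<in>J. \<Sum>m\<in>M. \<Sum>n\<in>N. \<Sum>r\<in>R. \<Sum>s\<in>S. \<Sum>u\<in>U. \<Sum>v\<in>V. \<Sum>k\<in>K. \<Sum>l\<in>L. t k l r s i j u v m n)"
  by (simp only:
    sum.swap[where A = K and B = R]
    sum.swap[where A = K and B = S]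
    sum.swap[where A = K and B = I]
    sum.swap[where A = K and B = J]
    sum.swap[where A = K and B = U]
    sum.swap[where A = K and B = V]
    sum.swap[where A = K and B = M]
    sum.swap[where A = K and B = N]
    sum.swap[where A = L and B = R]
    sum.swap[where A = L and B = S]
    sum.swap[where A = L and B = I]
    sum.swap[where A = L and B = J]
    sum.swap[where A = L and B = U]
    sum.swap[where A = L and B = V]
    sum.swap[where A = L and B = M]
    sum.swap[where A = L and B = N]
    sum.swap[where A = R and B = I]
    sum.swap[where A = R and B = J]
    sum.swap[where A = R and B = M]
    sum.swap[where A = R and B = N]
    sum.swap[where A = S and B = I]
    sum.swap[where A = S and B = J]
    sum.swap[where A = S and B = M]
    sum.swap[where A = S and B = N]
    sum.swap[where A = U and B = M]
    sum.swap[where A = U and B = N]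
    sum.swap[where A = V and B = M]
    sum.swap[where A = V and B = N])

section \<open>Choi matrices of the extraction and the extracted fidelity\<close>

definition pauliZ :: mf where "pauliZ r s = (if r = s then (if r = 0 then 1 else - 1) else 0)"
definition pauliX :: mf where "pauliX r s = (if r = s then 0 else 1)"

text \<open>The axes of the first party. With \<open>rotZ\<close>, \<open>rotX\<close> in place of
  P, M and Z, X in place of P', M', the form P P' + P M' + M P' - M M' becomes sqrt 2 (Z (x) Z + X
  (x) X), which is maximal at the Bell vector 0.\<close>

definition rotZ :: mf where "rotZ r s = (pauliZ r s + pauliX r s) / of_real (sqrt 2)"
definition rotX :: mf where "rotX r s = (pauliZ r s - pauliX r s) / of_real (sqrt 2)"

definition choi :: "nat \<Rightarrow> (nat \<Rightarrow> real) \<Rightarrow> mf \<Rightarrow> mf \<Rightarrow> mf \<Rightarrow> mf \<Rightarrow> nat \<Rightarrow> nat \<Rightarrow> nat \<Rightarrow> nat \<Rightarrow> complex" where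
  "choi n x P M Z X i r i' r' = ((if i = i' then 1 else 0) * (if r = r' then 1 else 0) + hatP x P i i' * Z r r' + hatM x M i i' * X r r'
     + (\<Sum>k<n. hatP x P i k * hatM x M k i') * (\<Sum>t<2. Z r t * X t r')) / 2"

definition pauli_pair :: "mf \<Rightarrow> mf \<Rightarrow> bool" where
  "pauli_pair Z X \<longleftrightarrow> herm 2 Z \<and> herm 2 X \<and>
    (\<forall>i<2. \<forall>j<2. (\<Sum>k<2. Z i k * Z k j) = (if i = j then 1 else 0) \<and> (\<Sum>k<2. X i k * X k j) = (if i = j then 1 else 0) \<and>
      (\<Sum>k<2. X i k * Z k j) = - (\<Sum>k<2. Z i k * X k j))"

lemma pauli_pair_ZX: "pauli_pair pauliZ pauliX"
  unfolding pauli_pair_def herm_def by (auto simp: pauliZ_def pauliX_def sum_lt2 dest!: less_2_cases')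

lemma sqrt2_sq: "complex_of_real (sqrt 2) * complex_of_real (sqrt 2) = 2"
  by (simp flip: of_real_mult)

lemma pauli_pair_rot: "pauli_pair rotZ rotX"
  unfolding pauli_pair_def herm_def by (auto simp: rotZ_def rotX_def pauliZ_def pauliX_def sum_lt2 sqrt2_sq dest!: less_2_cases')

lemma hat_anticomm:
  assumes j: "jordan n x P M" and il: "i < n" "l < n"
  shows "(\<Sum>k<n. hatM x M i k * hatP x P k l) = - (\<Sum>k<n. hatP x P i k * hatM x M k l)"
proof -
  note J = jordanD[OF j]
  define p m where "p = extP (x i) (sqrt (1 - (x i)\<^sup>2))" and "m = extM (x i) (sqrt (1 - (x i)\<^sup>2))"
  have "(\<Sum>k<n. hatM x M i k * hatP x P k l) = (\<Sum>k<n. of_real (m * p) * (M i k * P k l))"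
  proof (intro sum.cong refl)
    fix k assume "k \<in> {..<n}"
    then show "hatM x M i k * hatP x P k l = of_real (m * p) * (M i k * P k l)"
      using J(7)[OF il(1), of k] by (cases "x i = x k") (auto simp: hatM_def hatP_def p_def m_def)
  qed
  moreover have "(\<Sum>k<n. hatP x P i k * hatM x M k l) = (\<Sum>k<n. of_real (m * p) * (P i k * M k l))"
  proof (intro sum.cong refl)
    fix k assume "k \<in> {..<n}"
    then show "hatP x P i k * hatM x M k l = of_real (m * p) * (P i k * M k l)"
      using J(6)[OF il(1), of k] by (cases "x i = x k") (auto simp: hatM_def hatP_def p_def m_def)
  qed
  ultimately show ?thesis unfolding sum_distrib_left[symmetric] J(5)[OF il] by simp
qed

lemma opL_opR_apply:
  assumes "i < n" "j < m"
  shows "opL n A (opR m B v) i j = (\<Sum>i'<n. \<Sum>j'<m. A i i' * B j j' * v i' j')"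
  using assms by (simp only: opL_apply opR_apply sum_distrib_left mult.assoc)

lemma ip2_op:
  "ip2 n m v (opL n A (opR m B v)) = Re (\<Sum>i<n. \<Sum>j<m. \<Sum>i'<n. \<Sum>j'<m. cnj (v i j) * v i' j' * (A i i' * B j j'))"
  unfolding ip2_eq_Re
  by (rule arg_cong[of _ _ Re], intro sum.cong refl) (simp only: opL_opR_apply lessThan_iff sum_distrib_left mult_ac)

lemma opL_delta: "i < n \<Longrightarrow> opL n (\<lambda>i i'. if i = i' then 1 else 0) v i j = v i j"
  by (simp add: opL_apply if_distrib[of "\<lambda>z. z * _"] cong: if_cong)

lemma opR_delta: "j < m \<Longrightarrow> opR m (\<lambda>i i'. if i = i' then 1 else 0) v i j = v i j"
  by (simp add: opR_apply if_distrib[of "\<lambda>z. z * _"] cong: if_cong)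

lemma ip2_delta: "ip2 n m v (opL n (\<lambda>i i'. if i = i' then 1 else 0) (opR m (\<lambda>i i'. if i = i' then 1 else 0) v)) = ip2 n m v v"
  unfolding ip2_def by (intro sum.cong refl) (simp only: opL_delta opR_delta lessThan_iff)

lemma choi_gram:
  assumes j: "jordan n x P M" and pp: "pauli_pair Z X"
  obtains w :: "nat \<Rightarrow> mf" where "\<And>i r i' r'. i < n \<Longrightarrow> r < 2 \<Longrightarrow> i' < n \<Longrightarrow> r' < 2 \<Longrightarrow>
     choi n x P M Z X i r i' r' = (\<Sum>k<n * 2. cnj (w k i r) * w k i' r')"
proof -
  have ZX: "herm 2 Z" "herm 2 X" "\<And>i j. i < 2 \<Longrightarrow> j < 2 \<Longrightarrow> (\<Sum>k<2. Z i k * Z k j) = (if i = j then 1 else 0)"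
    "\<And>i j. i < 2 \<Longrightarrow> j < 2 \<Longrightarrow> (\<Sum>k<2. X i k * X k j) = (if i = j then 1 else 0)"
    "\<And>i j. i < 2 \<Longrightarrow> j < 2 \<Longrightarrow> (\<Sum>k<2. X i k * Z k j) = - (\<Sum>k<2. Z i k * X k j)"
    using pp unfolding pauli_pair_def by blast+
  note hh = hat_herm[OF j]
  define c where "c = choi n x P M Z X"
  \<comment> \<open>Taking adjoints reverses both products, P^ M^ and Z X; each reversal costs a
    sign, and the signs cancel.\<close>
  have cc: "cnj (c i' r' i r) = c i r i' r'" if lt: "i < n" "r < 2" "i' < n" "r' < 2" for i r i' r'
  proof -
    have "cnj (\<Sum>k<n. hatP x P i' k * hatM x M k i) = (\<Sum>k<n. hatM x M i k * hatP x P k i')"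
      unfolding cnj_sum complex_cnj_mult using lt by (intro sum.cong refl) (simp add: hermD[OF hh(1)] hermD[OF hh(2)] mult.commute)
    then have 1: "cnj (\<Sum>k<n. hatP x P i' k * hatM x M k i) = - (\<Sum>k<n. hatP x P i k * hatM x M k i')"
      unfolding hat_anticomm[OF j lt(1,3)] .
    have "cnj (\<Sum>t<2. Z r' t * X t r) = (\<Sum>t<2. X r t * Z t r')"
      unfolding cnj_sum complex_cnj_mult using lt by (intro sum.cong refl) (simp add: hermD[OF ZX(1)] hermD[OF ZX(2)] mult.commute)
    then have 2: "cnj (\<Sum>t<2. Z r' t * X t r) = - (\<Sum>t<2. Z r t * X t r')"
      unfolding ZX(5)[OF lt(2,4)] .
    have 3: "cnj (hatP x P i' i) = hatP x P i i'" "cnj (hatM x M i' i) = hatM x M i i'" "cnj (Z r' r) = Z r r'" "cnj (X r' r) = X r r'"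
      using hermD[OF hh(1) lt(3,1)] hermD[OF hh(2) lt(3,1)] hermD[OF ZX(1) lt(4,2)] hermD[OF ZX(2) lt(4,2)] by auto
    show ?thesis unfolding c_def choi_def complex_cnj_divide complex_cnj_add complex_cnj_mult 1 2 3
      by (cases "i' = i"; cases "r' = r"; simp)
  qed
  define C where "C = mat (n * 2) (n * 2) (\<lambda>(a, b). c (a div 2) (a mod 2) (b div 2) (b mod 2))"
  have C: "C \<in> carrier_mat (n * 2) (n * 2)" by (simp add: C_def)
  have Cent: "C $$ (i * 2 + r, i' * 2 + r') = c i r i' r'" if "i < n" "r < 2" "i' < n" "r' < 2" for i r i' r'
    using that mult_index_less[of i n r 2] mult_index_less[of i' n r' 2] by (simp add: C_def)
  have "psd C"
  proof (rule psdI[OF C])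
    fix a b assume ab: "a < n * 2" "b < n * 2"
    then have "a div 2 < n" "b div 2 < n" by auto
    then show "cnj (C $$ (b, a)) = C $$ (a, b)" using ab cc by (simp add: C_def)
  next
    fix f :: "nat \<Rightarrow> complex"
    define v where "v i r = f (i * 2 + r)" for i r
    have "(\<Sum>a<n * 2. \<Sum>b<n * 2. cnj (f a) * C $$ (a, b) * f b) = (\<Sum>i<n. \<Sum>r<2. \<Sum>i'<n. \<Sum>r'<2. cnj (v i r) * v i' r' * c i r i' r')"
      unfolding sum_mult_index by (intro sum.cong refl) (simp add: Cent v_def mult_ac)
    then have "Re (\<Sum>a<n * 2. \<Sum>b<n * 2. cnj (f a) * C $$ (a, b) * f b) = (ip2 n 2 v v + ip2 n 2 v (opL n (hatP x P) (opR 2 Z v)) + ip2 n 2 v (opL n (hatM x M) (opR 2 X v))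
      + ip2 n 2 v (opL n (\<lambda>i j. \<Sum>k<n. hatP x P i k * hatM x M k j) (opR 2 (\<lambda>i j. \<Sum>k<2. Z i k * X k j) v))) / 2"
      unfolding ip2_delta[of n 2 v, symmetric] ip2_op c_def choi_def
      by (simp only: times_divide_eq_right sum_divide_distrib[symmetric] distrib_left sum.distrib plus_complex.sel Re_divide_numeral)
    also have "\<dots> = ip2 n 2 v (v + opL n (hatP x P) (opR 2 Z v) + opL n (hatM x M) (opR 2 X v)
      + opL n (hatP x P) (opL n (hatM x M) (opR 2 Z (opR 2 X v)))) / 2"
      by (simp only: ip2.ip_lin opL_opL opR_opR)
    also have "\<dots> \<ge> 0" using extraction_choi_nonneg[OF j ZX(1,3,2,4,5), of v] by simp
    finally show "0 \<le> Re (\<Sum>a<n * 2. \<Sum>b<n * 2. cnj (f a) * C $$ (a, b) * f b)" .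
  qed
  then obtain W :: "nat \<Rightarrow> nat \<Rightarrow> complex" where W: "\<And>a b. a < n * 2 \<Longrightarrow> b < n * 2 \<Longrightarrow> C $$ (a, b) = (\<Sum>k<n * 2. W k a * cnj (W k b))"
    using psd_gram[OF C] by blast
  show thesis
  \<comment> \<open>\<open>psd_gram\<close> conjugates the second factor, Kraus operators the first;
    hence the conjugation.\<close>
  proof (rule that[of "\<lambda>k i r. cnj (W k (i * 2 + r))"])
    fix i r i' r' assume lt: "i < n" "r < (2::nat)" "i' < n" "r' < (2::nat)"
    show "choi n x P M Z X i r i' r' = (\<Sum>k<n * 2. cnj (cnj (W k (i * 2 + r))) * cnj (W k (i' * 2 + r')))"
      unfolding c_def[symmetric] Cent[OF lt, symmetric] using lt by (subst W) (simp_all add: mult_index_less)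
  qed
qed

text \<open>\<open>sgP b\<close> and \<open>sgM b\<close> are the correlations of the Bell vector b
  along Z (x) Z and X (x) X. They are also the signs in W_b = 2 (sgP (P P' + M P') + sgM (P M' - M
  M')).\<close>

definition sgP :: "nat \<Rightarrow> real" where "sgP b = (if b = 0 \<or> b = 1 then 1 else - 1)"
definition sgM :: "nat \<Rightarrow> real" where "sgM b = (if b = 0 \<or> b = 2 then 1 else - 1)"

text \<open>The Bell vector b has correlation sgP along Z (x) Z, sgM along X (x) X, sgP sgM along Z
  X (x) Z X, and none along the other products. The rotated axes account for the factor 1 / sqrt 2,
  and \<open>rotZ\<close> times \<open>rotX\<close> is - Z X, whence the last sign.\<close>

lemma bell_contraction:
  fixes a0 a1 a2 a3 c0 c1 c2 c3 :: complex
  assumes b: "b < 4"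
  defines "cA \<equiv> \<lambda>r r'. (a0 * (if r = r' then 1 else 0) + a1 * rotZ r r' + a2 * rotX r r' + a3 * (\<Sum>t<2. rotZ r t * rotX t r')) / 2"
    and "cC \<equiv> \<lambda>r r'. (c0 * (if r = r' then 1 else 0) + c1 * pauliZ r r' + c2 * pauliX r r' + c3 * (\<Sum>t<2. pauliZ r t * pauliX t r')) / 2"
  shows "(\<Sum>r<2. \<Sum>s<2. \<Sum>r'<2. \<Sum>s'<2. bellf b r s * bellf b r' s' * (cA r r' * cC s s')) =
    (a0 * c0 + (of_real (sgP b) * (a1 * c1) + of_real (sgM b) * (a1 * c2) + of_real (sgP b) * (a2 * c1) - of_real (sgM b) * (a2 * c2)) / of_real (sqrt 2)
      - of_real (sgP b * sgM b) * (a3 * c3)) / 4"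
proof -
  define t where "t = 1 / complex_of_real (sqrt 2)"
  have t: "t * t = 1 / 2" "t * (t * z) = z / 2" for z
    unfolding t_def mult.assoc[symmetric] inv_sqrt2_sq by simp_all
  have dv: "z / complex_of_real (sqrt 2) = t * z" for z by (simp add: t_def)
  have rz: "rotZ 0 0 = t" "rotZ 0 (Suc 0) = t" "rotZ (Suc 0) 0 = t" "rotZ (Suc 0) (Suc 0) = - t"
    "rotX 0 0 = t" "rotX 0 (Suc 0) = - t" "rotX (Suc 0) 0 = - t" "rotX (Suc 0) (Suc 0) = - t"
    by (simp_all add: rotZ_def rotX_def pauliZ_def pauliX_def t_def)
  have pz: "pauliZ 0 0 = 1" "pauliZ 0 (Suc 0) = 0" "pauliZ (Suc 0) 0 = 0" "pauliZ (Suc 0) (Suc 0) = - 1"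
    "pauliX 0 0 = 0" "pauliX 0 (Suc 0) = 1" "pauliX (Suc 0) 0 = 1" "pauliX (Suc 0) (Suc 0) = 0"
    by (simp_all add: pauliZ_def pauliX_def)
  note bv = bellf_values[folded t_def]
  have cAv: "cA 0 0 = (a0 + t * (a1 + a2)) / 2" "cA 0 (Suc 0) = (t * (a1 - a2) - a3) / 2"
    "cA (Suc 0) 0 = (t * (a1 - a2) + a3) / 2" "cA (Suc 0) (Suc 0) = (a0 - t * (a1 + a2)) / 2"
    by (simp_all add: cA_def sum_lt2 rz t algebra_simps)
  have cCv: "cC 0 0 = (c0 + c1) / 2" "cC 0 (Suc 0) = (c2 + c3) / 2" "cC (Suc 0) 0 = (c2 - c3) / 2" "cC (Suc 0) (Suc 0) = (c0 - c1) / 2"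
    by (simp_all add: cC_def sum_lt2 pz)
  show ?thesis
    using less_4_cases[OF b]
    by (elim disjE; simp only: sum_lt2 bv mult_zero_left mult_zero_right add_0_left add_0_right mult_minus_left mult_minus_right minus_minus t(1) cAv cCv dv;
        simp add: sgP_def sgM_def; simp add: field_simps)
qed

text \<open>Changing signs of P' and M' amounts to swapping or negating the observables of the last
  party. This reduces the four Bell operators to the first.\<close>

lemma jordan_sign:
  assumes j: "jordan m y P M" and ef: "e * e = 1" "f * f = (1::real)"
  shows "jordan m y (\<lambda>i k. of_real e * P i k) (\<lambda>i k. of_real f * M i k)"
proof -
  note J = jordanD[OF j]
  have c: "complex_of_real e * of_real e = 1" "complex_of_real f * of_real f = 1" using ef by (simp_all flip: of_real_mult)
  have s: "(\<Sum>k<m. of_real g * A i k * (of_real h * B k l)) = of_real g * of_real h * (\<Sum>k<m. A i k * B k l)" for A B :: mf and i l and g h :: real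
    unfolding sum_distrib_left by (intro sum.cong refl) simp
  show ?thesis unfolding jordan_def
  proof (intro conjI allI impI)
    show "herm m (\<lambda>i k. of_real e * P i k)" "herm m (\<lambda>i k. of_real f * M i k)"
      unfolding herm_def using hermD[OF J(1)] hermD[OF J(2)] by simp_all
    fix i l assume il: "i < m" "l < m"
    show "(\<Sum>k<m. of_real e * P i k * (of_real e * P k l)) = (if i = l then of_real ((y i)\<^sup>2) else 0)"
      unfolding s c J(3)[OF il] by simp
    show "(\<Sum>k<m. of_real f * M i k * (of_real f * M k l)) = (if i = l then of_real (1 - (y i)\<^sup>2) else 0)"
      unfolding s c J(4)[OF il] by simp
    show "(\<Sum>k<m. of_real f * M i k * (of_real e * P k l)) = - (\<Sum>k<m. of_real e * P i k * (of_real f * M k l))"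
      unfolding s J(5)[OF il] by simp
    assume "y i \<noteq> y l"
    then show "of_real e * P i l = 0" "of_real f * M i l = 0" using J(6,7)[OF il] by simp_all
  next
    fix i assume "i < m"
    then show "0 \<le> y i" "y i \<le> 1" using J(8,9) by auto
  qed
qed

lemma opR_real_kernel: "opR m (\<lambda>i k. of_real e * B i k) v = e *\<^sub>R opR m B v"
  by (intro ext) (simp add: opR_def scaleR_fun_def scaleR_conv_of_real sum_distrib_left mult.assoc)

lemma hat_real: "hatP y (\<lambda>i k. of_real e * P i k) = (\<lambda>i k. of_real e * hatP y P i k)"
  "hatM y (\<lambda>i k. of_real e * P i k) = (\<lambda>i k. of_real e * hatM y P i k)"
  by (simp_all add: hatP_def[abs_def] hatM_def[abs_def] mult_ac)

lemma sg_square: "sgP b * sgP b = 1" "sgM b * sgM b = 1"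
  by (simp_all add: sgP_def sgM_def)

definition kform :: "nat \<Rightarrow> nat \<Rightarrow> mf \<Rightarrow> mf \<Rightarrow> mf \<Rightarrow> complex" where
  "kform n m v A B = (\<Sum>i<n. \<Sum>j<m. \<Sum>i'<n. \<Sum>j'<m. cnj (v i j) * v i' j' * (A i i' * B j j'))"

text \<open>Summing over the Kraus indices k and l turns products of w and w' into Choi matrices,
  which \<open>bell_contraction\<close> pairs with the Bell projector; the outcome enters through
  the two signs only.\<close>

lemma extracted_fidelity_sum:
  fixes \<theta> :: mf and w w' :: "nat \<Rightarrow> mf"
  assumes w: "\<And>i r i' r'. i < n \<Longrightarrow> r < 2 \<Longrightarrow> i' < n \<Longrightarrow> r' < 2 \<Longrightarrow>
      choi n x P M rotZ rotX i r i' r' = (\<Sum>k<N. cnj (w k i r) * w k i' r')"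
    and w': "\<And>i r i' r'. i < m \<Longrightarrow> r < 2 \<Longrightarrow> i' < m \<Longrightarrow> r' < 2 \<Longrightarrow>
      choi m y P' M' pauliZ pauliX i r i' r' = (\<Sum>k<N'. cnj (w' k i r) * w' k i' r')"
    and b: "b < 4"
  defines "PM \<equiv> \<lambda>i i'. \<Sum>k<n. hatP x P i k * hatM x M k i'" and "PM' \<equiv> \<lambda>i i'. \<Sum>k<m. hatP y P' i k * hatM y M' k i'"
    and "E \<equiv> kform n m \<theta>" and "dl \<equiv> \<lambda>i i'::nat. if i = i' then 1 else 0"
  shows "(\<Sum>k<N. \<Sum>l<N'. fid b (\<lambda>r s. \<Sum>i<n. \<Sum>j<m. cnj (w k i r) * cnj (w' l j s) * cnj (\<theta> i j))) =
    Re ((E dl dl + (of_real (sgP b) * E (hatP x P) (hatP y P') + of_real (sgM b) * E (hatP x P) (hatM y M')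
      + of_real (sgP b) * E (hatM x M) (hatP y P') - of_real (sgM b) * E (hatM x M) (hatM y M')) / of_real (sqrt 2)
      - of_real (sgP b * sgM b) * E PM PM') / 4)"
proof -
  define X where "X k l r s i j = bellf b r s * (cnj (w k i r) * cnj (w' l j s) * cnj (\<theta> i j))" for k l r s i j
  have "fid b (\<lambda>r s. \<Sum>i<n. \<Sum>j<m. cnj (w k i r) * cnj (w' l j s) * cnj (\<theta> i j)) =
    Re (\<Sum>r<2. \<Sum>s<2. \<Sum>i<n. \<Sum>j<m. \<Sum>r'<2. \<Sum>s'<2. \<Sum>i'<n. \<Sum>j'<m. X k l r s i j * cnj (X k l r' s' i' j'))" for k l
  proof -
    have "fid b (\<lambda>r s. \<Sum>i<n. \<Sum>j<m. cnj (w k i r) * cnj (w' l j s) * cnj (\<theta> i j)) =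
      Re ((\<Sum>r<2. \<Sum>s<2. \<Sum>i<n. \<Sum>j<m. X k l r s i j) * (\<Sum>r<2. \<Sum>s<2. \<Sum>i<n. \<Sum>j<m. cnj (X k l r s i j)))"
      unfolding fid_def Re_mult_cnj(1)[symmetric] X_def cnj_sum sum_distrib_left complex_cnj_mult complex_cnj_cnj ..
    also have "(\<Sum>r<2. \<Sum>s<2. \<Sum>i<n. \<Sum>j<m. X k l r s i j) * (\<Sum>r<2. \<Sum>s<2. \<Sum>i<n. \<Sum>j<m. cnj (X k l r s i j)) =
      (\<Sum>r<2. \<Sum>s<2. \<Sum>i<n. \<Sum>j<m. \<Sum>r'<2. \<Sum>s'<2. \<Sum>i'<n. \<Sum>j'<m. X k l r s i j * cnj (X k l r' s' i' j'))"
      unfolding sum_distrib_right unfolding sum_distrib_left ..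
    finally show ?thesis .
  qed
  then have "(\<Sum>k<N. \<Sum>l<N'. fid b (\<lambda>r s. \<Sum>i<n. \<Sum>j<m. cnj (w k i r) * cnj (w' l j s) * cnj (\<theta> i j))) =
    Re (\<Sum>k<N. \<Sum>l<N'. \<Sum>r<2. \<Sum>s<2. \<Sum>i<n. \<Sum>j<m. \<Sum>r'<2. \<Sum>s'<2. \<Sum>i'<n. \<Sum>j'<m. X k l r s i j * cnj (X k l r' s' i' j'))"
    by (simp only: Re_sum)
  also have "(\<Sum>k<N. \<Sum>l<N'. \<Sum>r<2. \<Sum>s<2. \<Sum>i<n. \<Sum>j<m. \<Sum>r'<2. \<Sum>s'<2. \<Sum>i'<n. \<Sum>j'<m. X k l r s i j * cnj (X k l r' s' i' j')) =
    (\<Sum>i<n. \<Sum>j<m. \<Sum>i'<n. \<Sum>j'<m. \<Sum>r<2. \<Sum>s<2. \<Sum>r'<2. \<Sum>s'<2. \<Sum>k<N. \<Sum>l<N'. X k l r s i j * cnj (X k l r' s' i' j'))"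
    by (rule sum_reorder_fid)
  also have "\<dots> = (\<Sum>i<n. \<Sum>j<m. \<Sum>i'<n. \<Sum>j'<m. cnj (\<theta> i j) * \<theta> i' j' * (\<Sum>r<2. \<Sum>s<2. \<Sum>r'<2. \<Sum>s'<2.
      bellf b r s * bellf b r' s' * (choi n x P M rotZ rotX i r i' r' * choi m y P' M' pauliZ pauliX j s j' s')))"
    unfolding sum_distrib_left
  proof (intro sum.cong refl)
    fix i j i' j' r s r' s' assume lt: "i \<in> {..<n}" "j \<in> {..<m}" "i' \<in> {..<n}" "j' \<in> {..<m}" "r \<in> {..<2::nat}" "s \<in> {..<2::nat}" "r' \<in> {..<2::nat}" "s' \<in> {..<2::nat}"
    have "(\<Sum>k<N. \<Sum>l<N'. X k l r s i j * cnj (X k l r' s' i' j')) =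
      (\<Sum>k<N. \<Sum>l<N'. (cnj (w k i r) * w k i' r') * (cnj (\<theta> i j) * \<theta> i' j' * (bellf b r s * bellf b r' s')) * (cnj (w' l j s) * w' l j' s'))"
      by (intro sum.cong refl) (simp add: X_def bellf_cnj[OF b] mult_ac)
    also have "\<dots> = choi n x P M rotZ rotX i r i' r' * (cnj (\<theta> i j) * \<theta> i' j' * (bellf b r s * bellf b r' s')) * choi m y P' M' pauliZ pauliX j s j' s'"
      unfolding sum_bilinear using lt by (simp only: w w' lessThan_iff)
    finally show "(\<Sum>k<N. \<Sum>l<N'. X k l r s i j * cnj (X k l r' s' i' j')) = cnj (\<theta> i j) * \<theta> i' j' * (bellf b r s * bellf b r' s' *
      (choi n x P M rotZ rotX i r i' r' * choi m y P' M' pauliZ pauliX j s j' s'))" by (simp only: mult_ac)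
  qed
  also have "\<dots> = (\<Sum>i<n. \<Sum>j<m. \<Sum>i'<n. \<Sum>j'<m. cnj (\<theta> i j) * \<theta> i' j' * ((dl i i' * dl j j' +
      (of_real (sgP b) * (hatP x P i i' * hatP y P' j j') + of_real (sgM b) * (hatP x P i i' * hatM y M' j j')
      + of_real (sgP b) * (hatM x M i i' * hatP y P' j j') - of_real (sgM b) * (hatM x M i i' * hatM y M' j j')) / of_real (sqrt 2)
      - of_real (sgP b * sgM b) * (PM i i' * PM' j j')) / 4))"
    unfolding choi_def bell_contraction[OF b] PM_def PM'_def dl_def ..
  also have "\<dots> = (E dl dl + (of_real (sgP b) * E (hatP x P) (hatP y P') + of_real (sgM b) * E (hatP x P) (hatM y M')
      + of_real (sgP b) * E (hatM x M) (hatP y P') - of_real (sgM b) * E (hatM x M) (hatM y M')) / of_real (sqrt 2)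
      - of_real (sgP b * sgM b) * E PM PM') / 4"
  proof -
    have "t * ((z0 + (p * z1 + q * z2 + p * z3 - q * z4) / u - pq * z5) / 4) =
      (t * z0 + (p * (t * z1) + q * (t * z2) + p * (t * z3) - q * (t * z4)) / u - pq * (t * z5)) / 4" for t z0 z1 z2 z3 z4 z5 p q pq u :: complex
      by (simp add: add_divide_distrib diff_divide_distrib algebra_simps)
    then show ?thesis unfolding E_def kform_def
      by (simp only: sum_divide_distrib[symmetric] sum.distrib sum_subtractf sum_distrib_left[symmetric])
  qed
  finally show ?thesis .
qed

text \<open>Slope and offset are those of \<open>gfun\<close>, and twice the bracket is the
  expectation of W_b. The vector \<theta> is not normalised, so its squared norm accompanies the
  offset; summed over Gram vectors it becomes the probability of the outcome.\<close>

lemma extracted_fidelity_bound: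
  fixes \<theta> :: mf and w w' :: "nat \<Rightarrow> mf"
  assumes jA: "jordan n x P M" and jC: "jordan m y P' M'"
    and w: "\<And>i r i' r'. i < n \<Longrightarrow> r < 2 \<Longrightarrow> i' < n \<Longrightarrow> r' < 2 \<Longrightarrow>
      choi n x P M rotZ rotX i r i' r' = (\<Sum>k<N. cnj (w k i r) * w k i' r')"
    and w': "\<And>i r i' r'. i < m \<Longrightarrow> r < 2 \<Longrightarrow> i' < m \<Longrightarrow> r' < 2 \<Longrightarrow>
      choi m y P' M' pauliZ pauliX i r i' r' = (\<Sum>k<N'. cnj (w' k i r) * w' k i' r')"
    and b: "b < 4"
  defines "W \<equiv> \<lambda>A B. ip2 n m \<theta> (opL n A (opR m B \<theta>))"
  shows "(4 + 5 * sqrt 2) / 16 * (2 * (sgP b * W P P' + sgM b * W P M' + sgP b * W M P' - sgM b * W M M')) - (1 + 2 * sqrt 2) / 4 * ip2 n m \<theta> \<theta>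
    \<le> (\<Sum>k<N. \<Sum>l<N'. fid b (\<lambda>r s. \<Sum>i<n. \<Sum>j<m. cnj (w k i r) * cnj (w' l j s) * cnj (\<theta> i j)))" (is "?L \<le> ?R")
proof -
  define nn where "nn = ip2 n m \<theta> \<theta>"
  define S where "S = sgP b * W (hatP x P) (hatP y P') + sgM b * W (hatP x P) (hatM y M') + sgP b * W (hatM x M) (hatP y P') - sgM b * W (hatM x M) (hatM y M')"
  define T where "T = sgP b * sgM b * W (\<lambda>i i'. \<Sum>k<n. hatP x P i k * hatM x M k i') (\<lambda>i i'. \<Sum>k<m. hatP y P' i k * hatM y M' k i')"
  define om where "om = sgP b * W P P' + sgM b * W P M' + sgP b * W M P' - sgM b * W M M'"
  have WE: "W A B = Re (kform n m \<theta> A B)" for A B unfolding W_def kform_def by (rule ip2_op)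
  have nE: "nn = Re (kform n m \<theta> (\<lambda>i i'. if i = i' then 1 else 0) (\<lambda>i i'. if i = i' then 1 else 0))"
    unfolding nn_def WE[symmetric] W_def by (rule ip2_delta[symmetric])
  have "?R = (nn + S / sqrt 2 - T) / 4"
    unfolding S_def T_def nE WE
    by (rule trans[OF extracted_fidelity_sum[OF w w' b]]) (simp_all add: Re_divide_of_real)
  note R = this
  \<comment> \<open>The signs of outcome b are absorbed into P' and M', so the inequality for W_0
    applies.\<close>
  have "0 \<le> ip2 n m \<theta> ((4 + 2 * sqrt 2) *\<^sub>R \<theta> + opL n (hatP x P) (sgP b *\<^sub>R opR m (hatP y P') \<theta>) + opL n (hatP x P) (sgM b *\<^sub>R opR m (hatM y M') \<theta>)
      + opL n (hatM x M) (sgP b *\<^sub>R opR m (hatP y P') \<theta>) - opL n (hatM x M) (sgM b *\<^sub>R opR m (hatM y M') \<theta>)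
      - sqrt 2 *\<^sub>R opL n (hatP x P) (opL n (hatM x M) (sgP b *\<^sub>R opR m (hatP y P') (sgM b *\<^sub>R opR m (hatM y M') \<theta>)))
      - (5 + 2 * sqrt 2) *\<^sub>R (opL n P (sgP b *\<^sub>R opR m P' \<theta>) + opL n P (sgM b *\<^sub>R opR m M' \<theta>) + opL n M (sgP b *\<^sub>R opR m P' \<theta>) - opL n M (sgM b *\<^sub>R opR m M' \<theta>)))"
    using chsh_extraction[OF jA jordan_sign[OF jC sg_square(1)[of b] sg_square(2)[of b]], of \<theta>]
    unfolding hat_real opR_real_kernel .
  also have "\<dots> = (4 + 2 * sqrt 2) * nn + S - sqrt 2 * T - (5 + 2 * sqrt 2) * om"
    unfolding nn_def S_def T_def om_def W_def opL_lin opR_lin ip2.ip_lin opL_opL opR_opR by simp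
  finally have main: "0 \<le> (4 + 2 * sqrt 2) * nn + S - sqrt 2 * T - (5 + 2 * sqrt 2) * om" .
  have r: "sqrt 2 * sqrt 2 = (2::real)" "sqrt 2 * (sqrt 2 * z) = 2 * z" "0 < sqrt (2::real)" for z :: real
    by (simp_all add: mult.assoc[symmetric])
  \<comment> \<open>The factor 4 sqrt 2 brings the claim to the normalisation of
    \<open>main\<close>, since sqrt 2 (4 + 5 sqrt 2) / 2 = 5 + 2 sqrt 2.\<close>
  have "4 * sqrt 2 * ((4 + 5 * sqrt 2) / 16 * (2 * om) - (1 + 2 * sqrt 2) / 4 * nn) = (5 + 2 * sqrt 2) * om - (4 + sqrt 2) * nn"
    by (simp add: algebra_simps r add_divide_distrib)
  also have "\<dots> \<le> sqrt 2 * nn + S - sqrt 2 * T" using main by (simp add: algebra_simps)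
  also have "\<dots> = 4 * sqrt 2 * ((nn + S / sqrt 2 - T) / 4)" by (simp add: algebra_simps)
  finally have "(4 + 5 * sqrt 2) / 16 * (2 * om) - (1 + 2 * sqrt 2) / 4 * nn \<le> (nn + S / sqrt 2 - T) / 4"
    using r(3) by (simp only: mult_le_cancel_left_pos mult_pos_pos zero_less_numeral)
  then show ?thesis unfolding R om_def nn_def .
qed

lemma opL_adjoint: "ip2 n m u (opL n U v) = ip2 n m (opL n (\<lambda>i k. cnj (U k i)) u) v"
proof -
  have "(\<Sum>i<n. \<Sum>j<m. cnj (u i j) * opL n U v i j) = (\<Sum>i<n. \<Sum>j<m. \<Sum>k<n. cnj (u i j) * U i k * v k j)"
    by (intro sum.cong refl) (simp only: opL_apply lessThan_iff sum_distrib_left mult.assoc)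
  also have "\<dots> = (\<Sum>k<n. \<Sum>j<m. \<Sum>i<n. cnj (u i j) * U i k * v k j)"
    by (simp only: sum.swap[where A = "{..<m}" and B = "{..<n}"], rule sum.swap)
  also have "\<dots> = (\<Sum>k<n. \<Sum>j<m. cnj (opL n (\<lambda>i k. cnj (U k i)) u k j) * v k j)"
    by (intro sum.cong refl) (simp only: opL_apply lessThan_iff cnj_sum complex_cnj_mult complex_cnj_cnj sum_distrib_right sum_distrib_left mult_ac)
  finally show ?thesis by (simp add: ip2_eq_Re)
qed

lemma opR_adjoint: "ip2 n m u (opR m U v) = ip2 n m (opR m (\<lambda>i k. cnj (U k i)) u) v"
proof -
  have "(\<Sum>i<n. \<Sum>j<m. cnj (u i j) * opR m U v i j) = (\<Sum>i<n. \<Sum>j<m. \<Sum>k<m. cnj (u i j) * U j k * v i k)"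
    by (intro sum.cong refl) (simp only: opR_apply lessThan_iff sum_distrib_left mult.assoc)
  also have "\<dots> = (\<Sum>i<n. \<Sum>k<m. \<Sum>j<m. cnj (u i j) * U j k * v i k)"
    by (rule sum.cong[OF refl], rule sum.swap)
  also have "\<dots> = (\<Sum>i<n. \<Sum>k<m. cnj (opR m (\<lambda>i k. cnj (U k i)) u i k) * v i k)"
    by (intro sum.cong refl) (simp only: opR_apply lessThan_iff cnj_sum complex_cnj_mult complex_cnj_cnj sum_distrib_right sum_distrib_left mult_ac)
  finally show ?thesis by (simp add: ip2_eq_Re)
qed

lemma ip2_basis_change:
  fixes U U' A C a c :: mf
  assumes A: "\<And>i j. i < n \<Longrightarrow> j < n \<Longrightarrow> A i j = (\<Sum>k<n. U i k * (\<Sum>l<n. a k l * cnj (U j l)))"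
    and C: "\<And>i j. i < m \<Longrightarrow> j < m \<Longrightarrow> C i j = (\<Sum>k<m. U' i k * (\<Sum>l<m. c k l * cnj (U' j l)))"
  defines "Ud \<equiv> \<lambda>i k. cnj (U k i)" and "Ud' \<equiv> \<lambda>i k. cnj (U' k i)"
  shows "ip2 n m \<theta> (opL n A (opR m C \<theta>)) =
    ip2 n m (opL n Ud (opR m Ud' \<theta>)) (opL n a (opR m c (opL n Ud (opR m Ud' \<theta>))))"
proof -
  have eA: "opL n A v = opL n U (opL n a (opL n Ud v))" for v
    unfolding opL_opL Ud_def by (rule opL_cong) (simp add: A)
  have eC: "opR m C v = opR m U' (opR m c (opR m Ud' v))" for v
    unfolding opR_opR Ud'_def by (rule opR_cong) (simp add: C)
  have "ip2 n m \<theta> (opL n A (opR m C \<theta>)) = ip2 n m \<theta> (opL n U (opR m U' (opL n a (opR m c (opL n Ud (opR m Ud' \<theta>))))))"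
    unfolding eA eC by (simp only: opR_opL)
  also have "\<dots> = ip2 n m (opR m Ud' (opL n Ud \<theta>)) (opL n a (opR m c (opL n Ud (opR m Ud' \<theta>))))"
    unfolding opL_adjoint[of n m \<theta> U] opR_adjoint[of n m _ U'] Ud_def Ud'_def ..
  finally show ?thesis unfolding opR_opL .
qed

subsection \<open>Post-measurement states\<close>

lemma sum_reorder_state:
  "(\<Sum>m\<in>M. \<Sum>k\<in>K. \<Sum>n\<in>N. \<Sum>l\<in>L. \<Sum>p\<in>P. t m k n l p) = (\<Sum>l\<in>L. \<Sum>p\<in>P. \<Sum>n\<in>N. \<Sum>k\<in>K. \<Sum>m\<in>M. t m k n l p)"
  by (simp only:
    sum.swap[where A = M and B = K]
    sum.swap[where A = M and B = N]
    sum.swap[where A = M and B = L]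
    sum.swap[where A = M and B = P]
    sum.swap[where A = K and B = N]
    sum.swap[where A = K and B = L]
    sum.swap[where A = K and B = P]
    sum.swap[where A = N and B = L]
    sum.swap[where A = N and B = P])

lemma sum_reorder_omega:
  "(\<Sum>a\<in>A. \<Sum>b\<in>B. \<Sum>i\<in>I. \<Sum>j\<in>J. t a b i j) = (\<Sum>i\<in>I. \<Sum>j\<in>J. \<Sum>a\<in>A. \<Sum>b\<in>B. t a b i j)"
  by (simp only:
    sum.swap[where A = A and B = I]
    sum.swap[where A = A and B = J]
    sum.swap[where A = B and B = I]
    sum.swap[where A = B and B = J])

lemma sum_reorder_weight:
  "(\<Sum>l\<in>L. \<Sum>k\<in>K. \<Sum>m\<in>M. \<Sum>r\<in>R. \<Sum>i\<in>I. \<Sum>j\<in>J. t l k m r i j) = (\<Sum>l\<in>L. \<Sum>m\<in>M. \<Sum>i\<in>I. \<Sum>j\<in>J. \<Sum>r\<in>R. \<Sum>k\<in>K. t l k m r i j)"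
  by (simp only:
    sum.swap[where A = K and B = M]
    sum.swap[where A = K and B = R]
    sum.swap[where A = K and B = I]
    sum.swap[where A = K and B = J]
    sum.swap[where A = R and B = I]
    sum.swap[where A = R and B = J])

lemma kron_index:
  assumes "i < dim_row A" "k < dim_row B" "j < dim_col A" "l < dim_col B"
  shows "kron A B $$ (i * dim_row B + k, j * dim_col B + l) = A $$ (i, j) * B $$ (k, l)"
  using assms mult_index_less[of i "dim_row A" k "dim_row B"] mult_index_less[of j "dim_col A" l "dim_col B"] by (simp add: kron_def)

lemma kron_index_carrier:
  assumes "A \<in> carrier_mat a a" "B \<in> carrier_mat b b" "i < a" "k < b" "j < a" "l < b"
  shows "kron A B $$ (i * b + k, j * b + l) = A $$ (i, j) * B $$ (k, l)"
  using kron_index[of i A k B j l] assms by auto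

lemma kron_carrier: "A \<in> carrier_mat a a \<Longrightarrow> B \<in> carrier_mat b b \<Longrightarrow> kron A B \<in> carrier_mat (a * b) (a * b)"
  by (auto simp: kron_def)

text \<open>The unnormalised vector on A (x) C left when Gram vectors f and g of the two initial
  states are projected onto a Gram vector \<beta> of an effect; m div d2 and m mod d2 are the
  indices of the two middle systems.\<close>

definition theta :: "nat \<Rightarrow> nat \<Rightarrow> nat \<Rightarrow> (nat \<Rightarrow> complex) \<Rightarrow> (nat \<Rightarrow> complex) \<Rightarrow> (nat \<Rightarrow> complex) \<Rightarrow> mf" where
  "theta d1 d2 dC f g \<beta> i c = (\<Sum>m<d1 * d2. f (i * d1 + m div d2) * g (m mod d2 * dC + c) * cnj (\<beta> m))"

lemma post_measurement_entry:
  assumes t1: "t1 \<in> carrier_mat (dA * d1) (dA * d1)" and t2: "t2 \<in> carrier_mat (d2 * dC) (d2 * dC)"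
    and B: "B \<in> carrier_mat (d1 * d2) (d1 * d2)"
    and g1: "\<And>x y. x < dA * d1 \<Longrightarrow> y < dA * d1 \<Longrightarrow> t1 $$ (x, y) = (\<Sum>l<N1. f l x * cnj (f l y))"
    and g2: "\<And>x y. x < d2 * dC \<Longrightarrow> y < d2 * dC \<Longrightarrow> t2 $$ (x, y) = (\<Sum>l<N2. g l x * cnj (g l y))"
    and gB: "\<And>x y. x < d1 * d2 \<Longrightarrow> y < d1 * d2 \<Longrightarrow> B $$ (x, y) = (\<Sum>n<N. \<beta> n x * cnj (\<beta> n y))"
    and ic: "i < dA" "c < dC" "i' < dA" "c' < dC"
  shows "(\<Sum>m<d1 * d2. (kron (kron (1\<^sub>m dA) B) (1\<^sub>m dC) * kron t1 t2) $$ ((i * (d1 * d2) + m) * dC + c, (i' * (d1 * d2) + m) * dC + c')) =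
    (\<Sum>l<N1. \<Sum>p<N2. \<Sum>n<N. theta d1 d2 dC (f l) (g p) (\<beta> n) i c * cnj (theta d1 d2 dC (f l) (g p) (\<beta> n) i' c'))"
proof -
  define D where "D = d1 * d2"
  define X where "X = kron (kron (1\<^sub>m dA) B) (1\<^sub>m dC)"
  have one: "1\<^sub>m dA \<in> carrier_mat dA dA" "1\<^sub>m dC \<in> carrier_mat dC dC" by auto
  have B': "B \<in> carrier_mat D D" using B by (simp add: D_def)
  have X: "X \<in> carrier_mat (dA * D * dC) (dA * D * dC)" unfolding X_def by (intro kron_carrier one B')
  have T: "kron t1 t2 \<in> carrier_mat (dA * D * dC) (dA * D * dC)"
    using kron_carrier[OF t1 t2] by (simp add: D_def mult_ac)
  have Xe: "X $$ ((j * D + m) * dC + e, (j' * D + m') * dC + e') = (if j = j' then 1 else 0) * B $$ (m, m') * (if e = e' then 1 else 0)"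
    if "j < dA" "j' < dA" "m < D" "m' < D" "e < dC" "e' < dC" for j j' m m' e e'
    unfolding X_def using that kron_index_carrier[OF kron_carrier[OF one(1) B'] one(2), of "j * D + m" e "j' * D + m'" e']
      kron_index_carrier[OF one(1) B', of j m j' m'] by (simp add: mult_index_less)
  have Te: "kron t1 t2 $$ ((j * D + m) * dC + e, (j' * D + m') * dC + e') =
      t1 $$ (j * d1 + m div d2, j' * d1 + m' div d2) * t2 $$ (m mod d2 * dC + e, m' mod d2 * dC + e')"
    if "j < dA" "j' < dA" "m < D" "m' < D" "e < dC" "e' < dC" for j j' m m' e e'
  proof -
    have d2: "0 < d2" using that(3) by (cases d2) (auto simp: D_def)
    \<comment> \<open>The groupings A (B1 B2) C and (A B1) (B2 C) number the basis identically, so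
      no permutation of tensor factors is required.\<close>
    have idx: "(j * D + m) * dC + e = (j * d1 + m div d2) * (d2 * dC) + (m mod d2 * dC + e)" for j m e
    proof -
      have "(j * D + m) * dC + e = (j * D + (m div d2 * d2 + m mod d2)) * dC + e" by simp
      then show ?thesis by (simp only: D_def distrib_right mult.assoc add.assoc)
    qed
    have lt: "m div d2 < d1" "m' div d2 < d1" "m mod d2 < d2" "m' mod d2 < d2"
      using that d2 by (auto simp: D_def less_mult_imp_div_less)
    show ?thesis unfolding idx
      by (rule kron_index_carrier[OF t1 t2]) (use that lt in \<open>auto intro: mult_index_less\<close>)
  qed
  have XT: "(X * kron t1 t2) $$ ((i * D + m) * dC + c, (i' * D + m) * dC + c') =
      (\<Sum>m'<D. B $$ (m, m') * (t1 $$ (i * d1 + m' div d2, i' * d1 + m div d2) * t2 $$ (m' mod d2 * dC + c, m mod d2 * dC + c')))"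
    if m: "m < D" for m
  proof -
    have lt: "(i * D + m) * dC + c < dA * D * dC" "(i' * D + m) * dC + c' < dA * D * dC" using ic m by (auto intro!: mult_index_less)
    have "(X * kron t1 t2) $$ ((i * D + m) * dC + c, (i' * D + m) * dC + c') =
      (\<Sum>x<dA * D * dC. X $$ ((i * D + m) * dC + c, x) * kron t1 t2 $$ (x, (i' * D + m) * dC + c'))"
      using X T lt by (simp add: scalar_prod_def atLeast0LessThan)
    also have "\<dots> = (\<Sum>j<dA. \<Sum>m'<D. \<Sum>e<dC. X $$ ((i * D + m) * dC + c, (j * D + m') * dC + e) * kron t1 t2 $$ ((j * D + m') * dC + e, (i' * D + m) * dC + c'))"
      unfolding sum_mult_index ..
    also have "\<dots> = (\<Sum>j<dA. \<Sum>m'<D. \<Sum>e<dC. if e = c then (if j = i then B $$ (m, m') * (t1 $$ (i * d1 + m' div d2, i' * d1 + m div d2) * t2 $$ (m' mod d2 * dC + c, m mod d2 * dC + c')) else 0) else 0)"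
      using ic m by (intro sum.cong refl) (auto simp: Xe Te)
    also have "\<dots> = (\<Sum>j<dA. if j = i then (\<Sum>m'<D. B $$ (m, m') * (t1 $$ (i * d1 + m' div d2, i' * d1 + m div d2) * t2 $$ (m' mod d2 * dC + c, m mod d2 * dC + c'))) else 0)"
      using ic by (intro sum.cong refl) simp
    also have "\<dots> = (\<Sum>m'<D. B $$ (m, m') * (t1 $$ (i * d1 + m' div d2, i' * d1 + m div d2) * t2 $$ (m' mod d2 * dC + c, m mod d2 * dC + c')))"
      using ic by simp
    finally show ?thesis .
  qed
  define x where "x l p n m' = f l (i * d1 + m' div d2) * g p (m' mod d2 * dC + c) * cnj (\<beta> n m')" for l p n m'
  define y where "y l p n m = cnj (f l (i' * d1 + m div d2)) * cnj (g p (m mod d2 * dC + c')) * \<beta> n m" for l p n m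
  have "(\<Sum>m<D. (X * kron t1 t2) $$ ((i * D + m) * dC + c, (i' * D + m) * dC + c')) =
    (\<Sum>m<D. \<Sum>m'<D. \<Sum>n<N. \<Sum>l<N1. \<Sum>p<N2. x l p n m' * y l p n m)"
  proof (intro sum.cong refl)
    fix m assume m: "m \<in> {..<D}"
    show "(X * kron t1 t2) $$ ((i * D + m) * dC + c, (i' * D + m) * dC + c') = (\<Sum>m'<D. \<Sum>n<N. \<Sum>l<N1. \<Sum>p<N2. x l p n m' * y l p n m)"
      unfolding XT[OF m[unfolded lessThan_iff]]
    proof (intro sum.cong refl)
      fix m' assume m': "m' \<in> {..<D}"
      have d2: "0 < d2" using m by (cases d2) (auto simp: D_def)
      have lt: "m div d2 < d1" "m' div d2 < d1" "m mod d2 < d2" "m' mod d2 < d2" "m < d1 * d2" "m' < d1 * d2"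
        using m m' d2 by (auto simp: D_def less_mult_imp_div_less)
      have "B $$ (m, m') * (t1 $$ (i * d1 + m' div d2, i' * d1 + m div d2) * t2 $$ (m' mod d2 * dC + c, m mod d2 * dC + c')) =
        (\<Sum>n<N. \<beta> n m * cnj (\<beta> n m')) * ((\<Sum>l<N1. f l (i * d1 + m' div d2) * cnj (f l (i' * d1 + m div d2))) *
         (\<Sum>p<N2. g p (m' mod d2 * dC + c) * cnj (g p (m mod d2 * dC + c'))))"
        using ic lt by (simp only: gB g1 g2 mult_index_less)
      also have "\<dots> = (\<Sum>n<N. \<Sum>l<N1. \<Sum>p<N2. (\<beta> n m * cnj (\<beta> n m')) * ((f l (i * d1 + m' div d2) * cnj (f l (i' * d1 + m div d2))) * (g p (m' mod d2 * dC + c) * cnj (g p (m mod d2 * dC + c')))))"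
        unfolding sum_distrib_right unfolding sum_distrib_left ..
      also have "\<dots> = (\<Sum>n<N. \<Sum>l<N1. \<Sum>p<N2. x l p n m' * y l p n m)"
        by (intro sum.cong refl) (simp only: x_def y_def mult_ac)
      finally show "B $$ (m, m') * (t1 $$ (i * d1 + m' div d2, i' * d1 + m div d2) * t2 $$ (m' mod d2 * dC + c, m mod d2 * dC + c')) = (\<Sum>n<N. \<Sum>l<N1. \<Sum>p<N2. x l p n m' * y l p n m)" .
    qed
  qed
  also have "\<dots> = (\<Sum>l<N1. \<Sum>p<N2. \<Sum>n<N. \<Sum>m'<D. \<Sum>m<D. x l p n m' * y l p n m)"
    by (rule sum_reorder_state)
  also have "\<dots> = (\<Sum>l<N1. \<Sum>p<N2. \<Sum>n<N. theta d1 d2 dC (f l) (g p) (\<beta> n) i c * cnj (theta d1 d2 dC (f l) (g p) (\<beta> n) i' c'))"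
    unfolding theta_def x_def y_def D_def cnj_sum complex_cnj_mult complex_cnj_cnj sum_product ..
  finally show ?thesis by (simp only: X_def D_def)
qed

text \<open>Z, X and Z X are traceless, so tracing out the qubit leaves the identity: the extraction
  preserves the trace.\<close>

lemma choi_trace:
  assumes "(Z, X) \<in> {(pauliZ, pauliX), (rotZ, rotX)}"
  shows "(\<Sum>r<2. choi n x P M Z X i r i' r) = (if i = i' then 1 else 0)"
proof -
  have "Z 0 0 + Z (Suc 0) (Suc 0) = 0" "X 0 0 + X (Suc 0) (Suc 0) = 0"
    "Z 0 0 * X 0 0 + Z 0 (Suc 0) * X (Suc 0) 0 + (Z (Suc 0) 0 * X 0 (Suc 0) + Z (Suc 0) (Suc 0) * X (Suc 0) (Suc 0)) = 0"
    using assms by (auto simp: pauliZ_def pauliX_def rotZ_def rotX_def)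
  note z = this
  have "(\<Sum>r<2. choi n x P M Z X i r i' r) = (2 * (if i = i' then 1 else 0) + hatP x P i i' * (Z 0 0 + Z (Suc 0) (Suc 0)) + hatM x M i i' * (X 0 0 + X (Suc 0) (Suc 0))
    + (\<Sum>k<n. hatP x P i k * hatM x M k i') * (Z 0 0 * X 0 0 + Z 0 (Suc 0) * X (Suc 0) 0 + (Z (Suc 0) 0 * X 0 (Suc 0) + Z (Suc 0) (Suc 0) * X (Suc 0) (Suc 0)))) / 2"
    unfolding choi_def by (simp only: sum_lt2 add_divide_distrib[symmetric]) (simp add: distrib_left add_ac)
  then show ?thesis unfolding z by simp
qed

text \<open>By trace preservation the extracted Kraus operators keep the total weight of the vectors
  ph. This is where the marginals \<sigma> and \<sigma>' obtain trace 1.\<close>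

lemma extracted_weight:
  fixes w ph :: "nat \<Rightarrow> mf"
  assumes w: "\<And>i r i' r'. i < n \<Longrightarrow> r < 2 \<Longrightarrow> i' < n \<Longrightarrow> r' < 2 \<Longrightarrow>
      choi n x P M Z X i r i' r' = (\<Sum>k<N. cnj (w k i r) * w k i' r')"
    and ZX: "(Z, X) \<in> {(pauliZ, pauliX), (rotZ, rotX)}"
  shows "(\<Sum>\<kappa>\<in>{..<L} \<times> {..<N}. \<Sum>m<d. \<Sum>r<2. cnj (\<Sum>i<n. ph (fst \<kappa>) i m * w (snd \<kappa>) i r) * (\<Sum>i<n. ph (fst \<kappa>) i m * w (snd \<kappa>) i r)) =
    (\<Sum>l<L. \<Sum>m<d. \<Sum>i<n. cnj (ph l i m) * ph l i m)"
proof -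
  have sp: "(\<Sum>\<kappa>\<in>A \<times> B. g \<kappa>) = (\<Sum>l\<in>A. \<Sum>k\<in>B. g (l, k))" for A B :: "nat set" and g :: "nat \<times> nat \<Rightarrow> complex"
    by (simp add: sum.cartesian_product)
  have "(\<Sum>\<kappa>\<in>{..<L} \<times> {..<N}. \<Sum>m<d. \<Sum>r<2. cnj (\<Sum>i<n. ph (fst \<kappa>) i m * w (snd \<kappa>) i r) * (\<Sum>i<n. ph (fst \<kappa>) i m * w (snd \<kappa>) i r)) =
    (\<Sum>l<L. \<Sum>k<N. \<Sum>m<d. \<Sum>r<2. \<Sum>i<n. \<Sum>i'<n. cnj (ph l i m) * ph l i' m * (cnj (w k i r) * w k i' r))"
    unfolding sp fst_conv snd_conv cnj_sum sum_product by (intro sum.cong refl) (simp only: complex_cnj_mult mult_ac)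
  also have "\<dots> = (\<Sum>l<L. \<Sum>m<d. \<Sum>i<n. \<Sum>i'<n. \<Sum>r<2. \<Sum>k<N. cnj (ph l i m) * ph l i' m * (cnj (w k i r) * w k i' r))"
    by (rule sum_reorder_weight)
  also have "\<dots> = (\<Sum>l<L. \<Sum>m<d. \<Sum>i<n. \<Sum>i'<n. cnj (ph l i m) * ph l i' m * (\<Sum>r<2. choi n x P M Z X i r i' r))"
    unfolding sum_distrib_left[symmetric] by (intro sum.cong refl arg_cong2[of _ _ _ _ times]) (simp only: w lessThan_iff)
  also have "\<dots> = (\<Sum>l<L. \<Sum>m<d. \<Sum>i<n. \<Sum>i'<n. if i' = i then cnj (ph l i m) * ph l i m else 0)"
    unfolding choi_trace[OF ZX] by (intro sum.cong refl) simp
  finally show ?thesis by simp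
qed

text \<open>The bridge between the two readings of the same number: maps on the middle systems
  applied to the Gram vector \<beta> of an effect, or the extraction applied to the vector that
  \<beta> leaves on the outer systems.\<close>

lemma omega_extracted:
  "omega d1 d2 (\<lambda>m r. \<Sum>i<n. ph i m * w i r) (\<lambda>m r. \<Sum>j<k. ch j m * w' j r) \<beta> r s =
    (\<Sum>i<n. \<Sum>j<k. cnj (w i r) * cnj (w' j s) * cnj (\<Sum>a<d1. \<Sum>b<d2. ph i a * ch j b * cnj (\<beta> (a * d2 + b))))"
proof -
  have "omega d1 d2 (\<lambda>m r. \<Sum>i<n. ph i m * w i r) (\<lambda>m r. \<Sum>j<k. ch j m * w' j r) \<beta> r s =
    (\<Sum>a<d1. \<Sum>b<d2. \<Sum>i<n. \<Sum>j<k. cnj (w i r) * cnj (w' j s) * (cnj (ph i a) * cnj (ch j b) * \<beta> (a * d2 + b)))"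
    unfolding omega_def cnj_sum sum_distrib_right unfolding sum_distrib_left unfolding sum_distrib_right by (intro sum.cong refl) (simp only: complex_cnj_mult mult_ac)
  also have "\<dots> = (\<Sum>i<n. \<Sum>j<k. \<Sum>a<d1. \<Sum>b<d2. cnj (w i r) * cnj (w' j s) * (cnj (ph i a) * cnj (ch j b) * \<beta> (a * d2 + b)))"
    by (rule sum_reorder_omega)
  finally show ?thesis unfolding cnj_sum sum_distrib_left complex_cnj_mult complex_cnj_cnj .
qed

lemma theta_basis_change:
  assumes "i < n" "j < dC"
  shows "opL n U (opR dC U' (theta d1 d2 dC f g \<beta>)) i j =
    (\<Sum>a<d1. \<Sum>b<d2. (\<Sum>i'<n. U i i' * f (i' * d1 + a)) * (\<Sum>j'<dC. U' j j' * g (b * dC + j')) * cnj (\<beta> (a * d2 + b)))"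
proof -
  have th: "theta d1 d2 dC f g \<beta> i c = (\<Sum>a<d1. \<Sum>b<d2. f (i * d1 + a) * g (b * dC + c) * cnj (\<beta> (a * d2 + b)))" for i c
    unfolding theta_def sum_mult_index by (intro sum.cong refl) simp
  have "opL n U (opR dC U' (theta d1 d2 dC f g \<beta>)) i j = (\<Sum>i'<n. \<Sum>j'<dC. \<Sum>a<d1. \<Sum>b<d2. U i i' * U' j j' * (f (i' * d1 + a) * g (b * dC + j') * cnj (\<beta> (a * d2 + b))))"
    unfolding opL_opR_apply[OF assms] th sum_distrib_left ..
  also have "\<dots> = (\<Sum>a<d1. \<Sum>b<d2. \<Sum>i'<n. \<Sum>j'<dC. U i i' * U' j j' * (f (i' * d1 + a) * g (b * dC + j') * cnj (\<beta> (a * d2 + b))))"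
    by (rule sum_reorder_omega)
  also have "\<dots> = (\<Sum>a<d1. \<Sum>b<d2. (\<Sum>i'<n. U i i' * f (i' * d1 + a)) * (\<Sum>j'<dC. U' j j' * g (b * dC + j')) * cnj (\<beta> (a * d2 + b)))"
    unfolding sum_distrib_right unfolding sum_distrib_left unfolding sum_distrib_right by (intro sum.cong refl) (simp only: mult_ac)
  finally show ?thesis .
qed

lemma ip2_isometry:
  assumes "\<And>i j. i < n \<Longrightarrow> j < n \<Longrightarrow> (\<Sum>k<n. U i k * cnj (U j k)) = (if i = j then 1 else 0)"
  shows "ip2 n m (opL n (\<lambda>i k. cnj (U k i)) v) (opL n (\<lambda>i k. cnj (U k i)) v) = ip2 n m v v"
proof -
  have "opL n U (opL n (\<lambda>i k. cnj (U k i)) v) = opL n (\<lambda>i j. if i = j then 1 else 0) v"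
    unfolding opL_opL using assms by (intro opL_cong)
  then have "ip2 n m v (opL n U (opL n (\<lambda>i k. cnj (U k i)) v)) = ip2 n m v v"
    unfolding ip2_def by (intro sum.cong refl) (simp only: opL_delta lessThan_iff)
  then show ?thesis unfolding opL_adjoint[of n m v U] by simp
qed

text \<open>With s and t equal to 1 or -1 the arguments are P, M and P', M' expressed through the
  observables.\<close>

lemma kform_bilinear:
  fixes s t :: complex
  shows "kform n m v (\<lambda>i j. (a0 i j + s * a1 i j) / 2) (\<lambda>i j. (c0 i j + t * c1 i j) / 2) =
    (kform n m v a0 c0 + t * kform n m v a0 c1 + s * kform n m v a1 c0 + s * t * kform n m v a1 c1) / 4"
proof -
  have "z * ((x0 + s * x1) / 2 * ((y0 + t * y1) / 2)) = (z * (x0 * y0) + t * (z * (x0 * y1)) + s * (z * (x1 * y0)) + s * t * (z * (x1 * y1))) / 4" for z x0 x1 y0 y1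
    by (simp add: algebra_simps)
  then show ?thesis unfolding kform_def by (simp only: sum_divide_distrib[symmetric] sum.distrib sum_distrib_left[symmetric])
qed

lemma sum_reorder_pairs:
  "(\<Sum>l\<in>L. \<Sum>k\<in>K. \<Sum>p\<in>P. \<Sum>q\<in>Q. \<Sum>n\<in>N. t l k p q n) = (\<Sum>l\<in>L. \<Sum>p\<in>P. \<Sum>n\<in>N. \<Sum>k\<in>K. \<Sum>q\<in>Q. t l k p q n)"
  by (simp only:
    sum.swap[where A = K and B = P]
    sum.swap[where A = K and B = N]
    sum.swap[where A = Q and B = N])

lemma sum_reorder_diag:
  "(\<Sum>i\<in>I. \<Sum>c\<in>C. \<Sum>l\<in>L. \<Sum>p\<in>P. \<Sum>n\<in>N. t i c l p n) = (\<Sum>l\<in>L. \<Sum>p\<in>P. \<Sum>n\<in>N. \<Sum>i\<in>I. \<Sum>c\<in>C. t i c l p n)"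
  by (simp only:
    sum.swap[where A = I and B = L]
    sum.swap[where A = I and B = P]
    sum.swap[where A = I and B = N]
    sum.swap[where A = C and B = L]
    sum.swap[where A = C and B = P]
    sum.swap[where A = C and B = N])

lemma sum_reorder_form:
  "(\<Sum>i\<in>I. \<Sum>c\<in>C. \<Sum>j\<in>J. \<Sum>d\<in>D. \<Sum>l\<in>L. \<Sum>p\<in>P. \<Sum>n\<in>N. t i c j d l p n) = (\<Sum>l\<in>L. \<Sum>p\<in>P. \<Sum>n\<in>N. \<Sum>i\<in>I. \<Sum>c\<in>C. \<Sum>j\<in>J. \<Sum>d\<in>D. t i c j d l p n)"
  by (simp only:
    sum.swap[where A = I and B = L]
    sum.swap[where A = I and B = P]
    sum.swap[where A = I and B = N]
    sum.swap[where A = C and B = L]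
    sum.swap[where A = C and B = P]
    sum.swap[where A = C and B = N]
    sum.swap[where A = J and B = L]
    sum.swap[where A = J and B = P]
    sum.swap[where A = J and B = N]
    sum.swap[where A = D and B = L]
    sum.swap[where A = D and B = P]
    sum.swap[where A = D and B = N])

text \<open>The bases and Kraus vectors are fixed before b and \<theta>, so one extraction serves
  every outcome and every post-measurement vector.\<close>

lemma extraction_exists:
  assumes A: "A0 \<in> carrier_mat n n" "A1 \<in> carrier_mat n n" "dagger A0 = A0" "dagger A1 = A1" "A0 * A0 = 1\<^sub>m n" "A1 * A1 = 1\<^sub>m n"
    and C: "C0 \<in> carrier_mat m m" "C1 \<in> carrier_mat m m" "dagger C0 = C0" "dagger C1 = C1" "C0 * C0 = 1\<^sub>m m" "C1 * C1 = 1\<^sub>m m"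
  obtains U U' :: mf and w w' :: "nat \<Rightarrow> mf" and x P M y P' M'
  where "\<And>i j. i < n \<Longrightarrow> j < n \<Longrightarrow> (\<Sum>k<n. U i k * cnj (U j k)) = (if i = j then 1 else 0)"
    "\<And>i j. i < m \<Longrightarrow> j < m \<Longrightarrow> (\<Sum>k<m. U' i k * cnj (U' j k)) = (if i = j then 1 else 0)"
    "\<And>i r i' r'. i < n \<Longrightarrow> r < 2 \<Longrightarrow> i' < n \<Longrightarrow> r' < 2 \<Longrightarrow>
      choi n x P M rotZ rotX i r i' r' = (\<Sum>k<n * 2. cnj (w k i r) * w k i' r')"
    "\<And>i r i' r'. i < m \<Longrightarrow> r < 2 \<Longrightarrow> i' < m \<Longrightarrow> r' < 2 \<Longrightarrow>
      choi m y P' M' pauliZ pauliX i r i' r' = (\<Sum>k<m * 2. cnj (w' k i r) * w' k i' r')"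
    "\<And>b \<theta>. b < 4 \<Longrightarrow>
      (4 + 5 * sqrt 2) / 16 * (sgP b * (Re (kform n m \<theta> (\<lambda>i j. A0 $$ (i, j)) (\<lambda>i j. C0 $$ (i, j))) + Re (kform n m \<theta> (\<lambda>i j. A0 $$ (i, j)) (\<lambda>i j. C1 $$ (i, j))))
        + sgM b * (Re (kform n m \<theta> (\<lambda>i j. A1 $$ (i, j)) (\<lambda>i j. C0 $$ (i, j))) - Re (kform n m \<theta> (\<lambda>i j. A1 $$ (i, j)) (\<lambda>i j. C1 $$ (i, j)))))
        - (1 + 2 * sqrt 2) / 4 * ip2 n m \<theta> \<theta>
      \<le> (\<Sum>k<n * 2. \<Sum>l<m * 2. fid b (\<lambda>r s. \<Sum>i<n. \<Sum>j<m. cnj (w k i r) * cnj (w' l j s) *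
          cnj (opL n (\<lambda>i k. cnj (U k i)) (opR m (\<lambda>i k. cnj (U' k i)) \<theta>) i j)))"
proof -
  obtain U x where U: "U \<in> carrier_mat n n" "U * dagger U = 1\<^sub>m n"
    and jA: "jordan n x (\<lambda>i j. ((dagger U * A0 * U) $$ (i, j) + (dagger U * A1 * U) $$ (i, j)) / 2)
      (\<lambda>i j. ((dagger U * A0 * U) $$ (i, j) - (dagger U * A1 * U) $$ (i, j)) / 2)"
    by (rule observables_jordan[OF A])
  obtain U' y where U': "U' \<in> carrier_mat m m" "U' * dagger U' = 1\<^sub>m m"
    and jC: "jordan m y (\<lambda>i j. ((dagger U' * C0 * U') $$ (i, j) + (dagger U' * C1 * U') $$ (i, j)) / 2)
      (\<lambda>i j. ((dagger U' * C0 * U') $$ (i, j) - (dagger U' * C1 * U') $$ (i, j)) / 2)"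
    by (rule observables_jordan[OF C])
  define u where "u i j = U $$ (i, j)" for i j
  define u' where "u' i j = U' $$ (i, j)" for i j
  have unit: "(\<Sum>k<d. V $$ (i, k) * cnj (V $$ (j, k))) = (if i = j then 1 else 0)"
    if "V \<in> carrier_mat d d" "V * dagger V = 1\<^sub>m d" "i < d" "j < d" for V :: "complex mat" and d i j
  proof -
    have "(V * dagger V) $$ (i, j) = (\<Sum>k<d. V $$ (i, k) * cnj (V $$ (j, k)))"
      using that(1,3,4) by (simp add: scalar_prod_def atLeast0LessThan)
    then show ?thesis unfolding that(2) using that(3,4) by simp
  qed
  have conj: "B $$ (i, j) = (\<Sum>k<d. V $$ (i, k) * (\<Sum>l<d. (dagger V * B * V) $$ (k, l) * cnj (V $$ (j, l))))"
    if V: "V \<in> carrier_mat d d" "V * dagger V = 1\<^sub>m d" and B: "B \<in> carrier_mat d d" and ij: "i < d" "j < d" for V B :: "complex mat" and d i j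
  proof -
    have dV: "dagger V \<in> carrier_mat d d" using V by simp
    have asc: "X * Y * Z = X * (Y * Z)" if "X \<in> carrier_mat d d" "Y \<in> carrier_mat d d" "Z \<in> carrier_mat d d" for X Y Z :: "complex mat"
      using that by (rule assoc_mult_mat)
    have mc: "X * Y \<in> carrier_mat d d" if "X \<in> carrier_mat d d" "Y \<in> carrier_mat d d" for X Y :: "complex mat"
      using that by (rule mult_carrier_mat)
    have ent: "(X * Y) $$ (i, j) = (\<Sum>k<d. X $$ (i, k) * Y $$ (k, j))" if "X \<in> carrier_mat d d" "Y \<in> carrier_mat d d" "i < d" "j < d" for X Y :: "complex mat" and i j
      using that by (simp add: scalar_prod_def atLeast0LessThan)
    define Y where "Y = dagger V * B * V"
    have Y: "Y \<in> carrier_mat d d" unfolding Y_def using V dV B mc by auto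
    have "V * (Y * dagger V) = (V * dagger V) * B * (V * dagger V)"
      unfolding Y_def using V(1) dV B by (simp add: asc mc)
    then have "B = V * (Y * dagger V)" unfolding V(2) using B by simp
    then have "B $$ (i, j) = (V * (Y * dagger V)) $$ (i, j)" by simp
    also have "\<dots> = (\<Sum>k<d. V $$ (i, k) * (Y * dagger V) $$ (k, j))" by (rule ent[OF V(1) mc[OF Y dV] ij])
    also have "\<dots> = (\<Sum>k<d. V $$ (i, k) * (\<Sum>l<d. Y $$ (k, l) * cnj (V $$ (j, l))))"
    proof (rule sum.cong[OF refl])
      fix k assume "k \<in> {..<d}"
      then have k: "k < d" by simp
      have "(\<Sum>l<d. Y $$ (k, l) * dagger V $$ (l, j)) = (\<Sum>l<d. Y $$ (k, l) * cnj (V $$ (j, l)))"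
        using ij V(1) by (intro sum.cong refl) simp
      then show "V $$ (i, k) * (Y * dagger V) $$ (k, j) = V $$ (i, k) * (\<Sum>l<d. Y $$ (k, l) * cnj (V $$ (j, l)))"
        unfolding ent[OF Y dV k ij(2)] by simp
    qed
    finally show ?thesis unfolding Y_def .
  qed
  define a where "a B i j = (dagger U * B * U) $$ (i, j)" for B i j
  define c where "c B i j = (dagger U' * B * U') $$ (i, j)" for B i j
  have jA': "jordan n x (\<lambda>i j. (a A0 i j + 1 * a A1 i j) / 2) (\<lambda>i j. (a A0 i j + (- 1) * a A1 i j) / 2)"
    using jA unfolding a_def by simp
  have jC': "jordan m y (\<lambda>i j. (c C0 i j + 1 * c C1 i j) / 2) (\<lambda>i j. (c C0 i j + (- 1) * c C1 i j) / 2)"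
    using jC unfolding c_def by simp
  have "\<exists>w :: nat \<Rightarrow> mf. \<forall>i<n. \<forall>r<2. \<forall>i'<n. \<forall>r'<2. choi n x (\<lambda>i j. (a A0 i j + 1 * a A1 i j) / 2) (\<lambda>i j. (a A0 i j + (- 1) * a A1 i j) / 2) rotZ rotX i r i' r' = (\<Sum>k<n * 2. cnj (w k i r) * w k i' r')"
    by (rule choi_gram[OF jA' pauli_pair_rot]) blast
  then obtain w :: "nat \<Rightarrow> mf" where "\<forall>i<n. \<forall>r<2. \<forall>i'<n. \<forall>r'<2. choi n x (\<lambda>i j. (a A0 i j + 1 * a A1 i j) / 2) (\<lambda>i j. (a A0 i j + (- 1) * a A1 i j) / 2) rotZ rotX i r i' r' = (\<Sum>k<n * 2. cnj (w k i r) * w k i' r')"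
    by (rule exE)
  note w = this[rule_format]
  have "\<exists>w :: nat \<Rightarrow> mf. \<forall>i<m. \<forall>r<2. \<forall>i'<m. \<forall>r'<2. choi m y (\<lambda>i j. (c C0 i j + 1 * c C1 i j) / 2) (\<lambda>i j. (c C0 i j + (- 1) * c C1 i j) / 2) pauliZ pauliX i r i' r' = (\<Sum>k<m * 2. cnj (w k i r) * w k i' r')"
    by (rule choi_gram[OF jC' pauli_pair_ZX]) blast
  then obtain w' :: "nat \<Rightarrow> mf" where "\<forall>i<m. \<forall>r<2. \<forall>i'<m. \<forall>r'<2. choi m y (\<lambda>i j. (c C0 i j + 1 * c C1 i j) / 2) (\<lambda>i j. (c C0 i j + (- 1) * c C1 i j) / 2) pauliZ pauliX i r i' r' = (\<Sum>k<m * 2. cnj (w' k i r) * w' k i' r')"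
    by (rule exE)
  note w' = this[rule_format]
  show thesis
  proof (rule that[OF _ _ w w'])
    show "(\<Sum>k<n. u i k * cnj (u j k)) = (if i = j then 1 else 0)" if "i < n" "j < n" for i j
      unfolding u_def by (rule unit[OF U that])
    show "(\<Sum>k<m. u' i k * cnj (u' j k)) = (if i = j then 1 else 0)" if "i < m" "j < m" for i j
      unfolding u'_def by (rule unit[OF U' that])
    fix b :: nat and \<theta> :: mf assume b: "b < 4"
    define t where "t = opL n (\<lambda>i k. cnj (u k i)) (opR m (\<lambda>i k. cnj (u' k i)) \<theta>)"
    have kf: "Re (kform n m \<theta> (\<lambda>i j. Aa $$ (i, j)) (\<lambda>i j. Cc $$ (i, j))) = Re (kform n m t (a Aa) (c Cc))"
      if "Aa \<in> carrier_mat n n" "Cc \<in> carrier_mat m m" for Aa Cc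
      unfolding kform_def ip2_op[symmetric] t_def
      by (rule ip2_basis_change) (use conj[OF U that(1)] conj[OF U' that(2)] in \<open>simp_all add: u_def u'_def a_def c_def\<close>)
    have un: "(\<Sum>k<n. u i k * cnj (u j k)) = (if i = j then 1 else 0)" if "i < n" "j < n" for i j
      unfolding u_def by (rule unit[OF U that])
    have un': "(\<Sum>k<m. u' i k * cnj (u' j k)) = (if i = j then 1 else 0)" if "i < m" "j < m" for i j
      unfolding u'_def by (rule unit[OF U' that])
    have nt: "ip2 n m \<theta> \<theta> = ip2 n m t t"
    proof -
      have dl: "(if i = j then 1 else 0) = (\<Sum>k<d. v i k * (\<Sum>l<d. (if k = l then 1 else 0) * cnj (v j l)))"
        if v: "(\<Sum>k<d. v i k * cnj (v j k)) = (if i = j then 1 else (0::complex))" for v :: mf and d i j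
      proof -
        have "(\<Sum>l<d. (if k = l then 1 else 0) * cnj (v j l)) = cnj (v j k)" if "k < d" for k
        proof -
          have "(\<Sum>l<d. (if k = l then 1 else 0) * cnj (v j l)) = (\<Sum>l<d. if l = k then cnj (v j l) else 0)"
            by (intro sum.cong refl) auto
          then show ?thesis using that by simp
        qed
        then have "(\<Sum>k<d. v i k * (\<Sum>l<d. (if k = l then 1 else 0) * cnj (v j l))) = (\<Sum>k<d. v i k * cnj (v j k))"
          by (intro sum.cong refl) simp
        then show ?thesis unfolding v ..
      qed
      have "ip2 n m \<theta> (opL n (\<lambda>i j. if i = j then 1 else 0) (opR m (\<lambda>i j. if i = j then 1 else 0) \<theta>)) =
        ip2 n m t (opL n (\<lambda>i j. if i = j then 1 else 0) (opR m (\<lambda>i j. if i = j then 1 else 0) t))"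
        unfolding t_def by (rule ip2_basis_change) (rule dl, erule (1) un, rule dl, erule (1) un')
      then show ?thesis unfolding ip2_delta .
    qed
    note bd = extracted_fidelity_bound[OF jA' jC' w w' b, of t]
    \<comment> \<open>Undoing the passage to P, M, P', M': of the sixteen products only those
      occurring in W_b survive.\<close>
    have e: "2 * (sgP b * Re ((k00 + 1 * k01 + 1 * k10 + 1 * 1 * k11) / 4) + sgM b * Re ((k00 + - 1 * k01 + 1 * k10 + 1 * - 1 * k11) / 4)
        + sgP b * Re ((k00 + 1 * k01 + - 1 * k10 + - 1 * 1 * k11) / 4) - sgM b * Re ((k00 + - 1 * k01 + - 1 * k10 + - 1 * - 1 * k11) / 4)) =
      sgP b * (Re k00 + Re k01) + sgM b * (Re k10 - Re k11)" for k00 k01 k10 k11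
      by (simp add: algebra_simps add_divide_distrib diff_divide_distrib)
    show "(4 + 5 * sqrt 2) / 16 * (sgP b * (Re (kform n m \<theta> (\<lambda>i j. A0 $$ (i, j)) (\<lambda>i j. C0 $$ (i, j))) + Re (kform n m \<theta> (\<lambda>i j. A0 $$ (i, j)) (\<lambda>i j. C1 $$ (i, j))))
        + sgM b * (Re (kform n m \<theta> (\<lambda>i j. A1 $$ (i, j)) (\<lambda>i j. C0 $$ (i, j))) - Re (kform n m \<theta> (\<lambda>i j. A1 $$ (i, j)) (\<lambda>i j. C1 $$ (i, j)))))
        - (1 + 2 * sqrt 2) / 4 * ip2 n m \<theta> \<theta>
      \<le> (\<Sum>k<n * 2. \<Sum>l<m * 2. fid b (\<lambda>r s. \<Sum>i<n. \<Sum>j<m. cnj (w k i r) * cnj (w' l j s) *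
          cnj (opL n (\<lambda>i k. cnj (u k i)) (opR m (\<lambda>i k. cnj (u' k i)) \<theta>) i j)))"
      unfolding t_def[symmetric] nt kf[OF A(1) C(1)] kf[OF A(1) C(2)] kf[OF A(2) C(1)] kf[OF A(2) C(2)]
      using bd unfolding ip2_op kform_def[symmetric] kform_bilinear e .
  qed
qed

section \<open>Probabilities, Bell values and the affine function\<close>

lemma mtrace_kron:
  assumes "A \<in> carrier_mat a a" "B \<in> carrier_mat b b"
  shows "mtrace (kron A B) = mtrace A * mtrace B"
proof -
  have "dim_row (kron A B) = a * b" "dim_row A = a" "dim_row B = b" using assms by (auto simp: kron_def)
  then have "mtrace (kron A B) = (\<Sum>i<a. \<Sum>k<b. kron A B $$ (i * b + k, i * b + k))" and
    "mtrace A = (\<Sum>i<a. A $$ (i, i))" "mtrace B = (\<Sum>i<b. B $$ (i, i))"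
    unfolding mtrace_def by (simp_all only: sum_mult_index)
  moreover have "(\<Sum>i<a. \<Sum>k<b. kron A B $$ (i * b + k, i * b + k)) = (\<Sum>i<a. \<Sum>k<b. A $$ (i, i) * B $$ (k, k))"
    using kron_index_carrier[OF assms] by (intro sum.cong refl) simp
  ultimately show ?thesis by (simp only: sum_product)
qed

text \<open>Averaging the affine bound leaves the offset multiplied by the sum of all probabilities;
  that sum has to be 1 for \<open>gfun\<close> of the average to appear.\<close>

lemma total_probability:
  assumes T: "T \<in> carrier_mat (dA * D * dC) (dA * D * dC)" and Bc: "\<And>b. b < 4 \<Longrightarrow> Bm b \<in> carrier_mat D D"
    and one: "\<And>x y. x < D \<Longrightarrow> y < D \<Longrightarrow> (\<Sum>b<4. Bm b $$ (x, y)) = (if x = y then 1 else 0)"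
  shows "(\<Sum>b<4. mtrace (kron (kron (1\<^sub>m dA) (Bm b)) (1\<^sub>m dC) * T)) = mtrace T"
proof -
  have X: "kron (kron (1\<^sub>m dA) (Bm b)) (1\<^sub>m dC) \<in> carrier_mat (dA * D * dC) (dA * D * dC)" if "b < 4" for b
    by (intro kron_carrier Bc that) auto
  define Y where "Y x y = (\<Sum>b<4. kron (kron (1\<^sub>m dA) (Bm b)) (1\<^sub>m dC) $$ (x, y))" for x y
  have "(\<Sum>b<4. mtrace (kron (kron (1\<^sub>m dA) (Bm b)) (1\<^sub>m dC) * T)) =
    (\<Sum>b<4. \<Sum>x<dA * D * dC. \<Sum>y<dA * D * dC. kron (kron (1\<^sub>m dA) (Bm b)) (1\<^sub>m dC) $$ (x, y) * T $$ (y, x))"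
    using mtrace_mult[OF X T] by (intro sum.cong refl) simp
  also have "\<dots> = (\<Sum>x<dA * D * dC. \<Sum>y<dA * D * dC. Y x y * T $$ (y, x))"
    unfolding Y_def sum_distrib_right by (subst sum.swap, rule sum.cong[OF refl], rule sum.swap)
  also have "\<dots> = (\<Sum>x<dA * D * dC. \<Sum>y<dA * D * dC. if y = x then T $$ (x, x) else 0)"
  proof (intro sum.cong refl)
    fix x y assume xy: "x \<in> {..<dA * D * dC}" "y \<in> {..<dA * D * dC}"
    then have pos: "0 < D" "0 < dC" by (cases D; cases dC; simp)+
    define i m e where "i = x div dC div D" and "m = x div dC mod D" and "e = x mod dC"
    define i' m' e' where "i' = y div dC div D" and "m' = y div dC mod D" and "e' = y mod dC"
    have x: "x = (i * D + m) * dC + e" and y: "y = (i' * D + m') * dC + e'"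
      by (simp_all add: i_def m_def e_def i'_def m'_def e'_def)
    have "x div dC < dA * D" "y div dC < dA * D" using xy by (auto simp: less_mult_imp_div_less)
    then have lt: "i < dA" "m < D" "e < dC" "i' < dA" "m' < D" "e' < dC"
      using pos by (auto simp: i_def m_def e_def i'_def m'_def e'_def less_mult_imp_div_less)
    have "kron (kron (1\<^sub>m dA) (Bm b)) (1\<^sub>m dC) $$ (x, y) = (if i = i' then 1 else 0) * Bm b $$ (m, m') * (if e = e' then 1 else 0)" if "b < 4" for b
      unfolding x y using lt kron_index_carrier[OF kron_carrier[OF one_carrier_mat Bc[OF that]] one_carrier_mat, of "i * D + m" dA e dC "i' * D + m'" e']
        kron_index_carrier[OF one_carrier_mat Bc[OF that], of i dA m i' m'] by (simp add: mult_index_less)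
    then have "Y x y = (\<Sum>b<4. (if i = i' then 1 else 0) * Bm b $$ (m, m') * (if e = e' then 1 else 0))"
      unfolding Y_def by (intro sum.cong refl) simp
    also have "\<dots> = (if i = i' then 1 else 0) * (if m = m' then 1 else 0) * (if e = e' then 1 else 0)"
      unfolding sum_distrib_left[symmetric] sum_distrib_right[symmetric] one[OF lt(2,5)] ..
    also have "\<dots> = (if y = x then 1 else 0)"
    proof (cases "y = x")
      case True then show ?thesis by (simp add: i_def i'_def m_def m'_def e_def e'_def)
    next
      case False then show ?thesis using x y by auto
    qed
    finally show "Y x y * T $$ (y, x) = (if y = x then T $$ (x, x) else 0)" by simp
  qed
  also have "\<dots> = mtrace T" using T by (simp add: mtrace_def)
  finally show ?thesis .
qed

lemma gfun_affine: "gfun \<beta> = (4 + 5 * sqrt 2) / 16 * \<beta> - (1 + 2 * sqrt 2) / 4"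
proof -
  define r where "r = sqrt (2::real)"
  have r: "r * r = 2" by (simp add: r_def)
  have rr: "r * (r * z) = 2 * z" for z by (simp add: r mult.assoc[symmetric])
  \<comment> \<open>The slope 1 / (2 (2 sqrt 2 - xstar)) = 17 / (8 (5 sqrt 2 - 4)) with its
    denominator made rational.\<close>
  define s where "s = (4 + 5 * r) / 16"
  have s: "s * (2 * r - xstar) = 1 / 2" unfolding s_def xstar_def r_def[symmetric]
    by (simp add: field_simps r rr)
  have x: "s * xstar = 3 / 4 + r / 2" unfolding s_def xstar_def r_def[symmetric]
    by (simp add: field_simps r rr)
  have nz: "2 * r - xstar \<noteq> 0" using s by auto
  have "gfun \<beta> = 1 / 2 + (s * (2 * r - xstar)) * ((\<beta> - xstar) / (2 * r - xstar))"
    unfolding s gfun_def r_def[symmetric] ..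
  also have "\<dots> = 1 / 2 + s * (\<beta> - xstar)" using nz by simp
  also have "\<dots> = s * \<beta> - (1 + 2 * r) / 4" using x by (simp add: algebra_simps add_divide_distrib)
  finally show ?thesis by (simp add: s_def r_def)
qed

lemma gfun_gt_half: "\<beta> > xstar \<Longrightarrow> gfun \<beta> > 1 / 2"
proof -
  assume "\<beta> > xstar"
  moreover have "2 * sqrt 2 - xstar > 0" using sqrt2_bounds(1) by (simp add: xstar_def field_simps)
  ultimately show ?thesis by (simp add: gfun_def)
qed

lemma isometry_weight:
  fixes G :: "nat \<Rightarrow> mf"
  assumes U: "\<And>i j. i < n \<Longrightarrow> j < n \<Longrightarrow> (\<Sum>k<n. U i k * cnj (U j k)) = (if i = j then 1 else 0)"
    and G: "(\<Sum>l<L. \<Sum>i<n. \<Sum>m<d. G l i m * cnj (G l i m)) = 1"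
  shows "(\<Sum>l<L. \<Sum>m<d. \<Sum>i<n. cnj (\<Sum>i'<n. cnj (U i' i) * G l i' m) * (\<Sum>i'<n. cnj (U i' i) * G l i' m)) = 1"
proof -
  have ri: "cnj z * z = of_real (Re (cnj z * z))" for z :: complex
    using Re_mult_cnj(2)[of z] complex_norm_square[of z] by (simp add: mult.commute)
  have iso: "ip2 n d (opL n (\<lambda>i k. cnj (U k i)) (G l)) (opL n (\<lambda>i k. cnj (U k i)) (G l)) = ip2 n d (G l) (G l)" for l
    by (rule ip2_isometry) (rule U)
  have "(\<Sum>l<L. \<Sum>m<d. \<Sum>i<n. cnj (\<Sum>i'<n. cnj (U i' i) * G l i' m) * (\<Sum>i'<n. cnj (U i' i) * G l i' m)) =
    (\<Sum>l<L. \<Sum>m<d. \<Sum>i<n. of_real (Re (cnj (opL n (\<lambda>i k. cnj (U k i)) (G l) i m) * opL n (\<lambda>i k. cnj (U k i)) (G l) i m)))"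
    unfolding ri[symmetric] by (intro sum.cong refl) (simp only: opL_apply lessThan_iff)
  also have "\<dots> = (\<Sum>l<L. of_real (ip2 n d (opL n (\<lambda>i k. cnj (U k i)) (G l)) (opL n (\<lambda>i k. cnj (U k i)) (G l))))"
    unfolding ip2_def of_real_sum by (rule sum.cong[OF refl], rule sum.swap)
  also have "\<dots> = (\<Sum>l<L. of_real (ip2 n d (G l) (G l)))" unfolding iso ..
  also have "\<dots> = (\<Sum>l<L. \<Sum>i<n. \<Sum>m<d. cnj (G l i m) * G l i m)"
    unfolding ip2_def of_real_sum ri[symmetric] ..
  also have "\<dots> = 1" using G by (simp only: mult.commute)
  finally show ?thesis .
qed

lemma sum_lt4: "(\<Sum>b<4. h b) = h 0 + h 1 + h 2 + h (3::nat)" for h :: "nat \<Rightarrow> 'a::comm_monoid_add"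
  by (simp add: eval_nat_numeral)

lemma bell_op_index:
  assumes "A0 \<in> carrier_mat n n" "A1 \<in> carrier_mat n n" "C0 \<in> carrier_mat m m" "C1 \<in> carrier_mat m m"
    and "i < n" "i' < n" "c < m" "c' < m" "b < 4"
  shows "bell_op A0 A1 C0 C1 b $$ (i * m + c, i' * m + c') =
    of_real (sgP b) * (A0 $$ (i, i') * C0 $$ (c, c') + A0 $$ (i, i') * C1 $$ (c, c')) +
    of_real (sgM b) * (A1 $$ (i, i') * C0 $$ (c, c') - A1 $$ (i, i') * C1 $$ (c, c'))"
proof -
  note k = kron_index_carrier[OF assms(1) assms(3) assms(5,7,6,8)] kron_index_carrier[OF assms(1) assms(4) assms(5,7,6,8)]
    kron_index_carrier[OF assms(2) assms(3) assms(5,7,6,8)] kron_index_carrier[OF assms(2) assms(4) assms(5,7,6,8)]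
  have d: "dim_row (kron A B) = n * m" "dim_col (kron A B) = n * m" if "A \<in> carrier_mat n n" "B \<in> carrier_mat m m" for A B
    using that by (auto simp: kron_def)
  have "i * m + c < n * m" "i' * m + c' < n * m" using assms by (auto intro: mult_index_less)
  then show ?thesis using less_4_cases[OF assms(9)] assms(1-4)
    by (elim disjE) (simp_all add: bell_op_def Let_def sgP_def sgM_def d k)
qed

lemma bell_op_carrier:
  assumes "A0 \<in> carrier_mat n n" "A1 \<in> carrier_mat n n" "C0 \<in> carrier_mat m m" "C1 \<in> carrier_mat m m"
  shows "bell_op A0 A1 C0 C1 b \<in> carrier_mat (n * m) (n * m)"
  using kron_carrier[OF assms(1) assms(3)] kron_carrier[OF assms(1) assms(4)] kron_carrier[OF assms(2) assms(3)] kron_carrier[OF assms(2) assms(4)]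
  by (auto simp: bell_op_def Let_def)

lemma povm_gram_exists:
  assumes "\<forall>b<4. Bm b \<in> carrier_mat d d" "\<forall>b<4. psd (Bm b)"
  obtains \<beta> :: "nat \<Rightarrow> nat \<Rightarrow> nat \<Rightarrow> complex"
  where "\<forall>b<4. \<forall>x<d. \<forall>y<d. Bm b $$ (x, y) = (\<Sum>n<d. \<beta> b n x * cnj (\<beta> b n y))"
proof -
  have "\<exists>W :: nat \<Rightarrow> nat \<Rightarrow> complex. \<forall>x<d. \<forall>y<d. Bm b $$ (x, y) = (\<Sum>n<d. W n x * cnj (W n y))" if "b < 4" for b
    by (rule psd_gram[of "Bm b" d]) (use assms that in blast)+
  then have "\<forall>b. \<exists>W :: nat \<Rightarrow> nat \<Rightarrow> complex. b < 4 \<longrightarrow> (\<forall>x<d. \<forall>y<d. Bm b $$ (x, y) = (\<Sum>n<d. W n x * cnj (W n y)))" by blast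
  then obtain \<beta> where "\<forall>b. b < 4 \<longrightarrow> (\<forall>x<d. \<forall>y<d. Bm b $$ (x, y) = (\<Sum>n<d. \<beta> b n x * cnj (\<beta> b n y)))"
    using choice[of "\<lambda>b W. b < 4 \<longrightarrow> (\<forall>x<d. \<forall>y<d. Bm b $$ (x, y) = (\<Sum>n<d. W n x * cnj (W n y)))"] by blast
  then show thesis by (rule that)
qed

lemma density_gram_exists:
  assumes "density d \<rho>"
  obtains f :: "nat \<Rightarrow> nat \<Rightarrow> complex"
  where "\<forall>x<d. \<forall>y<d. \<rho> $$ (x, y) = (\<Sum>n<d. f n x * cnj (f n y))" "(\<Sum>n<d. \<Sum>x<d. f n x * cnj (f n x)) = 1"
proof -
  have \<rho>: "\<rho> \<in> carrier_mat d d" "psd \<rho>" "mtrace \<rho> = 1" using assms by (auto simp: density_def)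
  have "\<exists>W :: nat \<Rightarrow> nat \<Rightarrow> complex. \<forall>x<d. \<forall>y<d. \<rho> $$ (x, y) = (\<Sum>n<d. W n x * cnj (W n y))"
    by (rule psd_gram[OF \<rho>(1,2)]) blast
  then obtain f :: "nat \<Rightarrow> nat \<Rightarrow> complex" where f: "\<forall>x<d. \<forall>y<d. \<rho> $$ (x, y) = (\<Sum>n<d. f n x * cnj (f n y))"
    by (rule exE)
  have "mtrace \<rho> = (\<Sum>x<d. \<Sum>n<d. f n x * cnj (f n x))"
    unfolding mtrace_def using f \<rho>(1) by (intro sum.cong) auto
  also have "\<dots> = (\<Sum>n<d. \<Sum>x<d. f n x * cnj (f n x))" by (rule sum.swap)
  finally show thesis using that[OF f] \<rho>(3) by simp
qed

text \<open>Everything is stated before normalisation: the trace is the probability, and the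
  division by it will cancel in the average of the Bell values.\<close>

lemma post_measurement_state:
  fixes f g :: "nat \<Rightarrow> nat \<Rightarrow> complex" and \<beta> :: "nat \<Rightarrow> nat \<Rightarrow> complex"
  assumes t1: "t1 \<in> carrier_mat (dA * d1) (dA * d1)" and t2: "t2 \<in> carrier_mat (d2 * dC) (d2 * dC)"
    and B: "B \<in> carrier_mat (d1 * d2) (d1 * d2)"
    and g1: "\<forall>x<dA * d1. \<forall>y<dA * d1. t1 $$ (x, y) = (\<Sum>l<N1. f l x * cnj (f l y))"
    and g2: "\<forall>x<d2 * dC. \<forall>y<d2 * dC. t2 $$ (x, y) = (\<Sum>l<N2. g l x * cnj (g l y))"
    and gB: "\<forall>x<d1 * d2. \<forall>y<d1 * d2. B $$ (x, y) = (\<Sum>n<N. \<beta> n x * cnj (\<beta> n y))"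
  defines "Y \<equiv> kron (kron (1\<^sub>m dA) B) (1\<^sub>m dC) * kron t1 t2"
    and "th \<equiv> \<lambda>l p n. theta d1 d2 dC (f l) (g p) (\<beta> n)"
  shows "Re (mtrace Y) = (\<Sum>l<N1. \<Sum>p<N2. \<Sum>n<N. ip2 dA dC (th l p n) (th l p n))"
    and "i < dA \<Longrightarrow> c < dC \<Longrightarrow> i' < dA \<Longrightarrow> c' < dC \<Longrightarrow> ptrace_mid dA (d1 * d2) dC Y $$ (i * dC + c, i' * dC + c') =
      (\<Sum>l<N1. \<Sum>p<N2. \<Sum>n<N. th l p n i c * cnj (th l p n i' c'))"
proof -
  have pm: "(\<Sum>m<d1 * d2. Y $$ ((i * (d1 * d2) + m) * dC + c, (i' * (d1 * d2) + m) * dC + c')) =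
    (\<Sum>l<N1. \<Sum>p<N2. \<Sum>n<N. th l p n i c * cnj (th l p n i' c'))"
    if "i < dA" "c < dC" "i' < dA" "c' < dC" for i c i' c'
    unfolding Y_def th_def by (rule post_measurement_entry[OF t1 t2 B]) (simp_all add: g1 g2 gB that)
  have dr: "dim_row Y = dA * (d1 * d2) * dC" unfolding Y_def using B by (simp add: kron_def)
  have "mtrace Y = (\<Sum>i<dA. \<Sum>m<d1 * d2. \<Sum>c<dC. Y $$ ((i * (d1 * d2) + m) * dC + c, (i * (d1 * d2) + m) * dC + c))"
    unfolding mtrace_def dr by (simp only: sum_mult_index[of _ "dA * (d1 * d2)" dC] sum_mult_index[of _ dA "d1 * d2"])
  also have "\<dots> = (\<Sum>i<dA. \<Sum>c<dC. \<Sum>m<d1 * d2. Y $$ ((i * (d1 * d2) + m) * dC + c, (i * (d1 * d2) + m) * dC + c))"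
    by (rule sum.cong[OF refl], rule sum.swap)
  also have "\<dots> = (\<Sum>i<dA. \<Sum>c<dC. \<Sum>l<N1. \<Sum>p<N2. \<Sum>n<N. th l p n i c * cnj (th l p n i c))"
    by (rule sum.cong[OF refl], rule sum.cong[OF refl]) (simp only: pm lessThan_iff)
  also have "\<dots> = (\<Sum>l<N1. \<Sum>p<N2. \<Sum>n<N. \<Sum>i<dA. \<Sum>c<dC. th l p n i c * cnj (th l p n i c))"
    by (rule sum_reorder_diag)
  finally show "Re (mtrace Y) = (\<Sum>l<N1. \<Sum>p<N2. \<Sum>n<N. ip2 dA dC (th l p n) (th l p n))"
    unfolding ip2_def by (simp only: Re_sum mult.commute)
  assume ic: "i < dA" "c < dC" "i' < dA" "c' < dC"
  have "ptrace_mid dA (d1 * d2) dC Y $$ (i * dC + c, i' * dC + c') =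
    (\<Sum>m<d1 * d2. Y $$ ((i * (d1 * d2) + m) * dC + c, (i' * (d1 * d2) + m) * dC + c'))"
    unfolding ptrace_mid_def using ic mult_index_less[OF ic(1,2)] mult_index_less[OF ic(3,4)] by (simp add: distrib_right)
  then show "ptrace_mid dA (d1 * d2) dC Y $$ (i * dC + c, i' * dC + c') = (\<Sum>l<N1. \<Sum>p<N2. \<Sum>n<N. th l p n i c * cnj (th l p n i' c'))"
    unfolding pm[OF ic] .
qed

lemma bell_value:
  assumes A: "A0 \<in> carrier_mat n n" "A1 \<in> carrier_mat n n" and C: "C0 \<in> carrier_mat m m" "C1 \<in> carrier_mat m m" and b: "b < 4"
    and R: "R \<in> carrier_mat (n * m) (n * m)"
    and Re: "\<And>i c i' c'. i < n \<Longrightarrow> c < m \<Longrightarrow> i' < n \<Longrightarrow> c' < m \<Longrightarrow>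
      R $$ (i * m + c, i' * m + c') = (\<Sum>l<N1. \<Sum>p<N2. \<Sum>k<N. th l p k i c * cnj (th l p k i' c'))"
  defines "K \<equiv> \<lambda>\<theta> X Y. kform n m \<theta> (\<lambda>i j. X $$ (i, j)) (\<lambda>i j. Y $$ (i, j))"
  shows "Re (mtrace (bell_op A0 A1 C0 C1 b * R)) = (\<Sum>l<N1. \<Sum>p<N2. \<Sum>k<N.
    sgP b * (Re (K (th l p k) A0 C0) + Re (K (th l p k) A0 C1)) + sgM b * (Re (K (th l p k) A1 C0) - Re (K (th l p k) A1 C1)))"
proof -
  define W where "W i i' c c' = of_real (sgP b) * (A0 $$ (i, i') * C0 $$ (c, c') + A0 $$ (i, i') * C1 $$ (c, c')) +
    of_real (sgM b) * (A1 $$ (i, i') * C0 $$ (c, c') - A1 $$ (i, i') * C1 $$ (c, c'))" for i i' c c'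
  have "mtrace (bell_op A0 A1 C0 C1 b * R) = (\<Sum>i<n. \<Sum>c<m. \<Sum>i'<n. \<Sum>c'<m. bell_op A0 A1 C0 C1 b $$ (i * m + c, i' * m + c') * R $$ (i' * m + c', i * m + c))"
    unfolding mtrace_mult[OF bell_op_carrier[OF A C] R] sum_mult_index ..
  also have "\<dots> = (\<Sum>i<n. \<Sum>c<m. \<Sum>i'<n. \<Sum>c'<m. \<Sum>l<N1. \<Sum>p<N2. \<Sum>k<N. cnj (th l p k i c) * th l p k i' c' * W i i' c c')"
  proof (intro sum.cong refl)
    fix i c i' c' assume "i \<in> {..<n}" "c \<in> {..<m}" "i' \<in> {..<n}" "c' \<in> {..<m}"
    then have lt: "i < n" "c < m" "i' < n" "c' < m" by auto
    show "bell_op A0 A1 C0 C1 b $$ (i * m + c, i' * m + c') * R $$ (i' * m + c', i * m + c) =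
      (\<Sum>l<N1. \<Sum>p<N2. \<Sum>k<N. cnj (th l p k i c) * th l p k i' c' * W i i' c c')"
      unfolding bell_op_index[OF A C lt(1,3,2,4) b] W_def[symmetric] Re[OF lt(3,4,1,2)] sum_distrib_left
      by (intro sum.cong refl) (simp only: mult_ac)
  qed
  also have "\<dots> = (\<Sum>l<N1. \<Sum>p<N2. \<Sum>k<N. \<Sum>i<n. \<Sum>c<m. \<Sum>i'<n. \<Sum>c'<m. cnj (th l p k i c) * th l p k i' c' * W i i' c c')"
    by (rule sum_reorder_form)
  also have "\<dots> = (\<Sum>l<N1. \<Sum>p<N2. \<Sum>k<N. of_real (sgP b) * (K (th l p k) A0 C0 + K (th l p k) A0 C1) + of_real (sgM b) * (K (th l p k) A1 C0 - K (th l p k) A1 C1))"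
  proof -
    have e: "z * (s * (x0 + x1) + t * (x2 - x3)) = s * (z * x0 + z * x1) + t * (z * x2 - z * x3)" for z s t x0 x1 x2 x3 :: complex
      by (simp add: algebra_simps)
    show ?thesis unfolding K_def kform_def W_def e sum.distrib sum_subtractf sum_distrib_left[symmetric] ..
  qed
  finally show ?thesis by simp
qed

theorem theorem2:
  fixes dA dB1 dB2 dC :: nat
    and \<tau>AB1 \<tau>B2C A0 A1 C0 C1 :: "complex mat"
    and Bm :: "nat \<Rightarrow> complex mat"
  assumes tauAB1: "density (dA * dB1) \<tau>AB1"
    and tauB2C: "density (dB2 * dC) \<tau>B2C"
    and povm_carrier: "\<forall>b<4. Bm b \<in> carrier_mat (dB1 * dB2) (dB1 * dB2)"
    and povm_psd: "\<forall>b<4. psd (Bm b)"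
    and povm_sum: "Bm 0 + Bm 1 + Bm 2 + Bm 3 = 1\<^sub>m (dB1 * dB2)"
    and A_obs: "\<forall>A \<in> {A0, A1}. A \<in> carrier_mat dA dA \<and> hermitian A \<and> A * A = 1\<^sub>m dA"
    and C_obs: "\<forall>C \<in> {C0, C1}. C \<in> carrier_mat dC dC \<and> hermitian C \<and> C * C = 1\<^sub>m dC"
  defines "\<tau> \<equiv> kron \<tau>AB1 \<tau>B2C"
  defines "p \<equiv> (\<lambda>b. Re (mtrace (kron (kron (1\<^sub>m dA) (Bm b)) (1\<^sub>m dC) * \<tau>)))"
  defines "\<tau>AC \<equiv> (\<lambda>b. (1 / complex_of_real (p b)) \<cdot>\<^sub>m
                   ptrace_mid dA (dB1 * dB2) dC (kron (kron (1\<^sub>m dA) (Bm b)) (1\<^sub>m dC) * \<tau>))"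
  defines "\<beta> \<equiv> (\<lambda>b. Re (mtrace (bell_op A0 A1 C0 C1 b * \<tau>AC b)))"
  defines "\<beta>ave \<equiv> (\<Sum>b \<in> {b. b < 4 \<and> p b > 0}. p b * \<beta> b)"
  defines "q \<equiv> gfun \<beta>ave"
  defines "\<eta>s \<equiv> 2 * sqrt (q * (1 - q))"
  assumes gt: "\<beta>ave > xstar"
  shows "quality 4 dB1 dB2 2 2 Bm bell_proj \<ge>
           Inf ((\<lambda>\<eta>. (4 * sfun \<eta> * q - tfun \<eta>) / (8 * (1 + \<eta>s))) ` {0..\<eta>s})"
proof -
  have t1: "\<tau>AB1 \<in> carrier_mat (dA * dB1) (dA * dB1)" "mtrace \<tau>AB1 = 1" using tauAB1 by (auto simp: density_def)
  have t2: "\<tau>B2C \<in> carrier_mat (dB2 * dC) (dB2 * dC)" "mtrace \<tau>B2C = 1" using tauB2C by (auto simp: density_def)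
  \<comment> \<open>On a space of dimension 0 the trace could not be 1; the completion of the second
    map uses a basis vector of this space.\<close>
  have d2: "0 < dB2" using t2 by (cases dB2) (auto simp: mtrace_def)
  define N1 N2 N where "N1 = dA * dB1" and "N2 = dB2 * dC" and "N = dB1 * dB2"
  obtain f where f: "\<forall>x<dA * dB1. \<forall>y<dA * dB1. \<tau>AB1 $$ (x, y) = (\<Sum>n<N1. f n x * cnj (f n y))"
    and f1: "(\<Sum>n<N1. \<Sum>x<dA * dB1. f n x * cnj (f n x)) = 1"
    unfolding N1_def by (rule density_gram_exists[OF tauAB1])
  obtain g where g: "\<forall>x<dB2 * dC. \<forall>y<dB2 * dC. \<tau>B2C $$ (x, y) = (\<Sum>n<N2. g n x * cnj (g n y))"
    and g1: "(\<Sum>n<N2. \<Sum>x<dB2 * dC. g n x * cnj (g n x)) = 1"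
    unfolding N2_def by (rule density_gram_exists[OF tauB2C])
  obtain e where e: "\<forall>b<4. \<forall>x<dB1 * dB2. \<forall>y<dB1 * dB2. Bm b $$ (x, y) = (\<Sum>n<N. e b n x * cnj (e b n y))"
    unfolding N_def by (rule povm_gram_exists[OF povm_carrier povm_psd])
  have one: "(\<Sum>b<4. Bm b $$ (x, y)) = (if x = y then 1 else 0)" if "x < dB1 * dB2" "y < dB1 * dB2" for x y
  proof -
    have "Bm 0 \<in> carrier_mat (dB1 * dB2) (dB1 * dB2)" "Bm 1 \<in> carrier_mat (dB1 * dB2) (dB1 * dB2)"
      "Bm 2 \<in> carrier_mat (dB1 * dB2) (dB1 * dB2)" "Bm 3 \<in> carrier_mat (dB1 * dB2) (dB1 * dB2)" using povm_carrier by auto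
    then have "(\<Sum>b<4. Bm b $$ (x, y)) = (Bm 0 + Bm 1 + Bm 2 + Bm 3) $$ (x, y)" using that by (simp add: sum_lt4)
    then show ?thesis unfolding povm_sum using that by simp
  qed
  have A: "A0 \<in> carrier_mat dA dA" "A1 \<in> carrier_mat dA dA" "dagger A0 = A0" "dagger A1 = A1" "A0 * A0 = 1\<^sub>m dA" "A1 * A1 = 1\<^sub>m dA"
    using A_obs by (auto simp: hermitian_def)
  have C: "C0 \<in> carrier_mat dC dC" "C1 \<in> carrier_mat dC dC" "dagger C0 = C0" "dagger C1 = C1" "C0 * C0 = 1\<^sub>m dC" "C1 * C1 = 1\<^sub>m dC"
    using C_obs by (auto simp: hermitian_def)
  define th where "th b l p n = theta dB1 dB2 dC (f l) (g p) (e b n)" for b l p n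
  define Y where "Y b = kron (kron (1\<^sub>m dA) (Bm b)) (1\<^sub>m dC) * \<tau>" for b
  define R where "R b = ptrace_mid dA (dB1 * dB2) dC (Y b)" for b
  have state: "p b = (\<Sum>l<N1. \<Sum>p<N2. \<Sum>n<N. ip2 dA dC (th b l p n) (th b l p n))"
    "\<And>i c i' c'. i < dA \<Longrightarrow> c < dC \<Longrightarrow> i' < dA \<Longrightarrow> c' < dC \<Longrightarrow>
      R b $$ (i * dC + c, i' * dC + c') = (\<Sum>l<N1. \<Sum>p<N2. \<Sum>n<N. th b l p n i c * cnj (th b l p n i' c'))" if b: "b < 4" for b
  proof -
    note st = post_measurement_state[OF t1(1) t2(1) povm_carrier[rule_format, OF b] f g spec[OF e, THEN mp, OF b],
        folded \<tau>_def th_def, folded Y_def]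
    show "p b = (\<Sum>l<N1. \<Sum>p<N2. \<Sum>n<N. ip2 dA dC (th b l p n) (th b l p n))"
      unfolding p_def Y_def[symmetric] using st(1) .
    show "R b $$ (i * dC + c, i' * dC + c') = (\<Sum>l<N1. \<Sum>p<N2. \<Sum>n<N. th b l p n i c * cnj (th b l p n i' c'))"
      if "i < dA" "c < dC" "i' < dA" "c' < dC" for i c i' c' unfolding R_def using st(2)[OF that] .
  qed
  have p0: "0 \<le> p b" if "b < 4" for b
    unfolding state(1)[OF that] ip2_def by (intro sum_nonneg) simp
  have psum: "(\<Sum>b<4. p b) = 1"
  proof -
    have "\<tau> \<in> carrier_mat ((dA * dB1) * (dB2 * dC)) ((dA * dB1) * (dB2 * dC))" unfolding \<tau>_def by (rule kron_carrier[OF t1(1) t2(1)])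
    then have "\<tau> \<in> carrier_mat (dA * (dB1 * dB2) * dC) (dA * (dB1 * dB2) * dC)" by (simp only: mult.assoc)
    then have "(\<Sum>b<4. mtrace (Y b)) = mtrace \<tau>" unfolding Y_def
      by (rule total_probability) (use povm_carrier one in auto)
    also have "\<dots> = 1" unfolding \<tau>_def mtrace_kron[OF t1(1) t2(1)] t1(2) t2(2) by simp
    finally have "Re (\<Sum>b<4. mtrace (Y b)) = 1" by simp
    then show ?thesis unfolding p_def Y_def[symmetric] by (simp only: Re_sum)
  qed
  define K where "K \<theta> S T = kform dA dC \<theta> (\<lambda>i j. S $$ (i, j)) (\<lambda>i j. T $$ (i, j))" for \<theta> S T
  define bell where "bell b \<theta> = sgP b * (Re (K \<theta> A0 C0) + Re (K \<theta> A0 C1)) + sgM b * (Re (K \<theta> A1 C0) - Re (K \<theta> A1 C1))" for b \<theta>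
  \<comment> \<open>The weight p b removes the normalisation of the post-measurement state, leaving
    a sum over the unnormalised vectors.\<close>
  have bv: "p b * \<beta> b = (\<Sum>l<N1. \<Sum>p<N2. \<Sum>n<N. bell b (th b l p n))" if b: "b < 4" and pb: "p b > 0" for b
  proof -
    have Rc: "R b \<in> carrier_mat (dA * dC) (dA * dC)" by (simp add: R_def ptrace_mid_def)
    have "mtrace (bell_op A0 A1 C0 C1 b * (k \<cdot>\<^sub>m R b)) = k * mtrace (bell_op A0 A1 C0 C1 b * R b)" for k
      unfolding mtrace_mult[OF bell_op_carrier[OF A(1,2) C(1,2)] Rc] mtrace_mult[OF bell_op_carrier[OF A(1,2) C(1,2)] smult_carrier_mat[OF Rc]] sum_distrib_left
      using Rc by (intro sum.cong refl) (auto simp: mult_ac)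
    then have "\<beta> b = Re ((1 / complex_of_real (p b)) * mtrace (bell_op A0 A1 C0 C1 b * R b))"
      unfolding \<beta>_def \<tau>AC_def R_def Y_def by simp
    then have "\<beta> b = Re (mtrace (bell_op A0 A1 C0 C1 b * R b)) / p b" by simp
    then have "p b * \<beta> b = Re (mtrace (bell_op A0 A1 C0 C1 b * R b))" using pb by simp
    also have "\<dots> = (\<Sum>l<N1. \<Sum>p<N2. \<Sum>n<N. bell b (th b l p n))"
      unfolding bell_def K_def by (rule bell_value[OF A(1,2) C(1,2) b Rc]) (rule state(2)[OF b])
    finally show ?thesis .
  qed
  show ?thesis
  proof (rule extraction_exists[OF A C])
    fix U U' w w' x P M y P' M'
    assume U: "\<And>i j. i < dA \<Longrightarrow> j < dA \<Longrightarrow> (\<Sum>k<dA. U i k * cnj (U j k)) = (if i = j then 1 else 0)"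
      and U': "\<And>i j. i < dC \<Longrightarrow> j < dC \<Longrightarrow> (\<Sum>k<dC. U' i k * cnj (U' j k)) = (if i = j then 1 else 0)"
      and w: "\<And>i r i' r'. i < dA \<Longrightarrow> r < 2 \<Longrightarrow> i' < dA \<Longrightarrow> r' < 2 \<Longrightarrow>
        choi dA x P M rotZ rotX i r i' r' = (\<Sum>k<dA * 2. cnj (w k i r) * w k i' r')"
      and w': "\<And>i r i' r'. i < dC \<Longrightarrow> r < 2 \<Longrightarrow> i' < dC \<Longrightarrow> r' < 2 \<Longrightarrow>
        choi dC y P' M' pauliZ pauliX i r i' r' = (\<Sum>k<dC * 2. cnj (w' k i r) * w' k i' r')"
      and bound: "\<And>b \<theta>. b < 4 \<Longrightarrow>
        (4 + 5 * sqrt 2) / 16 * (sgP b * (Re (kform dA dC \<theta> (\<lambda>i j. A0 $$ (i, j)) (\<lambda>i j. C0 $$ (i, j))) + Re (kform dA dC \<theta> (\<lambda>i j. A0 $$ (i, j)) (\<lambda>i j. C1 $$ (i, j))))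
        + sgM b * (Re (kform dA dC \<theta> (\<lambda>i j. A1 $$ (i, j)) (\<lambda>i j. C0 $$ (i, j))) - Re (kform dA dC \<theta> (\<lambda>i j. A1 $$ (i, j)) (\<lambda>i j. C1 $$ (i, j)))))
        - (1 + 2 * sqrt 2) / 4 * ip2 dA dC \<theta> \<theta>
        \<le> (\<Sum>k<dA * 2. \<Sum>l<dC * 2. fid b (\<lambda>r s. \<Sum>i<dA. \<Sum>j<dC. cnj (w k i r) * cnj (w' l j s) *
          cnj (opL dA (\<lambda>i k. cnj (U k i)) (opR dC (\<lambda>i k. cnj (U' k i)) \<theta>) i j)))"
    define ph where "ph l i m = (\<Sum>i'<dA. cnj (U i' i) * f l (i' * dB1 + m))" for l i m
    define ch where "ch l j m = (\<Sum>j'<dC. cnj (U' j' j) * g l (m * dC + j'))" for l j m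
    \<comment> \<open>The Kraus operators on the first middle system: a Gram vector of the initial
      state, in the Jordan basis of A, contracted with a Kraus vector of the extraction.\<close>
    define V where "V \<kappa> m r = (\<Sum>i<dA. ph (fst \<kappa>) i m * w (snd \<kappa>) i r)" for \<kappa> :: "nat \<times> nat" and m r
    define V' where "V' \<kappa> m r = (\<Sum>j<dC. ch (fst \<kappa>) j m * w' (snd \<kappa>) j r)" for \<kappa> :: "nat \<times> nat" and m r
    define F where "F b \<theta> = (\<Sum>k<dA * 2. \<Sum>l<dC * 2. fid b (\<lambda>r s. \<Sum>i<dA. \<Sum>j<dC. cnj (w k i r) * cnj (w' l j s) *
          cnj (opL dA (\<lambda>i k. cnj (U k i)) (opR dC (\<lambda>i k. cnj (U' k i)) \<theta>) i j)))" for b \<theta>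
    have tr: "(\<Sum>\<kappa>\<in>{..<N1} \<times> {..<dA * 2}. \<Sum>m<dB1. \<Sum>r<2. cnj (V \<kappa> m r) * V \<kappa> m r) = 1"
    proof -
      have "(\<Sum>\<kappa>\<in>{..<N1} \<times> {..<dA * 2}. \<Sum>m<dB1. \<Sum>r<2. cnj (V \<kappa> m r) * V \<kappa> m r) = (\<Sum>l<N1. \<Sum>m<dB1. \<Sum>i<dA. cnj (ph l i m) * ph l i m)"
        unfolding V_def by (rule extracted_weight[where Z = rotZ and X = rotX], rule w) auto
      also have "\<dots> = 1" unfolding ph_def
        by (rule isometry_weight, rule U) (use f1 in \<open>simp_all only: sum_mult_index\<close>)
      finally show ?thesis .
    qed
    have tr': "(\<Sum>\<kappa>\<in>{..<N2} \<times> {..<dC * 2}. \<Sum>m<dB2. \<Sum>r<2. cnj (V' \<kappa> m r) * V' \<kappa> m r) = 1"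
    proof -
      have "(\<Sum>\<kappa>\<in>{..<N2} \<times> {..<dC * 2}. \<Sum>m<dB2. \<Sum>r<2. cnj (V' \<kappa> m r) * V' \<kappa> m r) = (\<Sum>l<N2. \<Sum>m<dB2. \<Sum>i<dC. cnj (ch l i m) * ch l i m)"
        unfolding V'_def by (rule extracted_weight[where Z = pauliZ and X = pauliX], rule w') auto
      also have "\<dots> = 1" unfolding ch_def
      proof (rule isometry_weight, rule U')
        have "(\<Sum>l<N2. \<Sum>m<dB2. \<Sum>i<dC. g l (m * dC + i) * cnj (g l (m * dC + i))) = 1" using g1 by (simp only: sum_mult_index)
        then show "(\<Sum>l<N2. \<Sum>i<dC. \<Sum>m<dB2. g l (m * dC + i) * cnj (g l (m * dC + i))) = 1"
          by (simp only: sum.swap[where A = "{..<dC}" and B = "{..<dB2}"])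
      qed
      finally show ?thesis .
    qed
    have om: "fid b (omega dB1 dB2 (V (l, k)) (V' (p, q)) (e b n)) = fid b (\<lambda>r s. \<Sum>i<dA. \<Sum>j<dC. cnj (w k i r) * cnj (w' q j s) *
          cnj (opL dA (\<lambda>i k. cnj (U k i)) (opR dC (\<lambda>i k. cnj (U' k i)) (th b l p n)) i j))" for b l k p q n
      unfolding V_def V'_def fst_conv snd_conv
    proof (rule fid_cong, unfold omega_extracted, intro sum.cong refl)
      fix r s i j assume "i \<in> {..<dA}" "j \<in> {..<dC}"
      then have ij: "i < dA" "j < dC" by auto
      show "cnj (w k i r) * cnj (w' q j s) * cnj (\<Sum>a<dB1. \<Sum>ba<dB2. ph l i a * ch p j ba * cnj (e b n (a * dB2 + ba))) =
        cnj (w k i r) * cnj (w' q j s) * cnj (opL dA (\<lambda>i k. cnj (U k i)) (opR dC (\<lambda>i k. cnj (U' k i)) (th b l p n)) i j)"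
        unfolding th_def theta_basis_change[OF ij] ph_def ch_def ..
    qed
    have sp: "(\<Sum>\<kappa>\<in>S \<times> T. h \<kappa>) = (\<Sum>l\<in>S. \<Sum>k\<in>T. h (l, k))" for S T :: "nat set" and h :: "nat \<times> nat \<Rightarrow> real"
      by (simp add: sum.cartesian_product)
    have total: "(\<Sum>\<kappa>\<in>{..<N1} \<times> {..<dA * 2}. \<Sum>\<kappa>'\<in>{..<N2} \<times> {..<dC * 2}. \<Sum>n<N. fid b (omega dB1 dB2 (V \<kappa>) (V' \<kappa>') (e b n))) =
      (\<Sum>l<N1. \<Sum>p<N2. \<Sum>n<N. F b (th b l p n))" for b
      unfolding sp om F_def by (rule sum_reorder_pairs)
    have Fb: "(4 + 5 * sqrt 2) / 16 * bell b \<theta> - (1 + 2 * sqrt 2) / 4 * ip2 dA dC \<theta> \<theta> \<le> F b \<theta>" if "b < 4" for b \<theta>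
      unfolding F_def bell_def K_def by (rule bound[OF that])
    have F0: "0 \<le> F b \<theta>" for b \<theta> unfolding F_def by (intro sum_nonneg fid_nonneg)
    define G where "G b = (\<Sum>l<N1. \<Sum>p<N2. \<Sum>n<N. F b (th b l p n))" for b
    \<comment> \<open>An outcome of probability 0 adds nothing on the left and nonnegative
      fidelities on the right, so the sum may run over all four outcomes although the average omits
      such outcomes.\<close>
    have Gb: "(4 + 5 * sqrt 2) / 16 * (if p b > 0 then p b * \<beta> b else 0) - (1 + 2 * sqrt 2) / 4 * p b \<le> G b" if b: "b < 4" for b
    proof (cases "p b > 0")
      case True
      have "(4 + 5 * sqrt 2) / 16 * (p b * \<beta> b) - (1 + 2 * sqrt 2) / 4 * p b =
        (\<Sum>l<N1. \<Sum>p<N2. \<Sum>n<N. (4 + 5 * sqrt 2) / 16 * bell b (th b l p n) - (1 + 2 * sqrt 2) / 4 * ip2 dA dC (th b l p n) (th b l p n))"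
        unfolding bv[OF b True] unfolding state(1)[OF b] by (simp only: sum_distrib_left sum_subtractf)
      also have "\<dots> \<le> G b" unfolding G_def by (intro sum_mono Fb b)
      finally show ?thesis using True by simp
    next
      case False
      then have "p b = 0" using p0[OF b] by simp
      moreover have "0 \<le> G b" unfolding G_def by (intro sum_nonneg F0)
      ultimately show ?thesis by simp
    qed
    have "\<beta>ave = (\<Sum>b<4. if p b > 0 then p b * \<beta> b else 0)"
    proof -
      have "{b. b < 4 \<and> p b > 0} = {b \<in> {..<4}. p b > 0}" by auto
      then show ?thesis unfolding \<beta>ave_def by (simp only: sum.inter_filter[OF finite_lessThan])
    qed
    \<comment> \<open>\<open>gfun\<close> is affine and the probabilities sum to 1, so the offset
      can be distributed over the outcomes.\<close>
    then have "q = (\<Sum>b<4. (4 + 5 * sqrt 2) / 16 * (if p b > 0 then p b * \<beta> b else 0) - (1 + 2 * sqrt 2) / 4 * p b)"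
      unfolding q_def gfun_affine sum_subtractf sum_distrib_left[symmetric] psum by simp
    also have "\<dots> \<le> (\<Sum>b<4. G b)" by (intro sum_mono Gb) simp
    finally have qG: "q \<le> (\<Sum>b<4. \<Sum>\<kappa>\<in>{..<N1} \<times> {..<dA * 2}. \<Sum>\<kappa>'\<in>{..<N2} \<times> {..<dC * 2}. \<Sum>n<N. fid b (omega dB1 dB2 (V \<kappa>) (V' \<kappa>') (e b n)))"
      unfolding total G_def .
    have q: "1 / 2 < q" unfolding q_def by (rule gfun_gt_half[OF gt])
    show "Inf ((\<lambda>\<eta>. (4 * sfun \<eta> * q - tfun \<eta>) / (8 * (1 + \<eta>s))) ` {0..\<eta>s}) \<le> quality 4 dB1 dB2 2 2 Bm bell_proj"
      unfolding \<eta>s_def by (rule quality_ge_extracted[OF _ _ d2 _ _ tr tr' q qG]) (use e one in auto)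
  qed
qed

end
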